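(* Let $(G,\pi_G)$ be a connected, complete Poisson-Lie group with dual 1-connected Poisson-Lie group $G^*$, and let $(\mathcal{G},\Omega)$, $\mathcal{G}\rightrightarrows M$, be a source-connected symplectic groupoid. Let $G\times\mathcal{G}\to\mathcal{G}$ be a hamiltonian action with momentum map $J:\mathcal{G}\to G^*$ such that $J(M)=\{e\}$ (where $M\subset\mathcal{G}$ via the identity section). Then the following are equivalent: (i) $J:\mathcal{G}\to G^*$ is a groupoid morphism: $J(x\cdot y)=J(x)\cdot J(y)$ for all $(x,y)\in\mathcal{G}^{(2)}$. (ii) The twisted multiplicativity property holds: $$g(x\cdot y)=(gx)\cdot(g^{J(x)}y)\quad\text{for all }(x,y)\in\mathcal{G}^{(2)},\ g\in G,$$ where $g^u$ denotes the right dressing action of $u\in G^*$ on $g\in G$.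
   Context: Conventions. For a Poisson bivector $\pi$, $\langle\beta,\pi^\sharp(\alpha)\rangle=\pi(\alpha,\beta)$. In a Lie groupoid $\mathcal{G}\rightrightarrows M$ with source $\mathbf{s}$ and target $\mathbf{t}$, $x\cdot y$ is defined when $\mathbf{s}(x)=\mathbf{t}(y)$ and $\mathcal{G}^{(2)}$ is the set of such pairs. A symplectic groupoid is a Lie groupoid with a symplectic form $\Omega$ such that $\mathbf{m}^*\Omega=\pi_1^*\Omega+\pi_2^*\Omega$ on $\mathcal{G}^{(2)}$; it is regarded as a Poisson manifold with the Poisson structure inverse to $\Omega$. Property (ii) includes the assertion that $gx$ and $g^{J(x)}y$ are composable. Lie algebras of Lie groups are identified with right invariant vector fields. Poisson-Lie groups. $(G,\pi_G)$ is a Poisson-Lie group if multiplication $G\times G\to G$ is Poisson. $\mathfrak{g}^*$, identified with right invariant 1-forms on $G$, has the Lie bracket induced by the bracket of 1-forms $[\alpha,\beta]=\mathcal{L}_{\pi^\sharp\alpha}\beta-\mathcal{L}_{\pi^\sharp\beta}\alpha-d(\pi(\alpha,\beta))$ of $\pi_G$. $G^*$ is the 1-connected Lie group with Lie algebra $\mathfrak{g}^*$, with the Poisson-Lie structure whose Lie bialgebra is $(\mathfrak{g}^*,\mathfrak{g})$. The (infinitesimal) left dressing action of $\mathfrak{g}^*$ on $G$ is $\eta\mapsto\pi_G^\sharp(\eta^R)$ and the right dressing action is the Lie algebra anti-morphism $\eta\mapsto-\pi_G^\sharp(\eta^L)$, where $\eta^R,\eta^L$ are the right/left invariant 1-forms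 with value $\eta$ at $e$; the dressing actions of $\mathfrak{g}$ on $G^*$ are defined by exchanging roles. $G$ is complete if the right dressing action of $\mathfrak g^*$ integrates to a global right action of $G^*$ on $G$, denoted $(g,u)\mapsto g^u$; then the left dressing action of $\mathfrak g$ on $G^*$ also integrates to a global left action of $G$ on $G^*$. Actions. A smooth action of $G$ on a Poisson manifold $(P,\pi_P)$ is Poisson if $G\times P\to P$ is a Poisson map for $\pi_G\oplus\pi_P$. With $\psi(\xi)_p=\frac{d}{dt}\exp(t\xi)p|_{t=0}$, a momentum map is a smooth map $\mu:P\to G^*$ with $\psi(\xi)=\pi_P^\sharp(\mu^*\xi^R)$ for all $\xi\in\mathfrak{g}$, where $\xi^R$ is the right invariant 1-form on $G^*$ with value $\xi$ at $e$. A Poisson action is hamiltonian (with momentum map $\mu$) if $\mu$ is a momentum map that is equivariant for the left dressing action of $G$ on $G^*$. *)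

theory Defs
  imports "HOL-Analysis.Analysis"
begin

section \<open>Smooth manifolds\<close>

primrec Ck_on :: "nat \<Rightarrow> 'a::real_normed_vector set \<Rightarrow> ('a \<Rightarrow> 'b::real_normed_vector) \<Rightarrow> bool" where
  "Ck_on 0 = (\<lambda>S f. continuous_on S f)"
| "Ck_on (Suc k) = (\<lambda>S f. (\<forall>x\<in>S. f differentiable (at x)) \<and>
      (\<forall>v. Ck_on k S (\<lambda>x. frechet_derivative f (at x) v)))"

text \<open>Only used for open subsets of finite-dimensional spaces, where directional and
  total derivatives give the same notion.\<close>

definition smooth_on :: "'a::real_normed_vector set \<Rightarrow> ('a \<Rightarrow> 'b::real_normed_vector) \<Rightarrow> bool" where
  "smooth_on S f \<longleftrightarrow> (\<forall>k. Ck_on k S f)"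

text \<open>A smooth structure on a type \<open>'a\<close> is an atlas indexed by the points: to each \<open>p\<close> it
  assigns a chart (domain and coordinate map) around \<open>p\<close>.  Every atlas contains such a
  subatlas.  The index also singles out a preferred chart at \<open>p\<close>, and its differential
  identifies \<open>T\<^sub>pM\<close> with the model space.  So tangent vectors are elements of the
  model space \<open>'v\<close>, cotangent vectors elements of \<open>'v \<Rightarrow>\<^sub>L real\<close>, and tensors are
  always read in the preferred chart at their base point.

  The model space is a finite-dimensional inner product space rather than a
  \<open>euclidean_space\<close>, because the latter class excludes dimension 0.  The inner product
  plays no role.\<close>

type_synonym ('a, 'v) atlas = "'a \<Rightarrow> 'a set \<times> ('a \<Rightarrow> 'v)"

abbreviation dom_at :: "('a, 'v) atlas \<Rightarrow> 'a \<Rightarrow> 'a set" where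
  "dom_at M p \<equiv> fst (M p)"

abbreviation chart_at :: "('a, 'v) atlas \<Rightarrow> 'a \<Rightarrow> 'a \<Rightarrow> 'v" where
  "chart_at M p \<equiv> snd (M p)"

definition chart_inv :: "('a, 'v) atlas \<Rightarrow> 'a \<Rightarrow> 'v \<Rightarrow> 'a" where
  "chart_inv M p = inv_into (dom_at M p) (chart_at M p)"

text \<open>Separation and countability axioms are not included here; they are expressed by the
  sort of the type \<open>'a\<close>.\<close>

definition manifold :: "('a::topological_space, 'v::real_inner) atlas \<Rightarrow> bool" where
  "manifold M \<longleftrightarrow>
     (\<exists>B::'v set. finite B \<and> span B = UNIV) \<and>
     (\<forall>p. p \<in> dom_at M p \<and> open (dom_at M p) \<and> open (chart_at M p ` dom_at M p) \<and>
          homeomorphism (dom_at M p) (chart_at M p ` dom_at M p) (chart_at M p) (chart_inv M p)) \<and>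
     (\<forall>p q. smooth_on (chart_at M p ` (dom_at M p \<inter> dom_at M q)) (chart_at M q \<circ> chart_inv M p))"

definition model :: "('v, 'v) atlas" where
  "model = (\<lambda>_. (UNIV, \<lambda>x. x))"

definition prod_atlas :: "('a, 'v) atlas \<Rightarrow> ('b, 'w) atlas \<Rightarrow> ('a \<times> 'b, 'v \<times> 'w) atlas" where
  "prod_atlas M N = (\<lambda>(p, q). (dom_at M p \<times> dom_at N q, \<lambda>(a, b). (chart_at M p a, chart_at N q b)))"

text \<open>A map is smooth on an arbitrary subset if it locally is the restriction of a smooth map
  on an open set.  This covers open subsets and embedded submanifolds.  Continuity of \<open>f\<close>
  on \<open>S\<close> is implied, as \<open>f\<close> maps a neighbourhood in \<open>S\<close> into a single chart domain.\<close>

definition smooth_map_on ::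
  "('a, 'v::real_normed_vector) atlas \<Rightarrow> ('b, 'w::real_normed_vector) atlas \<Rightarrow> 'a set \<Rightarrow> ('a \<Rightarrow> 'b) \<Rightarrow> bool" where
  "smooth_map_on M N S f \<longleftrightarrow>
     (\<forall>p\<in>S. \<exists>V F. open V \<and> chart_at M p p \<in> V \<and> smooth_on V F \<and>
        (\<forall>q \<in> S \<inter> dom_at M p. chart_at M p q \<in> V \<longrightarrow>
           f q \<in> dom_at N (f p) \<and> chart_at N (f p) (f q) = F (chart_at M p q)))"

abbreviation smooth_map ::
  "('a, 'v::real_normed_vector) atlas \<Rightarrow> ('b, 'w::real_normed_vector) atlas \<Rightarrow> ('a \<Rightarrow> 'b) \<Rightarrow> bool" where
  "smooth_map M N f \<equiv> smooth_map_on M N UNIV f"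

text \<open>The differential at \<open>p\<close> of a map defined on a subset \<open>S\<close>.  If \<open>S\<close> is an embedded submanifold
  and \<open>f\<close> is smooth on \<open>S\<close>, its values on vectors tangent to \<open>S\<close> are uniquely determined.\<close>

definition tmap_on ::
  "('a, 'v::real_normed_vector) atlas \<Rightarrow> ('b, 'w::real_normed_vector) atlas \<Rightarrow> 'a set \<Rightarrow> ('a \<Rightarrow> 'b) \<Rightarrow> 'a \<Rightarrow> 'v \<Rightarrow>\<^sub>L 'w" where
  "tmap_on M N S f p =
     Blinfun (frechet_derivative (\<lambda>z. chart_at N (f p) (f (chart_inv M p z)))
                (at (chart_at M p p) within chart_at M p ` (S \<inter> dom_at M p)))"

abbreviation tmap ::
  "('a, 'v::real_normed_vector) atlas \<Rightarrow> ('b, 'w::real_normed_vector) atlas \<Rightarrow> ('a \<Rightarrow> 'b) \<Rightarrow> 'a \<Rightarrow> 'v \<Rightarrow>\<^sub>L 'w" where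
  "tmap M N f p \<equiv> tmap_on M N UNIV f p"

abbreviation differential :: "('a, 'v::real_normed_vector) atlas \<Rightarrow> ('a \<Rightarrow> real) \<Rightarrow> 'a \<Rightarrow> 'v \<Rightarrow>\<^sub>L real" where
  "differential M f p \<equiv> tmap M model f p"


section \<open>Tensor fields\<close>

text \<open>The functions \<open>*_loc M T p\<close> are the coordinate expressions of a tensor field \<open>T\<close> in
  the chart at \<open>p\<close>, as functions of \<open>z\<close> in the image of that chart.  The differentials of the
  chart and its inverse convert from and to the preferred trivialization at each point.\<close>

definition frame :: "('a, 'v::real_normed_vector) atlas \<Rightarrow> 'a \<Rightarrow> 'v \<Rightarrow> 'v \<Rightarrow>\<^sub>L 'v" where
  "frame M p z = tmap model M (chart_inv M p) z"

definition coframe :: "('a, 'v::real_normed_vector) atlas \<Rightarrow> 'a \<Rightarrow> 'v \<Rightarrow> 'v \<Rightarrow>\<^sub>L 'v" where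
  "coframe M p z = tmap M model (chart_at M p) (chart_inv M p z)"

definition vf_loc :: "('a, 'v::real_normed_vector) atlas \<Rightarrow> ('a \<Rightarrow> 'v) \<Rightarrow> 'a \<Rightarrow> 'v \<Rightarrow> 'v" where
  "vf_loc M X p z = coframe M p z (X (chart_inv M p z))"

definition form1_loc :: "('a, 'v::real_normed_vector) atlas \<Rightarrow> ('a \<Rightarrow> 'v \<Rightarrow>\<^sub>L real) \<Rightarrow> 'a \<Rightarrow> 'v \<Rightarrow> 'v \<Rightarrow> real" where
  "form1_loc M \<alpha> p z v = \<alpha> (chart_inv M p z) (frame M p z v)"

definition form2_loc ::
  "('a, 'v::real_normed_vector) atlas \<Rightarrow> ('a \<Rightarrow> 'v \<Rightarrow> 'v \<Rightarrow> real) \<Rightarrow> 'a \<Rightarrow> 'v \<Rightarrow> 'v \<Rightarrow> 'v \<Rightarrow> real" where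
  "form2_loc M \<Omega> p z v w = \<Omega> (chart_inv M p z) (frame M p z v) (frame M p z w)"

type_synonym ('a, 'v) bivector_field = "'a \<Rightarrow> ('v \<Rightarrow>\<^sub>L real) \<Rightarrow> ('v \<Rightarrow>\<^sub>L real) \<Rightarrow> real"

definition bivector_loc ::
  "('a, 'v::real_normed_vector) atlas \<Rightarrow> ('a, 'v) bivector_field \<Rightarrow> 'a \<Rightarrow> 'v \<Rightarrow> ('v \<Rightarrow>\<^sub>L real) \<Rightarrow> ('v \<Rightarrow>\<^sub>L real) \<Rightarrow> real" where
  "bivector_loc M \<pi> p z \<alpha> \<beta> =
     \<pi> (chart_inv M p z) (\<alpha> o\<^sub>L coframe M p z) (\<beta> o\<^sub>L coframe M p z)"

definition vf_bracket ::
  "('a, 'v::real_normed_vector) atlas \<Rightarrow> ('a \<Rightarrow> 'v) \<Rightarrow> ('a \<Rightarrow> 'v) \<Rightarrow> 'a \<Rightarrow> 'v" where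
  "vf_bracket M X Y p =
     frechet_derivative (vf_loc M Y p) (at (chart_at M p p)) (X p)
   - frechet_derivative (vf_loc M X p) (at (chart_at M p p)) (Y p)"

text \<open>In coordinates, \<open>(L\<^sub>X \<beta>)\<^sub>i = X\<^sub>j \<partial>\<^sub>j \<beta>\<^sub>i + \<beta>\<^sub>j \<partial>\<^sub>i X\<^sub>j\<close>.\<close>

definition lie_derivative ::
  "('a, 'v::real_normed_vector) atlas \<Rightarrow> ('a \<Rightarrow> 'v) \<Rightarrow> ('a \<Rightarrow> 'v \<Rightarrow>\<^sub>L real) \<Rightarrow> 'a \<Rightarrow> 'v \<Rightarrow>\<^sub>L real" where
  "lie_derivative M X \<beta> p = Blinfun (\<lambda>v.
     frechet_derivative (\<lambda>z. form1_loc M \<beta> p z v) (at (chart_at M p p)) (X p)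
   + \<beta> p (frechet_derivative (vf_loc M X p) (at (chart_at M p p)) v))"


section \<open>Poisson and symplectic structures\<close>

definition sharp :: "('a, 'v::real_normed_vector) bivector_field \<Rightarrow> 'a \<Rightarrow> ('v \<Rightarrow>\<^sub>L real) \<Rightarrow> 'v" where
  "sharp \<pi> p \<alpha> = (THE v. \<forall>\<beta>. blinfun_apply \<beta> v = \<pi> p \<alpha> \<beta>)"

definition bivector_field :: "('a, 'v::real_normed_vector) atlas \<Rightarrow> ('a, 'v) bivector_field \<Rightarrow> bool" where
  "bivector_field M \<pi> \<longleftrightarrow>
     (\<forall>p. bounded_bilinear (\<pi> p) \<and> (\<forall>\<alpha>. \<pi> p \<alpha> \<alpha> = 0)) \<and>
     (\<forall>p \<alpha> \<beta>. smooth_on (chart_at M p ` dom_at M p) (\<lambda>z. bivector_loc M \<pi> p z \<alpha> \<beta>))"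

definition poisson_bracket ::
  "('a, 'v::real_normed_vector) atlas \<Rightarrow> ('a, 'v) bivector_field \<Rightarrow> ('a \<Rightarrow> real) \<Rightarrow> ('a \<Rightarrow> real) \<Rightarrow> 'a \<Rightarrow> real" where
  "poisson_bracket M \<pi> f g p = \<pi> p (differential M f p) (differential M g p)"

definition poisson_bivector :: "('a::topological_space, 'v::real_normed_vector) atlas \<Rightarrow> ('a, 'v) bivector_field \<Rightarrow> bool" where
  "poisson_bivector M \<pi> \<longleftrightarrow> bivector_field M \<pi> \<and>
     (\<forall>U f g h. open U \<longrightarrow>
        smooth_map_on M model U f \<longrightarrow> smooth_map_on M model U g \<longrightarrow> smooth_map_on M model U h \<longrightarrow>
        (\<forall>p\<in>U. poisson_bracket M \<pi> (poisson_bracket M \<pi> f g) h p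
             + poisson_bracket M \<pi> (poisson_bracket M \<pi> g h) f p
             + poisson_bracket M \<pi> (poisson_bracket M \<pi> h f) g p = 0))"

definition form1_bracket ::
  "('a, 'v::real_normed_vector) atlas \<Rightarrow> ('a, 'v) bivector_field \<Rightarrow>
   ('a \<Rightarrow> 'v \<Rightarrow>\<^sub>L real) \<Rightarrow> ('a \<Rightarrow> 'v \<Rightarrow>\<^sub>L real) \<Rightarrow> 'a \<Rightarrow> 'v \<Rightarrow>\<^sub>L real" where
  "form1_bracket M \<pi> \<alpha> \<beta> p =
     lie_derivative M (\<lambda>q. sharp \<pi> q (\<alpha> q)) \<beta> p
   - lie_derivative M (\<lambda>q. sharp \<pi> q (\<beta> q)) \<alpha> p
   - differential M (\<lambda>q. \<pi> q (\<alpha> q) (\<beta> q)) p"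

definition prod_bivector ::
  "('a, 'v::real_normed_vector) bivector_field \<Rightarrow> ('b, 'w::real_normed_vector) bivector_field \<Rightarrow> ('a \<times> 'b, 'v \<times> 'w) bivector_field" where
  "prod_bivector \<pi> \<sigma> = (\<lambda>(p, q) \<alpha> \<beta>.
     \<pi> p (\<alpha> o\<^sub>L Blinfun (\<lambda>v. (v, 0))) (\<beta> o\<^sub>L Blinfun (\<lambda>v. (v, 0)))
   + \<sigma> q (\<alpha> o\<^sub>L Blinfun (\<lambda>w. (0, w))) (\<beta> o\<^sub>L Blinfun (\<lambda>w. (0, w))))"

definition poisson_map ::
  "('a, 'v::real_normed_vector) atlas \<Rightarrow> ('a, 'v) bivector_field \<Rightarrow>
   ('b, 'w::real_normed_vector) atlas \<Rightarrow> ('b, 'w) bivector_field \<Rightarrow> ('a \<Rightarrow> 'b) \<Rightarrow> bool" where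
  "poisson_map M \<pi> N \<sigma> f \<longleftrightarrow> smooth_map M N f \<and>
     (\<forall>p \<alpha> \<beta>. \<pi> p (\<alpha> o\<^sub>L tmap M N f p) (\<beta> o\<^sub>L tmap M N f p) = \<sigma> (f p) \<alpha> \<beta>)"

definition symplectic_form :: "('a, 'v::real_normed_vector) atlas \<Rightarrow> ('a \<Rightarrow> 'v \<Rightarrow> 'v \<Rightarrow> real) \<Rightarrow> bool" where
  "symplectic_form M \<Omega> \<longleftrightarrow>
     (\<forall>p. bounded_bilinear (\<Omega> p) \<and> (\<forall>v. \<Omega> p v v = 0)) \<and>
     (\<forall>p v w. smooth_on (chart_at M p ` dom_at M p) (\<lambda>z. form2_loc M \<Omega> p z v w)) \<and>
     (\<forall>p u v w. let D = (\<lambda>u v w. frechet_derivative (\<lambda>z. form2_loc M \<Omega> p z v w) (at (chart_at M p p)) u)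
                in D u v w + D v w u + D w u v = 0) \<and>
     (\<forall>p v. v \<noteq> 0 \<longrightarrow> (\<exists>w. \<Omega> p v w \<noteq> 0))"

text \<open>Convention: the inverse bivector has \<open>\<pi>\<^sup>\<sharp> = (v \<mapsto> \<Omega>(v, \<cdot>))\<^sup>-\<^sup>1\<close>.  The opposite
  convention amounts to replacing \<open>\<Omega>\<close> by \<open>-\<Omega>\<close>.\<close>

definition inverse_bivector :: "('a \<Rightarrow> 'v::real_normed_vector \<Rightarrow> 'v \<Rightarrow> real) \<Rightarrow> ('a, 'v) bivector_field" where
  "inverse_bivector \<Omega> p \<alpha> \<beta> = \<beta> (THE v. \<forall>w. \<Omega> p v w = \<alpha> w)"


section \<open>Poisson-Lie groups and duality\<close>

record ('g, 'v) lie_group =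
  atlas :: "('g, 'v) atlas"
  gmult :: "'g \<Rightarrow> 'g \<Rightarrow> 'g"
  gone :: 'g
  ginv :: "'g \<Rightarrow> 'g"

record (overloaded) ('g, 'v::real_normed_vector) poisson_lie_group = "('g, 'v) lie_group" +
  bivector :: "('g, 'v) bivector_field"

definition is_lie_group :: "('g::topological_space, 'v::real_inner, 'z) lie_group_scheme \<Rightarrow> bool" where
  "is_lie_group G \<longleftrightarrow> manifold (atlas G) \<and> group (gmult G) (gone G) (ginv G) \<and>
     smooth_map (prod_atlas (atlas G) (atlas G)) (atlas G) (\<lambda>(g, h). gmult G g h) \<and>
     smooth_map (atlas G) (atlas G) (ginv G)"

definition right_inv_vf :: "('g, 'v::real_normed_vector, 'z) lie_group_scheme \<Rightarrow> 'v \<Rightarrow> 'g \<Rightarrow> 'v" where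
  "right_inv_vf G \<xi> g = tmap (atlas G) (atlas G) (\<lambda>h. gmult G h g) (gone G) \<xi>"

definition right_inv_form :: "('g, 'v::real_normed_vector, 'z) lie_group_scheme \<Rightarrow> ('v \<Rightarrow>\<^sub>L real) \<Rightarrow> 'g \<Rightarrow> 'v \<Rightarrow>\<^sub>L real" where
  "right_inv_form G \<eta> g = \<eta> o\<^sub>L tmap (atlas G) (atlas G) (\<lambda>h. gmult G h (ginv G g)) g"

definition left_inv_form :: "('g, 'v::real_normed_vector, 'z) lie_group_scheme \<Rightarrow> ('v \<Rightarrow>\<^sub>L real) \<Rightarrow> 'g \<Rightarrow> 'v \<Rightarrow>\<^sub>L real" where
  "left_inv_form G \<eta> g = \<eta> o\<^sub>L tmap (atlas G) (atlas G) (\<lambda>h. gmult G (ginv G g) h) g"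

text \<open>The Lie algebra is \<open>T\<^sub>eG\<close> with the bracket of right invariant vector fields.\<close>

definition lie_bracket :: "('g, 'v::real_normed_vector, 'z) lie_group_scheme \<Rightarrow> 'v \<Rightarrow> 'v \<Rightarrow> 'v" where
  "lie_bracket G \<xi> \<eta> = vf_bracket (atlas G) (right_inv_vf G \<xi>) (right_inv_vf G \<eta>) (gone G)"

definition is_poisson_lie_group ::
  "('g::topological_space, 'v::real_inner) poisson_lie_group \<Rightarrow> bool" where
  "is_poisson_lie_group G \<longleftrightarrow> is_lie_group G \<and> poisson_bivector (atlas G) (bivector G) \<and>
     poisson_map (prod_atlas (atlas G) (atlas G)) (prod_bivector (bivector G) (bivector G))
                 (atlas G) (bivector G) (\<lambda>(g, h). gmult G g h)"

definition dual_bracket ::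
  "('g, 'v::real_normed_vector) poisson_lie_group \<Rightarrow> ('v \<Rightarrow>\<^sub>L real) \<Rightarrow> ('v \<Rightarrow>\<^sub>L real) \<Rightarrow> ('v \<Rightarrow>\<^sub>L real)" where
  "dual_bracket G \<eta> \<zeta> =
     form1_bracket (atlas G) (bivector G) (right_inv_form G \<eta>) (right_inv_form G \<zeta>) (gone G)"

text \<open>\<open>\<iota> : Lie(G\<^sup>*) \<rightarrow> \<gg>\<^sup>*\<close> is the identification of the Lie algebra of the dual group
  with the dual space of \<open>\<gg>\<close>; its transpose identifies \<open>\<gg>\<close> with the dual space of
  \<open>Lie(G\<^sup>*)\<close>.\<close>

definition id_transpose ::
  "('w::real_normed_vector \<Rightarrow>\<^sub>L 'v::real_normed_vector \<Rightarrow>\<^sub>L real) \<Rightarrow> 'v \<Rightarrow> ('w \<Rightarrow>\<^sub>L real)" where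
  "id_transpose \<iota> \<xi> = Blinfun (\<lambda>u. \<iota> u \<xi>)"

definition is_dual_group ::
  "('g::topological_space, 'v::real_inner) poisson_lie_group \<Rightarrow>
   ('h::topological_space, 'w::real_inner) poisson_lie_group \<Rightarrow> ('w \<Rightarrow>\<^sub>L 'v \<Rightarrow>\<^sub>L real) \<Rightarrow> bool" where
  "is_dual_group G Gs \<iota> \<longleftrightarrow>
     is_poisson_lie_group Gs \<and> connected (UNIV :: 'h set) \<and> simply_connected (UNIV :: 'h set) \<and>
     bij (blinfun_apply \<iota>) \<and>
     (\<forall>u v. \<iota> (lie_bracket Gs u v) = dual_bracket G (\<iota> u) (\<iota> v)) \<and>
     (\<forall>\<xi> \<eta>. id_transpose \<iota> (lie_bracket G \<xi> \<eta>) = dual_bracket Gs (id_transpose \<iota> \<xi>) (id_transpose \<iota> \<eta>))"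


section \<open>Actions and dressing actions\<close>

definition smooth_left_action ::
  "('g::topological_space, 'v::real_inner, 'z) lie_group_scheme \<Rightarrow> ('p, 'u::real_inner) atlas \<Rightarrow> ('g \<Rightarrow> 'p \<Rightarrow> 'p) \<Rightarrow> bool" where
  "smooth_left_action G P act \<longleftrightarrow>
     smooth_map (prod_atlas (atlas G) P) P (\<lambda>(g, p). act g p) \<and>
     (\<forall>p. act (gone G) p = p) \<and> (\<forall>g h p. act (gmult G g h) p = act g (act h p))"

definition smooth_right_action ::
  "('h::topological_space, 'w::real_inner, 'z) lie_group_scheme \<Rightarrow> ('p, 'u::real_inner) atlas \<Rightarrow> ('p \<Rightarrow> 'h \<Rightarrow> 'p) \<Rightarrow> bool" where
  "smooth_right_action H P act \<longleftrightarrow>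
     smooth_map (prod_atlas P (atlas H)) P (\<lambda>(p, u). act p u) \<and>
     (\<forall>p. act p (gone H) = p) \<and> (\<forall>p u v. act p (gmult H u v) = act (act p u) v)"

text \<open>The infinitesimal generator at \<open>p\<close>: as \<open>exp(t\<xi>)\<close> has velocity \<open>\<xi>\<close> at \<open>t = 0\<close>, this is
  the derivative of \<open>exp(t\<xi>) p\<close> at \<open>t = 0\<close>.  The argument \<open>orb\<close> is the orbit map through \<open>p\<close>.\<close>

definition generator ::
  "('g, 'v::real_normed_vector, 'z) lie_group_scheme \<Rightarrow> ('p, 'u::real_normed_vector) atlas \<Rightarrow> ('g \<Rightarrow> 'p) \<Rightarrow> 'v \<Rightarrow> 'u" where
  "generator G P orb \<xi> = tmap (atlas G) P orb (gone G) \<xi>"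

definition is_right_dressing_action ::
  "('g::topological_space, 'v::real_inner) poisson_lie_group \<Rightarrow>
   ('h::topological_space, 'w::real_inner) poisson_lie_group \<Rightarrow> ('w \<Rightarrow>\<^sub>L 'v \<Rightarrow>\<^sub>L real) \<Rightarrow> ('g \<Rightarrow> 'h \<Rightarrow> 'g) \<Rightarrow> bool" where
  "is_right_dressing_action G Gs \<iota> \<rho> \<longleftrightarrow> smooth_right_action Gs (atlas G) \<rho> \<and>
     (\<forall>u g. generator Gs (atlas G) (\<lambda>a. \<rho> g a) u = - sharp (bivector G) g (left_inv_form G (\<iota> u) g))"

definition is_left_dressing_action ::
  "('g::topological_space, 'v::real_inner) poisson_lie_group \<Rightarrow>
   ('h::topological_space, 'w::real_inner) poisson_lie_group \<Rightarrow> ('w \<Rightarrow>\<^sub>L 'v \<Rightarrow>\<^sub>L real) \<Rightarrow> ('g \<Rightarrow> 'h \<Rightarrow> 'h) \<Rightarrow> bool" where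
  "is_left_dressing_action G Gs \<iota> \<sigma> \<longleftrightarrow> smooth_left_action G (atlas Gs) \<sigma> \<and>
     (\<forall>\<xi> a. generator G (atlas Gs) (\<lambda>g. \<sigma> g a) \<xi> = sharp (bivector Gs) a (right_inv_form Gs (id_transpose \<iota> \<xi>) a))"

definition complete_poisson_lie_group ::
  "('g::topological_space, 'v::real_inner) poisson_lie_group \<Rightarrow>
   ('h::topological_space, 'w::real_inner) poisson_lie_group \<Rightarrow> ('w \<Rightarrow>\<^sub>L 'v \<Rightarrow>\<^sub>L real) \<Rightarrow> bool" where
  "complete_poisson_lie_group G Gs \<iota> \<longleftrightarrow> (\<exists>\<rho>. is_right_dressing_action G Gs \<iota> \<rho>)"

text \<open>The action \<open>(g, u) \<mapsto> g\<^sup>u\<close>.  It is unique if it exists, because \<open>G\<^sup>*\<close> is connected.\<close>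

definition dress ::
  "('g::topological_space, 'v::real_inner) poisson_lie_group \<Rightarrow>
   ('h::topological_space, 'w::real_inner) poisson_lie_group \<Rightarrow> ('w \<Rightarrow>\<^sub>L 'v \<Rightarrow>\<^sub>L real) \<Rightarrow> 'g \<Rightarrow> 'h \<Rightarrow> 'g" where
  "dress G Gs \<iota> = (SOME \<rho>. is_right_dressing_action G Gs \<iota> \<rho>)"

definition poisson_action ::
  "('g::topological_space, 'v::real_inner) poisson_lie_group \<Rightarrow> ('p, 'u::real_inner) atlas \<Rightarrow>
   ('p, 'u) bivector_field \<Rightarrow> ('g \<Rightarrow> 'p \<Rightarrow> 'p) \<Rightarrow> bool" where
  "poisson_action G P \<pi> act \<longleftrightarrow> smooth_left_action G P act \<and>
     poisson_map (prod_atlas (atlas G) P) (prod_bivector (bivector G) \<pi>) P \<pi> (\<lambda>(g, p). act g p)"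

definition momentum_map ::
  "('g::topological_space, 'v::real_inner) poisson_lie_group \<Rightarrow>
   ('h::topological_space, 'w::real_inner) poisson_lie_group \<Rightarrow> ('w \<Rightarrow>\<^sub>L 'v \<Rightarrow>\<^sub>L real) \<Rightarrow>
   ('p, 'u::real_inner) atlas \<Rightarrow> ('p, 'u) bivector_field \<Rightarrow> ('g \<Rightarrow> 'p \<Rightarrow> 'p) \<Rightarrow> ('p \<Rightarrow> 'h) \<Rightarrow> bool" where
  "momentum_map G Gs \<iota> P \<pi> act \<mu> \<longleftrightarrow> smooth_map P (atlas Gs) \<mu> \<and>
     (\<forall>\<xi> p. generator G P (\<lambda>g. act g p) \<xi> =
        sharp \<pi> p (right_inv_form Gs (id_transpose \<iota> \<xi>) (\<mu> p) o\<^sub>L tmap P (atlas Gs) \<mu> p))"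

definition hamiltonian_action ::
  "('g::topological_space, 'v::real_inner) poisson_lie_group \<Rightarrow>
   ('h::topological_space, 'w::real_inner) poisson_lie_group \<Rightarrow> ('w \<Rightarrow>\<^sub>L 'v \<Rightarrow>\<^sub>L real) \<Rightarrow>
   ('p, 'u::real_inner) atlas \<Rightarrow> ('p, 'u) bivector_field \<Rightarrow> ('g \<Rightarrow> 'p \<Rightarrow> 'p) \<Rightarrow> ('p \<Rightarrow> 'h) \<Rightarrow> bool" where
  "hamiltonian_action G Gs \<iota> P \<pi> act \<mu> \<longleftrightarrow>
     poisson_action G P \<pi> act \<and> momentum_map G Gs \<iota> P \<pi> act \<mu> \<and>
     (\<exists>\<sigma>. is_left_dressing_action G Gs \<iota> \<sigma> \<and> (\<forall>g p. \<mu> (act g p) = \<sigma> g (\<mu> p)))"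


section \<open>Symplectic groupoids\<close>

text \<open>The multiplication \<open>comp\<close> is a total function, but its values matter only on the set of
  composable pairs.\<close>

record ('p, 'u, 'm, 'x) groupoid =
  arrows :: "('p, 'u) atlas"
  objects :: "('m, 'x) atlas"
  src :: "'p \<Rightarrow> 'm"
  tgt :: "'p \<Rightarrow> 'm"
  ident :: "'m \<Rightarrow> 'p"
  invs :: "'p \<Rightarrow> 'p"
  arr_mult :: "'p \<Rightarrow> 'p \<Rightarrow> 'p"

definition composable :: "('p, 'u, 'm, 'x) groupoid \<Rightarrow> ('p \<times> 'p) set" where
  "composable \<G> = {(x, y). src \<G> x = tgt \<G> y}"

definition is_groupoid :: "('p, 'u, 'm, 'x) groupoid \<Rightarrow> bool" where
  "is_groupoid \<G> \<longleftrightarrow>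
     (\<forall>(x, y) \<in> composable \<G>. src \<G> (arr_mult \<G> x y) = src \<G> y \<and> tgt \<G> (arr_mult \<G> x y) = tgt \<G> x) \<and>
     (\<forall>x y z. (x, y) \<in> composable \<G> \<longrightarrow> (y, z) \<in> composable \<G> \<longrightarrow>
        arr_mult \<G> (arr_mult \<G> x y) z = arr_mult \<G> x (arr_mult \<G> y z)) \<and>
     (\<forall>m. src \<G> (ident \<G> m) = m \<and> tgt \<G> (ident \<G> m) = m) \<and>
     (\<forall>x. arr_mult \<G> x (ident \<G> (src \<G> x)) = x \<and> arr_mult \<G> (ident \<G> (tgt \<G> x)) x = x) \<and>
     (\<forall>x. src \<G> (invs \<G> x) = tgt \<G> x \<and> tgt \<G> (invs \<G> x) = src \<G> x \<and>
        arr_mult \<G> x (invs \<G> x) = ident \<G> (tgt \<G> x) \<and> arr_mult \<G> (invs \<G> x) x = ident \<G> (src \<G> x))"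

definition submersion ::
  "('a, 'v::real_normed_vector) atlas \<Rightarrow> ('b, 'w::real_normed_vector) atlas \<Rightarrow> ('a \<Rightarrow> 'b) \<Rightarrow> bool" where
  "submersion M N f \<longleftrightarrow> smooth_map M N f \<and> (\<forall>p. surj (blinfun_apply (tmap M N f p)))"

definition lie_groupoid ::
  "('p::topological_space, 'u::real_inner, 'm::topological_space, 'x::real_inner) groupoid \<Rightarrow> bool" where
  "lie_groupoid \<G> \<longleftrightarrow> is_groupoid \<G> \<and> manifold (arrows \<G>) \<and> manifold (objects \<G>) \<and>
     submersion (arrows \<G>) (objects \<G>) (src \<G>) \<and> submersion (arrows \<G>) (objects \<G>) (tgt \<G>) \<and>
     smooth_map (objects \<G>) (arrows \<G>) (ident \<G>) \<and> smooth_map (arrows \<G>) (arrows \<G>) (invs \<G>) \<and>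
     smooth_map_on (prod_atlas (arrows \<G>) (arrows \<G>)) (arrows \<G>) (composable \<G>) (\<lambda>(x, y). arr_mult \<G> x y)"

text \<open>As \<open>src\<close> and \<open>tgt\<close> are submersions, the set of composable pairs is an embedded submanifold
  whose tangent space consists of the pairs \<open>(v, w)\<close> with \<open>d src(v) = d tgt(w)\<close>.\<close>

definition composable_tangent ::
  "('p, 'u::real_normed_vector, 'm, 'x::real_normed_vector) groupoid \<Rightarrow> 'p \<times> 'p \<Rightarrow> ('u \<times> 'u) set" where
  "composable_tangent \<G> = (\<lambda>(x, y). {(v, w).
     tmap (arrows \<G>) (objects \<G>) (src \<G>) x v = tmap (arrows \<G>) (objects \<G>) (tgt \<G>) y w})"

definition multiplicative_form ::
  "('p, 'u::real_normed_vector, 'm, 'x::real_normed_vector) groupoid \<Rightarrow> ('p \<Rightarrow> 'u \<Rightarrow> 'u \<Rightarrow> real) \<Rightarrow> bool" where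
  "multiplicative_form \<G> \<Omega> \<longleftrightarrow>
     (\<forall>(x, y) \<in> composable \<G>. \<forall>(v, w) \<in> composable_tangent \<G> (x, y).
      \<forall>(v', w') \<in> composable_tangent \<G> (x, y).
        let dm = tmap_on (prod_atlas (arrows \<G>) (arrows \<G>)) (arrows \<G>) (composable \<G>) (\<lambda>(x, y). arr_mult \<G> x y) (x, y)
        in \<Omega> (arr_mult \<G> x y) (dm (v, w)) (dm (v', w')) = \<Omega> x v v' + \<Omega> y w w')"

definition symplectic_groupoid ::
  "('p::topological_space, 'u::real_inner, 'm::topological_space, 'x::real_inner) groupoid \<Rightarrow>
   ('p \<Rightarrow> 'u \<Rightarrow> 'u \<Rightarrow> real) \<Rightarrow> bool" where
  "symplectic_groupoid \<G> \<Omega> \<longleftrightarrow>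
     lie_groupoid \<G> \<and> symplectic_form (arrows \<G>) \<Omega> \<and> multiplicative_form \<G> \<Omega>"

definition source_connected :: "('p::topological_space, 'u, 'm, 'x) groupoid \<Rightarrow> bool" where
  "source_connected \<G> \<longleftrightarrow> (\<forall>m. connected {x. src \<G> x = m})"

end

theory Submission
  imports Defs
begin

text \<open>
  Write \<open>X\<^sub>\<xi>\<close> for the generator of \<open>\<xi>\<close> on \<open>\<G>\<close> and \<open>\<kappa>\<^sub>u\<close> for the coadjoint operator of \<open>u \<in> G\<^sup>*\<close>.  Both properties are
  equivalent to the infinitesimal identity \<open>X\<^sub>\<xi>(x y) = dm(X\<^sub>\<xi>(x), X\<^sub>\<eta>(y))\<close> with \<open>\<eta> = \<kappa>\<^bsub>J(x)\<^esub> \<xi>\<close>.  By the momentum map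
  condition, \<open>\<Omega>(X\<^sub>\<xi>, _)\<close> is the differential of \<open>J\<close> paired with \<open>\<xi>\<close>, so multiplicativity of \<open>\<Omega>\<close> turns this identity into
  the statement that \<open>J(x y)\<close> and \<open>J(x) J(y)\<close> have the same logarithmic derivative.  On source fibres, which are
  connected, it integrates to \<open>J(x y) = J(x) J(y)\<close>.  Conversely it is recovered from (i), since composability of two
  tangent vectors, as well as their product, is detected by pairing with all composable tangent vectors through \<open>\<Omega>\<close>.

  Along the connected group \<open>G\<close> the identity integrates to twisted multiplicativity, provided that the differential of
  \<open>h \<mapsto> h\<^sup>u\<close> at \<open>h\<close>, in right trivializations, is the coadjoint operator of the left dressing translate of \<open>u\<close> by \<open>h\<close>.
  This compatibility of the two dressing actions holds because its defect and that of its mirror image solve a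
  homogeneous linear Goursat problem on \<open>G \<times> G\<^sup>*\<close> with zero initial values.

  No differential equation has to be solved: in preferred charts tangent spaces are literally the model space and
  differentials are functorial, and each integration is the remark that a map with zero differential on a connected
  manifold, or on a connected fibre of a submersion, is constant.
\<close>

section \<open>Finite-dimensional inner product spaces\<close>

text \<open>What shapes the development is that the differential of the groupoid multiplication
  lives on the set of composable pairs, which is in general not open. There \<open>tmap_on\<close>
  is a derivative within a subset, with arbitrary values off the tangent space, so identities for it
  are obtained by differentiating curves of composable pairs; submersions supply enough of them. A
  lift of a curve needs a prescribed velocity at one parameter value only, hence may be chosen
  pointwise, without continuity elsewhere. The two dressing actions enter asymmetrically, one on the
  left and one on the right, with right and left invariant forms. Opposite groups and a symmetric
  notion of dual pairing restore the symmetry, so that both equations of the Goursat problem are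
  instances of one computation. The Poisson structures enter it through the behaviour of their
  fundamental fields under products and through their linearization at the unit. Model spaces may
  have dimension 0; compactness, boundedness and continuity of operators are derived from expansions
  in a finite orthonormal set.\<close>

definition onb :: "'v::real_inner set \<Rightarrow> bool" where
  "onb B \<longleftrightarrow> finite B \<and> (\<forall>b\<in>B. norm b = 1) \<and> (\<forall>x. (\<Sum>b\<in>B. (x \<bullet> b) *\<^sub>R b) = x)"

definition fin_dim :: "'v::real_inner itself \<Rightarrow> bool" where
  "fin_dim _ \<longleftrightarrow> (\<exists>B::'v set. onb B)"

text \<open>Orthogonalize a finite spanning set and normalize its nonzero members.
  \<open>onb\<close> records orthogonality only through the expansion: for x = b in B it yields that
  the squares of b \<bullet> c sum to 1, and the term c = b is already 1.\<close>

lemma fin_dimI: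
  assumes "finite (B::'v::real_inner set)" "span B = UNIV"
  shows "fin_dim TYPE('v)"
proof -
  from basis_orthogonal[OF assms(1)] obtain C :: "'v set" where C: "finite C" "span C = UNIV" "pairwise orthogonal C"
    using assms(2) by metis
  define D where "D = (\<lambda>x. x /\<^sub>R norm x) ` (C - {0})"
  have orth: "x \<bullet> y = 0" if "x \<in> D" "y \<in> D" "x \<noteq> y" for x y
    using that C(3) unfolding D_def pairwise_def orthogonal_def by force
  have n1: "norm x = 1" if "x \<in> D" for x
  proof -
    from that obtain y where "x = y /\<^sub>R norm y" "y \<noteq> 0" unfolding D_def by blast
    then show ?thesis by simp
  qed
  have fD: "finite D" using C(1) unfolding D_def by auto
  have "C \<subseteq> span D"
  proof
    fix x assume "x \<in> C"
    show "x \<in> span D"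
    proof (cases "x = 0")
      case False
      then have "x /\<^sub>R norm x \<in> span D" using \<open>x \<in> C\<close> unfolding D_def by (intro span_base) auto
      then have "norm x *\<^sub>R (x /\<^sub>R norm x) \<in> span D" by (rule span_scale)
      then show ?thesis using False by simp
    qed (simp add: span_zero)
  qed
  then have sp: "span D = UNIV" using C(2) span_minimal[OF _ subspace_span] by (metis top.extremum_unique)
  have "(\<Sum>b\<in>D. (x \<bullet> b) *\<^sub>R b) = x" for x
  proof -
    have "x \<in> span D" using sp by auto
    then obtain u where u: "x = (\<Sum>v\<in>D. u v *\<^sub>R v)" using span_finite[OF fD] by auto
    have "x \<bullet> b = u b" if "b \<in> D" for b
    proof -
      have "x \<bullet> b = (\<Sum>v\<in>D. u v * (v \<bullet> b))" unfolding u by (simp add: inner_sum_left)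
      also have "\<dots> = (\<Sum>v\<in>D. if v = b then u v else 0)"
        using orth that n1 by (intro sum.cong) (auto simp: norm_eq_1)
      also have "\<dots> = u b" using that fD by simp
      finally show ?thesis .
    qed
    then show ?thesis by (subst (2) u) (intro sum.cong, auto)
  qed
  then show ?thesis unfolding fin_dim_def onb_def using fD n1 by blast
qed

lemma fin_dimE:
  assumes "fin_dim TYPE('v::real_inner)"
  obtains B :: "'v::real_inner set" where "finite B" "\<And>b. b \<in> B \<Longrightarrow> norm b = 1" "\<And>x. (\<Sum>b\<in>B. (x \<bullet> b) *\<^sub>R b) = x"
proof -
  from assms obtain B :: "'v set" where B: "onb B" unfolding fin_dim_def by blast
  then show thesis by (intro that[of B]) (simp_all add: onb_def)
qed

lemma fin_dim_real: "fin_dim TYPE(real)"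
proof (rule fin_dimI[of "{1}"])
  have "x \<in> span {1}" for x :: real using span_scale[OF span_base[of 1 "{1::real}"], of x] by simp
  then show "span {1::real} = UNIV" by blast
qed simp

lemma fin_dim_prod:
  assumes "fin_dim TYPE('v::real_inner)" "fin_dim TYPE('w::real_inner)"
  shows "fin_dim TYPE('v \<times> 'w)"
proof -
  obtain B :: "'v set" where B: "finite B" "\<And>x. (\<Sum>b\<in>B. (x \<bullet> b) *\<^sub>R b) = x" using fin_dimE[OF assms(1)] by metis
  obtain C :: "'w set" where C: "finite C" "\<And>x. (\<Sum>b\<in>C. (x \<bullet> b) *\<^sub>R b) = x" using fin_dimE[OF assms(2)] by metis
  let ?D = "(\<lambda>b. (b, 0)) ` B \<union> (\<lambda>c. (0, c)) ` C"
  have "x \<in> span ?D" for x :: "'v \<times> 'w"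
  proof -
    have "(\<Sum>b\<in>B. (fst x \<bullet> b) *\<^sub>R (b, 0)) + (\<Sum>c\<in>C. (snd x \<bullet> c) *\<^sub>R (0, c)) \<in> span ?D"
      by (intro span_add span_sum span_scale span_base) auto
    also have "(\<Sum>b\<in>B. (fst x \<bullet> b) *\<^sub>R (b, 0)) + (\<Sum>c\<in>C. (snd x \<bullet> c) *\<^sub>R (0, c)) = x"
      by (rule prod_eqI) (simp_all add: fst_sum snd_sum B(2) C(2))
    finally show ?thesis .
  qed
  then show ?thesis using B(1) C(1) by (intro fin_dimI[of ?D]) auto
qed

lemma linear_bounded_fin_dim:
  fixes f :: "'v::real_inner \<Rightarrow> 'w::real_normed_vector"
  assumes "fin_dim TYPE('v)" "linear f"
  shows "bounded_linear f"
proof -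
  obtain B :: "'v set" where B: "finite B" "\<And>x. (\<Sum>b\<in>B. (x \<bullet> b) *\<^sub>R b) = x" using fin_dimE[OF assms(1)] by metis
  have "f = (\<lambda>x. \<Sum>b\<in>B. (x \<bullet> b) *\<^sub>R f b)"
  proof
    fix x show "f x = (\<Sum>b\<in>B. (x \<bullet> b) *\<^sub>R f b)"
      by (subst B(2)[symmetric]) (simp add: linear_sum[OF assms(2)] linear_cmul[OF assms(2)])
  qed
  moreover have "bounded_linear (\<lambda>x. \<Sum>b\<in>B. (x \<bullet> b) *\<^sub>R f b)"
    by (intro bounded_linear_sum bounded_linear_scaleR_left[THEN bounded_linear_compose] bounded_linear_inner_left)
  ultimately show ?thesis by simp
qed

text \<open>The closed ball around 0 is a closed part of the set of all combinations of the
  orthonormal set with coefficients in [-r, r], which is compact as an iterated sum of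
  segments.\<close>

lemma compact_cball_fin_dim:
  fixes x :: "'v::real_inner"
  assumes "fin_dim TYPE('v)"
  shows "compact (cball x r)"
proof -
  obtain B :: "'v set" where B: "finite B" "\<And>b. b \<in> B \<Longrightarrow> norm b = 1" "\<And>x. (\<Sum>b\<in>B. (x \<bullet> b) *\<^sub>R b) = x"
    using fin_dimE[OF assms] by metis
  have *: "compact {\<Sum>b\<in>C. c b *\<^sub>R b | c. \<forall>b\<in>C. \<bar>c b\<bar> \<le> R}" if "finite C" for C :: "'v set" and R :: real
    using that
  proof induction
    case (insert x F)
    have "{\<Sum>b\<in>insert x F. c b *\<^sub>R b | c. \<forall>b\<in>insert x F. \<bar>c b\<bar> \<le> R}
       = {y + z | y z. y \<in> (\<lambda>t. t *\<^sub>R x) ` {-R..R} \<and> z \<in> {\<Sum>b\<in>F. c b *\<^sub>R b | c. \<forall>b\<in>F. \<bar>c b\<bar> \<le> R}}" (is "?L = ?R")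
    proof (intro equalityI subsetI)
      fix y assume "y \<in> ?L"
      then obtain c where c: "\<forall>b\<in>insert x F. \<bar>c b\<bar> \<le> R" "y = (\<Sum>b\<in>insert x F. c b *\<^sub>R b)" by blast
      then have "y = c x *\<^sub>R x + (\<Sum>b\<in>F. c b *\<^sub>R b)" using insert by simp
      moreover have "c x *\<^sub>R x \<in> (\<lambda>t. t *\<^sub>R x) ` {-R..R}" using c(1) by (auto simp: abs_le_iff)
      moreover have "(\<Sum>b\<in>F. c b *\<^sub>R b) \<in> {\<Sum>b\<in>F. c b *\<^sub>R b | c. \<forall>b\<in>F. \<bar>c b\<bar> \<le> R}" using c(1) by auto
      ultimately show "y \<in> ?R" by blast
    next
      fix y assume "y \<in> ?R"
      then obtain t c where tc0: "t \<in> {-R..R}" "\<forall>b\<in>F. \<bar>c b\<bar> \<le> R" "y = t *\<^sub>R x + (\<Sum>b\<in>F. c b *\<^sub>R b)" by blast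
      then have tc: "\<bar>t\<bar> \<le> R" "\<forall>b\<in>F. \<bar>c b\<bar> \<le> R" "y = t *\<^sub>R x + (\<Sum>b\<in>F. c b *\<^sub>R b)" by (auto simp: abs_le_iff)
      have "(\<Sum>b\<in>insert x F. (c(x := t)) b *\<^sub>R b) = y"
      proof -
        have "(\<Sum>b\<in>F. (c(x := t)) b *\<^sub>R b) = (\<Sum>b\<in>F. c b *\<^sub>R b)" using insert by (intro sum.cong) auto
        then show ?thesis using insert tc(3) by simp
      qed
      moreover have "\<forall>b\<in>insert x F. \<bar>(c(x := t)) b\<bar> \<le> R" using tc by auto
      ultimately show "y \<in> ?L" by blast
    qed
    moreover have "compact ((\<lambda>t. t *\<^sub>R x) ` {-R..R})" by (intro compact_continuous_image continuous_intros) auto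
    ultimately show ?case using compact_sums[OF _ insert.IH] by simp
  qed (auto)
  have "cball 0 r' \<subseteq> {\<Sum>b\<in>B. c b *\<^sub>R b | c. \<forall>b\<in>B. \<bar>c b\<bar> \<le> r'}" for r'
  proof
    fix y :: 'v assume "y \<in> cball 0 r'"
    then have "\<forall>b\<in>B. \<bar>y \<bullet> b\<bar> \<le> r'" using Cauchy_Schwarz_ineq2[of y] B(2) by (fastforce intro: order_trans)
    then show "y \<in> {\<Sum>b\<in>B. c b *\<^sub>R b | c. \<forall>b\<in>B. \<bar>c b\<bar> \<le> r'}" using B(3)[of y] by (intro CollectI exI[of _ "\<lambda>b. y \<bullet> b"]) auto
  qed
  then have "compact (cball 0 r :: 'v set)"
    using compact_Int_closed[OF *[OF B(1), of r] closed_cball[of 0 r]] by (simp only: Int_absorb1)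
  then have "compact ((\<lambda>y. x + y) ` cball 0 r)" by (intro compact_continuous_image continuous_intros)
  then show ?thesis by simp
qed

text \<open>Reflexivity: \<phi> is determined by its values on the inner products with members of an
  orthonormal set, which span the dual. It gives meaning to the \<open>THE\<close> in
  \<open>sharp\<close>.\<close>

lemma linear_functional_eval:
  fixes \<phi> :: "('v::real_inner \<Rightarrow>\<^sub>L real) \<Rightarrow> real"
  assumes "fin_dim TYPE('v)" "linear \<phi>"
  shows "\<exists>!v. \<forall>\<beta>. blinfun_apply \<beta> v = \<phi> \<beta>"
proof -
  obtain B :: "'v set" where B: "finite B" "\<And>x. (\<Sum>b\<in>B. (x \<bullet> b) *\<^sub>R b) = x" using fin_dimE[OF assms(1)] by metis
  let ?e = "\<lambda>b. blinfun_inner_left b"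
  let ?v = "\<Sum>b\<in>B. \<phi> (?e b) *\<^sub>R b"
  have "blinfun_apply \<beta> ?v = \<phi> \<beta>" for \<beta>
  proof -
    have "\<beta> = (\<Sum>b\<in>B. \<beta> b *\<^sub>R ?e b)"
    proof (rule blinfun_eqI)
      fix x have "blinfun_apply \<beta> x = \<beta> (\<Sum>b\<in>B. (x \<bullet> b) *\<^sub>R b)" by (simp add: B(2))
      then show "blinfun_apply \<beta> x = (\<Sum>b\<in>B. \<beta> b *\<^sub>R ?e b) x"
        by (simp add: blinfun.sum_right blinfun.scaleR_right blinfun.sum_left blinfun.scaleR_left inner_commute mult.commute)
    qed
    then have "\<phi> \<beta> = \<phi> (\<Sum>b\<in>B. \<beta> b *\<^sub>R ?e b)" by (rule arg_cong)
    then have "\<phi> \<beta> = (\<Sum>b\<in>B. \<beta> b * \<phi> (?e b))"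
      by (simp add: linear_sum[OF assms(2)] linear_cmul[OF assms(2)])
    then show ?thesis by (simp add: blinfun.sum_right blinfun.scaleR_right mult.commute)
  qed
  moreover have "v = w" if "\<forall>\<beta>. blinfun_apply \<beta> v = \<phi> \<beta>" "\<forall>\<beta>. blinfun_apply \<beta> w = \<phi> \<beta>" for v w
  proof -
    have "blinfun_apply (blinfun_inner_left b) v = blinfun_apply (blinfun_inner_left b) w" for b
      using that by (simp del: blinfun_inner_left.rep_eq)
    then have "v \<bullet> b = w \<bullet> b" for b by (simp add: inner_commute)
    then show ?thesis by (metis vector_eq_ldot vector_eq_rdot)
  qed
  ultimately show ?thesis by blast
qed

lemma covector_eqD:
  fixes v w :: "'v::real_inner"
  assumes "\<And>\<beta> :: 'v \<Rightarrow>\<^sub>L real. blinfun_apply \<beta> v = \<beta> w"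
  shows "v = w"
proof -
  have "v \<bullet> b = w \<bullet> b" for b using assms[of "blinfun_inner_left b"] by (simp add: inner_commute)
  then show ?thesis by (metis vector_eq_ldot vector_eq_rdot)
qed

text \<open>Dimension count: a vector outside the span of the image of a basis would enlarge that
  image to an independent set with more elements than the basis.\<close>

lemma linear_inj_imp_surj_fin_dim:
  fixes f :: "'v::real_inner \<Rightarrow> 'v"
  assumes "fin_dim TYPE('v)" "linear f" "inj f"
  shows "surj f"
proof -
  obtain B :: "'v set" where B: "finite B" "\<And>x. (\<Sum>b\<in>B. (x \<bullet> b) *\<^sub>R b) = x" using fin_dimE[OF assms(1)] by metis
  have sB: "span B = UNIV"
  proof -
    have "x \<in> span B" for x using B(2)[of x] by (metis (no_types, lifting) span_base span_scale span_sum)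
    then show ?thesis by auto
  qed
  obtain C where C: "C \<subseteq> B" "independent C" "span C = UNIV"
    using maximal_independent_subset[of B] sB by (metis span_mono span_span top.extremum_uniqueI)
  have fC: "finite C" using C(1) B(1) finite_subset by auto
  have ind: "independent (f ` C)" using linear_independent_injective_image[OF assms(2) C(2)] assms(3) inj_on_subset by blast
  have "x \<in> span (f ` C)" for x
  proof (rule ccontr)
    assume x: "x \<notin> span (f ` C)"
    then have "independent (insert x (f ` C))" using ind by (simp add: independent_insertI)
    then have "card (insert x (f ` C)) \<le> card C" using independent_span_bound[OF fC, of "insert x (f ` C)"] C(3) by auto
    moreover have "x \<notin> f ` C" using x span_superset[of "f ` C"] by auto
    moreover have "card (f ` C) = card C" using assms(3) by (meson card_image inj_on_subset subset_UNIV)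
    ultimately show False using fC by simp
  qed
  then show ?thesis using linear_span_image[OF assms(2), of C] C(3) by blast
qed

text \<open>An operator is a finite sum of rank one operators built from its values on an
  orthonormal set, so pointwise continuity gives continuity in the operator norm.\<close>

lemma continuous_blinfunI:
  fixes A :: "'a::topological_space \<Rightarrow> 'v::real_inner \<Rightarrow>\<^sub>L 'w::real_normed_vector"
  assumes "fin_dim TYPE('v)" "\<And>v. continuous_on S (\<lambda>x. A x v)"
  shows "continuous_on S A"
proof -
  obtain B :: "'v set" where B: "finite B" "\<And>x. (\<Sum>b\<in>B. (x \<bullet> b) *\<^sub>R b) = x" using fin_dimE[OF assms(1)] by metis
  have "A x = (\<Sum>b\<in>B. blinfun_scaleR_left (A x b) o\<^sub>L blinfun_inner_left b)" for x
  proof (rule blinfun_eqI)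
    fix v have "A x v = A x (\<Sum>b\<in>B. (v \<bullet> b) *\<^sub>R b)" by (simp add: B(2))
    then show "A x v = (\<Sum>b\<in>B. blinfun_scaleR_left (A x b) o\<^sub>L blinfun_inner_left b) v"
      by (simp add: blinfun.sum_right blinfun.scaleR_right blinfun.sum_left inner_commute)
  qed
  moreover have "continuous_on S (\<lambda>x. \<Sum>b\<in>B. blinfun_scaleR_left (A x b) o\<^sub>L blinfun_inner_left b)"
    by (intro continuous_on_sum bounded_bilinear.continuous_on[OF bounded_bilinear_blinfun_compose] continuous_on_const
        bounded_linear.continuous_on[OF bounded_linear_blinfun_scaleR_left] assms(2))
  ultimately show ?thesis by presburger
qed

section \<open>Functions of class Ck\<close>

lemma Ck_on_Suc_iff: "Ck_on (Suc k) S f \<longleftrightarrow> (\<forall>x\<in>S. f differentiable (at x)) \<and>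
      (\<forall>v. Ck_on k S (\<lambda>x. frechet_derivative f (at x) v))"
  by simp

lemma Ck_on_cong:
  assumes "open S" "\<And>x. x \<in> S \<Longrightarrow> f x = g x" "Ck_on k S f"
  shows "Ck_on k S g"
  using assms(2,3)
proof (induction k arbitrary: f g)
  case 0 then show ?case by (auto cong: continuous_on_cong)
next
  case (Suc k)
  have d: "frechet_derivative f (at x) = frechet_derivative g (at x)" if "x \<in> S" for x
    using frechet_derivative_transform_within_open[OF _ assms(1) that, of f g] Suc.prems that by auto
  have "g differentiable at x" if "x \<in> S" for x
    using Suc.prems that assms(1) unfolding Ck_on.simps differentiable_def by (metis has_derivative_transform_within_open)
  moreover have "Ck_on k S (\<lambda>x. frechet_derivative g (at x) v)" for v
    by (rule Suc.IH[of "\<lambda>x. frechet_derivative f (at x) v"]) (use Suc.prems d in auto)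
  ultimately show ?case by simp
qed

lemma Ck_on_subset: "Ck_on k S f \<Longrightarrow> T \<subseteq> S \<Longrightarrow> Ck_on k T f"
proof (induction k arbitrary: f)
  case 0 then show ?case by (auto intro: continuous_on_subset)
next
  case (Suc k) then show ?case unfolding Ck_on_Suc_iff by blast
qed

lemma Ck_on_SucD: "Ck_on (Suc k) S f \<Longrightarrow> Ck_on k S f"
proof (induction k arbitrary: f)
  case 0
  then have "isCont f x" if "x \<in> S" for x using that differentiable_imp_continuous_within by auto
  then show ?case by (simp add: continuous_at_imp_continuous_on)
next
  case (Suc k)
  then show ?case by (meson Ck_on_Suc_iff)
qed

lemma Ck_on_has_derivative:
  "Ck_on (Suc k) S f \<Longrightarrow> x \<in> S \<Longrightarrow> (f has_derivative frechet_derivative f (at x)) (at x)"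
  using Ck_on_Suc_iff[of k S f] frechet_derivative_works by blast

lemma Ck_on_SucI:
  assumes "open S" "\<And>x. x \<in> S \<Longrightarrow> (f has_derivative f' x) (at x)" "\<And>v. Ck_on k S (\<lambda>x. f' x v)"
  shows "Ck_on (Suc k) S f"
proof -
  have "frechet_derivative f (at x) = f' x" if "x \<in> S" for x using assms(2)[OF that] frechet_derivative_at by metis
  then have "Ck_on k S (\<lambda>x. frechet_derivative f (at x) v)" for v
    by (intro Ck_on_cong[OF assms(1) _ assms(3)]) auto
  then show ?thesis using assms(2) by (auto simp: differentiable_def)
qed

lemma Ck_on_const: "open S \<Longrightarrow> Ck_on k S (\<lambda>x. c)"
proof (induction k arbitrary: c)
  case (Suc k) then show ?case by (intro Ck_on_SucI[where f' = "\<lambda>x v. 0"]) auto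
qed auto

lemma Ck_on_linear:
  assumes "open S" "bounded_linear L" "Ck_on k S f"
  shows "Ck_on k S (\<lambda>x. L (f x))"
  using assms(3)
proof (induction k arbitrary: f)
  case 0 then show ?case using bounded_linear.continuous_on[OF assms(2)] by auto
next
  case (Suc k)
  show ?case
    by (rule Ck_on_SucI[OF assms(1) bounded_linear.has_derivative[OF assms(2) Ck_on_has_derivative[OF Suc.prems]]])
       (use Suc in auto)
qed

lemma Ck_on_bounded_linear: "open S \<Longrightarrow> bounded_linear L \<Longrightarrow> Ck_on k S L"
proof (induction k)
  case 0 then show ?case using bounded_linear.continuous_on[OF _ continuous_on_id, of L S] by auto
next
  case (Suc k)
  show ?case by (rule Ck_on_SucI[OF Suc.prems(1) bounded_linear_imp_has_derivative[OF Suc.prems(2)]]) (use Suc.prems Ck_on_const in auto)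
qed

lemma Ck_on_add:
  assumes "open S" "Ck_on k S f" "Ck_on k S g"
  shows "Ck_on k S (\<lambda>x. f x + g x)"
  using assms(2,3)
proof (induction k arbitrary: f g)
  case 0 then show ?case by (auto intro: continuous_on_add)
next
  case (Suc k)
  show ?case
    by (rule Ck_on_SucI[OF assms(1) has_derivative_add[OF Ck_on_has_derivative[OF Suc.prems(1)] Ck_on_has_derivative[OF Suc.prems(2)]]])
       (use Suc in auto)
qed

lemma Ck_on_sum:
  assumes "open S" "finite B" "\<And>b. b \<in> B \<Longrightarrow> Ck_on k S (f b)"
  shows "Ck_on k S (\<lambda>x. \<Sum>b\<in>B. f b x)"
  using assms(2,3)
proof induction
  case empty then show ?case using Ck_on_const[OF assms(1)] by simp
next
  case (insert b F)
  then show ?case using Ck_on_add[OF assms(1), of k "f b"] by simp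
qed

lemma Ck_on_scaleR:
  fixes f :: "'a::real_normed_vector \<Rightarrow> real"
  assumes "open S" "Ck_on k S f" "Ck_on k S g"
  shows "Ck_on k S (\<lambda>x. f x *\<^sub>R g x)"
  using assms(2,3)
proof (induction k arbitrary: f g)
  case 0 then show ?case by (auto intro: continuous_on_scaleR)
next
  case (Suc k)
  show ?case
    apply (rule Ck_on_SucI[OF assms(1) has_derivative_scaleR[OF Ck_on_has_derivative[OF Suc.prems(1)] Ck_on_has_derivative[OF Suc.prems(2)]]], assumption, assumption)
    apply (intro Ck_on_add assms(1) Suc.IH)
    using Suc.prems Ck_on_SucD[OF Suc.prems(1)] Ck_on_SucD[OF Suc.prems(2)] by auto
qed

text \<open>\<open>Ck_on\<close> speaks of derivatives in fixed directions, whereas the chain rule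
  inserts the variable direction f'(x) v. Expanding this direction in an orthonormal set of the
  middle space makes the derivative a finite sum of products within reach of the induction
  hypothesis.\<close>

lemma Ck_on_compose:
  fixes f :: "'a::real_normed_vector \<Rightarrow> 'b::real_inner" and g :: "'b \<Rightarrow> 'c::real_normed_vector"
  assumes "fin_dim TYPE('b)" "open S" "f ` S \<subseteq> T" "Ck_on k S f" "Ck_on k T g"
  shows "Ck_on k S (\<lambda>x. g (f x))"
  using assms(4,5)
proof (induction k arbitrary: g)
  case 0 then show ?case using continuous_on_compose2[OF _ _ assms(3)] by auto
next
  case (Suc k)
  obtain B :: "'b set" where B: "finite B" "\<And>x. (\<Sum>b\<in>B. (x \<bullet> b) *\<^sub>R b) = x" using fin_dimE[OF assms(1)] by metis
  have der: "((\<lambda>x. g (f x)) has_derivative (\<lambda>v. frechet_derivative g (at (f x)) (frechet_derivative f (at x) v))) (at x)"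
    if "x \<in> S" for x
    using has_derivative_compose[OF Ck_on_has_derivative[OF Suc.prems(1) that] Ck_on_has_derivative[OF Suc.prems(2)]] assms(3) that by blast
  have eq: "frechet_derivative g (at (f x)) w = (\<Sum>b\<in>B. (w \<bullet> b) *\<^sub>R frechet_derivative g (at (f x)) b)" if "x \<in> S" for x w
  proof -
    have lin: "linear (frechet_derivative g (at (f x)))"
      using Suc.prems(2) that assms(3) by (intro linear_frechet_derivative) auto
    show ?thesis by (subst B(2)[symmetric, of w]) (simp add: linear_sum[OF lin] linear_cmul[OF lin])
  qed
  have k: "Ck_on k S (\<lambda>x. frechet_derivative g (at (f x)) b)" for b
    using Suc.IH[of "\<lambda>y. frechet_derivative g (at y) b"] Suc.prems(2) Ck_on_SucD[OF Suc.prems(1)] by auto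
  have k2: "Ck_on k S (\<lambda>x. frechet_derivative f (at x) v \<bullet> b)" for v b
    using Suc.prems(1) by (intro Ck_on_linear[OF assms(2) bounded_linear_inner_left]) auto
  show ?case
    apply (rule Ck_on_SucI[OF assms(2) der], assumption)
    apply (rule Ck_on_cong[OF assms(2) eq[symmetric]], assumption)
    by (intro Ck_on_sum assms(2) B(1) Ck_on_scaleR k k2)
qed

lemma smooth_onD: "smooth_on S f \<Longrightarrow> Ck_on k S f"
  by (simp add: smooth_on_def)

lemma smooth_onI: "(\<And>k. Ck_on k S f) \<Longrightarrow> smooth_on S f"
  by (simp add: smooth_on_def)

lemma smooth_on_cong: "open S \<Longrightarrow> (\<And>x. x \<in> S \<Longrightarrow> f x = g x) \<Longrightarrow> smooth_on S f \<Longrightarrow> smooth_on S g"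
  by (rule smooth_onI, rule Ck_on_cong[of S f g], assumption, blast, rule smooth_onD)

lemma smooth_on_subset: "smooth_on S f \<Longrightarrow> T \<subseteq> S \<Longrightarrow> smooth_on T f"
  by (rule smooth_onI, rule Ck_on_subset, rule smooth_onD)

lemma smooth_on_const: "open S \<Longrightarrow> smooth_on S (\<lambda>x. c)"
  by (rule smooth_onI, rule Ck_on_const)

lemma smooth_on_bounded_linear: "open S \<Longrightarrow> bounded_linear L \<Longrightarrow> smooth_on S L"
  by (rule smooth_onI, rule Ck_on_bounded_linear)

lemma smooth_on_linear: "open S \<Longrightarrow> bounded_linear L \<Longrightarrow> smooth_on S f \<Longrightarrow> smooth_on S (\<lambda>x. L (f x))"
  by (rule smooth_onI, rule Ck_on_linear, assumption, assumption, rule smooth_onD)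

lemma smooth_on_compose:
  fixes f :: "'a::real_normed_vector \<Rightarrow> 'b::real_inner"
  assumes "fin_dim TYPE('b)" "open S" "f ` S \<subseteq> T" "smooth_on S f" "smooth_on T g"
  shows "smooth_on S (\<lambda>x. g (f x))"
  by (rule smooth_onI, rule Ck_on_compose[OF assms(1-3) smooth_onD[OF assms(4)] smooth_onD[OF assms(5)]])

lemma smooth_on_add: "open S \<Longrightarrow> smooth_on S f \<Longrightarrow> smooth_on S g \<Longrightarrow> smooth_on S (\<lambda>x. f x + g x)"
  by (rule smooth_onI, rule Ck_on_add, assumption, rule smooth_onD, assumption, rule smooth_onD)

lemma smooth_on_Pair:
  assumes "open S" "smooth_on S f" "smooth_on S g"
  shows "smooth_on S (\<lambda>x. (f x, g x))"
proof -
  have "bounded_linear (\<lambda>x. (x, 0))" "bounded_linear (\<lambda>x. (0, x))"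
    by (intro bounded_linear_Pair bounded_linear_ident bounded_linear_zero)+
  then have "smooth_on S (\<lambda>x. (f x, 0) + (0, g x))"
    by (intro smooth_on_add smooth_on_linear[where L = "\<lambda>x. (x, 0)"] smooth_on_linear[where L = "\<lambda>x. (0, x)"] assms)
  then show ?thesis by simp
qed

lemma smooth_on_has_derivative:
  assumes "smooth_on S f" "x \<in> S"
  shows "(f has_derivative frechet_derivative f (at x)) (at x)"
  by (rule Ck_on_has_derivative[OF smooth_onD[OF assms(1)] assms(2)])

lemma smooth_on_continuous_on: "smooth_on S f \<Longrightarrow> continuous_on S f"
  using smooth_onD[of S f 0] by simp

lemma smooth_on_frechet_derivative:
  assumes "smooth_on S f"
  shows "smooth_on S (\<lambda>x. frechet_derivative f (at x) v)"
proof (rule smooth_onI)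
  fix k
  show "Ck_on k S (\<lambda>x. frechet_derivative f (at x) v)"
    using smooth_onD[OF assms, of "Suc k"] by simp
qed

lemma smooth_on_continuous_derivative:
  fixes f :: "'a::real_inner \<Rightarrow> 'b::real_normed_vector"
  assumes "fin_dim TYPE('a)" "smooth_on S f"
  shows "continuous_on S (\<lambda>x. Blinfun (frechet_derivative f (at x)))"
proof (rule continuous_blinfunI[OF assms(1)])
  fix v
  have "continuous_on S (\<lambda>x. frechet_derivative f (at x) v)"
    by (rule smooth_on_continuous_on[OF smooth_on_frechet_derivative[OF assms(2)]])
  moreover have "Blinfun (frechet_derivative f (at x)) v = frechet_derivative f (at x) v" if "x \<in> S" for x
    using has_derivative_bounded_linear[OF smooth_on_has_derivative[OF assms(2) that]] by (simp add: bounded_linear_Blinfun_apply)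
  ultimately show "continuous_on S (\<lambda>x. Blinfun (frechet_derivative f (at x)) v)" by (simp cong: continuous_on_cong)
qed

text \<open>Strict differentiability: as the derivative is continuous, f minus its linearization at
  x0 has a small Lipschitz constant near x0. The fixed point argument for submersions rests on
  it.\<close>

lemma smooth_on_strict:
  fixes f :: "'a::real_inner \<Rightarrow> 'b::real_normed_vector"
  assumes "fin_dim TYPE('a)" "smooth_on S f" "open S" "x0 \<in> S" "e > 0"
  obtains r where "r > 0" "cball x0 r \<subseteq> S"
    "\<And>a b. a \<in> cball x0 r \<Longrightarrow> b \<in> cball x0 r \<Longrightarrow>
      norm (f a - f b - frechet_derivative f (at x0) (a - b)) \<le> e * norm (a - b)"
proof -
  let ?D = "\<lambda>x. Blinfun (frechet_derivative f (at x))"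
  have D: "blinfun_apply (?D x) = frechet_derivative f (at x)" if "x \<in> S" for x
    using has_derivative_bounded_linear[OF smooth_on_has_derivative[OF assms(2) that]] by (simp add: bounded_linear_Blinfun_apply)
  have "isCont ?D x0" using smooth_on_continuous_derivative[OF assms(1,2)] assms(3,4) continuous_on_eq_continuous_at by blast
  then obtain d where d: "d > 0" "\<And>x. dist x x0 < d \<Longrightarrow> dist (?D x) (?D x0) < e"
    using assms(5) unfolding continuous_at_eps_delta by blast
  obtain r1 where r1: "r1 > 0" "cball x0 r1 \<subseteq> S" using open_contains_cball assms(3,4) by blast
  define r where "r = min r1 (d/2)"
  have sub: "cball x0 r \<subseteq> S" "\<And>x. x \<in> cball x0 r \<Longrightarrow> dist x x0 < d"
    using r1 d(1) unfolding r_def by (auto simp: dist_commute)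
  have "norm (f a - f b - frechet_derivative f (at x0) (a - b)) \<le> e * norm (a - b)" if "a \<in> cball x0 r" "b \<in> cball x0 r" for a b
  proof -
    let ?g = "\<lambda>x. f x - ?D x0 x"
    have "norm (?g a - ?g b) \<le> e * norm (a - b)"
    proof (rule differentiable_bound[OF convex_cball[of x0 r] _ _ that])
      fix x assume x: "x \<in> cball x0 r"
      have "(?g has_derivative (\<lambda>v. frechet_derivative f (at x) v - ?D x0 v)) (at x)"
        using sub x by (intro has_derivative_diff smooth_on_has_derivative[OF assms(2)] bounded_linear_imp_has_derivative blinfun.bounded_linear_right) auto
      moreover have "(\<lambda>v. frechet_derivative f (at x) v - ?D x0 v) = blinfun_apply (?D x - ?D x0)"
        by (rule ext) (use D[of x] sub(1) x in \<open>auto simp: blinfun.diff_left\<close>)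
      ultimately have "(?g has_derivative (?D x - ?D x0)) (at x)" by simp
      then show "(?g has_derivative (?D x - ?D x0)) (at x within cball x0 r)" by (rule has_derivative_at_withinI)
      show "onorm (?D x - ?D x0) \<le> e" using d(2) sub(2)[OF x] by (simp add: dist_norm norm_blinfun.rep_eq less_imp_le)
    qed
    moreover have "?g a - ?g b = f a - f b - frechet_derivative f (at x0) (a - b)"
      using D[OF assms(4)] blinfun.diff_right[of "?D x0" a b] by (simp add: algebra_simps)
    ultimately show ?thesis by simp
  qed
  then show thesis using that[of r] sub(1) r1 d(1) unfolding r_def by auto
qed

text \<open>The mean value inequality for \<phi>, whose derivative is a difference of two values of
  y \<mapsto> f' y v minus its linear prediction, reduces the claim to differentiability of that map
  at the single point x.\<close>

lemma second_difference_bound: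
  fixes f :: "'a::real_normed_vector \<Rightarrow> 'b::real_normed_vector"
  assumes "\<And>y. y \<in> ball x r \<Longrightarrow> (f has_derivative f' y) (at y)" "r > 0"
    and "((\<lambda>y. f' y v) has_derivative A) (at x)" "e > 0"
  obtains d where "d > 0" "\<And>t. 0 < t \<Longrightarrow> t < d \<Longrightarrow>
     norm (f (x + t *\<^sub>R v + t *\<^sub>R w) - f (x + t *\<^sub>R v) - f (x + t *\<^sub>R w) + f x - t^2 *\<^sub>R A w) \<le> e * t^2"
proof -
  \<comment> \<open>All points x + s v + u w with 0 \<le> s, u \<le> t stay within t N of x; the
    summand 1 keeps N positive. Two errors of relative size e / (2 N) then add up to at most e
    t.\<close>
  define N where "N = norm v + norm w + 1"
  have N: "N > 0" unfolding N_def by (simp add: add_pos_nonneg add_nonneg_pos)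
  interpret A: bounded_linear A using assms(3) by (rule has_derivative_bounded_linear)
  have "e / (2 * N) > 0" using assms(4) N by simp
  then obtain d1 where d1: "d1 > 0" "\<And>y. norm (y - x) < d1 \<Longrightarrow> norm (f' y v - f' x v - A (y - x)) \<le> e / (2 * N) * norm (y - x)"
    using assms(3) unfolding has_derivative_at_alt by meson
  define d where "d = min d1 r / N"
  have dz: "dist x (x + y) = norm y" for y by (simp add: dist_norm)
  have "norm (f (x + t *\<^sub>R v + t *\<^sub>R w) - f (x + t *\<^sub>R v) - f (x + t *\<^sub>R w) + f x - t^2 *\<^sub>R A w) \<le> e * t^2"
    if t: "0 < t" "t < d" for t
  proof -
    have tN: "t * N < min d1 r" using t N unfolding d_def by (simp add: pos_less_divide_eq)
    have bd: "norm (s *\<^sub>R v + u *\<^sub>R w) \<le> t * N" if "0 \<le> s" "s \<le> t" "0 \<le> u" "u \<le> t" for s u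
    proof -
      have "norm (s *\<^sub>R v + u *\<^sub>R w) \<le> s * norm v + u * norm w" using norm_triangle_ineq[of "s *\<^sub>R v" "u *\<^sub>R w"] that by simp
      also have "\<dots> \<le> t * norm v + t * norm w" using that by (intro add_mono mult_right_mono) auto
      also have "\<dots> \<le> t * N" using t(1) unfolding N_def by (simp add: algebra_simps)
      finally show ?thesis .
    qed
    define \<phi> where "\<phi> = (\<lambda>s. f (x + s *\<^sub>R v + t *\<^sub>R w) - f (x + s *\<^sub>R v) - s *\<^sub>R A (t *\<^sub>R w))"
    have "norm (\<phi> t - \<phi> 0) \<le> (e * t) * norm (t - 0)"
    proof (rule differentiable_bound[of "{0..t}"])
      fix s assume s: "s \<in> {0..t}"
      have in1: "x + s *\<^sub>R v + t *\<^sub>R w \<in> ball x r" "x + s *\<^sub>R v \<in> ball x r"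
        using bd[of s t] bd[of s 0] s tN t(1) unfolding add.assoc mem_ball dz by auto
      have e1: "((\<lambda>s. f (x + s *\<^sub>R v + t *\<^sub>R w)) has_derivative (\<lambda>h. f' (x + s *\<^sub>R v + t *\<^sub>R w) (h *\<^sub>R v))) (at s)"
        by (rule has_derivative_compose[of "\<lambda>s. x + s *\<^sub>R v + t *\<^sub>R w", OF _ assms(1)[OF in1(1)]]) (auto intro!: derivative_eq_intros)
      have e2: "((\<lambda>s. f (x + s *\<^sub>R v)) has_derivative (\<lambda>h. f' (x + s *\<^sub>R v) (h *\<^sub>R v))) (at s)"
        by (rule has_derivative_compose[of "\<lambda>s. x + s *\<^sub>R v", OF _ assms(1)[OF in1(2)]]) (auto intro!: derivative_eq_intros)
      interpret b1: bounded_linear "f' (x + s *\<^sub>R v + t *\<^sub>R w)" by (rule has_derivative_bounded_linear[OF assms(1)[OF in1(1)]])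
      interpret b2: bounded_linear "f' (x + s *\<^sub>R v)" by (rule has_derivative_bounded_linear[OF assms(1)[OF in1(2)]])
      let ?c = "f' (x + s *\<^sub>R v + t *\<^sub>R w) v - f' (x + s *\<^sub>R v) v - A (t *\<^sub>R w)"
      have "(\<phi> has_derivative (\<lambda>h. f' (x + s *\<^sub>R v + t *\<^sub>R w) (h *\<^sub>R v) - f' (x + s *\<^sub>R v) (h *\<^sub>R v) - h *\<^sub>R A (t *\<^sub>R w))) (at s)"
        unfolding \<phi>_def by (intro has_derivative_diff e1 e2) (auto intro!: derivative_eq_intros)
      then have "(\<phi> has_derivative (\<lambda>h. h *\<^sub>R ?c)) (at s)"
        by (simp add: b1.scaleR b2.scaleR scaleR_diff_right)
      then show "(\<phi> has_derivative (\<lambda>h. h *\<^sub>R ?c)) (at s within {0..t})" by (rule has_derivative_at_withinI)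
      have "onorm (\<lambda>h. h *\<^sub>R ?c) \<le> norm ?c" by (rule onorm_le) (simp add: mult.commute)
      also have "norm ?c = norm ((f' (x + s *\<^sub>R v + t *\<^sub>R w) v - f' x v - A (s *\<^sub>R v + t *\<^sub>R w)) - (f' (x + s *\<^sub>R v) v - f' x v - A (s *\<^sub>R v)))"
        by (simp add: A.add algebra_simps)
      also have "\<dots> \<le> norm (f' (x + s *\<^sub>R v + t *\<^sub>R w) v - f' x v - A (s *\<^sub>R v + t *\<^sub>R w)) + norm (f' (x + s *\<^sub>R v) v - f' x v - A (s *\<^sub>R v))"
        by (rule norm_triangle_ineq4)
      also have "\<dots> \<le> e / (2 * N) * norm (s *\<^sub>R v + t *\<^sub>R w) + e / (2 * N) * norm (s *\<^sub>R v)"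
        using d1(2)[of "x + s *\<^sub>R v + t *\<^sub>R w"] d1(2)[of "x + s *\<^sub>R v"] bd[of s t] bd[of s 0] s tN t(1)
        by (intro add_mono) (auto simp: add.assoc)
      also have "\<dots> \<le> e / (2 * N) * (t * N) + e / (2 * N) * (t * N)"
        using bd[of s t] bd[of s 0] s t(1) assms(4) N by (intro add_mono mult_left_mono) auto
      also have "\<dots> = e * t" using N by (simp add: field_simps)
      finally show "onorm (\<lambda>h. h *\<^sub>R ?c) \<le> e * t" .
    qed (use t in auto)
    moreover have "\<phi> t - \<phi> 0 = f (x + t *\<^sub>R v + t *\<^sub>R w) - f (x + t *\<^sub>R v) - f (x + t *\<^sub>R w) + f x - t^2 *\<^sub>R A w"
      unfolding \<phi>_def by (simp add: A.scaleR power2_eq_square)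
    ultimately show ?thesis using t by (simp add: power2_eq_square mult.assoc)
  qed
  moreover have "d > 0" using d1(1) assms(2) N unfolding d_def by simp
  ultimately show thesis using that by blast
qed

text \<open>Both sides are limits of the same second difference divided by \<open>t^2\<close>, which
  is symmetric in v and w.\<close>

lemma symmetric_second_derivative:
  fixes f :: "'a::real_normed_vector \<Rightarrow> 'b::real_normed_vector"
  assumes "\<And>y. y \<in> ball x r \<Longrightarrow> (f has_derivative f' y) (at y)" "r > 0"
    and "((\<lambda>y. f' y v) has_derivative A) (at x)" "((\<lambda>y. f' y w) has_derivative B) (at x)"
  shows "A w = B v"
proof -
  have "norm (A w - B v) \<le> e" if "e > 0" for e
  proof -
    have e2: "e / 2 > 0" using that by simp
    obtain d1 where d1: "d1 > 0" "\<And>t. 0 < t \<Longrightarrow> t < d1 \<Longrightarrow>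
     norm (f (x + t *\<^sub>R v + t *\<^sub>R w) - f (x + t *\<^sub>R v) - f (x + t *\<^sub>R w) + f x - t^2 *\<^sub>R A w) \<le> e/2 * t^2"
      using second_difference_bound[OF assms(1,2,3) e2, where w = w] by metis
    obtain d2 where d2: "d2 > 0" "\<And>t. 0 < t \<Longrightarrow> t < d2 \<Longrightarrow>
     norm (f (x + t *\<^sub>R w + t *\<^sub>R v) - f (x + t *\<^sub>R w) - f (x + t *\<^sub>R v) + f x - t^2 *\<^sub>R B v) \<le> e/2 * t^2"
      using second_difference_bound[OF assms(1,2,4) e2, where w = v] by metis
    define t where "t = min d1 d2 / 2"
    have t: "0 < t" "t < d1" "t < d2" using d1(1) d2(1) unfolding t_def by auto
    let ?F = "f (x + t *\<^sub>R v + t *\<^sub>R w) - f (x + t *\<^sub>R v) - f (x + t *\<^sub>R w) + f x"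
    have F2: "f (x + t *\<^sub>R w + t *\<^sub>R v) - f (x + t *\<^sub>R w) - f (x + t *\<^sub>R v) + f x = ?F"
      by (simp add: add.assoc add.commute[of "t *\<^sub>R w"] algebra_simps)
    have "t^2 *\<^sub>R (A w - B v) = (?F - t^2 *\<^sub>R B v) - (?F - t^2 *\<^sub>R A w)" by (simp add: scaleR_diff_right)
    then have "norm (t^2 *\<^sub>R (A w - B v)) \<le> norm (?F - t^2 *\<^sub>R B v) + norm (?F - t^2 *\<^sub>R A w)"
      using norm_triangle_ineq4 by metis
    also have "\<dots> \<le> e/2 * t^2 + e/2 * t^2" using d1(2)[of t] d2(2)[of t] t unfolding F2 by (intro add_mono) auto
    finally have "t^2 * norm (A w - B v) \<le> t^2 * e" by (simp add: mult.commute)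
    then show ?thesis using t(1) by simp
  qed
  then have "norm (A w - B v) \<le> 0" by (rule field_le_epsilon[of _ 0, simplified])
  then show ?thesis by simp
qed

lemma smooth_on_symmetric:
  assumes "open S" "smooth_on S f" "x \<in> S"
  shows "frechet_derivative (\<lambda>y. frechet_derivative f (at y) v) (at x) w
       = frechet_derivative (\<lambda>y. frechet_derivative f (at y) w) (at x) v"
proof -
  obtain r where r: "r > 0" "ball x r \<subseteq> S" using assms(1,3) open_contains_ball by blast
  show ?thesis
    by (rule symmetric_second_derivative[OF _ r(1), of x f "\<lambda>y. frechet_derivative f (at y)"])
      (use r(2) assms in \<open>auto intro!: smooth_on_has_derivative[OF assms(2)] smooth_on_has_derivative[OF smooth_on_frechet_derivative[OF assms(2)]]\<close>)
qed

section \<open>Submersions between open subsets of linear spaces\<close>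

lemma surj_right_inverse:
  fixes A :: "'a::real_normed_vector \<Rightarrow> 'x::real_inner"
  assumes "fin_dim TYPE('x)" "linear A" "surj A"
  obtains R where "bounded_linear R" "\<And>c. A (R c) = c"
proof -
  obtain B :: "'x set" where B: "finite B" "\<And>x. (\<Sum>b\<in>B. (x \<bullet> b) *\<^sub>R b) = x" using fin_dimE[OF assms(1)] by metis
  define R where "R = (\<lambda>c. \<Sum>b\<in>B. (c \<bullet> b) *\<^sub>R inv A b)"
  have "A (R c) = c" for c
    unfolding R_def using B(2)[of c] assms(3) by (simp add: linear_sum[OF assms(2)] linear_cmul[OF assms(2)] surj_f_inv_f)
  moreover have "bounded_linear R" unfolding R_def
    by (intro bounded_linear_sum bounded_linear_scaleR_left[THEN bounded_linear_compose] bounded_linear_inner_left)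
  ultimately show thesis using that by blast
qed

text \<open>Newton's method with frozen derivative: for a right inverse R of the derivative at z0,
  the map \<open>T\<close> is a contraction with factor 1/2, so it preserves the ball whose radius
  is twice norm (f y - c). The resulting bound on \<zeta> is what makes corrections negligible
  later.\<close>

lemma submersion_solve:
  fixes f :: "'u::real_inner \<Rightarrow> 'x::real_inner"
  assumes fd: "fin_dim TYPE('u)" "fin_dim TYPE('x)"
    and S: "open S" "smooth_on S f" "z0 \<in> S"
    and R: "bounded_linear R" "\<And>c. frechet_derivative f (at z0) (R c) = c"
  obtains r where "r > 0" "\<And>y c. y \<in> ball z0 r \<Longrightarrow> c \<in> ball (f z0) r \<Longrightarrow>
     \<exists>\<zeta>. norm \<zeta> \<le> 2 * norm (f y - c) \<and> y + R \<zeta> \<in> S \<and> f (y + R \<zeta>) = c"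
proof -
  interpret R: bounded_linear R by fact
  obtain K where K: "K > 0" "\<And>c. norm (R c) \<le> norm c * K" using R.pos_bounded by blast
  \<comment> \<open>Chosen so that the error e of the linearization, amplified by the norm bound K
    of R, is 1/2.\<close>
  define e where "e = 1 / (2 * K)"
  have e: "e > 0" "e * K = 1/2" using K by (auto simp: e_def)
  let ?D = "frechet_derivative f (at z0)"
  obtain r0 where r0: "r0 > 0" "cball z0 r0 \<subseteq> S"
    "\<And>a b. a \<in> cball z0 r0 \<Longrightarrow> b \<in> cball z0 r0 \<Longrightarrow> norm (f a - f b - ?D (a - b)) \<le> e * norm (a - b)"
    using smooth_on_strict[OF fd(1) S(2,1,3) e(1)] by metis
  \<comment> \<open>With y and c this close, \<rho> < 4 q, hence \<rho> K \<le> r0 / 2, and the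
    other half of r0 is left for the distance from z0 to y.\<close>
  define q where "q = r0 / (8 * K)"
  have q: "q > 0" using r0 K by (simp add: q_def)
  have "isCont f z0" using smooth_on_has_derivative[OF S(2,3)] has_derivative_continuous by blast
  then obtain d where d: "d > 0" "\<And>y. dist y z0 < d \<Longrightarrow> dist (f y) (f z0) < q" using q unfolding continuous_at_eps_delta by blast
  define r where "r = min (min d q) (r0 / 2)"
  have "\<exists>\<zeta>. norm \<zeta> \<le> 2 * norm (f y - c) \<and> y + R \<zeta> \<in> S \<and> f (y + R \<zeta>) = c" if y: "y \<in> ball z0 r" and c: "c \<in> ball (f z0) r" for y c
  proof -
    define \<rho> where "\<rho> = 2 * norm (f y - c)"
    have "dist (f y) c \<le> dist (f y) (f z0) + dist (f z0) c" by (rule dist_triangle)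
    also have "\<dots> < q + q" using d(2)[of y] y c by (intro add_strict_mono) (auto simp: r_def dist_commute)
    finally have "\<rho> < 4 * q" by (simp add: \<rho>_def dist_norm)
    then have \<rho>K: "\<rho> * K \<le> r0 / 2" using K by (simp add: q_def field_simps)
    have inb: "y + R \<zeta> \<in> cball z0 r0" if "\<zeta> \<in> cball 0 \<rho>" for \<zeta>
    proof -
      have "norm \<zeta> * K \<le> \<rho> * K" using that K(1) by (intro mult_right_mono) auto
      then have "norm (R \<zeta>) \<le> r0/2" using K(2)[of \<zeta>] \<rho>K by linarith
      moreover have "dist z0 y < r0/2" using y by (simp add: r_def)
      ultimately have "dist z0 y + norm (R \<zeta>) \<le> r0" by linarith
      then show ?thesis using dist_triangle[of z0 "y + R \<zeta>" y] by (simp add: dist_norm)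
    qed
    define T where "T = (\<lambda>\<zeta>. \<zeta> - (f (y + R \<zeta>) - c))"
    have lip: "norm (T a - T b) \<le> 1/2 * norm (a - b)" if "a \<in> cball 0 \<rho>" "b \<in> cball 0 \<rho>" for a b
    proof -
      have "norm (f (y + R a) - f (y + R b) - ?D (y + R a - (y + R b))) \<le> e * norm (y + R a - (y + R b))"
        by (rule r0(3)[OF inb[OF that(1)] inb[OF that(2)]])
      moreover have "y + R a - (y + R b) = R (a - b)" by (simp add: R.diff)
      ultimately have "norm (f (y + R a) - f (y + R b) - (a - b)) \<le> e * norm (R (a - b))" by (simp add: R(2))
      also have "\<dots> \<le> e * (norm (a - b) * K)" using K(2) e(1) by (intro mult_left_mono) auto
      also have "\<dots> = 1/2 * norm (a - b)" using e(2) by (metis mult.assoc mult.commute)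
      finally show ?thesis unfolding T_def by (simp add: norm_minus_commute algebra_simps)
    qed
    have "\<exists>!x\<in>cball 0 \<rho>. T x = x"
    proof (rule Banach_fix[of _ "1/2"])
      show "complete (cball (0::'x) \<rho>)" by (rule compact_imp_complete[OF compact_cball_fin_dim[OF fd(2)]])
      show "cball (0::'x) \<rho> \<noteq> {}" by (simp add: \<rho>_def)
      show "T ` cball 0 \<rho> \<subseteq> cball 0 \<rho>"
      proof (rule image_subsetI)
        fix x :: 'x assume x: "x \<in> cball 0 \<rho>"
        have "norm (T x) \<le> norm (T x - T 0) + norm (T 0)" using norm_triangle_ineq[of "T x - T 0" "T 0"] by simp
        also have "norm (T x - T 0) \<le> 1/2 * norm x" using lip[OF x, of 0] by (simp add: \<rho>_def)
        also have "norm (T 0) = \<rho> / 2" by (simp add: T_def \<rho>_def R.zero norm_minus_commute)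
        finally show "T x \<in> cball 0 \<rho>" using x by simp
      qed
      show "\<And>x ya. x \<in> cball 0 \<rho> \<Longrightarrow> ya \<in> cball 0 \<rho> \<Longrightarrow> dist (T x) (T ya) \<le> 1 / 2 * dist x ya" using lip by (simp add: dist_norm)
    qed simp_all
    then obtain \<zeta> where "\<zeta> \<in> cball 0 \<rho>" "T \<zeta> = \<zeta>" by blast
    then show ?thesis using inb r0(2) by (intro exI[of _ \<zeta>]) (auto simp: T_def \<rho>_def)
  qed
  moreover have "r > 0" using d q r0 by (simp add: r_def)
  ultimately show thesis using that by blast
qed

text \<open>The straight line z0 + t v is corrected by R (\<zeta> t), where \<zeta> t is bounded by
  twice the norm of f (z0 + t v) - c t. That difference is o(t), because c has the velocity which
  the derivative of f assigns to v, so the correction leaves the velocity at 0 unchanged. No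
  regularity of the lift for t \<noteq> 0 is claimed.\<close>

lemma curve_lift:
  fixes f :: "'u::real_inner \<Rightarrow> 'x::real_inner" and c :: "real \<Rightarrow> 'x"
  assumes fd: "fin_dim TYPE('u)" "fin_dim TYPE('x)"
    and S: "open S" "smooth_on S f" "z0 \<in> S" and sur: "surj (frechet_derivative f (at z0))"
    and c: "c 0 = f z0" "(c has_derivative (\<lambda>t. t *\<^sub>R frechet_derivative f (at z0) v)) (at 0)"
  obtains \<gamma> \<delta> where "\<delta> > 0" "\<gamma> 0 = z0" "(\<gamma> has_derivative (\<lambda>t. t *\<^sub>R v)) (at 0)"
    "\<And>t. \<bar>t\<bar> < \<delta> \<Longrightarrow> \<gamma> t \<in> S \<and> f (\<gamma> t) = c t"
proof -
  let ?D = "frechet_derivative f (at z0)"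
  have fD: "(f has_derivative ?D) (at z0)" by (rule smooth_on_has_derivative[OF S(2,3)])
  interpret D: bounded_linear ?D by (rule has_derivative_bounded_linear[OF fD])
  obtain R where R: "bounded_linear R" "\<And>c. ?D (R c) = c" using surj_right_inverse[OF fd(2) D.linear sur] by metis
  interpret R: bounded_linear R by fact
  obtain r where r: "r > 0" "\<And>y c. y \<in> ball z0 r \<Longrightarrow> c \<in> ball (f z0) r \<Longrightarrow>
     \<exists>\<zeta>. norm \<zeta> \<le> 2 * norm (f y - c) \<and> y + R \<zeta> \<in> S \<and> f (y + R \<zeta>) = c"
    using submersion_solve[OF fd S R] by metis
  define P where "P = (\<lambda>t \<zeta>. norm \<zeta> \<le> 2 * norm (f (z0 + t *\<^sub>R v) - c t) \<and> z0 + t *\<^sub>R v + R \<zeta> \<in> S \<and> f (z0 + t *\<^sub>R v + R \<zeta>) = c t)"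
  \<comment> \<open>The default 0 makes the norm bound hold for every t, also where no solution
    exists.\<close>
  define \<zeta> where "\<zeta> = (\<lambda>t. if \<exists>z. P t z then SOME z. P t z else 0)"
  have P: "P t (\<zeta> t)" if "\<exists>z. P t z" for t using that unfolding \<zeta>_def by (simp add: someI_ex)
  have nb: "norm (\<zeta> t) \<le> 2 * norm (f (z0 + t *\<^sub>R v) - c t)" for t
    by (cases "\<exists>z. P t z") (use P[of t] in \<open>auto simp: P_def \<zeta>_def\<close>)
  have ex: "\<exists>\<delta>>0. \<forall>t. \<bar>t\<bar> < \<delta> \<longrightarrow> (\<exists>z. P t z)"
  proof -
    have "((\<lambda>t. z0 + t *\<^sub>R v) \<longlongrightarrow> z0 + 0 *\<^sub>R v) (at 0)" by (intro tendsto_intros)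
    then have 1: "eventually (\<lambda>t. z0 + t *\<^sub>R v \<in> ball z0 r) (at 0)"
      by (rule topological_tendstoD) (use r(1) in auto)
    have "(c \<longlongrightarrow> c 0) (at 0)" using has_derivative_continuous[OF c(2)] by (simp add: continuous_at)
    then have 2: "eventually (\<lambda>t. c t \<in> ball (f z0) r) (at 0)"
      by (rule topological_tendstoD) (use r(1) c(1) in auto)
    have "eventually (\<lambda>t. \<exists>z. P t z) (at 0)" using 1 2 by eventually_elim (use r(2) in \<open>auto simp: P_def\<close>)
    then obtain \<delta> where "\<delta> > 0" "\<And>t. t \<noteq> 0 \<Longrightarrow> \<bar>t\<bar> < \<delta> \<Longrightarrow> \<exists>z. P t z" unfolding eventually_at by (auto simp: dist_real_def)
    moreover have "\<exists>z. P 0 z" using r(2)[of z0 "c 0"] r(1) c(1) by (auto simp: P_def)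
    ultimately show ?thesis by metis
  qed
  then obtain \<delta> where \<delta>: "\<delta> > 0" "\<And>t. \<bar>t\<bar> < \<delta> \<Longrightarrow> \<exists>z. P t z" by blast
  define \<gamma> where "\<gamma> = (\<lambda>t. z0 + t *\<^sub>R v + R (\<zeta> t))"
  have "\<zeta> 0 = 0" using nb[of 0] c(1) by simp
  have "((\<lambda>t. f (z0 + t *\<^sub>R v)) has_derivative (\<lambda>t. ?D (t *\<^sub>R v))) (at 0)"
    by (rule has_derivative_compose[of "\<lambda>t. z0 + t *\<^sub>R v"]) (use fD in \<open>auto intro!: derivative_eq_intros\<close>)
  from has_derivative_diff[OF this c(2)]
  have g: "((\<lambda>t. f (z0 + t *\<^sub>R v) - c t) has_derivative (\<lambda>t. 0)) (at 0)" by (simp add: D.scaleR)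
  have "(\<zeta> has_derivative (\<lambda>t. 0)) (at 0)"
    unfolding has_derivative_at_alt
  proof (intro conjI allI impI)
    fix e :: real assume "e > 0"
    then have "e / 2 > 0" by simp
    then obtain d where d: "d > 0" "\<And>t. norm (t - 0) < d \<Longrightarrow> norm (f (z0 + t *\<^sub>R v) - c t - (f (z0 + 0 *\<^sub>R v) - c 0) - 0) \<le> e/2 * norm (t - 0)"
      using g unfolding has_derivative_at_alt by meson
    show "\<exists>d>0. \<forall>y. norm (y - 0) < d \<longrightarrow> norm (\<zeta> y - \<zeta> 0 - 0) \<le> e * norm (y - 0)"
      by (rule exI[of _ d]) (use d nb \<open>\<zeta> 0 = 0\<close> c(1) in \<open>fastforce intro: order_trans\<close>)
  qed simp
  then have "(\<gamma> has_derivative (\<lambda>t. t *\<^sub>R v)) (at 0)"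
    unfolding \<gamma>_def by (auto intro!: derivative_eq_intros bounded_linear.has_derivative[OF R(1)] simp: R.zero)
  then show thesis
    using that[of \<delta> \<gamma>] \<delta> P \<open>\<zeta> 0 = 0\<close> unfolding P_def \<gamma>_def by (auto simp: R.zero)
qed

text \<open>When the outer derivative vanishes, the chain rule survives for an inner map that is
  Lipschitz at the point but perhaps not differentiable.\<close>

lemma has_derivative_zero_lipschitz:
  fixes p :: "'a::real_normed_vector \<Rightarrow> 'b::real_normed_vector"
  assumes "(\<Phi> has_derivative (\<lambda>h. 0)) (at (p x))" and "\<And>y. y \<in> T \<Longrightarrow> norm (p y - p x) \<le> L * norm (y - x)"
  shows "((\<lambda>y. \<Phi> (p y)) has_derivative (\<lambda>h. 0)) (at x within T)"
  unfolding has_derivative_within_alt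
proof (intro conjI allI impI)
  fix e :: real assume "e > 0"
  define L' where "L' = \<bar>L\<bar> + 1"
  have L': "L' > 0" "\<And>y. y \<in> T \<Longrightarrow> norm (p y - p x) \<le> L' * norm (y - x)"
    using assms(2) unfolding L'_def by (auto intro!: order_trans[OF assms(2)] mult_right_mono)
  have "e / L' > 0" using \<open>e > 0\<close> L' by simp
  then obtain d where d: "d > 0" "\<And>z. norm (z - p x) < d \<Longrightarrow> norm (\<Phi> z - \<Phi> (p x) - 0) \<le> e / L' * norm (z - p x)"
    using assms(1) unfolding has_derivative_at_alt by meson
  have "norm (\<Phi> (p y) - \<Phi> (p x) - 0) \<le> e * norm (y - x)" if "y \<in> T" "norm (y - x) < d / L'" for y
  proof -
    have "norm (p y - p x) < d" using L'(2)[OF that(1)] that(2) L'(1) by (simp add: field_simps)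
    then have "norm (\<Phi> (p y) - \<Phi> (p x) - 0) \<le> e / L' * norm (p y - p x)" by (rule d(2))
    also have "\<dots> \<le> e / L' * (L' * norm (y - x))" using L' \<open>e > 0\<close> that(1) by (intro mult_left_mono) auto
    finally show ?thesis using L'(1) by simp
  qed
  then show "\<exists>d>0. \<forall>y\<in>T. norm (y - x) < d \<longrightarrow> norm (\<Phi> (p y) - \<Phi> (p x) - 0) \<le> e * norm (y - x)"
    using d(1) L'(1) by (intro exI[of _ "d / L'"]) auto
qed simp

text \<open>A point z1 of the fibre near z0 is reached by a path p inside the fibre: the segment
  along the kernel component n of z1 - z0, pushed back to the fibre by
  \<open>submersion_solve\<close>. The corrections are chosen pointwise, so p is known to be
  Lipschitz only, which is enough to see that F has zero derivative along it.\<close>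

lemma submersion_fibre_constant:
  fixes f :: "'u::real_inner \<Rightarrow> 'x::real_inner" and F :: "'u \<Rightarrow> 'y::real_normed_vector"
  assumes fd: "fin_dim TYPE('u)" "fin_dim TYPE('x)"
    and S: "open S" "smooth_on S f" "smooth_on S F" "z0 \<in> S"
    and sur: "\<And>z. z \<in> S \<Longrightarrow> surj (frechet_derivative f (at z))"
    and ker: "\<And>z v. z \<in> S \<Longrightarrow> f z = f z0 \<Longrightarrow> frechet_derivative f (at z) v = 0 \<Longrightarrow> frechet_derivative F (at z) v = 0"
  obtains r where "r > 0" "\<And>z. z \<in> ball z0 r \<Longrightarrow> f z = f z0 \<Longrightarrow> F z = F z0"
proof -
  let ?A = "frechet_derivative f (at z0)"
  have fA: "(f has_derivative ?A) (at z0)" by (rule smooth_on_has_derivative[OF S(2,4)])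
  interpret A: bounded_linear ?A by (rule has_derivative_bounded_linear[OF fA])
  obtain R where R: "bounded_linear R" "\<And>c. ?A (R c) = c" using surj_right_inverse[OF fd(2) A.linear sur[OF S(4)]] by metis
  interpret R: bounded_linear R by fact
  obtain K where K: "K > 0" "\<And>c. norm (R c) \<le> norm c * K" using R.pos_bounded by blast
  define e where "e = 1 / (2 * K)"
  have e: "e > 0" "e * K = 1/2" using K by (auto simp: e_def)
  obtain r0 where r0: "r0 > 0" "cball z0 r0 \<subseteq> S"
    "\<And>a b. a \<in> cball z0 r0 \<Longrightarrow> b \<in> cball z0 r0 \<Longrightarrow> norm (f a - f b - ?A (a - b)) \<le> e * norm (a - b)"
    using smooth_on_strict[OF fd(1) S(2,1,4) e(1)] by metis
  obtain r1 where r1: "r1 > 0" "\<And>y c. y \<in> ball z0 r1 \<Longrightarrow> c \<in> ball (f z0) r1 \<Longrightarrow>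
     \<exists>\<zeta>. norm \<zeta> \<le> 2 * norm (f y - c) \<and> y + R \<zeta> \<in> S \<and> f (y + R \<zeta>) = c"
    using submersion_solve[OF fd S(1,2,4) R] by metis
  obtain KA where KA: "KA > 0" "\<And>c. norm (?A c) \<le> norm c * KA" using A.pos_bounded by blast
  \<comment> \<open>Bounds the norm of the projection onto the kernel of the derivative at z0, which
    subtracts R applied to the image of a vector.\<close>
  define m where "m = 1 + KA * K"
  have m: "m > 0" using K KA by (simp add: m_def add_pos_pos)
  \<comment> \<open>The correction is at most as long as t n, so with norm (t n) below r2 the
    corrected point remains in the ball of radius r0 where the strict estimate holds.\<close>
  define r2 where "r2 = min r1 (r0 / 2) / 2"
  define r where "r = min (r2 / m) r0"
  have rpos: "r > 0" using r0 r1 m by (simp add: r_def r2_def)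
  have "F z1 = F z0" if z1: "z1 \<in> ball z0 r" "f z1 = f z0" for z1
  proof -
    define \<zeta>1 where "\<zeta>1 = ?A (z1 - z0)"
    define n where "n = z1 - z0 - R \<zeta>1"
    have An: "?A n = 0" by (simp add: n_def \<zeta>1_def A.diff R(2))
    have "norm n \<le> norm (z1 - z0) + norm (R \<zeta>1)" unfolding n_def by (rule norm_triangle_ineq4)
    also have "norm (R \<zeta>1) \<le> norm (z1 - z0) * KA * K"
      using K(2)[of \<zeta>1] mult_right_mono[OF KA(2)[of "z1 - z0"], of K] K(1) unfolding \<zeta>1_def by linarith
    finally have "norm n \<le> norm (z1 - z0) * m" by (simp add: m_def algebra_simps)
    also have "\<dots> < r2" using z1(1) m by (simp add: r_def dist_norm norm_minus_commute pos_less_divide_eq)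
    finally have n: "norm n < r2" .
    have y: "norm (t *\<^sub>R n) < r2" if "t \<in> {0..1}" for t
      using n that by (auto intro: le_less_trans[OF mult_left_le_one_le])
    have fb: "norm (f (z0 + t *\<^sub>R n) - f z0) \<le> e * norm (t *\<^sub>R n)" if "t \<in> {0..1}" for t
      using r0(3)[of "z0 + t *\<^sub>R n" z0] y[OF that] r0(1) An by (simp add: r2_def dist_norm A.scaleR)
    have "\<exists>\<zeta>. norm \<zeta> \<le> 2 * norm (f (z0 + t *\<^sub>R n) - f z0) \<and> z0 + t *\<^sub>R n + R \<zeta> \<in> S \<and> f (z0 + t *\<^sub>R n + R \<zeta>) = f z0" if "t \<in> {0..1}" for t
      using r1(2)[of "z0 + t *\<^sub>R n" "f z0"] y[OF that] r1(1) by (simp add: r2_def dist_norm)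
    then obtain \<zeta> where \<zeta>: "\<And>t. t \<in> {0..1} \<Longrightarrow> norm (\<zeta> t) \<le> 2 * norm (f (z0 + t *\<^sub>R n) - f z0)"
      "\<And>t. t \<in> {0..1} \<Longrightarrow> z0 + t *\<^sub>R n + R (\<zeta> t) \<in> S" "\<And>t. t \<in> {0..1} \<Longrightarrow> f (z0 + t *\<^sub>R n + R (\<zeta> t)) = f z0" by metis
    define p where "p = (\<lambda>t. z0 + t *\<^sub>R n + R (\<zeta> t))"
    have nR: "norm (R (\<zeta> t)) \<le> norm (t *\<^sub>R n)" if "t \<in> {0..1}" for t
    proof -
      have "norm (\<zeta> t) \<le> 2 * (e * norm (t *\<^sub>R n))" using \<zeta>(1)[OF that] fb[OF that] by linarith
      then have "norm (\<zeta> t) * K \<le> 2 * (e * norm (t *\<^sub>R n)) * K" using K(1) by (intro mult_right_mono) auto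
      also have "\<dots> = 2 * (e * K) * norm (t *\<^sub>R n)" by (simp only: mult.assoc mult.commute mult.left_commute)
      also have "\<dots> = norm (t *\<^sub>R n)" unfolding e(2) by simp
      finally show ?thesis using K(2)[of "\<zeta> t"] by linarith
    qed
    have pb: "p t \<in> cball z0 r0" if "t \<in> {0..1}" for t
    proof -
      have "norm (t *\<^sub>R n + R (\<zeta> t)) \<le> r0" using norm_triangle_ineq[of "t *\<^sub>R n" "R (\<zeta> t)"] nR[OF that] y[OF that] norm_ge_zero[of "t *\<^sub>R n"]
        unfolding r2_def by linarith
      then show ?thesis by (simp add: p_def dist_norm norm_minus_commute add.assoc flip: norm_minus_cancel[of "t *\<^sub>R n + R (\<zeta> t)"])
    qed
    \<comment> \<open>For two points of one fibre, strict differentiability bounds the difference of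
      their \<zeta> by e times their distance, and since e K = 1/2 half of the distance can be
      absorbed.\<close>
    have lipp: "norm (p t - p s) \<le> 2 * norm n * norm (t - s)" if "t \<in> {0..1}" "s \<in> {0..1}" for t s
    proof -
      have eq: "p t - p s = (t - s) *\<^sub>R n + R (\<zeta> t - \<zeta> s)" by (simp add: p_def R.diff algebra_simps)
      have "norm (?A (p t - p s)) \<le> e * norm (p t - p s)"
        using r0(3)[OF pb[OF that(1)] pb[OF that(2)]] \<zeta>(3)[OF that(1)] \<zeta>(3)[OF that(2)] by (simp add: p_def)
      then have 1: "norm (\<zeta> t - \<zeta> s) \<le> e * norm (p t - p s)" unfolding eq by (simp add: A.add A.scaleR An R(2))
      have 2: "norm (p t - p s) \<le> norm ((t - s) *\<^sub>R n) + norm (R (\<zeta> t - \<zeta> s))" unfolding eq by (rule norm_triangle_ineq)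
      have "norm (R (\<zeta> t - \<zeta> s)) \<le> (e * norm (p t - p s)) * K"
        using K(2)[of "\<zeta> t - \<zeta> s"] mult_right_mono[OF 1, of K] K(1) by linarith
      also have "\<dots> = (e * K) * norm (p t - p s)" by simp
      finally have "norm (R (\<zeta> t - \<zeta> s)) \<le> 1/2 * norm (p t - p s)" unfolding e(2) .
      with 2 have "norm (p t - p s) \<le> norm ((t - s) *\<^sub>R n) + 1/2 * norm (p t - p s)" by linarith
      then have "norm (p t - p s) \<le> 2 * norm ((t - s) *\<^sub>R n)" by linarith
      then show ?thesis by (simp add: mult.commute mult.left_commute)
    qed
    have "F (p 1) = F (p 0)"
    proof (rule has_derivative_zero_unique[of "{0..1::real}" "\<lambda>t. F (p t)"])
      fix t :: real assume t: "t \<in> {0..1}"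
      have pS: "p t \<in> S" "f (p t) = f z0" using \<zeta>(2,3)[OF t] by (auto simp: p_def)
      let ?f' = "frechet_derivative f (at (p t))" and ?F' = "frechet_derivative F (at (p t))"
      have f': "(f has_derivative ?f') (at (p t))" and F': "(F has_derivative ?F') (at (p t))"
        using smooth_on_has_derivative[OF S(2) pS(1)] smooth_on_has_derivative[OF S(3) pS(1)] by auto
      interpret f': bounded_linear ?f' by (rule has_derivative_bounded_linear[OF f'])
      interpret F': bounded_linear ?F' by (rule has_derivative_bounded_linear[OF F'])
      obtain Q where Q: "bounded_linear Q" "\<And>c. ?f' (Q c) = c" using surj_right_inverse[OF fd(2) f'.linear sur[OF pS(1)]] by metis
      \<comment> \<open>Subtracting a linear function of \<open>f\<close>, which is constant along \<open>p\<close>, makes the full derivative vanish.\<close>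
      let ?\<Phi> = "\<lambda>z. F z - ?F' (Q (f z))"
      have "(?\<Phi> has_derivative (\<lambda>v. ?F' v - ?F' (Q (?f' v)))) (at (p t))"
        by (intro has_derivative_diff F' bounded_linear.has_derivative[OF F'.bounded_linear_axioms] bounded_linear.has_derivative[OF Q(1)] f')
      moreover have "?F' v - ?F' (Q (?f' v)) = 0" for v
        using ker[OF pS, of "v - Q (?f' v)"] by (simp add: f'.diff F'.diff Q(2))
      ultimately have "(?\<Phi> has_derivative (\<lambda>v. 0)) (at (p t))" by simp
      from has_derivative_zero_lipschitz[of ?\<Phi> p t "{0..1}" "2 * norm n", OF this] lipp t
      have "((\<lambda>s. ?\<Phi> (p s)) has_derivative (\<lambda>v. 0)) (at t within {0..1})" by auto
      then have "((\<lambda>s. ?\<Phi> (p s) + ?F' (Q (f z0))) has_derivative (\<lambda>v. 0)) (at t within {0..1})"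
        using has_derivative_add[OF _ has_derivative_const] by fastforce
      then show "((\<lambda>s. F (p s)) has_derivative (\<lambda>v. 0)) (at t within {0..1})"
        by (rule has_derivative_transform[OF t, rotated]) (use \<zeta>(3) in \<open>auto simp: p_def\<close>)
    qed auto
    moreover have "\<zeta> 0 = 0" using \<zeta>(1)[of 0] by simp
    then have "p 0 = z0" by (simp add: p_def R.zero)
    \<comment> \<open>Both points have the form z0 + n + R \<zeta> and the same value of f, and
      within the ball of radius r0 this determines \<zeta>, because e K < 1.\<close>
    moreover have "p 1 = z1"
    proof -
      have z1': "z1 = z0 + n + R \<zeta>1" by (simp add: n_def)
      have z1b: "z1 \<in> cball z0 r0" using z1(1) by (simp add: r_def)
      have "p 1 - z1 = R (\<zeta> 1 - \<zeta>1)" using z1' by (simp add: p_def R.diff)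
      moreover have "f (p 1) = f z1" using \<zeta>(3)[of 1] z1(2) by (simp add: p_def)
      ultimately have "norm (\<zeta> 1 - \<zeta>1) \<le> e * norm (R (\<zeta> 1 - \<zeta>1))"
        using r0(3)[OF pb[of 1] z1b] by (simp add: R(2) norm_minus_commute)
      also have "\<dots> \<le> e * (norm (\<zeta> 1 - \<zeta>1) * K)" using K(2) e(1) by (intro mult_left_mono) auto
      also have "\<dots> = (e * K) * norm (\<zeta> 1 - \<zeta>1)" by simp
      finally have "norm (\<zeta> 1 - \<zeta>1) \<le> 0" unfolding e(2) by simp
      then show ?thesis using z1' by (simp add: p_def)
    qed
    ultimately show ?thesis by simp
  qed
  then show thesis using that rpos by blast
qed

section \<open>Calculus in preferred charts\<close>

lemma manifold_fin_dim: "manifold (M :: ('a::topological_space, 'v::real_inner) atlas) \<Longrightarrow> fin_dim TYPE('v)"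
  unfolding manifold_def by (elim conjE exE) (rule fin_dimI)

lemma manifold_chartD:
  assumes "manifold M"
  shows "p \<in> dom_at M p" "open (dom_at M p)" "open (chart_at M p ` dom_at M p)"
    "homeomorphism (dom_at M p) (chart_at M p ` dom_at M p) (chart_at M p) (chart_inv M p)"
    "smooth_on (chart_at M p ` (dom_at M p \<inter> dom_at M q)) (chart_at M q \<circ> chart_inv M p)"
proof -
  note m = assms[unfolded manifold_def]
  note 1 = m[THEN conjunct2, THEN conjunct1, THEN spec[of _ p]]
  show "p \<in> dom_at M p" "open (dom_at M p)" "open (chart_at M p ` dom_at M p)"
    "homeomorphism (dom_at M p) (chart_at M p ` dom_at M p) (chart_at M p) (chart_inv M p)"
    using 1 by simp_all
  show "smooth_on (chart_at M p ` (dom_at M p \<inter> dom_at M q)) (chart_at M q \<circ> chart_inv M p)"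
    by (rule m[THEN conjunct2, THEN conjunct2, THEN spec[of _ p], THEN spec[of _ q]])
qed

lemma chart_inv_chart: "manifold M \<Longrightarrow> q \<in> dom_at M p \<Longrightarrow> chart_inv M p (chart_at M p q) = q"
  by (rule homeomorphism_apply1[OF manifold_chartD(4)])

lemma chart_inv_in: "manifold M \<Longrightarrow> z \<in> chart_at M p ` dom_at M p \<Longrightarrow> chart_inv M p z \<in> dom_at M p"
  by (elim imageE) (simp add: chart_inv_chart)

lemma chart_chart_inv: "manifold M \<Longrightarrow> z \<in> chart_at M p ` dom_at M p \<Longrightarrow> chart_at M p (chart_inv M p z) = z"
  by (elim imageE) (simp add: chart_inv_chart)

lemma chart_inv_chart_self: "manifold M \<Longrightarrow> chart_inv M p (chart_at M p p) = p"
  by (rule chart_inv_chart[OF _ manifold_chartD(1)])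

lemma chart_in_image: "manifold M \<Longrightarrow> chart_at M p p \<in> chart_at M p ` dom_at M p"
  by (rule imageI[OF manifold_chartD(1)])

lemma chart_inj: "manifold M \<Longrightarrow> q \<in> dom_at M p \<Longrightarrow> r \<in> dom_at M p \<Longrightarrow> chart_at M p q = chart_at M p r \<Longrightarrow> q = r"
  by (drule arg_cong[of _ _ "chart_inv M p"]) (simp only: chart_inv_chart)

lemma chart_open_image:
  assumes "manifold M" "open U"
  shows "open (chart_at M p ` (dom_at M p \<inter> U))"
proof -
  have "openin (top_of_set (dom_at M p)) (dom_at M p \<inter> U)" using assms(2) by (simp add: openin_open_Int)
  then have "openin (top_of_set (chart_at M p ` dom_at M p)) (chart_at M p ` (dom_at M p \<inter> U))"
    using homeomorphism_imp_open_map[OF manifold_chartD(4)[OF assms(1)]] by blast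
  then show ?thesis using manifold_chartD(3)[OF assms(1)] openin_open_eq by blast
qed

lemma chart_open_vimage:
  assumes "manifold M" "open V"
  shows "open {q \<in> dom_at M p. chart_at M p q \<in> V}"
proof -
  have "continuous_on (dom_at M p) (chart_at M p)" using manifold_chartD(4)[OF assms(1)] homeomorphism_def by blast
  then have "open (dom_at M p \<inter> chart_at M p -` V)" using continuous_open_preimage manifold_chartD(2)[OF assms(1)] assms(2) by blast
  moreover have "dom_at M p \<inter> chart_at M p -` V = {q \<in> dom_at M p. chart_at M p q \<in> V}" by auto
  ultimately show ?thesis by simp
qed

lemma model_simps [simp]: "dom_at model p = UNIV" "chart_at model p x = x" "chart_inv model p x = x"
proof -
  show "dom_at model p = UNIV" "chart_at model p x = x" by (simp_all add: model_def)
  have "inv_into UNIV (\<lambda>x. x) x = x" using inv_into_f_f[of "\<lambda>x. x" UNIV x] by simp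
  then show "chart_inv model p x = x" by (simp add: chart_inv_def model_def)
qed

lemma manifold_model: "fin_dim TYPE('v::real_inner) \<Longrightarrow> manifold (model :: ('v, 'v) atlas)"
proof -
  assume "fin_dim TYPE('v)"
  then obtain B :: "'v set" where B: "finite B" "\<And>x. (\<Sum>b\<in>B. (x \<bullet> b) *\<^sub>R b) = x" using fin_dimE by metis
  have "x \<in> span B" for x using span_sum[of B "\<lambda>b. (x \<bullet> b) *\<^sub>R b" B] B(2)[of x] by (simp add: span_base span_scale)
  then have "span B = UNIV" by auto
  have "chart_at model p = id" "chart_inv model p = id" for p :: 'v by (auto simp: fun_eq_iff)
  moreover have "homeomorphism (UNIV::'v set) UNIV id id" by (simp add: homeomorphism_def)
  moreover have "smooth_on (UNIV::'v set) id" unfolding id_def by (rule smooth_on_bounded_linear) (auto)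
  ultimately show ?thesis unfolding manifold_def using B(1) \<open>span B = UNIV\<close> by (auto intro!: exI[of _ B])
qed

lemma prod_atlas_simps [simp]:
  "dom_at (prod_atlas M N) (p, q) = dom_at M p \<times> dom_at N q"
  "chart_at (prod_atlas M N) (p, q) (a, b) = (chart_at M p a, chart_at N q b)"
  by (simp_all add: prod_atlas_def)

lemma prod_chart_image:
  "chart_at (prod_atlas M N) (p, q) ` (A \<times> B) = (chart_at M p ` A) \<times> (chart_at N q ` B)"
  unfolding prod_atlas_def by (simp add: image_paired_Times)

lemma prod_chart_inv:
  assumes "manifold M" "manifold N" "z \<in> chart_at M p ` dom_at M p" "w \<in> chart_at N q ` dom_at N q"
  shows "chart_inv (prod_atlas M N) (p, q) (z, w) = (chart_inv M p z, chart_inv N q w)"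
  unfolding chart_inv_def[of "prod_atlas M N"]
proof (rule inv_into_f_eq)
  show "inj_on (chart_at (prod_atlas M N) (p, q)) (dom_at (prod_atlas M N) (p, q))"
    by (rule inj_onI) (auto dest: chart_inj[OF assms(1)] chart_inj[OF assms(2)])
qed (use chart_inv_in[OF assms(1,3)] chart_inv_in[OF assms(2,4)] chart_chart_inv[OF assms(1,3)] chart_chart_inv[OF assms(2,4)] in simp_all)

section \<open>Smooth maps on subsets and product atlases\<close>

lemma smooth_map_onI:
  assumes "\<And>p. p \<in> S \<Longrightarrow> \<exists>V F. open V \<and> chart_at M p p \<in> V \<and> smooth_on V F \<and>
        (\<forall>q \<in> S \<inter> dom_at M p. chart_at M p q \<in> V \<longrightarrow> f q \<in> dom_at N (f p) \<and> chart_at N (f p) (f q) = F (chart_at M p q))"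
  shows "smooth_map_on M N S f"
  unfolding smooth_map_on_def by (intro ballI assms)

lemma smooth_map_onE:
  assumes "smooth_map_on M N S f" "p \<in> S"
  obtains V F where "open V" "chart_at M p p \<in> V" "smooth_on V F"
    "\<And>q. q \<in> S \<Longrightarrow> q \<in> dom_at M p \<Longrightarrow> chart_at M p q \<in> V \<Longrightarrow> f q \<in> dom_at N (f p)"
    "\<And>q. q \<in> S \<Longrightarrow> q \<in> dom_at M p \<Longrightarrow> chart_at M p q \<in> V \<Longrightarrow> chart_at N (f p) (f q) = F (chart_at M p q)"
proof -
  obtain V F where "open V" "chart_at M p p \<in> V" "smooth_on V F"
    and *: "\<forall>q \<in> S \<inter> dom_at M p. chart_at M p q \<in> V \<longrightarrow> f q \<in> dom_at N (f p) \<and> chart_at N (f p) (f q) = F (chart_at M p q)"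
    using bspec[OF assms(1)[unfolded smooth_map_on_def] assms(2)] by (elim exE conjE)
  then show thesis using that[of V F] by blast
qed

lemma smooth_map_on_subset: "smooth_map_on M N S f \<Longrightarrow> T \<subseteq> S \<Longrightarrow> smooth_map_on M N T f"
proof (rule smooth_map_onI)
  fix p assume *: "smooth_map_on M N S f" "T \<subseteq> S" and p: "p \<in> T"
  have pS: "p \<in> S" using * p by blast
  obtain V F where "open V" "chart_at M p p \<in> V" "smooth_on V F"
    "\<And>q. q \<in> S \<Longrightarrow> q \<in> dom_at M p \<Longrightarrow> chart_at M p q \<in> V \<Longrightarrow> f q \<in> dom_at N (f p)"
    "\<And>q. q \<in> S \<Longrightarrow> q \<in> dom_at M p \<Longrightarrow> chart_at M p q \<in> V \<Longrightarrow> chart_at N (f p) (f q) = F (chart_at M p q)"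
    by (rule smooth_map_onE[OF *(1) pS]) blast
  then show "\<exists>V F. open V \<and> chart_at M p p \<in> V \<and> smooth_on V F \<and>
        (\<forall>q \<in> T \<inter> dom_at M p. chart_at M p q \<in> V \<longrightarrow> f q \<in> dom_at N (f p) \<and> chart_at N (f p) (f q) = F (chart_at M p q))"
    using *(2) by (intro exI[of _ V] exI[of _ F]) (simp add: subset_eq)
qed

lemma smooth_map_on_compose:
  fixes N :: "('b::topological_space, 'w::real_inner) atlas"
  assumes "manifold M" "manifold N" "smooth_map_on M N S f" "smooth_map_on N K T g" "\<And>x. x \<in> S \<Longrightarrow> f x \<in> T"
  shows "smooth_map_on M K S (\<lambda>x. g (f x))"
proof (rule smooth_map_onI)
  fix p assume p: "p \<in> S"
  obtain V F where F: "open V" "chart_at M p p \<in> V" "smooth_on V F"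
    "\<And>q. q \<in> S \<Longrightarrow> q \<in> dom_at M p \<Longrightarrow> chart_at M p q \<in> V \<Longrightarrow> f q \<in> dom_at N (f p)"
    "\<And>q. q \<in> S \<Longrightarrow> q \<in> dom_at M p \<Longrightarrow> chart_at M p q \<in> V \<Longrightarrow> chart_at N (f p) (f q) = F (chart_at M p q)"
    by (rule smooth_map_onE[OF assms(3) p]) blast
  obtain W G where G: "open W" "chart_at N (f p) (f p) \<in> W" "smooth_on W G"
    "\<And>q. q \<in> T \<Longrightarrow> q \<in> dom_at N (f p) \<Longrightarrow> chart_at N (f p) q \<in> W \<Longrightarrow> g q \<in> dom_at K (g (f p))"
    "\<And>q. q \<in> T \<Longrightarrow> q \<in> dom_at N (f p) \<Longrightarrow> chart_at N (f p) q \<in> W \<Longrightarrow> chart_at K (g (f p)) (g q) = G (chart_at N (f p) q)"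
    by (rule smooth_map_onE[OF assms(4) assms(5)[OF p]]) blast
  let ?V = "V \<inter> F -` W"
  have V: "open ?V" using continuous_open_preimage[OF smooth_on_continuous_on[OF F(3)] F(1) G(1)] .
  have sm: "smooth_on ?V (\<lambda>x. G (F x))"
    by (rule smooth_on_compose[OF manifold_fin_dim[OF assms(2)] V _ smooth_on_subset[OF F(3)] G(3)]) auto
  have "chart_at M p p \<in> ?V" using F(5)[OF p manifold_chartD(1)[OF assms(1)] F(2)] G(2) F(2) by auto
  then show "\<exists>V F. open V \<and> chart_at M p p \<in> V \<and> smooth_on V F \<and>
        (\<forall>q \<in> S \<inter> dom_at M p. chart_at M p q \<in> V \<longrightarrow> g (f q) \<in> dom_at K (g (f p)) \<and> chart_at K (g (f p)) (g (f q)) = F (chart_at M p q))"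
    using V sm F(4,5) G(4,5) assms(5) by (intro exI[of _ ?V] exI[of _ "\<lambda>x. G (F x)"]) simp
qed

lemma smooth_map_on_Pair:
  assumes "smooth_map_on M N S f" "smooth_map_on M K S g"
  shows "smooth_map_on M (prod_atlas N K) S (\<lambda>x. (f x, g x))"
proof (rule smooth_map_onI)
  fix p assume p: "p \<in> S"
  obtain V F where F: "open V" "chart_at M p p \<in> V" "smooth_on V F"
    "\<And>q. q \<in> S \<Longrightarrow> q \<in> dom_at M p \<Longrightarrow> chart_at M p q \<in> V \<Longrightarrow> f q \<in> dom_at N (f p)"
    "\<And>q. q \<in> S \<Longrightarrow> q \<in> dom_at M p \<Longrightarrow> chart_at M p q \<in> V \<Longrightarrow> chart_at N (f p) (f q) = F (chart_at M p q)"
    by (rule smooth_map_onE[OF assms(1) p]) blast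
  obtain W G where G: "open W" "chart_at M p p \<in> W" "smooth_on W G"
    "\<And>q. q \<in> S \<Longrightarrow> q \<in> dom_at M p \<Longrightarrow> chart_at M p q \<in> W \<Longrightarrow> g q \<in> dom_at K (g p)"
    "\<And>q. q \<in> S \<Longrightarrow> q \<in> dom_at M p \<Longrightarrow> chart_at M p q \<in> W \<Longrightarrow> chart_at K (g p) (g q) = G (chart_at M p q)"
    by (rule smooth_map_onE[OF assms(2) p]) blast
  have "smooth_on (V \<inter> W) (\<lambda>x. (F x, G x))"
    by (intro smooth_on_Pair open_Int F(1) G(1) smooth_on_subset[OF F(3)] smooth_on_subset[OF G(3)]) auto
  then show "\<exists>V F. open V \<and> chart_at M p p \<in> V \<and> smooth_on V F \<and>
        (\<forall>q \<in> S \<inter> dom_at M p. chart_at M p q \<in> V \<longrightarrow> (f q, g q) \<in> dom_at (prod_atlas N K) (f p, g p) \<and>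
          chart_at (prod_atlas N K) (f p, g p) (f q, g q) = F (chart_at M p q))"
    using F G by (intro exI[of _ "V \<inter> W"] exI[of _ "\<lambda>x. (F x, G x)"]) (simp add: open_Int)
qed

lemma smooth_map_on_fst:
  fixes M :: "('a, 'v::real_normed_vector) atlas" and N :: "('b, 'w::real_normed_vector) atlas"
  shows "smooth_map_on (prod_atlas M N) M S fst"
proof (rule smooth_map_onI)
  fix p assume "p \<in> S"
  have "smooth_on (UNIV::('v\<times>'w) set) fst" by (rule smooth_on_bounded_linear[OF open_UNIV bounded_linear_fst])
  then show "\<exists>V F. open V \<and> chart_at (prod_atlas M N) p p \<in> V \<and> smooth_on V F \<and>
        (\<forall>q \<in> S \<inter> dom_at (prod_atlas M N) p. chart_at (prod_atlas M N) p q \<in> V \<longrightarrow> fst q \<in> dom_at M (fst p) \<and>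
          chart_at M (fst p) (fst q) = F (chart_at (prod_atlas M N) p q))"
    by (intro exI[of _ UNIV] exI[of _ fst]) (cases p, auto)
qed

lemma smooth_map_on_snd:
  fixes M :: "('a, 'v::real_normed_vector) atlas" and N :: "('b, 'w::real_normed_vector) atlas"
  shows "smooth_map_on (prod_atlas M N) N S snd"
proof (rule smooth_map_onI)
  fix p assume "p \<in> S"
  have "smooth_on (UNIV::('v\<times>'w) set) snd" by (rule smooth_on_bounded_linear[OF open_UNIV bounded_linear_snd])
  then show "\<exists>V F. open V \<and> chart_at (prod_atlas M N) p p \<in> V \<and> smooth_on V F \<and>
        (\<forall>q \<in> S \<inter> dom_at (prod_atlas M N) p. chart_at (prod_atlas M N) p q \<in> V \<longrightarrow> snd q \<in> dom_at N (snd p) \<and>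
          chart_at N (snd p) (snd q) = F (chart_at (prod_atlas M N) p q))"
    by (intro exI[of _ UNIV] exI[of _ snd]) (cases p, auto)
qed

lemma smooth_map_on_const: "manifold N \<Longrightarrow> smooth_map_on M N S (\<lambda>x. c)"
  by (rule smooth_map_onI, rule exI[of _ UNIV], rule exI[of _ "\<lambda>x. chart_at N c c"])
    (simp add: smooth_on_const[OF open_UNIV] manifold_chartD(1))

lemma smooth_map_on_ident: "smooth_map_on M M S (\<lambda>x. x)"
  by (rule smooth_map_onI, rule exI[of _ UNIV], rule exI[of _ "\<lambda>x. x"])
    (simp add: smooth_on_bounded_linear[OF open_UNIV bounded_linear_ident])

lemma smooth_map_on_chart:
  assumes "manifold M"
  shows "smooth_map_on M model (dom_at M p) (chart_at M p)"
proof (rule smooth_map_onI)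
  fix q assume q: "q \<in> dom_at M p"
  let ?V = "chart_at M q ` (dom_at M q \<inter> dom_at M p)"
  have "r \<in> dom_at M p \<and> r \<in> dom_at M q" if "r \<in> dom_at M q" "chart_at M q r \<in> ?V" for r
    using that chart_inj[OF assms] by (elim imageE) blast
  then show "\<exists>V F. open V \<and> chart_at M q q \<in> V \<and> smooth_on V F \<and>
        (\<forall>r \<in> dom_at M p \<inter> dom_at M q. chart_at M q r \<in> V \<longrightarrow> chart_at M p r \<in> dom_at model (chart_at M p q) \<and>
          chart_at model (chart_at M p q) (chart_at M p r) = F (chart_at M q r))"
    using chart_open_image[OF assms manifold_chartD(2)[OF assms], of q p] manifold_chartD(5)[OF assms, of q p]
      q manifold_chartD(1)[OF assms, of q] chart_inv_chart[OF assms]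
    by (intro exI[of _ ?V] exI[of _ "chart_at M p \<circ> chart_inv M q"]) auto
qed

lemma smooth_map_on_chart_inv:
  assumes "manifold M"
  shows "smooth_map_on model M (chart_at M p ` dom_at M p) (chart_inv M p)"
proof (rule smooth_map_onI)
  fix z assume z: "z \<in> chart_at M p ` dom_at M p"
  define q where "q = chart_inv M p z"
  have q: "q \<in> dom_at M p" "chart_at M p q = z" using chart_inv_in[OF assms z] chart_chart_inv[OF assms z] by (auto simp: q_def)
  let ?V = "chart_at M p ` (dom_at M p \<inter> dom_at M q)"
  have 1: "z \<in> ?V" using q manifold_chartD(1)[OF assms, of q] by blast
  have 2: "chart_inv M p x \<in> dom_at M q" if "x \<in> ?V" for x
    using that chart_inv_chart[OF assms] by auto
  show "\<exists>V F. open V \<and> chart_at model z z \<in> V \<and> smooth_on V F \<and>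
        (\<forall>x \<in> chart_at M p ` dom_at M p \<inter> dom_at model z. chart_at model z x \<in> V \<longrightarrow> chart_inv M p x \<in> dom_at M (chart_inv M p z) \<and>
          chart_at M (chart_inv M p z) (chart_inv M p x) = F (chart_at model z x))"
    using chart_open_image[OF assms manifold_chartD(2)[OF assms], of p q] manifold_chartD(5)[OF assms, of p q] 1 2
    unfolding q_def[symmetric] by (intro exI[of _ ?V] exI[of _ "chart_at M q \<circ> chart_inv M p"]) simp
qed

lemma manifold_prod:
  fixes M :: "('a::topological_space, 'v::real_inner) atlas" and N :: "('b::topological_space, 'w::real_inner) atlas"
  assumes "manifold M" "manifold N"
  shows "manifold (prod_atlas M N)"
  unfolding manifold_def
proof (intro conjI allI)
  obtain B :: "('v \<times> 'w) set" where B: "finite B" "\<And>x. (\<Sum>b\<in>B. (x \<bullet> b) *\<^sub>R b) = x"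
    using fin_dimE[OF fin_dim_prod[OF manifold_fin_dim[OF assms(1)] manifold_fin_dim[OF assms(2)]]] by metis
  have "x \<in> span B" for x using span_sum[of B "\<lambda>b. (x \<bullet> b) *\<^sub>R b" B] B(2)[of x] by (simp add: span_base span_scale)
  then show "\<exists>B::('v \<times> 'w) set. finite B \<and> span B = UNIV" using B(1) by blast
next
  fix p :: "'a \<times> 'b"
  obtain p1 p2 where p: "p = (p1, p2)" by fastforce
  show "p \<in> dom_at (prod_atlas M N) p" using assms by (simp add: p manifold_chartD(1))
  show "open (dom_at (prod_atlas M N) p)" using assms by (simp add: p open_Times manifold_chartD(2))
  show "open (chart_at (prod_atlas M N) p ` dom_at (prod_atlas M N) p)"
    using assms by (simp add: p prod_chart_image open_Times manifold_chartD(3))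
  note h1 = manifold_chartD(4)[OF assms(1), of p1] and h2 = manifold_chartD(4)[OF assms(2), of p2]
  have c: "continuous_on (dom_at M p1) (chart_at M p1)" "continuous_on (chart_at M p1 ` dom_at M p1) (chart_inv M p1)"
    "continuous_on (dom_at N p2) (chart_at N p2)" "continuous_on (chart_at N p2 ` dom_at N p2) (chart_inv N p2)"
    using h1 h2 unfolding homeomorphism_def by blast+
  show "homeomorphism (dom_at (prod_atlas M N) p) (chart_at (prod_atlas M N) p ` dom_at (prod_atlas M N) p)
       (chart_at (prod_atlas M N) p) (chart_inv (prod_atlas M N) p)"
  proof (rule homeomorphismI)
    have "continuous_on (dom_at M p1 \<times> dom_at N p2) (\<lambda>x. (chart_at M p1 (fst x), chart_at N p2 (snd x)))"
      by (intro continuous_on_Pair continuous_on_compose2[OF c(1)] continuous_on_compose2[OF c(3)] continuous_on_fst continuous_on_snd continuous_on_id) auto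
    then show "continuous_on (dom_at (prod_atlas M N) p) (chart_at (prod_atlas M N) p)"
      unfolding p prod_atlas_simps by (rule continuous_on_eq) auto
    have "continuous_on ((chart_at M p1 ` dom_at M p1) \<times> (chart_at N p2 ` dom_at N p2)) (\<lambda>x. (chart_inv M p1 (fst x), chart_inv N p2 (snd x)))"
      by (intro continuous_on_Pair continuous_on_compose2[OF c(2)] continuous_on_compose2[OF c(4)] continuous_on_fst continuous_on_snd continuous_on_id) auto
    then have "continuous_on ((chart_at M p1 ` dom_at M p1) \<times> (chart_at N p2 ` dom_at N p2)) (chart_inv (prod_atlas M N) (p1, p2))"
      by (rule continuous_on_eq) (auto simp: prod_chart_inv[OF assms])
    then show "continuous_on (chart_at (prod_atlas M N) p ` dom_at (prod_atlas M N) p) (chart_inv (prod_atlas M N) p)"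
      by (simp add: p prod_chart_image)
    show "chart_inv (prod_atlas M N) p ` (chart_at (prod_atlas M N) p ` dom_at (prod_atlas M N) p) \<subseteq> dom_at (prod_atlas M N) p"
      by (auto simp: p prod_chart_inv[OF assms] chart_inv_chart[OF assms(1)] chart_inv_chart[OF assms(2)])
    show "\<And>x. x \<in> dom_at (prod_atlas M N) p \<Longrightarrow> chart_inv (prod_atlas M N) p (chart_at (prod_atlas M N) p x) = x"
      by (auto simp: p prod_chart_inv[OF assms] chart_inv_chart[OF assms(1)] chart_inv_chart[OF assms(2)])
    show "\<And>y. y \<in> chart_at (prod_atlas M N) p ` dom_at (prod_atlas M N) p \<Longrightarrow> chart_at (prod_atlas M N) p (chart_inv (prod_atlas M N) p y) = y"
      by (auto simp: p prod_chart_inv[OF assms] chart_inv_chart[OF assms(1)] chart_inv_chart[OF assms(2)])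
  qed simp
next
  fix p q :: "'a \<times> 'b"
  obtain p1 p2 q1 q2 where p: "p = (p1, p2)" and q: "q = (q1, q2)" by fastforce
  let ?A = "chart_at M p1 ` (dom_at M p1 \<inter> dom_at M q1)" and ?B = "chart_at N p2 ` (dom_at N p2 \<inter> dom_at N q2)"
  have o: "open (?A \<times> ?B)" by (intro open_Times chart_open_image manifold_chartD(2) assms)
  have 1: "smooth_on (?A \<times> ?B) (\<lambda>x. (chart_at M q1 \<circ> chart_inv M p1) (fst x))"
    by (rule smooth_on_compose[OF manifold_fin_dim[OF assms(1)] o _ smooth_on_bounded_linear[OF o bounded_linear_fst] manifold_chartD(5)[OF assms(1)]]) auto
  have 2: "smooth_on (?A \<times> ?B) (\<lambda>x. (chart_at N q2 \<circ> chart_inv N p2) (snd x))"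
    by (rule smooth_on_compose[OF manifold_fin_dim[OF assms(2)] o _ smooth_on_bounded_linear[OF o bounded_linear_snd] manifold_chartD(5)[OF assms(2)]]) auto
  have "smooth_on (?A \<times> ?B) (chart_at (prod_atlas M N) q \<circ> chart_inv (prod_atlas M N) p)"
    by (rule smooth_on_cong[OF o _ smooth_on_Pair[OF o 1 2]]) (auto simp: p q prod_chart_inv[OF assms])
  moreover have "chart_at (prod_atlas M N) p ` (dom_at (prod_atlas M N) p \<inter> dom_at (prod_atlas M N) q) = ?A \<times> ?B"
    by (simp add: p q Times_Int_Times prod_chart_image)
  ultimately show "smooth_on (chart_at (prod_atlas M N) p ` (dom_at (prod_atlas M N) p \<inter> dom_at (prod_atlas M N) q))
     (chart_at (prod_atlas M N) q \<circ> chart_inv (prod_atlas M N) p)" by simp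
qed

text \<open>Differentials as a relation. Unlike \<open>tmap_on\<close> it contains the existence of
  the derivative, and the first conjunct keeps f inside the chart domain at f p, outside of which
  \<open>chart_at\<close> has no meaning. Several A may qualify when S is thin; for S =
  \<open>UNIV\<close> the chart image is open and A is unique.\<close>

definition has_tmap ::
  "('a, 'v::real_normed_vector) atlas \<Rightarrow> ('b, 'w::real_normed_vector) atlas \<Rightarrow> 'a set \<Rightarrow> ('a \<Rightarrow> 'b) \<Rightarrow> 'a \<Rightarrow> ('v \<Rightarrow> 'w) \<Rightarrow> bool" where
  "has_tmap M N S f p A \<longleftrightarrow>
     (\<exists>V. open V \<and> chart_at M p p \<in> V \<and> (\<forall>q \<in> S \<inter> dom_at M p. chart_at M p q \<in> V \<longrightarrow> f q \<in> dom_at N (f p))) \<and>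
     ((\<lambda>z. chart_at N (f p) (f (chart_inv M p z))) has_derivative A)
       (at (chart_at M p p) within chart_at M p ` (S \<inter> dom_at M p))"

lemma has_tmap_linear: "has_tmap M N S f p A \<Longrightarrow> bounded_linear A"
  unfolding has_tmap_def by (elim conjE) (rule has_derivative_bounded_linear)

text \<open>The smooth local extension supplies a derivative within S, so the choice made by
  \<open>tmap_on\<close> is one of the derivatives.\<close>

lemma smooth_map_on_has_tmap:
  assumes "manifold M" "smooth_map_on M N S f" "p \<in> S"
  shows "has_tmap M N S f p (tmap_on M N S f p)"
proof -
  obtain V F where F: "open V" "chart_at M p p \<in> V" "smooth_on V F"
    "\<And>q. q \<in> S \<Longrightarrow> q \<in> dom_at M p \<Longrightarrow> chart_at M p q \<in> V \<Longrightarrow> f q \<in> dom_at N (f p)"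
    "\<And>q. q \<in> S \<Longrightarrow> q \<in> dom_at M p \<Longrightarrow> chart_at M p q \<in> V \<Longrightarrow> chart_at N (f p) (f q) = F (chart_at M p q)"
    by (rule smooth_map_onE[OF assms(2,3)]) blast
  let ?T = "chart_at M p ` (S \<inter> dom_at M p)" and ?z = "chart_at M p p"
  let ?f = "\<lambda>z. chart_at N (f p) (f (chart_inv M p z))"
  have eq: "F z = ?f z" if "z \<in> ?T" "z \<in> V" for z
    using that F(5) chart_inv_chart[OF assms(1)] by (elim imageE) simp
  obtain d where d: "d > 0" "ball ?z d \<subseteq> V" using F(1,2) open_contains_ball by blast
  have zT: "?z \<in> ?T" using assms(3) manifold_chartD(1)[OF assms(1)] by blast
  have D: "(?f has_derivative frechet_derivative F (at ?z)) (at ?z within ?T)"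
    by (rule has_derivative_transform_within[OF has_derivative_at_withinI[OF smooth_on_has_derivative[OF F(3,2)]] d(1) zT])
       (rule eq, assumption, use d(2) in \<open>auto simp: dist_commute\<close>)
  have W: "(?f has_derivative frechet_derivative ?f (at ?z within ?T)) (at ?z within ?T)"
    using D unfolding frechet_derivative_works[symmetric] differentiable_def by blast
  have "blinfun_apply (tmap_on M N S f p) = frechet_derivative ?f (at ?z within ?T)"
    unfolding tmap_on_def by (rule bounded_linear_Blinfun_apply[OF has_derivative_bounded_linear[OF W]])
  then show ?thesis unfolding has_tmap_def using W F(1,2,4) by (intro conjI exI[of _ V]) simp_all
qed

lemma has_tmap_unique:
  assumes "manifold M" "has_tmap M N UNIV f p A"
  shows "blinfun_apply (tmap M N f p) = A"
proof -
  let ?T = "chart_at M p ` (UNIV \<inter> dom_at M p)" and ?z = "chart_at M p p"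
  let ?f = "\<lambda>z. chart_at N (f p) (f (chart_inv M p z))"
  have o: "at ?z within ?T = at ?z"
    by (rule at_within_open) (use manifold_chartD(1,3)[OF assms(1)] in auto)
  have D: "(?f has_derivative A) (at ?z within ?T)" using assms(2) unfolding has_tmap_def by blast
  have "frechet_derivative ?f (at ?z within ?T) = A" using frechet_derivative_at[OF D[unfolded o]] unfolding o by simp
  then show ?thesis
    unfolding tmap_on_def using bounded_linear_Blinfun_apply[OF has_derivative_bounded_linear[OF D]] by simp
qed

lemma has_tmap_tmap:
  assumes "manifold M" "has_tmap M N UNIV f p A"
  shows "has_tmap M N UNIV f p (tmap M N f p)"
  using assms(2) unfolding has_tmap_unique[OF assms] .

lemma has_tmap_uniq2:
  assumes "manifold M" "has_tmap M N UNIV f p A" "has_tmap M N UNIV f p B"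
  shows "A = B"
  using has_tmap_unique[OF assms(1,2)] has_tmap_unique[OF assms(1,3)] by simp

lemma has_tmap_subset:
  assumes "has_tmap M N S f p A" "T \<subseteq> S"
  shows "has_tmap M N T f p A"
proof -
  have "chart_at M p ` (T \<inter> dom_at M p) \<subseteq> chart_at M p ` (S \<inter> dom_at M p)" using assms(2) by blast
  then show ?thesis using assms unfolding has_tmap_def by (meson IntD1 IntD2 IntI has_derivative_subset subsetD)
qed

lemma has_derivative_within_Int_open:
  assumes "open W" "x \<in> W"
  shows "(f has_derivative A) (at x within T \<inter> W) \<longleftrightarrow> (f has_derivative A) (at x within T)"
proof -
  have "at x within T \<inter> W = at x within T" by (rule at_within_nhd[OF assms(2,1)]) auto
  then show ?thesis by simp
qed

text \<open>Only a neighbourhood of p matters; away from it T and S are unrelated. This moves a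
  differential from an open domain to \<open>UNIV\<close>, where uniqueness holds.\<close>

lemma has_tmap_cong_open:
  assumes "manifold M" "has_tmap M N S f p A" "open U" "p \<in> U" "p \<in> T" "\<And>q. q \<in> T \<Longrightarrow> q \<in> U \<Longrightarrow> q \<in> S"
    and fg: "\<And>q. q \<in> T \<Longrightarrow> q \<in> U \<Longrightarrow> f q = g q"
  shows "has_tmap M N T g p A"
proof -
  have fp: "g p = f p" using fg[OF assms(5,4)] by simp
  obtain V where V: "open V" "chart_at M p p \<in> V" "\<And>q. q \<in> S \<Longrightarrow> q \<in> dom_at M p \<Longrightarrow> chart_at M p q \<in> V \<Longrightarrow> f q \<in> dom_at N (f p)"
    and D: "((\<lambda>z. chart_at N (f p) (f (chart_inv M p z))) has_derivative A) (at (chart_at M p p) within chart_at M p ` (S \<inter> dom_at M p))"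
    using assms(2) unfolding has_tmap_def by blast
  let ?W = "chart_at M p ` (dom_at M p \<inter> U)" and ?z = "chart_at M p p" and ?T = "chart_at M p ` (T \<inter> dom_at M p)"
  have W: "open ?W" "?z \<in> ?W" using chart_open_image[OF assms(1,3)] manifold_chartD(1)[OF assms(1)] assms(4) by auto
  have inW: "q \<in> U" if "q \<in> dom_at M p" "chart_at M p q \<in> ?W" for q
    using that chart_inj[OF assms(1)] by (elim imageE) blast
  have "?T \<inter> ?W \<subseteq> chart_at M p ` (S \<inter> dom_at M p)"
    using inW assms(6) by blast
  then have D1: "((\<lambda>z. chart_at N (f p) (f (chart_inv M p z))) has_derivative A) (at ?z within ?T \<inter> ?W)"
    using D has_derivative_subset by blast
  have zT: "?z \<in> ?T \<inter> ?W" using W(2) assms(5) manifold_chartD(1)[OF assms(1)] by blast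
  have "chart_at N (f p) (f (chart_inv M p z)) = chart_at N (g p) (g (chart_inv M p z))" if z: "z \<in> ?T \<inter> ?W" for z
  proof -
    obtain q where q: "q \<in> T" "q \<in> dom_at M p" "z = chart_at M p q" using z by blast
    then have "q \<in> U" using inW z by blast
    then show ?thesis using fg[OF q(1)] by (simp add: q(3) chart_inv_chart[OF assms(1) q(2)] fp)
  qed
  from has_derivative_transform[OF zT this[symmetric] D1]
  have "((\<lambda>z. chart_at N (g p) (g (chart_inv M p z))) has_derivative A) (at ?z within ?T \<inter> ?W)" .
  then have D2: "((\<lambda>z. chart_at N (g p) (g (chart_inv M p z))) has_derivative A) (at ?z within ?T)"
    unfolding has_derivative_within_Int_open[OF W] .
  have "g q \<in> dom_at N (g p)" if "q \<in> T \<inter> dom_at M p" "chart_at M p q \<in> V \<inter> ?W" for q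
  proof -
    have "q \<in> U" using inW that by blast
    then show ?thesis using V(3)[of q] fg[of q] assms(6)[of q] that fp by simp
  qed
  then show ?thesis unfolding has_tmap_def using D2 V(1,2) W by (intro conjI exI[of _ "V \<inter> ?W"]) (auto simp del: image_Int)
qed

lemma has_tmap_chain:
  assumes M: "manifold M" "manifold N"
    and f: "has_tmap M N S f p A" and g: "has_tmap N K T g (f p) B" and pS: "p \<in> S" "\<And>q. q \<in> S \<Longrightarrow> f q \<in> T"
  shows "has_tmap M K S (\<lambda>x. g (f x)) p (\<lambda>v. B (A v))"
proof -
  let ?z = "chart_at M p p" and ?T = "chart_at M p ` (S \<inter> dom_at M p)" and ?T' = "chart_at N (f p) ` (T \<inter> dom_at N (f p))"
  let ?f = "\<lambda>z. chart_at N (f p) (f (chart_inv M p z))" and ?g = "\<lambda>z. chart_at K (g (f p)) (g (chart_inv N (f p) z))"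
  obtain V where V: "open V" "?z \<in> V" "\<And>q. q \<in> S \<Longrightarrow> q \<in> dom_at M p \<Longrightarrow> chart_at M p q \<in> V \<Longrightarrow> f q \<in> dom_at N (f p)"
    and D: "(?f has_derivative A) (at ?z within ?T)"
    using f unfolding has_tmap_def by blast
  obtain V2 where V2: "open V2" "chart_at N (f p) (f p) \<in> V2" "\<And>q. q \<in> T \<Longrightarrow> q \<in> dom_at N (f p) \<Longrightarrow> chart_at N (f p) q \<in> V2 \<Longrightarrow> g q \<in> dom_at K (g (f p))"
    and D': "(?g has_derivative B) (at (chart_at N (f p) (f p)) within ?T')"
    using g unfolding has_tmap_def by blast
  have fz: "?f ?z = chart_at N (f p) (f p)" by (simp add: chart_inv_chart_self[OF M(1)])
  have "continuous (at ?z within ?T) ?f" using D has_derivative_continuous by blast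
  then obtain W where W: "open W" "?z \<in> W" "\<And>z. z \<in> ?T \<Longrightarrow> z \<in> W \<Longrightarrow> ?f z \<in> V2"
    unfolding continuous_within_topological using V2(1,2) fz by metis
  have cd: "f q \<in> dom_at N (f p) \<and> chart_at N (f p) (f q) \<in> V2 \<and> ?f (chart_at M p q) = chart_at N (f p) (f q)"
    if "q \<in> S" "q \<in> dom_at M p" "chart_at M p q \<in> V" "chart_at M p q \<in> W" for q
  proof -
    have *: "chart_inv M p (chart_at M p q) = q" by (rule chart_inv_chart[OF M(1) that(2)])
    have "chart_at M p q \<in> ?T" using that by blast
    from W(3)[OF this that(4)] show ?thesis using V(3)[OF that(1,2,3)] unfolding * by simp
  qed
  let ?U = "?T \<inter> (V \<inter> W)"
  have o: "open (V \<inter> W)" "?z \<in> V \<inter> W" using V W by auto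
  have zU: "?z \<in> ?U" using o(2) pS(1) manifold_chartD(1)[OF M(1)] by blast
  have DU: "(?f has_derivative A) (at ?z within ?U)" using D unfolding has_derivative_within_Int_open[OF o] .
  have sub: "?f ` ?U \<subseteq> ?T'"
  proof (rule image_subsetI)
    fix z assume "z \<in> ?U"
    then obtain q where q: "q \<in> S" "q \<in> dom_at M p" "z = chart_at M p q" "z \<in> V" "z \<in> W" by blast
    then show "?f z \<in> ?T'" using cd[of q] pS(2)[of q] by blast
  qed
  have "(?g has_derivative B) (at (?f ?z) within ?f ` ?U)" unfolding fz by (rule has_derivative_subset[OF D' sub])
  from has_derivative_in_compose[OF DU this]
  have E: "((\<lambda>z. ?g (?f z)) has_derivative (\<lambda>v. B (A v))) (at ?z within ?U)" .
  have "?g (?f z) = chart_at K (g (f p)) (g (f (chart_inv M p z)))" if u: "z \<in> ?U" for z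
  proof -
    obtain q where q: "q \<in> S" "q \<in> dom_at M p" "z = chart_at M p q" "z \<in> V" "z \<in> W" using u by blast
    then have c: "f q \<in> dom_at N (f p)" "?f z = chart_at N (f p) (f q)" using cd[of q] by auto
    show ?thesis unfolding c(2) using chart_inv_chart[OF M(2) c(1)] chart_inv_chart[OF M(1) q(2)] q(3) by simp
  qed
  from has_derivative_transform[OF zU this[symmetric] E]
  have "((\<lambda>z. chart_at K (g (f p)) (g (f (chart_inv M p z)))) has_derivative (\<lambda>v. B (A v))) (at ?z within ?U)" .
  then have "((\<lambda>z. chart_at K (g (f p)) (g (f (chart_inv M p z)))) has_derivative (\<lambda>v. B (A v))) (at ?z within ?T)"
    unfolding has_derivative_within_Int_open[OF o] .
  moreover have "g (f q) \<in> dom_at K (g (f p))" if "q \<in> S \<inter> dom_at M p" "chart_at M p q \<in> V \<inter> W" for q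
    using cd[of q] V2(3)[of "f q"] pS(2)[of q] that by simp
  ultimately show ?thesis unfolding has_tmap_def using o by (intro conjI exI[of _ "V \<inter> W"]) simp_all
qed

lemma has_tmap_model_iff: "has_tmap model model S f z A \<longleftrightarrow> (f has_derivative A) (at z within S)"
  unfolding has_tmap_def by auto

lemma has_tmap_Pair:
  assumes "has_tmap M N S f p A" "has_tmap M K S g p B"
  shows "has_tmap M (prod_atlas N K) S (\<lambda>x. (f x, g x)) p (\<lambda>v. (A v, B v))"
proof -
  let ?z = "chart_at M p p" and ?T = "chart_at M p ` (S \<inter> dom_at M p)"
  obtain V where V: "open V" "?z \<in> V" "\<And>q. q \<in> S \<Longrightarrow> q \<in> dom_at M p \<Longrightarrow> chart_at M p q \<in> V \<Longrightarrow> f q \<in> dom_at N (f p)"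
    and D: "((\<lambda>z. chart_at N (f p) (f (chart_inv M p z))) has_derivative A) (at ?z within ?T)"
    using assms(1) unfolding has_tmap_def by blast
  obtain W where W: "open W" "?z \<in> W" "\<And>q. q \<in> S \<Longrightarrow> q \<in> dom_at M p \<Longrightarrow> chart_at M p q \<in> W \<Longrightarrow> g q \<in> dom_at K (g p)"
    and E: "((\<lambda>z. chart_at K (g p) (g (chart_inv M p z))) has_derivative B) (at ?z within ?T)"
    using assms(2) unfolding has_tmap_def by blast
  show ?thesis unfolding has_tmap_def prod_atlas_simps
    using has_derivative_Pair[OF D E] V W by (intro conjI exI[of _ "V \<inter> W"]) auto
qed

lemma has_tmap_const: "manifold N \<Longrightarrow> has_tmap M N S (\<lambda>x. c) p (\<lambda>v. 0)"
  unfolding has_tmap_def by (auto simp: manifold_chartD(1))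

lemma has_tmap_ident:
  assumes "manifold M" "p \<in> S"
  shows "has_tmap M M S (\<lambda>x. x) p (\<lambda>v. v)"
proof -
  let ?z = "chart_at M p p" and ?T = "chart_at M p ` (S \<inter> dom_at M p)"
  have "?z \<in> ?T" using assms manifold_chartD(1) by blast
  moreover have "chart_at M p (chart_inv M p z) = z" if "z \<in> ?T" for z
    using that chart_chart_inv[OF assms(1), of z p] by blast
  ultimately have "((\<lambda>z. chart_at M p (chart_inv M p z)) has_derivative (\<lambda>v. v)) (at ?z within ?T)"
    by (rule has_derivative_transform[OF _ _ has_derivative_ident])
  then show ?thesis unfolding has_tmap_def by (intro conjI exI[of _ UNIV]) auto
qed

lemma has_tmap_two:
  assumes M: "manifold M" "manifold N"
    and f: "has_tmap (prod_atlas M N) K UNIV (\<lambda>(a, b). f a b) (p, q) A"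
  shows "has_tmap M K UNIV (\<lambda>a. f a q) p (\<lambda>v. A (v, 0))" "has_tmap N K UNIV (\<lambda>b. f p b) q (\<lambda>w. A (0, w))"
    "A (v, w) = A (v, 0) + A (0, w)"
proof -
  note P = manifold_prod[OF M]
  have "has_tmap M (prod_atlas M N) UNIV (\<lambda>a. (a, q)) p (\<lambda>v. (v, 0))"
    by (intro has_tmap_Pair has_tmap_ident has_tmap_const M UNIV_I)
  from has_tmap_chain[OF M(1) P this f] show "has_tmap M K UNIV (\<lambda>a. f a q) p (\<lambda>v. A (v, 0))" by simp
  have "has_tmap N (prod_atlas M N) UNIV (\<lambda>b. (p, b)) q (\<lambda>w. (0, w))"
    by (intro has_tmap_Pair has_tmap_ident has_tmap_const M UNIV_I)
  from has_tmap_chain[OF M(2) P this f] show "has_tmap N K UNIV (\<lambda>b. f p b) q (\<lambda>w. A (0, w))" by simp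
  interpret A: bounded_linear A by (rule has_tmap_linear[OF f])
  show "A (v, w) = A (v, 0) + A (0, w)" by (simp flip: A.add)
qed

lemma smooth_map_slices:
  assumes M: "manifold M" "manifold N" "manifold K"
    and f: "smooth_map (prod_atlas M N) K (\<lambda>(a, b). f a b)"
  shows "smooth_map M K (\<lambda>a. f a q)" "smooth_map N K (\<lambda>b. f p b)"
proof -
  note P = manifold_prod[OF M(1,2)]
  have "smooth_map M (prod_atlas M N) (\<lambda>a. (a, q))"
    by (intro smooth_map_on_Pair smooth_map_on_ident smooth_map_on_const M)
  from smooth_map_on_compose[OF M(1) P this f] show "smooth_map M K (\<lambda>a. f a q)" by simp
  have "smooth_map N (prod_atlas M N) (\<lambda>b. (p, b))"
    by (intro smooth_map_on_Pair smooth_map_on_ident smooth_map_on_const M)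
  from smooth_map_on_compose[OF M(2) P this f] show "smooth_map N K (\<lambda>b. f p b)" by simp
qed

lemma smooth_map_has_tmap:
  "manifold M \<Longrightarrow> smooth_map M N f \<Longrightarrow> has_tmap M N UNIV f p (tmap M N f p)"
  by (rule smooth_map_on_has_tmap[OF _ _ UNIV_I])

lemma smooth_map_on_compose2:
  assumes M: "manifold L" "manifold M" "manifold N"
    and f: "smooth_map (prod_atlas M N) K (\<lambda>(a, b). f a b)"
    and g: "smooth_map_on L M S g" "smooth_map_on L N S h"
  shows "smooth_map_on L K S (\<lambda>x. f (g x) (h x))"
  using smooth_map_on_compose[OF M(1) manifold_prod[OF M(2,3)] smooth_map_on_Pair[OF g] f] by simp

text \<open>The differential at (g x, h x) is additive in the two factors, so partial differentials
  suffice. Products in a group and moving points under an action are differentiated with this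
  rule.\<close>

lemma has_tmap_compose2:
  assumes M: "manifold L" "manifold M" "manifold N"
    and f: "smooth_map (prod_atlas M N) K (\<lambda>(a, b). f a b)"
    and g: "has_tmap L M S g x G" "has_tmap L N S h x H" "x \<in> S"
  shows "has_tmap L K S (\<lambda>x. f (g x) (h x)) x
     (\<lambda>v. tmap M K (\<lambda>a. f a (h x)) (g x) (G v) + tmap N K (\<lambda>b. f (g x) b) (h x) (H v))"
proof -
  note P = manifold_prod[OF M(2,3)]
  let ?A = "tmap (prod_atlas M N) K (\<lambda>(a, b). f a b) (g x, h x)"
  have f': "has_tmap (prod_atlas M N) K UNIV (\<lambda>(a, b). f a b) (g x, h x) ?A"
    by (rule smooth_map_has_tmap[OF P f])
  have "has_tmap L K S (\<lambda>x. (\<lambda>(a, b). f a b) (g x, h x)) x (\<lambda>v. ?A (G v, H v))"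
    by (rule has_tmap_chain[OF M(1) P has_tmap_Pair[OF g(1,2)] f' g(3) UNIV_I])
  moreover have "?A (G v, H v) = tmap M K (\<lambda>a. f a (h x)) (g x) (G v) + tmap N K (\<lambda>b. f (g x) b) (h x) (H v)" for v
    unfolding has_tmap_unique[OF M(2) has_tmap_two(1)[OF M(2,3) f']] has_tmap_unique[OF M(3) has_tmap_two(2)[OF M(2,3) f']]
    by (rule has_tmap_two(3)[OF M(2,3) f'])
  ultimately show ?thesis by simp
qed

lemma smooth_map_on_continuous_on:
  assumes M: "manifold M" "manifold N" and f: "smooth_map_on M N S f"
  shows "continuous_on S f"
  unfolding continuous_on_topological
proof (intro ballI allI impI)
  fix p B assume p: "p \<in> S" and B: "open B" "f p \<in> B"
  obtain V F where F: "open V" "chart_at M p p \<in> V" "smooth_on V F"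
    "\<And>q. q \<in> S \<Longrightarrow> q \<in> dom_at M p \<Longrightarrow> chart_at M p q \<in> V \<Longrightarrow> f q \<in> dom_at N (f p)"
    "\<And>q. q \<in> S \<Longrightarrow> q \<in> dom_at M p \<Longrightarrow> chart_at M p q \<in> V \<Longrightarrow> chart_at N (f p) (f q) = F (chart_at M p q)"
    by (rule smooth_map_onE[OF f p]) blast
  let ?W = "chart_at N (f p) ` (dom_at N (f p) \<inter> B)"
  have W: "open ?W" by (rule chart_open_image[OF M(2) B(1)])
  let ?V = "V \<inter> F -` ?W"
  have V: "open ?V" using continuous_open_preimage[OF smooth_on_continuous_on[OF F(3)] F(1) W] .
  have "F (chart_at M p p) = chart_at N (f p) (f p)" using F(5)[OF p manifold_chartD(1)[OF M(1)] F(2)] by simp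
  then have pV: "chart_at M p p \<in> ?V" using F(2) B(2) manifold_chartD(1)[OF M(2)] by auto
  show "\<exists>A. open A \<and> p \<in> A \<and> (\<forall>y\<in>S. y \<in> A \<longrightarrow> f y \<in> B)"
  proof (intro exI[of _ "{q \<in> dom_at M p. chart_at M p q \<in> ?V}"] conjI ballI impI)
    show "open {q \<in> dom_at M p. chart_at M p q \<in> ?V}" by (rule chart_open_vimage[OF M(1) V])
    show "p \<in> {q \<in> dom_at M p. chart_at M p q \<in> ?V}" using pV manifold_chartD(1)[OF M(1)] by blast
    fix q assume q: "q \<in> S" "q \<in> {q \<in> dom_at M p. chart_at M p q \<in> ?V}"
    then have d: "f q \<in> dom_at N (f p)" "chart_at N (f p) (f q) = F (chart_at M p q)" using F(4,5) by auto
    then have "chart_at N (f p) (f q) \<in> ?W" using q(2) by auto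
    then obtain r where "r \<in> dom_at N (f p)" "r \<in> B" "chart_at N (f p) (f q) = chart_at N (f p) r" by blast
    then show "f q \<in> B" using chart_inj[OF M(2) d(1)] by blast
  qed
qed

lemma has_tmap_nhd:
  assumes M: "manifold M" "manifold N" and f: "has_tmap M N UNIV f p A" and B: "open B" "f p \<in> B"
  obtains U where "open U" "p \<in> U" "\<And>q. q \<in> U \<Longrightarrow> f q \<in> B" "U \<subseteq> dom_at M p"
proof -
  let ?f = "\<lambda>z. chart_at N (f p) (f (chart_inv M p z))" and ?z = "chart_at M p p"
  obtain V where V: "open V" "?z \<in> V" "\<And>q. q \<in> dom_at M p \<Longrightarrow> chart_at M p q \<in> V \<Longrightarrow> f q \<in> dom_at N (f p)"
    and D: "(?f has_derivative A) (at ?z within chart_at M p ` (UNIV \<inter> dom_at M p))"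
    using f unfolding has_tmap_def by blast
  let ?W = "chart_at N (f p) ` (dom_at N (f p) \<inter> B)"
  have W: "open ?W" by (rule chart_open_image[OF M(2) B(1)])
  have "?f ?z \<in> ?W" using B(2) manifold_chartD(1)[OF M(2)] by (simp add: chart_inv_chart_self[OF M(1)])
  moreover have "continuous (at ?z within chart_at M p ` (UNIV \<inter> dom_at M p)) ?f" using D has_derivative_continuous by blast
  ultimately obtain X where X: "open X" "?z \<in> X" "\<And>z. z \<in> chart_at M p ` (UNIV \<inter> dom_at M p) \<Longrightarrow> z \<in> X \<Longrightarrow> ?f z \<in> ?W"
    unfolding continuous_within_topological using W by metis
  let ?U = "{q \<in> dom_at M p. chart_at M p q \<in> V \<inter> X}"
  have "f q \<in> B" if "q \<in> ?U" for q
  proof -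
    have d: "f q \<in> dom_at N (f p)" using V(3) that by blast
    have "?f (chart_at M p q) \<in> ?W" using X(3) that by blast
    then have "chart_at N (f p) (f q) \<in> ?W" using chart_inv_chart[OF M(1), of q p] that by simp
    then obtain r where "r \<in> dom_at N (f p)" "r \<in> B" "chart_at N (f p) (f q) = chart_at N (f p) r" by blast
    then show "f q \<in> B" using chart_inj[OF M(2) d] by blast
  qed
  moreover have "open ?U" using V(1) X(1) by (intro chart_open_vimage[OF M(1)] open_Int)
  moreover have "p \<in> ?U" using manifold_chartD(1)[OF M(1)] V(2) X(2) by blast
  ultimately show thesis using that[of ?U] by blast
qed

section \<open>Differentials of charts and maps with zero differential\<close>

lemma frame_has_tmap:
  assumes "manifold M" "z \<in> chart_at M p ` dom_at M p"
  shows "has_tmap model M UNIV (chart_inv M p) z (frame M p z)"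
proof -
  note m = manifold_model[OF manifold_fin_dim[OF assms(1)]]
  have "has_tmap model M (chart_at M p ` dom_at M p) (chart_inv M p) z (tmap_on model M (chart_at M p ` dom_at M p) (chart_inv M p) z)"
    by (rule smooth_map_on_has_tmap[OF m smooth_map_on_chart_inv[OF assms(1)] assms(2)])
  then have "has_tmap model M UNIV (chart_inv M p) z (tmap_on model M (chart_at M p ` dom_at M p) (chart_inv M p) z)"
    by (rule has_tmap_cong_open[OF m _ manifold_chartD(3)[OF assms(1)] assms(2)]) auto
  from has_tmap_tmap[OF m this] show ?thesis unfolding frame_def .
qed

lemma coframe_has_tmap:
  assumes "manifold M" "q \<in> dom_at M p"
  shows "has_tmap M model UNIV (chart_at M p) q (coframe M p (chart_at M p q))"
proof -
  have "has_tmap M model (dom_at M p) (chart_at M p) q (tmap_on M model (dom_at M p) (chart_at M p) q)"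
    by (rule smooth_map_on_has_tmap[OF assms(1) smooth_map_on_chart[OF assms(1)] assms(2)])
  then have "has_tmap M model UNIV (chart_at M p) q (tmap_on M model (dom_at M p) (chart_at M p) q)"
    by (rule has_tmap_cong_open[OF assms(1) _ manifold_chartD(2)[OF assms(1)] assms(2)]) auto
  from has_tmap_tmap[OF assms(1) this] show ?thesis unfolding coframe_def chart_inv_chart[OF assms] .
qed

lemma coframe_frame:
  assumes "manifold M" "z \<in> chart_at M p ` dom_at M p"
  shows "coframe M p z (frame M p z v) = v" "frame M p z (coframe M p z w) = w"
proof -
  note m = manifold_model[OF manifold_fin_dim[OF assms(1)]]
  let ?q = "chart_inv M p z"
  have q: "?q \<in> dom_at M p" "chart_at M p ?q = z" using chart_inv_in[OF assms] chart_chart_inv[OF assms] by auto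
  have c: "has_tmap M model UNIV (chart_at M p) ?q (coframe M p z)" using coframe_has_tmap[OF assms(1) q(1)] unfolding q(2) .
  have "has_tmap model model UNIV (\<lambda>x. chart_at M p (chart_inv M p x)) z (\<lambda>v. coframe M p z (frame M p z v))"
    by (rule has_tmap_chain[OF m assms(1) frame_has_tmap[OF assms] c]) auto
  moreover have "has_tmap model model UNIV (\<lambda>x. chart_at M p (chart_inv M p x)) z (\<lambda>v. v)"
    by (rule has_tmap_cong_open[OF m has_tmap_ident[OF m UNIV_I] manifold_chartD(3)[OF assms(1)] assms(2)])
       (simp_all add: chart_chart_inv[OF assms(1)])
  ultimately show "coframe M p z (frame M p z v) = v" using has_tmap_uniq2[OF m] by metis
  have "has_tmap M M UNIV (\<lambda>x. chart_inv M p (chart_at M p x)) ?q (\<lambda>v. frame M p z (coframe M p z v))"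
    by (rule has_tmap_chain[OF assms(1) m c]) (use frame_has_tmap[OF assms] q(2) in auto)
  moreover have "has_tmap M M UNIV (\<lambda>x. chart_inv M p (chart_at M p x)) ?q (\<lambda>v. v)"
    by (rule has_tmap_cong_open[OF assms(1) has_tmap_ident[OF assms(1) UNIV_I] manifold_chartD(2)[OF assms(1)] q(1)])
       (simp_all add: chart_inv_chart[OF assms(1)])
  ultimately show "frame M p z (coframe M p z w) = w" using has_tmap_uniq2[OF assms(1)] by metis
qed

text \<open>In the preferred chart at p the chart map is the identity in coordinates. Tensors at p
  can therefore be read off in the chart at p without conversion.\<close>

lemma coframe_self: "manifold M \<Longrightarrow> coframe M p (chart_at M p p) v = v"
proof -
  assume M: "manifold M"
  note m = manifold_model[OF manifold_fin_dim[OF M]]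
  let ?z = "chart_at M p p"
  have o: "open (chart_at M p ` dom_at M p)" "?z \<in> chart_at M p ` dom_at M p" using manifold_chartD[OF M] chart_in_image[OF M] by auto
  have "((\<lambda>z. chart_at M p (chart_inv M p z)) has_derivative (\<lambda>v. v)) (at ?z within UNIV)"
    by (rule has_derivative_transform_within_open[OF _ o]) (simp_all add: chart_chart_inv[OF M])
  then have "((\<lambda>z. chart_at M p (chart_inv M p z)) has_derivative (\<lambda>v. v)) (at ?z within chart_at M p ` (UNIV \<inter> dom_at M p))"
    by (rule has_derivative_subset) simp
  then have "has_tmap M model UNIV (chart_at M p) p (\<lambda>v. v)"
    unfolding has_tmap_def by (intro conjI exI[of _ UNIV]) simp_all
  from has_tmap_uniq2[OF M this coframe_has_tmap[OF M manifold_chartD(1)[OF M]]]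
  show ?thesis by metis
qed

lemma frame_self: "manifold M \<Longrightarrow> frame M p (chart_at M p p) v = v"
  using coframe_frame(2)[where M = M and p = p and z = "chart_at M p p" and w = v] chart_in_image[of M p] coframe_self[of M p v]
  by simp

text \<open>Relates the ordinary derivative in fixed charts, where calculus is done, to the
  differential at the moving point, which is written in the preferred chart there.\<close>

lemma local_rep_has_derivative:
  assumes M: "manifold M" "manifold N" and z: "z \<in> chart_at M p ` dom_at M p"
    and f: "has_tmap M N UNIV f (chart_inv M p z) A" and d: "f (chart_inv M p z) \<in> dom_at N r"
  shows "((\<lambda>x. chart_at N r (f (chart_inv M p x))) has_derivative
     (\<lambda>v. coframe N r (chart_at N r (f (chart_inv M p z))) (A (frame M p z v)))) (at z)"
proof -
  note m = manifold_model[OF manifold_fin_dim[OF M(1)]]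
  have "has_tmap model N UNIV (\<lambda>x. f (chart_inv M p x)) z (\<lambda>v. A (frame M p z v))"
    by (rule has_tmap_chain[OF m M(1) frame_has_tmap[OF M(1) z] f]) auto
  from has_tmap_chain[OF m M(2) this coframe_has_tmap[OF M(2) d]]
  show ?thesis unfolding has_tmap_model_iff by simp
qed

text \<open>In chart balls the coordinate expression has zero derivative, so f is locally constant.
  A level set and its complement are then both open, an argument that also covers non-Hausdorff
  targets such as a space of arrows.\<close>

lemma tmap_zero_constant:
  assumes M: "manifold M" "manifold N" and c: "connected (UNIV :: 'a::topological_space set)"
    and f: "\<And>p::'a. has_tmap M N UNIV f p (\<lambda>v. 0)"
  shows "f x = f y"
proof -
  have loc: "\<exists>U. open U \<and> p \<in> U \<and> (\<forall>q\<in>U. f q = f p)" for p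
  proof -
    obtain U where U: "open U" "p \<in> U" "\<And>q. q \<in> U \<Longrightarrow> f q \<in> dom_at N (f p)" "U \<subseteq> dom_at M p"
      using has_tmap_nhd[OF M f manifold_chartD(2)[OF M(2)] manifold_chartD(1)[OF M(2)]] by metis
    let ?z = "chart_at M p p"
    have "open (chart_at M p ` (dom_at M p \<inter> U))" "?z \<in> chart_at M p ` (dom_at M p \<inter> U)"
      using chart_open_image[OF M(1) U(1)] U(2) manifold_chartD(1)[OF M(1)] by auto
    then obtain r where r: "r > 0" "ball ?z r \<subseteq> chart_at M p ` (dom_at M p \<inter> U)" using open_contains_ball by blast
    let ?f = "\<lambda>z. chart_at N (f p) (f (chart_inv M p z))"
    have "(?f has_derivative (\<lambda>v. 0)) (at z within ball ?z r)" if "z \<in> ball ?z r" for z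
    proof -
      have z: "z \<in> chart_at M p ` dom_at M p" using r(2) that by blast
      obtain q where q: "q \<in> dom_at M p" "q \<in> U" "z = chart_at M p q" using r(2) \<open>z \<in> ball ?z r\<close> by blast
      have d: "f (chart_inv M p z) \<in> dom_at N (f p)" using U(3)[OF q(2)] by (simp add: q(3) chart_inv_chart[OF M(1) q(1)])
      show ?thesis using has_derivative_at_withinI[OF local_rep_has_derivative[OF M z f d]] by simp
    qed
    then have const: "?f z = ?f ?z" if "z \<in> ball ?z r" for z
      using has_derivative_zero_unique[OF convex_ball[of ?z r], of ?f] that r(1) by (meson centre_in_ball)
    have "f q = f p" if "q \<in> {q \<in> dom_at M p. chart_at M p q \<in> ball ?z r}" for q
    proof -
      have q: "q \<in> dom_at M p" "chart_at M p q \<in> ball ?z r" using that by auto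
      obtain q' where "q' \<in> dom_at M p" "q' \<in> U" "chart_at M p q = chart_at M p q'" using r(2) q(2) by blast
      then have "q \<in> U" using chart_inj[OF M(1) q(1)] by blast
      have "chart_at N (f p) (f q) = chart_at N (f p) (f p)"
        using const[OF q(2)] chart_inv_chart[OF M(1) q(1)] chart_inv_chart_self[OF M(1)] by simp
      then show ?thesis using chart_inj[OF M(2) U(3)[OF \<open>q \<in> U\<close>] manifold_chartD(1)[OF M(2)]] by blast
    qed
    moreover have "p \<in> {q \<in> dom_at M p. chart_at M p q \<in> ball ?z r}" using r(1) manifold_chartD(1)[OF M(1)] by simp
    ultimately show ?thesis using chart_open_vimage[OF M(1) open_ball] by meson
  qed
  have "open {q. f q = f x}"
    unfolding open_subopen[of "{q. f q = f x}"] using loc by (smt (verit) mem_Collect_eq subsetI)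
  moreover have "open {q. f q \<noteq> f x}"
    unfolding open_subopen[of "{q. f q \<noteq> f x}"] using loc by (smt (verit) mem_Collect_eq subsetI)
  ultimately have "{q. f q = f x} = {} \<or> {q. f q \<noteq> f x} = {}"
    using connectedD[OF c, of "{q. f q = f x}" "{q. f q \<noteq> f x}"] by auto
  then have "f y = f x" by auto
  then show ?thesis by simp
qed

section \<open>Local representatives and mixed partial derivatives\<close>

lemma smooth_map_local_rep:
  assumes M: "manifold M" "manifold N" and f: "smooth_map M N f"
  obtains V where "open V" "chart_at M p p \<in> V" "V \<subseteq> chart_at M p ` dom_at M p"
    "smooth_on V (\<lambda>z. chart_at N (f p) (f (chart_inv M p z)))" "\<And>z. z \<in> V \<Longrightarrow> f (chart_inv M p z) \<in> dom_at N (f p)"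
proof -
  obtain V F where F: "open V" "chart_at M p p \<in> V" "smooth_on V F"
    "\<And>q. q \<in> UNIV \<Longrightarrow> q \<in> dom_at M p \<Longrightarrow> chart_at M p q \<in> V \<Longrightarrow> f q \<in> dom_at N (f p)"
    "\<And>q. q \<in> UNIV \<Longrightarrow> q \<in> dom_at M p \<Longrightarrow> chart_at M p q \<in> V \<Longrightarrow> chart_at N (f p) (f q) = F (chart_at M p q)"
    by (rule smooth_map_onE[OF f UNIV_I]) blast
  let ?V = "V \<inter> chart_at M p ` dom_at M p"
  have V: "open ?V" using F(1) manifold_chartD(3)[OF M(1)] by (rule open_Int)
  have *: "f (chart_inv M p z) \<in> dom_at N (f p)" "F z = chart_at N (f p) (f (chart_inv M p z))" if "z \<in> ?V" for z
    using F(4,5)[of "chart_inv M p z"] chart_inv_in[OF M(1), of z p] chart_chart_inv[OF M(1), of z p] that by auto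
  show thesis
    by (rule that[OF V _ _ smooth_on_cong[OF V *(2) smooth_on_subset[OF F(3)]] *(1)])
      (use F(2) chart_in_image[OF M(1)] in auto)
qed

definition lrep2 where
  "lrep2 A B C p q f = (\<lambda>(z, w). chart_at C (f p q) (f (chart_inv A p z) (chart_inv B q w)))"

lemma lrep2_smooth:
  assumes M: "manifold A" "manifold B" "manifold C" and f: "smooth_map (prod_atlas A B) C (\<lambda>(a, b). f a b)"
  obtains V where "open V" "(chart_at A p p, chart_at B q q) \<in> V"
    "V \<subseteq> (chart_at A p ` dom_at A p) \<times> (chart_at B q ` dom_at B q)" "smooth_on V (lrep2 A B C p q f)"
    "\<And>z w. (z, w) \<in> V \<Longrightarrow> f (chart_inv A p z) (chart_inv B q w) \<in> dom_at C (f p q)"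
proof -
  obtain V where V: "open V" "chart_at (prod_atlas A B) (p, q) (p, q) \<in> V" "V \<subseteq> chart_at (prod_atlas A B) (p, q) ` dom_at (prod_atlas A B) (p, q)"
    "smooth_on V (\<lambda>z. chart_at C (case (p, q) of (a, b) \<Rightarrow> f a b) (case chart_inv (prod_atlas A B) (p, q) z of (a, b) \<Rightarrow> f a b))"
    "\<And>z. z \<in> V \<Longrightarrow> (case chart_inv (prod_atlas A B) (p, q) z of (a, b) \<Rightarrow> f a b) \<in> dom_at C (case (p, q) of (a, b) \<Rightarrow> f a b)"
    by (rule smooth_map_local_rep[OF manifold_prod[OF M(1,2)] M(3) f, of "(p, q)"]) blast
  have sub: "V \<subseteq> (chart_at A p ` dom_at A p) \<times> (chart_at B q ` dom_at B q)" using V(3) by (simp add: prod_chart_image)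
  have inv: "chart_inv (prod_atlas A B) (p, q) (z, w) = (chart_inv A p z, chart_inv B q w)" if "(z, w) \<in> V" for z w
    using prod_chart_inv[OF M(1,2)] sub that by blast
  have "smooth_on V (lrep2 A B C p q f)"
    by (rule smooth_on_cong[OF V(1) _ V(4)]) (auto simp: inv lrep2_def)
  moreover have "f (chart_inv A p z) (chart_inv B q w) \<in> dom_at C (f p q)" if "(z, w) \<in> V" for z w
    using V(5)[OF that] by (simp add: inv[OF that])
  ultimately show thesis using that[of V] V(1,2) sub by simp
qed

lemma lrep2_partials:
  assumes M: "manifold A" "manifold B" "manifold C" and f: "smooth_map (prod_atlas A B) C (\<lambda>(a, b). f a b)"
    and V: "open V" "V \<subseteq> (chart_at A p ` dom_at A p) \<times> (chart_at B q ` dom_at B q)" "smooth_on V (lrep2 A B C p q f)"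
    "\<And>z w. (z, w) \<in> V \<Longrightarrow> f (chart_inv A p z) (chart_inv B q w) \<in> dom_at C (f p q)"
    and zw: "(z, w) \<in> V"
  shows "frechet_derivative (lrep2 A B C p q f) (at (z, w)) (\<xi>, 0) =
     coframe C (f p q) (lrep2 A B C p q f (z, w)) (tmap A C (\<lambda>a. f a (chart_inv B q w)) (chart_inv A p z) (frame A p z \<xi>))" (is ?P1)
    "frechet_derivative (lrep2 A B C p q f) (at (z, w)) (0, \<eta>) =
     coframe C (f p q) (lrep2 A B C p q f (z, w)) (tmap B C (\<lambda>b. f (chart_inv A p z) b) (chart_inv B q w) (frame B q w \<eta>))" (is ?P2)
proof -
  let ?F = "lrep2 A B C p q f"
  have im: "z \<in> chart_at A p ` dom_at A p" "w \<in> chart_at B q ` dom_at B q" using V(2) zw by auto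
  have D: "(?F has_derivative frechet_derivative ?F (at (z, w))) (at (z, w))" by (rule smooth_on_has_derivative[OF V(3) zw])
  note sl = smooth_map_slices[OF M f]
  have "((\<lambda>x. (x, w)) has_derivative (\<lambda>v. (v, 0))) (at z)" by (auto intro!: derivative_eq_intros)
  from has_derivative_compose[OF this D]
  have 1: "((\<lambda>x. ?F (x, w)) has_derivative (\<lambda>v. frechet_derivative ?F (at (z, w)) (v, 0))) (at z)" by simp
  have "((\<lambda>x. ?F (x, w)) has_derivative (\<lambda>v. coframe C (f p q) (?F (z, w)) (tmap A C (\<lambda>a. f a (chart_inv B q w)) (chart_inv A p z) (frame A p z v)))) (at z)"
    using local_rep_has_derivative[OF M(1,3) im(1) smooth_map_has_tmap[OF M(1) sl(1)] V(4)[OF zw]] by (simp add: lrep2_def)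
  from fun_cong[OF has_derivative_unique[OF 1 this], of \<xi>] show ?P1 .
  have "((\<lambda>x. (z, x)) has_derivative (\<lambda>v. (0, v))) (at w)" by (auto intro!: derivative_eq_intros)
  from has_derivative_compose[OF this D]
  have 2: "((\<lambda>x. ?F (z, x)) has_derivative (\<lambda>v. frechet_derivative ?F (at (z, w)) (0, v))) (at w)" by simp
  have "((\<lambda>x. ?F (z, x)) has_derivative (\<lambda>v. coframe C (f p q) (?F (z, w)) (tmap B C (\<lambda>b. f (chart_inv A p z) b) (chart_inv B q w) (frame B q w v)))) (at w)"
    using local_rep_has_derivative[OF M(2,3) im(2) smooth_map_has_tmap[OF M(2) sl(2)] V(4)[OF zw]] by (simp add: lrep2_def)
  from fun_cong[OF has_derivative_unique[OF 2 this], of \<eta>] show ?P2 .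
qed

text \<open>H is the mixed second derivative of the coordinate expression of f, and the symmetry of
  second derivatives makes it serve both orders. The \<open>coframe\<close> factor carries a partial
  differential from the moving point of C to the chart at f p q.\<close>

lemma mixed_partials:
  assumes M: "manifold A" "manifold B" "manifold C" and f: "smooth_map (prod_atlas A B) C (\<lambda>(a, b). f a b)"
  obtains H where
    "\<And>\<xi>. ((\<lambda>w. coframe C (f p q) (chart_at C (f p q) (f p (chart_inv B q w))) (tmap A C (\<lambda>a. f a (chart_inv B q w)) p \<xi>))
       has_derivative (\<lambda>\<eta>. H \<xi> \<eta>)) (at (chart_at B q q))"
    "\<And>\<eta>. ((\<lambda>z. coframe C (f p q) (chart_at C (f p q) (f (chart_inv A p z) q)) (tmap B C (\<lambda>b. f (chart_inv A p z) b) q \<eta>))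
       has_derivative (\<lambda>\<xi>. H \<xi> \<eta>)) (at (chart_at A p p))"
proof -
  let ?F = "lrep2 A B C p q f"
  let ?z = "chart_at A p p" and ?w = "chart_at B q q"
  obtain V where V: "open V" "(?z, ?w) \<in> V" "V \<subseteq> (chart_at A p ` dom_at A p) \<times> (chart_at B q ` dom_at B q)" "smooth_on V ?F"
    "\<And>z w. (z, w) \<in> V \<Longrightarrow> f (chart_inv A p z) (chart_inv B q w) \<in> dom_at C (f p q)"
    using lrep2_smooth[OF M f] by metis
  note part = lrep2_partials[OF M f V(1,3,4,5)]
  define H where "H = (\<lambda>\<xi> \<eta>. frechet_derivative (\<lambda>x. frechet_derivative ?F (at x) (\<xi>, 0)) (at (?z, ?w)) (0, \<eta>))"
  have H2: "H \<xi> \<eta> = frechet_derivative (\<lambda>x. frechet_derivative ?F (at x) (0, \<eta>)) (at (?z, ?w)) (\<xi>, 0)" for \<xi> \<eta>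
    unfolding H_def by (rule smooth_on_symmetric[OF V(1,4,2)])
  have D: "((\<lambda>x. frechet_derivative ?F (at x) v) has_derivative frechet_derivative (\<lambda>x. frechet_derivative ?F (at x) v) (at (?z, ?w))) (at (?z, ?w))" for v
    by (rule smooth_on_has_derivative[OF smooth_on_frechet_derivative[OF V(4)] V(2)])
  have 1: "((\<lambda>w. coframe C (f p q) (chart_at C (f p q) (f p (chart_inv B q w))) (tmap A C (\<lambda>a. f a (chart_inv B q w)) p \<xi>))
       has_derivative (\<lambda>\<eta>. H \<xi> \<eta>)) (at ?w)" for \<xi>
  proof (rule has_derivative_transform_within_open)
    have "((\<lambda>w. (?z, w)) has_derivative (\<lambda>v. (0, v))) (at ?w)" by (auto intro!: derivative_eq_intros)
    from has_derivative_compose[OF this D]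
    show "((\<lambda>w. frechet_derivative ?F (at (?z, w)) (\<xi>, 0)) has_derivative (\<lambda>\<eta>. H \<xi> \<eta>)) (at ?w)" unfolding H_def by simp
    have "open (Pair ?z -` V)" by (intro open_vimage V(1) continuous_intros)
    then show "open {w. (?z, w) \<in> V}" by (simp add: vimage_def)
    show "?w \<in> {w. (?z, w) \<in> V}" using V(2) by simp
    fix w assume "w \<in> {w. (?z, w) \<in> V}"
    then show "frechet_derivative ?F (at (?z, w)) (\<xi>, 0) = coframe C (f p q) (chart_at C (f p q) (f p (chart_inv B q w))) (tmap A C (\<lambda>a. f a (chart_inv B q w)) p \<xi>)"
      using part(1)[of ?z w \<xi>] by (simp add: chart_inv_chart_self[OF M(1)] frame_self[OF M(1)] lrep2_def)
  qed
  have 2: "((\<lambda>z. coframe C (f p q) (chart_at C (f p q) (f (chart_inv A p z) q)) (tmap B C (\<lambda>b. f (chart_inv A p z) b) q \<eta>))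
       has_derivative (\<lambda>\<xi>. H \<xi> \<eta>)) (at ?z)" for \<eta>
  proof (rule has_derivative_transform_within_open)
    have "((\<lambda>z. (z, ?w)) has_derivative (\<lambda>v. (v, 0))) (at ?z)" by (auto intro!: derivative_eq_intros)
    from has_derivative_compose[OF this D]
    show "((\<lambda>z. frechet_derivative ?F (at (z, ?w)) (0, \<eta>)) has_derivative (\<lambda>\<xi>. H \<xi> \<eta>)) (at ?z)" unfolding H2 by simp
    have "open ((\<lambda>z. (z, ?w)) -` V)" by (intro open_vimage V(1) continuous_intros)
    then show "open {z. (z, ?w) \<in> V}" by (simp add: vimage_def)
    show "?z \<in> {z. (z, ?w) \<in> V}" using V(2) by simp
    fix z assume "z \<in> {z. (z, ?w) \<in> V}"
    then show "frechet_derivative ?F (at (z, ?w)) (0, \<eta>) = coframe C (f p q) (chart_at C (f p q) (f (chart_inv A p z) q)) (tmap B C (\<lambda>b. f (chart_inv A p z) b) q \<eta>)"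
      using part(2)[of z ?w \<eta>] by (simp add: chart_inv_chart_self[OF M(2)] frame_self[OF M(2)] lrep2_def)
  qed
  show thesis by (rule that[OF 1 2])
qed

text \<open>As all f a send q to the same point r, their differentials at q take values in one
  tangent space, and the parameter dependence is that of a vector-valued function.\<close>

lemma smooth_parameter_tmap:
  assumes M: "manifold A" "manifold B" "manifold C" and f: "smooth_map (prod_atlas A B) C (\<lambda>(a, b). f a b)"
    and r: "\<And>a. f a q = r"
  shows "smooth_map A model (\<lambda>a. tmap B C (f a) q \<eta>)"
proof (rule smooth_map_onI)
  fix p
  let ?F = "lrep2 A B C p q f"
  let ?z = "chart_at A p p" and ?w = "chart_at B q q"
  obtain V where V: "open V" "(?z, ?w) \<in> V" "V \<subseteq> (chart_at A p ` dom_at A p) \<times> (chart_at B q ` dom_at B q)" "smooth_on V ?F"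
    "\<And>z w. (z, w) \<in> V \<Longrightarrow> f (chart_inv A p z) (chart_inv B q w) \<in> dom_at C (f p q)"
    using lrep2_smooth[OF M f] by metis
  let ?V = "{z. (z, ?w) \<in> V}" and ?G = "\<lambda>z. frechet_derivative ?F (at (z, ?w)) (0, \<eta>)"
  have "open ((\<lambda>z. (z, ?w)) -` V)" by (intro open_vimage V(1) continuous_intros)
  then have oV: "open ?V" by (simp add: vimage_def)
  have "smooth_on ?V (\<lambda>z. (z, ?w))"
    by (intro smooth_on_Pair oV smooth_on_const smooth_on_bounded_linear bounded_linear_ident)
  then have "smooth_on ?V ?G"
    by (intro smooth_on_compose[of ?V "\<lambda>z. (z, ?w)" V, OF fin_dim_prod[OF manifold_fin_dim[OF M(1)] manifold_fin_dim[OF M(2)]] oV _ _ smooth_on_frechet_derivative[OF V(4)]]) auto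
  moreover have "tmap B C (f k) q \<eta> = ?G (chart_at A p k)" if "k \<in> dom_at A p" "chart_at A p k \<in> ?V" for k
    using lrep2_partials(2)[OF M f V(1,3,4,5), of "chart_at A p k" ?w \<eta>] that
    by (simp add: chart_inv_chart_self[OF M(2)] frame_self[OF M(2)] lrep2_def chart_inv_chart[OF M(1)] r coframe_self[OF M(3)])
  ultimately show "\<exists>V F. open V \<and> ?z \<in> V \<and> smooth_on V F \<and> (\<forall>k \<in> UNIV \<inter> dom_at A p. chart_at A p k \<in> V \<longrightarrow>
     tmap B C (f k) q \<eta> \<in> dom_at model (tmap B C (f p) q \<eta>) \<and> chart_at model (tmap B C (f p) q \<eta>) (tmap B C (f k) q \<eta>) = F (chart_at A p k))"
    using oV V(2) by (intro exI[of _ ?V] exI[of _ ?G]) simp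
qed

text \<open>f behaves like an action with neutral element p that fixes q. The derivative of its
  linear isotropy maps is the linearization at q of the infinitesimal vector field, by equality of
  mixed partials.\<close>

lemma derivative_of_parameter_tmap:
  assumes M: "manifold A" "manifold B" and f: "smooth_map (prod_atlas A B) B (\<lambda>(a, b). f a b)"
    and f1: "\<And>b. f p b = b" and f2: "\<And>a. f a q = q"
  shows "has_tmap A model UNIV (\<lambda>a. tmap B B (f a) q \<eta>) p
     (\<lambda>\<xi>. frechet_derivative (vf_loc B (\<lambda>b. tmap A B (\<lambda>a. f a b) p \<xi>) q) (at (chart_at B q q)) \<eta>)"
proof -
  obtain H where
    H1: "\<And>\<xi>. ((\<lambda>w. coframe B (f p q) (chart_at B (f p q) (f p (chart_inv B q w))) (tmap A B (\<lambda>a. f a (chart_inv B q w)) p \<xi>))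
       has_derivative (\<lambda>\<eta>. H \<xi> \<eta>)) (at (chart_at B q q))" and
    H2: "\<And>\<eta>. ((\<lambda>z. coframe B (f p q) (chart_at B (f p q) (f (chart_inv A p z) q)) (tmap B B (\<lambda>b. f (chart_inv A p z) b) q \<eta>))
       has_derivative (\<lambda>\<xi>. H \<xi> \<eta>)) (at (chart_at A p p))"
    by (rule mixed_partials[OF M(1,2,2) f, of p q]) blast
  have "(vf_loc B (\<lambda>b. tmap A B (\<lambda>a. f a b) p \<xi>) q has_derivative (\<lambda>\<eta>. H \<xi> \<eta>)) (at (chart_at B q q))" for \<xi>
    by (rule has_derivative_transform_within_open[OF H1[of \<xi>] manifold_chartD(3)[OF M(2), of q] chart_in_image[OF M(2)]])
      (simp add: vf_loc_def f1 chart_chart_inv[OF M(2)])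
  from frechet_derivative_at[OF this]
  have eq: "H \<xi> \<eta> = frechet_derivative (vf_loc B (\<lambda>b. tmap A B (\<lambda>a. f a b) p \<xi>) q) (at (chart_at B q q)) \<eta>" for \<xi> by metis
  have "((\<lambda>z. tmap B B (f (chart_inv A p z)) q \<eta>) has_derivative (\<lambda>\<xi>. H \<xi> \<eta>)) (at (chart_at A p p))"
    using H2[of \<eta>] by (simp add: f1 f2 coframe_self[OF M(2)])
  from has_derivative_at_withinI[OF this] show ?thesis unfolding has_tmap_def eq
    by (intro conjI exI[of _ UNIV]) simp_all
qed

lemma vf_loc_differentiable:
  assumes M: "manifold A" "manifold B" and f: "smooth_map (prod_atlas A B) B (\<lambda>(a, b). f a b)"
    and f1: "\<And>b. f p b = b"
  shows "vf_loc B (\<lambda>b. tmap A B (\<lambda>a. f a b) p \<xi>) q differentiable at (chart_at B q q)"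
proof -
  obtain H where
    H1: "\<And>\<xi>. ((\<lambda>w. coframe B (f p q) (chart_at B (f p q) (f p (chart_inv B q w))) (tmap A B (\<lambda>a. f a (chart_inv B q w)) p \<xi>))
       has_derivative (\<lambda>\<eta>. H \<xi> \<eta>)) (at (chart_at B q q))"
    by (rule mixed_partials[OF M(1,2,2) f, of p q]) blast
  have "(vf_loc B (\<lambda>b. tmap A B (\<lambda>a. f a b) p \<xi>) q has_derivative (\<lambda>\<eta>. H \<xi> \<eta>)) (at (chart_at B q q))"
    by (rule has_derivative_transform_within_open[OF H1[of \<xi>] manifold_chartD(3)[OF M(2), of q] chart_in_image[OF M(2)]])
      (simp add: vf_loc_def f1 chart_chart_inv[OF M(2)])
  then show ?thesis unfolding differentiable_def by blast
qed

section \<open>Lie groups and actions\<close>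

definition dR :: "('g, 'v::real_normed_vector, 'z) lie_group_scheme \<Rightarrow> 'g \<Rightarrow> 'g \<Rightarrow> 'v \<Rightarrow> 'v" where
  "dR G h g = blinfun_apply (tmap (atlas G) (atlas G) (\<lambda>k. gmult G k h) g)"

definition dL :: "('g, 'v::real_normed_vector, 'z) lie_group_scheme \<Rightarrow> 'g \<Rightarrow> 'g \<Rightarrow> 'v \<Rightarrow> 'v" where
  "dL G h g = blinfun_apply (tmap (atlas G) (atlas G) (\<lambda>k. gmult G h k) g)"

definition Ad :: "('g, 'v::real_normed_vector, 'z) lie_group_scheme \<Rightarrow> 'g \<Rightarrow> 'v \<Rightarrow> 'v" where
  "Ad G g v = dR G (ginv G g) g (dL G g (gone G) v)"

text \<open>Pullback of the right invariant Maurer-Cartan form to the chart at the unit.\<close>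

definition rlog :: "('g, 'v::real_normed_vector, 'z) lie_group_scheme \<Rightarrow> 'v \<Rightarrow> 'v \<Rightarrow> 'v" where
  "rlog G z v = dR G (ginv G (chart_inv (atlas G) (gone G) z)) (chart_inv (atlas G) (gone G) z) (frame (atlas G) (gone G) z v)"

text \<open>Exchanges left and right translations and keeps unit and inverse; the Lie bracket
  changes sign.\<close>

definition op_group :: "('g, 'v, 'z) lie_group_scheme \<Rightarrow> ('g, 'v, 'z) lie_group_scheme" where
  "op_group G = G\<lparr>gmult := \<lambda>x y. gmult G y x\<rparr>"

lemma op_group_simps [simp]:
  "atlas (op_group G) = atlas G" "gmult (op_group G) x y = gmult G y x" "gone (op_group G) = gone G" "ginv (op_group G) = ginv G"
  "op_group (op_group G) = G"
  by (simp_all add: op_group_def)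

locale lie_grp =
  fixes G :: "('g::topological_space, 'v::real_inner, 'z) lie_group_scheme"
  assumes lie_group: "is_lie_group G"
begin

abbreviation mult (infixl "\<star>" 70) where "x \<star> y \<equiv> gmult G x y"
abbreviation one ("\<e>") where "\<e> \<equiv> gone G"
abbreviation inv where "inv x \<equiv> ginv G x"

lemma mf: "manifold (atlas G)"
  using lie_group unfolding is_lie_group_def by blast

lemma smooth_mult: "smooth_map (prod_atlas (atlas G) (atlas G)) (atlas G) (\<lambda>(g, h). g \<star> h)"
  and smooth_inv: "smooth_map (atlas G) (atlas G) (ginv G)"
  using lie_group unfolding is_lie_group_def by blast+

sublocale group "gmult G" "gone G" "ginv G"
  using lie_group unfolding is_lie_group_def by blast

lemma inv_mult [simp]: "inv x \<star> (x \<star> y) = y" "x \<star> (inv x \<star> y) = y" "(y \<star> x) \<star> inv x = y" "(y \<star> inv x) \<star> x = y"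
proof -
  show "inv x \<star> (x \<star> y) = y" "x \<star> (inv x \<star> y) = y"
    by (simp_all only: assoc[symmetric] left_inverse right_inverse left_neutral)
  show "(y \<star> x) \<star> inv x = y" "(y \<star> inv x) \<star> x = y"
    by (simp_all only: assoc left_inverse right_inverse right_neutral)
qed

lemma inv_op [simp]: "inv (x \<star> y) = inv y \<star> inv x" "inv (inv x) = x" "inv \<e> = \<e>"
  by (simp_all add: inverse_distrib_swap)

lemma smooth_R: "smooth_map (atlas G) (atlas G) (\<lambda>k. k \<star> h)" and smooth_L: "smooth_map (atlas G) (atlas G) (\<lambda>k. h \<star> k)"
  using smooth_map_slices[OF mf mf mf smooth_mult] by auto

lemma has_tmap_R: "has_tmap (atlas G) (atlas G) UNIV (\<lambda>k. k \<star> h) g (dR G h g)"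
  unfolding dR_def by (rule smooth_map_has_tmap[OF mf smooth_R])

lemma has_tmap_L: "has_tmap (atlas G) (atlas G) UNIV (\<lambda>k. h \<star> k) g (dL G h g)"
  unfolding dL_def by (rule smooth_map_has_tmap[OF mf smooth_L])

lemma dR_linear: "bounded_linear (dR G h g)" and dL_linear: "bounded_linear (dL G h g)"
  unfolding dR_def dL_def by (rule blinfun.bounded_linear_right)+

lemma dR_zero [simp]: "dR G h g 0 = 0" and dL_zero [simp]: "dL G h g 0 = 0"
  unfolding dR_def dL_def by (rule blinfun.zero_right)+

lemma dR_uminus: "dR G h g (- v) = - dR G h g v" and dL_uminus: "dL G h g (- v) = - dL G h g v"
  unfolding dR_def dL_def by (rule blinfun.minus_right)+

lemma dR_dR: "dR G k (g \<star> h) (dR G h g v) = dR G (h \<star> k) g v"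
proof -
  have "has_tmap (atlas G) (atlas G) UNIV (\<lambda>x. (x \<star> h) \<star> k) g (\<lambda>v. dR G k (g \<star> h) (dR G h g v))"
    by (rule has_tmap_chain[OF mf mf has_tmap_R has_tmap_R]) auto
  then have "has_tmap (atlas G) (atlas G) UNIV (\<lambda>x. x \<star> (h \<star> k)) g (\<lambda>v. dR G k (g \<star> h) (dR G h g v))" by (simp add: assoc)
  from has_tmap_uniq2[OF mf this has_tmap_R] show ?thesis by (rule fun_cong)
qed

lemma dL_dL: "dL G k (h \<star> g) (dL G h g v) = dL G (k \<star> h) g v"
proof -
  have "has_tmap (atlas G) (atlas G) UNIV (\<lambda>x. k \<star> (h \<star> x)) g (\<lambda>v. dL G k (h \<star> g) (dL G h g v))"
    by (rule has_tmap_chain[OF mf mf has_tmap_L has_tmap_L]) auto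
  then have "has_tmap (atlas G) (atlas G) UNIV (\<lambda>x. (k \<star> h) \<star> x) g (\<lambda>v. dL G k (h \<star> g) (dL G h g v))" by (simp add: assoc)
  from has_tmap_uniq2[OF mf this has_tmap_L] show ?thesis by (rule fun_cong)
qed

lemma dL_dR: "dL G k (g \<star> h) (dR G h g v) = dR G h (k \<star> g) (dL G k g v)"
proof -
  have 1: "has_tmap (atlas G) (atlas G) UNIV (\<lambda>x. k \<star> (x \<star> h)) g (\<lambda>v. dL G k (g \<star> h) (dR G h g v))"
    by (rule has_tmap_chain[OF mf mf has_tmap_R has_tmap_L]) auto
  have "has_tmap (atlas G) (atlas G) UNIV (\<lambda>x. (k \<star> x) \<star> h) g (\<lambda>v. dR G h (k \<star> g) (dL G k g v))"
    by (rule has_tmap_chain[OF mf mf has_tmap_L has_tmap_R]) auto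
  then have 2: "has_tmap (atlas G) (atlas G) UNIV (\<lambda>x. k \<star> (x \<star> h)) g (\<lambda>v. dR G h (k \<star> g) (dL G k g v))" by (simp add: assoc)
  from has_tmap_uniq2[OF mf 1 2] show ?thesis by (rule fun_cong)
qed

lemma dR_one [simp]: "dR G \<e> g v = v"
proof -
  have "has_tmap (atlas G) (atlas G) UNIV (\<lambda>x. x) g (dR G \<e> g)" using has_tmap_R[of \<e> g] by simp
  from has_tmap_uniq2[OF mf this has_tmap_ident[OF mf UNIV_I]] show ?thesis by (rule fun_cong)
qed

lemma dL_one [simp]: "dL G \<e> g v = v"
proof -
  have "has_tmap (atlas G) (atlas G) UNIV (\<lambda>x. x) g (dL G \<e> g)" using has_tmap_L[of \<e> g] by simp
  from has_tmap_uniq2[OF mf this has_tmap_ident[OF mf UNIV_I]] show ?thesis by (rule fun_cong)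
qed

lemma dR_inv: "dR G (inv h) (g \<star> h) (dR G h g v) = v" and dL_inv: "dL G (inv h) (h \<star> g) (dL G h g v) = v"
  by (simp_all add: dR_dR dL_dL)

lemma dL_eqD: "dL G h g v = dL G h g w \<Longrightarrow> v = w"
  by (metis dL_inv)

lemma dR_rlog: "dR G g \<e> (dR G (inv g) g v) = v"
  using dR_dR[of g g "inv g" v] by simp

lemma has_tmap_mult:
  assumes L: "manifold L" and g: "has_tmap L (atlas G) S f x F" "has_tmap L (atlas G) S h x H" "x \<in> S"
  shows "has_tmap L (atlas G) S (\<lambda>x. f x \<star> h x) x (\<lambda>v. dR G (h x) (f x) (F v) + dL G (f x) (h x) (H v))"
  using has_tmap_compose2[OF L mf mf smooth_mult g] unfolding dR_def dL_def .

lemma smooth_map_mult: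
  assumes L: "manifold L" and g: "smooth_map_on L (atlas G) S f" "smooth_map_on L (atlas G) S h"
  shows "smooth_map_on L (atlas G) S (\<lambda>x. f x \<star> h x)"
  by (rule smooth_map_on_compose2[OF L mf mf smooth_mult g])

lemma smooth_map_inv: "manifold L \<Longrightarrow> smooth_map_on L (atlas G) S f \<Longrightarrow> smooth_map_on L (atlas G) S (\<lambda>x. inv (f x))"
  by (rule smooth_map_on_compose[OF _ mf _ smooth_inv]) auto

lemma has_tmap_inv_one: "has_tmap (atlas G) (atlas G) UNIV (ginv G) \<e> (\<lambda>v. - v)"
proof -
  obtain I where I: "has_tmap (atlas G) (atlas G) UNIV (ginv G) \<e> I" using smooth_map_has_tmap[OF mf smooth_inv] by blast
  have "has_tmap (atlas G) (atlas G) UNIV (\<lambda>x. x \<star> inv x) \<e> (\<lambda>v. dR G (inv \<e>) \<e> v + dL G \<e> (inv \<e>) (I v))"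
    by (rule has_tmap_mult[OF mf has_tmap_ident[OF mf UNIV_I] I UNIV_I])
  then have "has_tmap (atlas G) (atlas G) UNIV (\<lambda>x. \<e>) \<e> (\<lambda>v. v + I v)" by simp
  from has_tmap_uniq2[OF mf this has_tmap_const[OF mf]] have "v + I v = 0" for v by metis
  then have "I v = - v" for v by (metis minus_unique)
  then have "I = (\<lambda>v. - v)" by (rule ext)
  then show ?thesis using I by simp
qed

lemma smooth_conj: "smooth_map (prod_atlas (atlas G) (atlas G)) (atlas G) (\<lambda>(g, h). g \<star> h \<star> inv g)"
proof -
  note P = manifold_prod[OF mf mf]
  have "smooth_map (prod_atlas (atlas G) (atlas G)) (atlas G) (\<lambda>x. fst x \<star> snd x \<star> inv (fst x))"
    by (intro smooth_map_mult[OF P] smooth_map_inv[OF P] smooth_map_on_fst smooth_map_on_snd)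
  then show ?thesis by (simp add: case_prod_unfold)
qed

lemma has_tmap_conj: "has_tmap (atlas G) (atlas G) UNIV (\<lambda>k. g \<star> k \<star> inv g) \<e> (Ad G g)"
proof -
  have "has_tmap (atlas G) (atlas G) UNIV (\<lambda>k. (g \<star> k) \<star> inv g) \<e> (\<lambda>v. dR G (inv g) (g \<star> \<e>) (dL G g \<e> v))"
    by (rule has_tmap_chain[OF mf mf has_tmap_L has_tmap_R]) auto
  then show ?thesis by (simp add: Ad_def[abs_def])
qed

lemma Ad_tmap: "Ad G g = tmap (atlas G) (atlas G) (\<lambda>k. g \<star> k \<star> inv g) \<e>"
  using has_tmap_unique[OF mf has_tmap_conj] by simp

lemma Ad_linear: "bounded_linear (Ad G g)"
  unfolding Ad_tmap by (rule blinfun.bounded_linear_right)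

lemma Ad_mult: "Ad G (g \<star> h) v = Ad G g (Ad G h v)"
proof -
  have e: "h \<star> \<e> \<star> inv h = \<e>" by (simp add: right_inverse)
  have "has_tmap (atlas G) (atlas G) UNIV (\<lambda>k. g \<star> (h \<star> k \<star> inv h) \<star> inv g) \<e> (\<lambda>v. Ad G g (Ad G h v))"
    by (rule has_tmap_chain[OF mf mf has_tmap_conj]) (use has_tmap_conj e in auto)
  then have "has_tmap (atlas G) (atlas G) UNIV (\<lambda>k. (g \<star> h) \<star> k \<star> inv (g \<star> h)) \<e> (\<lambda>v. Ad G g (Ad G h v))" by (simp add: assoc)
  from has_tmap_uniq2[OF mf has_tmap_conj this] show ?thesis by (rule fun_cong)
qed

lemma Ad_one [simp]: "Ad G \<e> v = v"
  by (simp add: Ad_def)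

lemma Ad_inv [simp]: "Ad G (inv g) (Ad G g v) = v" "Ad G g (Ad G (inv g) v) = v"
  using Ad_mult[of "inv g" g v] Ad_mult[of g "inv g" v] by (simp_all add: left_inverse right_inverse)

lemma smooth_Ad: "smooth_map (atlas G) model (\<lambda>g. Ad G g \<eta>)"
  unfolding Ad_tmap by (rule smooth_parameter_tmap[OF mf mf mf smooth_conj, of "\<e>" "\<e>"]) (simp add: right_inverse)

text \<open>In the chart at the unit, right and left invariant fields linearize to the two slots of
  the mixed second derivative H of the multiplication. Right invariant fields of the opposite group
  are left invariant fields, which explains the two signs.\<close>

lemma lie_bracket_mixed:
  obtains H where
    "\<And>\<xi>. (vf_loc (atlas G) (\<lambda>b. dR G b \<e> \<xi>) \<e> has_derivative (\<lambda>\<eta>. H \<xi> \<eta>)) (at (chart_at (atlas G) \<e> \<e>))"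
    "\<And>\<eta>. (vf_loc (atlas G) (\<lambda>a. dL G a \<e> \<eta>) \<e> has_derivative (\<lambda>\<xi>. H \<xi> \<eta>)) (at (chart_at (atlas G) \<e> \<e>))"
    "\<And>\<xi> \<eta>. lie_bracket G \<xi> \<eta> = H \<eta> \<xi> - H \<xi> \<eta>"
    "\<And>\<xi> \<eta>. lie_bracket (op_group G) \<xi> \<eta> = H \<xi> \<eta> - H \<eta> \<xi>"
proof -
  let ?A = "atlas G"
  obtain H where
    H1: "\<And>\<xi>. ((\<lambda>w. coframe ?A (\<e> \<star> \<e>) (chart_at ?A (\<e> \<star> \<e>) (\<e> \<star> (chart_inv ?A \<e> w))) (tmap ?A ?A (\<lambda>a. a \<star> (chart_inv ?A \<e> w)) \<e> \<xi>))
       has_derivative (\<lambda>\<eta>. H \<xi> \<eta>)) (at (chart_at ?A \<e> \<e>))" and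
    H2: "\<And>\<eta>. ((\<lambda>z. coframe ?A (\<e> \<star> \<e>) (chart_at ?A (\<e> \<star> \<e>) (chart_inv ?A \<e> z \<star> \<e>)) (tmap ?A ?A (\<lambda>b. chart_inv ?A \<e> z \<star> b) \<e> \<eta>))
       has_derivative (\<lambda>\<xi>. H \<xi> \<eta>)) (at (chart_at ?A \<e> \<e>))"
    by (rule mixed_partials[OF mf mf mf smooth_mult, of "\<e>" "\<e>"]) blast
  have 1: "(vf_loc ?A (\<lambda>b. dR G b \<e> \<xi>) \<e> has_derivative (\<lambda>\<eta>. H \<xi> \<eta>)) (at (chart_at ?A \<e> \<e>))" for \<xi>
    by (rule has_derivative_transform_within_open[OF H1[of \<xi>] manifold_chartD(3)[OF mf, of \<e>] chart_in_image[OF mf]])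
      (simp add: vf_loc_def chart_chart_inv[OF mf] dR_def)
  have 2: "(vf_loc ?A (\<lambda>a. dL G a \<e> \<eta>) \<e> has_derivative (\<lambda>\<xi>. H \<xi> \<eta>)) (at (chart_at ?A \<e> \<e>))" for \<eta>
    by (rule has_derivative_transform_within_open[OF H2[of \<eta>] manifold_chartD(3)[OF mf, of \<e>] chart_in_image[OF mf]])
      (simp add: vf_loc_def chart_chart_inv[OF mf] dL_def)
  have R: "right_inv_vf G \<xi> = (\<lambda>b. dR G b \<e> \<xi>)" for \<xi> by (simp add: right_inv_vf_def dR_def fun_eq_iff)
  have L: "right_inv_vf (op_group G) \<xi> = (\<lambda>b. dL G b \<e> \<xi>)" for \<xi> by (simp add: right_inv_vf_def dL_def fun_eq_iff)
  have 3: "lie_bracket G \<xi> \<eta> = H \<eta> \<xi> - H \<xi> \<eta>" for \<xi> \<eta>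
    unfolding lie_bracket_def vf_bracket_def R frechet_derivative_at[OF 1, symmetric] by simp
  have 4: "lie_bracket (op_group G) \<xi> \<eta> = H \<xi> \<eta> - H \<eta> \<xi>" for \<xi> \<eta>
    unfolding lie_bracket_def vf_bracket_def L op_group_simps frechet_derivative_at[OF 2, symmetric] by simp
  show thesis by (rule that[OF 1 2 3 4])
qed

lemma lie_bracket_op: "lie_bracket (op_group G) \<xi> \<eta> = - lie_bracket G \<xi> \<eta>"
  by (rule lie_bracket_mixed) simp

text \<open>Conjugation fixes the unit, and its infinitesimal field is the right invariant minus the
  left invariant field, so its linearization is H \<xi> \<eta> - H \<eta> \<xi>. For the bracket of
  right invariant fields this is minus the bracket.\<close>

lemma has_tmap_Ad_one: "has_tmap (atlas G) model UNIV (\<lambda>g. Ad G g \<eta>) \<e> (\<lambda>\<xi>. - lie_bracket G \<xi> \<eta>)"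
proof -
  let ?A = "atlas G"
  obtain H where H: "\<And>\<xi>. (vf_loc ?A (\<lambda>b. dR G b \<e> \<xi>) \<e> has_derivative (\<lambda>\<eta>. H \<xi> \<eta>)) (at (chart_at ?A \<e> \<e>))"
    "\<And>\<eta>. (vf_loc ?A (\<lambda>a. dL G a \<e> \<eta>) \<e> has_derivative (\<lambda>\<xi>. H \<xi> \<eta>)) (at (chart_at ?A \<e> \<e>))"
    "\<And>\<xi> \<eta>. lie_bracket G \<xi> \<eta> = H \<eta> \<xi> - H \<xi> \<eta>"
    using lie_bracket_mixed by metis
  have X: "tmap ?A ?A (\<lambda>a. a \<star> b \<star> inv a) \<e> \<xi> = dR G b \<e> \<xi> - dL G b \<e> \<xi>" for b \<xi>
  proof -
    have "has_tmap ?A ?A UNIV (\<lambda>a. (a \<star> b) \<star> inv a) \<e> (\<lambda>v. dR G (inv \<e>) (\<e> \<star> b) (dR G b \<e> v) + dL G (\<e> \<star> b) (inv \<e>) (- v))"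
      by (rule has_tmap_mult[OF mf has_tmap_R has_tmap_inv_one UNIV_I])
    from has_tmap_unique[OF mf this] show ?thesis by (simp add: dL_uminus)
  qed
  have "vf_loc ?A (\<lambda>b. tmap ?A ?A (\<lambda>a. a \<star> b \<star> inv a) \<e> \<xi>) \<e> = (\<lambda>z. vf_loc ?A (\<lambda>b. dR G b \<e> \<xi>) \<e> z - vf_loc ?A (\<lambda>b. dL G b \<e> \<xi>) \<e> z)" for \<xi>
    unfolding X vf_loc_def by (simp add: blinfun.diff_right)
  then have "frechet_derivative (vf_loc ?A (\<lambda>b. tmap ?A ?A (\<lambda>a. a \<star> b \<star> inv a) \<e> \<xi>) \<e>) (at (chart_at ?A \<e> \<e>)) \<eta> = H \<xi> \<eta> - H \<eta> \<xi>" for \<xi>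
    using frechet_derivative_at[OF has_derivative_diff[OF H(1)[of \<xi>] H(2)[of \<xi>]]] by metis
  then have "frechet_derivative (vf_loc ?A (\<lambda>b. tmap ?A ?A (\<lambda>a. a \<star> b \<star> inv a) \<e> \<xi>) \<e>) (at (chart_at ?A \<e> \<e>)) \<eta> = - lie_bracket G \<xi> \<eta>" for \<xi>
    unfolding H(3) by simp
  with derivative_of_parameter_tmap[OF mf mf smooth_conj, of "\<e>" "\<e>" \<eta>]
  show ?thesis unfolding Ad_tmap by (simp add: right_inverse)
qed

lemma lie_op: "is_lie_group (op_group G)"
proof -
  have "group (gmult (op_group G)) (gone (op_group G)) (ginv (op_group G))"
    by standard (simp_all add: assoc right_inverse)
  moreover have "smooth_map (prod_atlas (atlas G) (atlas G)) (atlas G) (\<lambda>x. snd x \<star> fst x)"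
    by (intro smooth_map_mult[OF manifold_prod[OF mf mf]] smooth_map_on_fst smooth_map_on_snd)
  ultimately show ?thesis using mf smooth_inv unfolding is_lie_group_def by (simp add: case_prod_unfold)
qed

lemma dR_op: "dR (op_group G) h g = dL G h g" and dL_op: "dL (op_group G) h g = dR G h g"
  by (simp_all add: dR_def dL_def)

text \<open>On the diagonal, the partial differential of (a, b) \<mapsto> a b^-1 in a is right
  translation back to the unit, so the pulled back Maurer-Cartan form is a partial derivative of a
  smooth local representative.\<close>

lemma rlog_smooth:
  obtains W where "open W" "chart_at (atlas G) \<e> \<e> \<in> W" "W \<subseteq> chart_at (atlas G) \<e> ` dom_at (atlas G) \<e>"
    "\<And>\<xi>. smooth_on W (\<lambda>z. rlog G z \<xi>)"
proof -
  let ?A = "atlas G" and ?f = "\<lambda>a b. a \<star> inv b"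
  let ?F = "lrep2 ?A ?A ?A \<e> \<e> ?f" and ?z = "chart_at ?A \<e> \<e>"
  have "smooth_map (prod_atlas ?A ?A) ?A (\<lambda>x. fst x \<star> inv (snd x))"
    by (intro smooth_map_mult[OF manifold_prod[OF mf mf]] smooth_map_inv[OF manifold_prod[OF mf mf]] smooth_map_on_fst smooth_map_on_snd)
  then have f: "smooth_map (prod_atlas ?A ?A) ?A (\<lambda>(a, b). ?f a b)" by (simp add: case_prod_unfold)
  obtain V where V: "open V" "(?z, ?z) \<in> V" "V \<subseteq> (chart_at ?A \<e> ` dom_at ?A \<e>) \<times> (chart_at ?A \<e> ` dom_at ?A \<e>)" "smooth_on V ?F"
    "\<And>z w. (z, w) \<in> V \<Longrightarrow> ?f (chart_inv ?A \<e> z) (chart_inv ?A \<e> w) \<in> dom_at ?A (?f \<e> \<e>)"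
    by (rule lrep2_smooth[OF mf mf mf f, of \<e> \<e>]) blast
  let ?W = "(\<lambda>z. (z, z)) -` V"
  have W: "open ?W" by (intro open_vimage V(1) continuous_intros)
  have "smooth_on ?W (\<lambda>z. rlog G z \<xi>)" for \<xi>
  proof (rule smooth_on_cong[OF W])
    have "smooth_on ?W (\<lambda>z. (z, z))" by (intro smooth_on_Pair W smooth_on_bounded_linear bounded_linear_ident)
    then show "smooth_on ?W (\<lambda>z. frechet_derivative ?F (at (z, z)) (\<xi>, 0))"
      by (intro smooth_on_compose[of ?W "\<lambda>z. (z, z)" V, OF fin_dim_prod[OF manifold_fin_dim[OF mf] manifold_fin_dim[OF mf]] W _ _ smooth_on_frechet_derivative[OF V(4)]]) auto
    fix z assume z: "z \<in> ?W"
    then have "(z, z) \<in> V" by simp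
    from lrep2_partials(1)[OF mf mf mf f V(1,3,4,5) this, of \<xi>]
    show "frechet_derivative ?F (at (z, z)) (\<xi>, 0) = rlog G z \<xi>"
      by (simp add: lrep2_def right_inverse coframe_self[OF mf] rlog_def dR_def)
  qed
  then show thesis using that[OF W] V(2,3) by auto
qed

lemma rlog_one: "rlog G (chart_at (atlas G) \<e> \<e>) v = v"
  by (simp add: rlog_def chart_inv_chart_self[OF mf] frame_self[OF mf])

end

section \<open>Mean value estimates on translates and the Goursat problem\<close>

lemma connected_induct:
  assumes "connected (UNIV :: 'a::topological_space set)" "closed X" "\<And>x. x \<in> X \<Longrightarrow> \<exists>U. open U \<and> x \<in> U \<and> U \<subseteq> X" "(a :: 'a) \<in> X"
  shows "x \<in> X"
proof -
  have "open X" unfolding open_subopen[of X] using assms(3) by blast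
  moreover have "open (- X)" using assms(2) by (simp add: closed_def)
  ultimately show ?thesis using connectedD[OF assms(1), of X "- X"] assms(4) by auto
qed

context lie_grp
begin

lemma rlog_linear: "bounded_linear (rlog G z)"
proof -
  have "rlog G z = dR G (inv (chart_inv (atlas G) \<e> z)) (chart_inv (atlas G) \<e> z) \<circ> blinfun_apply (frame (atlas G) \<e> z)"
    by (simp add: fun_eq_iff rlog_def)
  then show ?thesis using bounded_linear_compose[OF dR_linear blinfun.bounded_linear_right] by (simp add: comp_def)
qed

text \<open>The mean value inequality in the chart at the unit, carried to h by right translation. C
  bounds the Maurer-Cartan form on a compact ball, so C and \<rho> depend neither on h nor on
  f.\<close>

lemma translate_bound:
  obtains \<rho> C where "\<rho> > 0" "C > 0" "cball (chart_at (atlas G) \<e> \<e>) \<rho> \<subseteq> chart_at (atlas G) \<e> ` dom_at (atlas G) \<e>"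
    "\<And>(f :: 'g \<Rightarrow> 'e::real_inner) h r K z. r \<le> \<rho> \<Longrightarrow> K \<ge> 0 \<Longrightarrow>
      (\<And>z. z \<in> cball (chart_at (atlas G) \<e> \<e>) r \<Longrightarrow> \<exists>D. has_tmap (atlas G) model UNIV (\<lambda>k. f (k \<star> (chart_inv (atlas G) \<e> z \<star> h))) \<e> D
         \<and> (\<forall>\<xi>. norm (D \<xi>) \<le> K * norm \<xi>)) \<Longrightarrow>
      z \<in> cball (chart_at (atlas G) \<e> \<e>) r \<Longrightarrow> norm (f (chart_inv (atlas G) \<e> z \<star> h) - f h) \<le> C * K * r"
proof -
  let ?A = "atlas G" and ?z = "chart_at (atlas G) \<e> \<e>" and ?\<phi> = "chart_inv (atlas G) \<e>"
  note m = manifold_model[OF manifold_fin_dim[OF mf]]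
  obtain W where W: "open W" "?z \<in> W" "W \<subseteq> chart_at ?A \<e> ` dom_at ?A \<e>" "\<And>\<xi>. smooth_on W (\<lambda>z. rlog G z \<xi>)"
    using rlog_smooth by metis
  obtain \<rho> where \<rho>: "\<rho> > 0" "cball ?z \<rho> \<subseteq> W" using W(1,2) open_contains_cball by blast
  have app: "blinfun_apply (Blinfun (rlog G z)) = rlog G z" for z by (rule bounded_linear_Blinfun_apply[OF rlog_linear])
  have "continuous_on (cball ?z \<rho>) (\<lambda>z. Blinfun (rlog G z))"
    by (rule continuous_blinfunI[OF manifold_fin_dim[OF mf]], unfold app,
        rule continuous_on_subset[OF smooth_on_continuous_on[OF W(4)] \<rho>(2)])
  from compact_continuous_image[OF this compact_cball_fin_dim[OF manifold_fin_dim[OF mf]]]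
  have "bounded ((\<lambda>z. Blinfun (rlog G z)) ` cball ?z \<rho>)" by (rule compact_imp_bounded)
  then obtain C where C: "C > 0" "\<And>z. z \<in> cball ?z \<rho> \<Longrightarrow> norm (Blinfun (rlog G z)) \<le> C" unfolding bounded_pos by blast
  have Cb: "norm (rlog G z v) \<le> C * norm v" if "z \<in> cball ?z \<rho>" for z v
    using norm_blinfun[of "Blinfun (rlog G z)" v] mult_right_mono[OF C(2)[OF that], of "norm v"] unfolding app by simp
  have sub: "cball ?z \<rho> \<subseteq> chart_at ?A \<e> ` dom_at ?A \<e>" using \<rho>(2) W(3) by blast
  have "norm (f (?\<phi> z \<star> h) - f h) \<le> C * K * r"
    if r: "r \<le> \<rho>" "K \<ge> 0" and D: "\<And>z. z \<in> cball ?z r \<Longrightarrow> \<exists>D. has_tmap ?A model UNIV (\<lambda>k. f (k \<star> (?\<phi> z \<star> h))) \<e> D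
         \<and> (\<forall>\<xi>. norm (D \<xi>) \<le> K * norm \<xi>)" and z: "z \<in> cball ?z r" for f :: "'g \<Rightarrow> 'e" and h r K z
  proof -
    have "\<exists>E. ((\<lambda>z. f (?\<phi> z \<star> h)) has_derivative E) (at z within cball ?z r) \<and> onorm E \<le> C * K" if z: "z \<in> cball ?z r" for z
    proof -
      have z': "z \<in> cball ?z \<rho>" using z r(1) by auto
      obtain D where D: "has_tmap ?A model UNIV (\<lambda>k. f (k \<star> (?\<phi> z \<star> h))) \<e> D" "\<And>\<xi>. norm (D \<xi>) \<le> K * norm \<xi>" using D[OF z] by blast
      have "has_tmap model ?A UNIV (\<lambda>x. ?\<phi> x \<star> inv (?\<phi> z)) z (\<lambda>v. dR G (inv (?\<phi> z)) (?\<phi> z) (frame ?A \<e> z v))"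
        by (rule has_tmap_chain[OF m mf frame_has_tmap[OF mf] has_tmap_R]) (use sub z' in auto)
      then have 1: "has_tmap model ?A UNIV (\<lambda>x. ?\<phi> x \<star> inv (?\<phi> z)) z (rlog G z)" unfolding rlog_def[abs_def] .
      have D': "has_tmap ?A model UNIV (\<lambda>k. f (k \<star> (?\<phi> z \<star> h))) (?\<phi> z \<star> inv (?\<phi> z)) D" using D(1) by (simp add: right_inverse)
      have "has_tmap model model UNIV (\<lambda>x. f (?\<phi> x \<star> inv (?\<phi> z) \<star> (?\<phi> z \<star> h))) z (\<lambda>v. D (rlog G z v))"
        by (rule has_tmap_chain[OF m mf 1 D']) auto
      then have "((\<lambda>x. f (?\<phi> x \<star> h)) has_derivative (\<lambda>v. D (rlog G z v))) (at z)"
        by (simp add: has_tmap_model_iff assoc)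
      moreover have "norm (D (rlog G z v)) \<le> C * K * norm v" for v :: 'v
      proof -
        have "norm (D (rlog G z v)) \<le> K * norm (rlog G z v)" by (rule D(2))
        also have "\<dots> \<le> K * (C * norm v)" by (rule mult_left_mono[OF Cb[OF z'] r(2)])
        finally show ?thesis by (simp add: mult_ac)
      qed
      note * = this
      have "onorm (\<lambda>v. D (rlog G z v)) \<le> C * K" by (rule onorm_bound) (use * C(1) r(2) in auto)
      ultimately show ?thesis using has_derivative_at_withinI by blast
    qed
    then obtain E where E: "\<And>z. z \<in> cball ?z r \<Longrightarrow> ((\<lambda>z. f (?\<phi> z \<star> h)) has_derivative E z) (at z within cball ?z r)"
      "\<And>z. z \<in> cball ?z r \<Longrightarrow> onorm (E z) \<le> C * K" by metis
    have r0: "r \<ge> 0" "?z \<in> cball ?z r" using z by (auto intro: order_trans[OF zero_le_dist])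
    have "norm (f (?\<phi> z \<star> h) - f (?\<phi> ?z \<star> h)) \<le> C * K * norm (z - ?z)"
      by (rule differentiable_bound[OF convex_cball E z r0(2)])
    also have "\<dots> \<le> C * K * r" using z C(1) r(2) by (intro mult_left_mono) (auto simp: dist_norm norm_minus_commute)
    finally show ?thesis by (simp add: chart_inv_chart_self[OF mf])
  qed
  then show thesis using that[of \<rho> C] \<rho>(1) C(1) sub by blast
qed

lemma translate_nhd:
  assumes "r > 0"
  obtains U where "open U" "h \<in> U" "U \<subseteq> (\<lambda>z. chart_inv (atlas G) \<e> z \<star> h) ` cball (chart_at (atlas G) \<e> \<e>) r"
proof -
  let ?A = "atlas G" and ?z = "chart_at (atlas G) \<e> \<e>" and ?\<phi> = "chart_inv (atlas G) \<e>"
  let ?V = "{q \<in> dom_at ?A \<e>. chart_at ?A \<e> q \<in> ball ?z r}"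
  have "open ?V" by (rule chart_open_vimage[OF mf open_ball])
  then have "open ((\<lambda>k. k \<star> inv h) -` ?V)"
    by (rule open_vimage[OF _ smooth_map_on_continuous_on[OF mf mf smooth_R]])
  moreover have "h \<in> (\<lambda>k. k \<star> inv h) -` ?V" using assms manifold_chartD(1)[OF mf] by (simp add: right_inverse)
  moreover have "(\<lambda>k. k \<star> inv h) -` ?V \<subseteq> (\<lambda>z. ?\<phi> z \<star> h) ` cball ?z r"
  proof
    fix k assume k: "k \<in> (\<lambda>k. k \<star> inv h) -` ?V"
    then have "?\<phi> (chart_at ?A \<e> (k \<star> inv h)) \<star> h = k" using chart_inv_chart[OF mf] by simp
    moreover have "chart_at ?A \<e> (k \<star> inv h) \<in> cball ?z r" using k by simp
    ultimately show "k \<in> (\<lambda>z. ?\<phi> z \<star> h) ` cball ?z r" by (metis imageI)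
  qed
  ultimately show thesis using that by blast
qed

lemma translate_compact:
  assumes "cball (chart_at (atlas G) \<e> \<e>) \<rho> \<subseteq> chart_at (atlas G) \<e> ` dom_at (atlas G) \<e>"
  shows "compact ((\<lambda>z. chart_inv (atlas G) \<e> z \<star> h) ` cball (chart_at (atlas G) \<e> \<e>) \<rho>)"
proof (rule compact_continuous_image[OF _ compact_cball_fin_dim[OF manifold_fin_dim[OF mf]]])
  have "continuous_on (chart_at (atlas G) \<e> ` dom_at (atlas G) \<e>) (chart_inv (atlas G) \<e>)"
    using manifold_chartD(4)[OF mf] unfolding homeomorphism_def by blast
  then have "continuous_on (cball (chart_at (atlas G) \<e> \<e>) \<rho>) (chart_inv (atlas G) \<e>)" using assms by (rule continuous_on_subset)
  then show "continuous_on (cball (chart_at (atlas G) \<e> \<e>) \<rho>) (\<lambda>z. chart_inv (atlas G) \<e> z \<star> h)"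
    by (rule continuous_on_compose2[OF smooth_map_on_continuous_on[OF mf mf smooth_R]]) simp
qed

end

lemma compact_bound_real:
  fixes f :: "'a::topological_space \<Rightarrow> real"
  assumes "compact S" "continuous_on UNIV f"
  obtains K where "K \<ge> 0" "\<And>x. x \<in> S \<Longrightarrow> f x \<le> K"
proof -
  have "bounded (f ` S)" by (rule compact_imp_bounded[OF compact_continuous_image[OF continuous_on_subset[OF assms(2)] assms(1)]]) simp
  then obtain K where "K > 0" "\<And>x. x \<in> S \<Longrightarrow> norm (f x) \<le> K" unfolding bounded_pos by blast
  then show thesis using that[of K] by (fastforce simp: abs_le_iff)
qed

text \<open>If \<open>F1\<close> vanishes for \<open>h = h1\<close> and \<open>F2\<close> for \<open>u = p\<close>, then near \<open>(h1, p)\<close> integrating in both variables bounds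
  \<open>F1\<close> by half of any bound of itself, hence \<open>F1 = 0\<close> and then \<open>F2 = 0\<close>.  Taking the neighbourhood of \<open>h1\<close> small
  suffices for this, so the neighbourhood \<open>NB p\<close> of \<open>p\<close> can be kept fixed while \<open>h1\<close> moves through the whole group.\<close>

lemma goursat_uniqueness:
  fixes A :: "('a::topological_space, 'v::real_inner, 'z) lie_group_scheme" and B :: "('b::topological_space, 'w::real_inner, 'y) lie_group_scheme"
    and F1 :: "'a \<Rightarrow> 'b \<Rightarrow> 'e1::real_normed_vector \<Rightarrow>\<^sub>L 'f1::real_inner" and F2 :: "'a \<Rightarrow> 'b \<Rightarrow> 'e2::real_normed_vector \<Rightarrow>\<^sub>L 'f2::real_inner"
  assumes lie: "is_lie_group A" "is_lie_group B" and conn: "connected (UNIV :: 'a set)" "connected (UNIV :: 'b set)"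
    and cF: "continuous_on UNIV (\<lambda>(h, u). F1 h u)" "continuous_on UNIV (\<lambda>(h, u). F2 h u)"
    and ck: "continuous_on UNIV (\<lambda>(h, u). k1 h u :: real)" "continuous_on UNIV (\<lambda>(h, u). k2 h u :: real)"
    and d1: "\<And>h u \<eta>. \<exists>D. has_tmap (atlas A) model UNIV (\<lambda>k. F1 (gmult A k h) u \<eta>) (gone A) D
      \<and> (\<forall>\<xi>. norm (D \<xi>) \<le> k1 h u * norm (F2 h u) * norm \<eta> * norm \<xi>)"
    and d2: "\<And>h u \<eta>. \<exists>D. has_tmap (atlas B) model UNIV (\<lambda>k. F2 h (gmult B k u) \<eta>) (gone B) D
      \<and> (\<forall>\<xi>. norm (D \<xi>) \<le> k2 h u * norm (F1 h u) * norm \<eta> * norm \<xi>)"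
    and init: "\<And>u. F1 (gone A) u = 0" "\<And>h. F2 h (gone B) = 0"
  shows "F1 h u = 0" "F2 h u = 0"
proof -
  interpret A: lie_grp A by (rule lie_grp.intro[OF lie(1)])
  interpret B: lie_grp B by (rule lie_grp.intro[OF lie(2)])
  let ?za = "chart_at (atlas A) (gone A) (gone A)" and ?\<phi> = "chart_inv (atlas A) (gone A)"
  let ?zb = "chart_at (atlas B) (gone B) (gone B)" and ?\<psi> = "chart_inv (atlas B) (gone B)"
  obtain ra CA where a: "ra > 0" "CA > 0" "cball ?za ra \<subseteq> chart_at (atlas A) (gone A) ` dom_at (atlas A) (gone A)"
    and bA: "\<And>(f :: 'a \<Rightarrow> 'f1) h r K z. r \<le> ra \<Longrightarrow> K \<ge> 0 \<Longrightarrow>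
      (\<And>z. z \<in> cball ?za r \<Longrightarrow> \<exists>D. has_tmap (atlas A) model UNIV (\<lambda>k. f (gmult A k (gmult A (?\<phi> z) h))) (gone A) D
         \<and> (\<forall>\<xi>. norm (D \<xi>) \<le> K * norm \<xi>)) \<Longrightarrow>
      z \<in> cball ?za r \<Longrightarrow> norm (f (gmult A (?\<phi> z) h) - f h) \<le> CA * K * r"
    by (rule A.translate_bound[where 'e = 'f1]) blast
  obtain rb CB where b: "rb > 0" "CB > 0" "cball ?zb rb \<subseteq> chart_at (atlas B) (gone B) ` dom_at (atlas B) (gone B)"
    and bB: "\<And>(f :: 'b \<Rightarrow> 'f2) h r K z. r \<le> rb \<Longrightarrow> K \<ge> 0 \<Longrightarrow>
      (\<And>z. z \<in> cball ?zb r \<Longrightarrow> \<exists>D. has_tmap (atlas B) model UNIV (\<lambda>k. f (gmult B k (gmult B (?\<psi> z) h))) (gone B) D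
         \<and> (\<forall>\<xi>. norm (D \<xi>) \<le> K * norm \<xi>)) \<Longrightarrow>
      z \<in> cball ?zb r \<Longrightarrow> norm (f (gmult B (?\<psi> z) h) - f h) \<le> CB * K * r"
    by (rule B.translate_bound[where 'e = 'f2]) blast
  define NB where "NB = (\<lambda>p. (\<lambda>w. gmult B (?\<psi> w) p) ` cball ?zb rb)"
  define NA where "NA = (\<lambda>r h. (\<lambda>z. gmult A (?\<phi> z) h) ` cball ?za r)"
  have cNB: "compact (NB p)" for p unfolding NB_def by (rule B.translate_compact[OF b(3)])
  have cNA: "compact (NA ra h)" for h unfolding NA_def by (rule A.translate_compact[OF a(3)])
  \<comment> \<open>Integration in the second variable from p, where F2 vanishes; K and M bound the
    coefficient and F1 over all of \<open>NB p\<close>.\<close>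
  have step2: "norm (F2 h u) \<le> CB * (K * M) * rb"
    if asm: "F2 h p = 0" "u \<in> NB p" "K \<ge> 0" "M \<ge> 0" "\<And>u. u \<in> NB p \<Longrightarrow> k2 h u \<le> K" "\<And>u. u \<in> NB p \<Longrightarrow> norm (F1 h u) \<le> M" for h p u K M
  proof (rule norm_blinfun_bound)
    show "0 \<le> CB * (K * M) * rb" using asm b by simp
    fix \<eta>
    obtain w where w: "w \<in> cball ?zb rb" "u = gmult B (?\<psi> w) p" using asm(2) unfolding NB_def by blast
    have "norm (F2 h (gmult B (?\<psi> w) p) \<eta> - F2 h p \<eta>) \<le> CB * (K * M * norm \<eta>) * rb"
    proof (rule bB[of rb, OF order_refl _ _ w(1)])
      fix z assume z: "z \<in> cball ?zb rb"
      let ?u = "gmult B (?\<psi> z) p"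
      have u: "?u \<in> NB p" unfolding NB_def using z by blast
      obtain D where D: "has_tmap (atlas B) model UNIV (\<lambda>k. F2 h (gmult B k ?u) \<eta>) (gone B) D"
        "\<And>\<xi>. norm (D \<xi>) \<le> k2 h ?u * norm (F1 h ?u) * norm \<eta> * norm \<xi>" using d2 by blast
      have "k2 h ?u * norm (F1 h ?u) \<le> K * M" using asm(3,4) asm(5,6)[OF u] by (intro mult_mono) auto
      then have "k2 h ?u * norm (F1 h ?u) * norm \<eta> * norm \<xi> \<le> K * M * norm \<eta> * norm \<xi>" for \<xi> by (intro mult_right_mono) auto
      then show "\<exists>D. has_tmap (atlas B) model UNIV (\<lambda>k. F2 h (gmult B k ?u) \<eta>) (gone B) D \<and> (\<forall>\<xi>. norm (D \<xi>) \<le> K * M * norm \<eta> * norm \<xi>)"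
        using D order_trans by blast
    qed (use asm in simp)
    then show "norm (F2 h u \<eta>) \<le> CB * (K * M) * rb * norm \<eta>" using asm(1) w(2) by (simp add: mult_ac)
  qed
  \<comment> \<open>The same in the first variable, with the radius r left free: it is the small
    factor of the final estimate.\<close>
  have step1: "norm (F1 h u) \<le> CA * (K * M) * r"
    if asm: "r \<le> ra" "F1 h1 u = 0" "h \<in> NA r h1" "K \<ge> 0" "M \<ge> 0" "r \<ge> 0" "\<And>h. h \<in> NA r h1 \<Longrightarrow> k1 h u \<le> K" "\<And>h. h \<in> NA r h1 \<Longrightarrow> norm (F2 h u) \<le> M" for h h1 u K M r
  proof (rule norm_blinfun_bound)
    show "0 \<le> CA * (K * M) * r" using asm a by simp
    fix \<eta>
    obtain w where w: "w \<in> cball ?za r" "h = gmult A (?\<phi> w) h1" using asm(3) unfolding NA_def by blast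
    have "norm (F1 (gmult A (?\<phi> w) h1) u \<eta> - F1 h1 u \<eta>) \<le> CA * (K * M * norm \<eta>) * r"
    proof (rule bA[of r _ "\<lambda>h. F1 h u \<eta>", OF asm(1) _ _ w(1)])
      fix z assume z: "z \<in> cball ?za r"
      let ?h = "gmult A (?\<phi> z) h1"
      have h: "?h \<in> NA r h1" unfolding NA_def using z by blast
      obtain D where D: "has_tmap (atlas A) model UNIV (\<lambda>k. F1 (gmult A k ?h) u \<eta>) (gone A) D"
        "\<And>\<xi>. norm (D \<xi>) \<le> k1 ?h u * norm (F2 ?h u) * norm \<eta> * norm \<xi>" using d1 by blast
      have "k1 ?h u * norm (F2 ?h u) \<le> K * M" using asm(4,5) asm(7,8)[OF h] by (intro mult_mono) auto
      then have "k1 ?h u * norm (F2 ?h u) * norm \<eta> * norm \<xi> \<le> K * M * norm \<eta> * norm \<xi>" for \<xi> by (intro mult_right_mono) auto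
      then show "\<exists>D. has_tmap (atlas A) model UNIV (\<lambda>k. F1 (gmult A k ?h) u \<eta>) (gone A) D \<and> (\<forall>\<xi>. norm (D \<xi>) \<le> K * M * norm \<eta> * norm \<xi>)"
        using D order_trans by blast
    qed (use asm in simp)
    then show "norm (F1 h u \<eta>) \<le> CA * (K * M) * r * norm \<eta>" using asm(2) w(2) by (simp add: mult_ac)
  qed
  have c1: "continuous_on UNIV (\<lambda>h. F1 h u)" "continuous_on UNIV (\<lambda>h. F2 h u)" for u
    using continuous_on_compose2[OF cF(1), of UNIV "\<lambda>h. (h, u)"] continuous_on_compose2[OF cF(2), of UNIV "\<lambda>h. (h, u)"]
    by (simp_all add: continuous_on_Pair)
  have c2: "continuous_on UNIV (\<lambda>u. F2 h u)" "continuous_on UNIV (\<lambda>u. k2 h u)" for h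
    using continuous_on_compose2[OF cF(2), of UNIV "\<lambda>u. (h, u)"] continuous_on_compose2[OF ck(2), of UNIV "\<lambda>u. (h, u)"]
    by (simp_all add: continuous_on_Pair)
  have main: "F1 h u = 0 \<and> F2 h u = 0" if p: "\<And>h. F2 h p = 0" and u: "u \<in> NB p" for h u p
  proof -
    \<comment> \<open>Vanishing is required on the whole of \<open>NB p\<close>, since the bound on
      F2 at one u integrates F1 over that neighbourhood.\<close>
    define X where "X = {h. \<forall>u\<in>NB p. F1 h u = 0 \<and> F2 h u = 0}"
    have "h \<in> X"
    proof (rule connected_induct[OF conn(1)])
      have "X = (\<Inter>u\<in>NB p. {h. F1 h u = 0} \<inter> {h. F2 h u = 0})" unfolding X_def by auto
      moreover have "closed {h. F1 h u = 0}" "closed {h. F2 h u = 0}" for u by (intro closed_Collect_eq c1 continuous_on_const)+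
      ultimately show "closed X" by (simp add: closed_INT closed_Int)
      obtain K where K: "K \<ge> 0" "\<And>u. u \<in> NB p \<Longrightarrow> k2 (gone A) u \<le> K" using compact_bound_real[OF cNB c2(2)] by metis
      show "gone A \<in> X" unfolding X_def using step2[OF p _ K(1) order_refl, of _ "gone A"] K(2) init(1) by auto
      fix h1 assume h1: "h1 \<in> X"
      let ?S = "NA ra h1 \<times> NB p"
      have cS: "compact ?S" by (rule compact_Times[OF cNA cNB])
      obtain K1 where K1: "K1 \<ge> 0" "\<And>h u. (h, u) \<in> ?S \<Longrightarrow> k1 h u \<le> K1" using compact_bound_real[OF cS ck(1)] by (metis case_prod_conv)
      obtain K2 where K2: "K2 \<ge> 0" "\<And>h u. (h, u) \<in> ?S \<Longrightarrow> k2 h u \<le> K2" using compact_bound_real[OF cS ck(2)] by (metis case_prod_conv)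
      have "continuous_on UNIV (\<lambda>x. norm (case x of (h, u) \<Rightarrow> F1 h u))" by (rule continuous_on_norm[OF cF(1)])
      from compact_bound_real[OF cS this] obtain M where M: "M \<ge> 0" "\<And>h u. (h, u) \<in> ?S \<Longrightarrow> norm (F1 h u) \<le> M" by (metis case_prod_conv)
      \<comment> \<open>The factor picked up, apart from r, when a bound on F1 is passed to F2 and
        back. The radius r makes Q r \<le> 1/2, and Q + 1 avoids division by zero.\<close>
      define Q where "Q = CA * K1 * CB * K2 * rb"
      have Q: "Q \<ge> 0" using a b K1 K2 by (simp add: Q_def)
      define r where "r = min ra (1 / (2 * (Q + 1)))"
      have r: "r > 0" "r \<le> ra" using a(1) Q by (auto simp: r_def)
      have "Q * r \<le> Q * (1 / (2 * (Q + 1)))" using Q by (intro mult_left_mono) (auto simp: r_def)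
      also have "\<dots> \<le> 1/2" using Q by (simp add: field_simps)
      finally have Qr: "Q * r \<le> 1/2" .
      have sub: "NA r h1 \<subseteq> NA ra h1" unfolding NA_def using r(2) by (intro image_mono) auto
      have half: "norm (F1 h u) \<le> M / 2" if M: "M \<ge> 0" "\<And>h u. h \<in> NA r h1 \<Longrightarrow> u \<in> NB p \<Longrightarrow> norm (F1 h u) \<le> M" and hu: "h \<in> NA r h1" "u \<in> NB p" for M h u
      proof -
        have 2: "norm (F2 h u) \<le> CB * (K2 * M) * rb" if "h \<in> NA r h1" "u \<in> NB p" for h u
          by (rule step2[OF p that(2) K2(1) M(1)]) (use that(1) sub K2(2) M(2) in auto)
        have "norm (F1 h u) \<le> CA * (K1 * (CB * (K2 * M) * rb)) * r"
          by (rule step1[OF r(2) _ hu(1) K1(1)]) (use h1 hu K1(2) sub 2 M(1) K2(1) b r in \<open>auto simp: X_def\<close>)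
        also have "\<dots> = (Q * r) * M" by (simp add: Q_def)
        also have "\<dots> \<le> 1/2 * M" by (rule mult_right_mono[OF Qr M(1)])
        finally show ?thesis by simp
      qed
      \<comment> \<open>M comes from compactness, and each round of the two integrations halves the
        bound.\<close>
      have "norm (F1 h u) \<le> M / 2 ^ n" if "h \<in> NA r h1" "u \<in> NB p" for h u n
        using that
      proof (induction n arbitrary: h u)
        case 0 then show ?case using M(2) sub by auto
      next
        case (Suc n)
        have "norm (F1 h u) \<le> (M / 2 ^ n) / 2" by (rule half) (use Suc M(1) in auto)
        then show ?case by (simp add: mult.commute)
      qed
      then have F1z: "F1 h u = 0" if "h \<in> NA r h1" "u \<in> NB p" for h u
      proof -
        have "(\<lambda>n. M / 2 ^ n) \<longlonglongrightarrow> 0" using LIMSEQ_divide_realpow_zero[of 2 M] by simp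
        then have "norm (F1 h u) \<le> 0" by (rule LIMSEQ_le_const) (use \<open>\<And>u n h. h \<in> NA r h1 \<Longrightarrow> u \<in> NB p \<Longrightarrow> norm (F1 h u) \<le> M / 2 ^ n\<close> that in auto)
        then show ?thesis by simp
      qed
      have "F2 h u = 0" if "h \<in> NA r h1" "u \<in> NB p" for h u
      proof -
        have "norm (F2 h u) \<le> CB * (K2 * 0) * rb"
          by (rule step2[OF p that(2) K2(1) order_refl]) (use that(1) sub K2(2) F1z in auto)
        then show ?thesis by simp
      qed
      then have "NA r h1 \<subseteq> X" using F1z unfolding X_def by blast
      moreover obtain U where "open U" "h1 \<in> U" "U \<subseteq> NA r h1" unfolding NA_def using A.translate_nhd[OF r(1)] by metis
      ultimately show "\<exists>U. open U \<and> h1 \<in> U \<and> U \<subseteq> X" by blast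
    qed
    then show ?thesis using u unfolding X_def by blast
  qed
  have inNB: "p \<in> NB p" for p
    unfolding NB_def by (rule image_eqI[of _ _ ?zb]) (use b(1) in \<open>simp_all add: chart_inv_chart_self[OF B.mf]\<close>)
  have Y: "p \<in> {p. \<forall>h. F2 h p = 0}" for p
  proof (rule connected_induct[OF conn(2)])
    have "{p. \<forall>h. F2 h p = 0} = (\<Inter>h. {p. F2 h p = 0})" by auto
    moreover have "closed {p. F2 h p = 0}" for h by (intro closed_Collect_eq c2 continuous_on_const)
    ultimately show "closed {p. \<forall>h. F2 h p = 0}" by (simp add: closed_INT)
    show "gone B \<in> {p. \<forall>h. F2 h p = 0}" using init(2) by simp
    fix p assume "p \<in> {p. \<forall>h. F2 h p = 0}"
    then have "NB p \<subseteq> {p. \<forall>h. F2 h p = 0}" using main[of p] by blast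
    moreover obtain U where "open U" "p \<in> U" "U \<subseteq> NB p" unfolding NB_def using B.translate_nhd[OF b(1)] by metis
    ultimately show "\<exists>U. open U \<and> p \<in> U \<and> U \<subseteq> {p. \<forall>h. F2 h p = 0}" by blast
  qed
  then have "F1 h u = 0 \<and> F2 h u = 0" using main[OF _ inNB] by blast
  then show "F1 h u = 0" "F2 h u = 0" by auto
qed

section \<open>Dual pairings and coadjoint operators\<close>

text \<open>A perfect pairing, stated symmetrically in both spaces instead of identifying one with
  the dual of the other, so that a group and its dual exchange roles by flipping the
  arguments.\<close>

locale dual_pair =
  fixes p :: "'v::real_inner \<Rightarrow> 'w::real_inner \<Rightarrow> real"
  assumes bilinear: "bounded_bilinear p"
    and fin_dim: "fin_dim TYPE('v)" "fin_dim TYPE('w)"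
    and represent: "\<And>\<phi>. linear \<phi> \<Longrightarrow> \<exists>\<xi>. \<forall>w. \<phi> w = p \<xi> w" "\<And>\<phi>. linear \<phi> \<Longrightarrow> \<exists>w. \<forall>\<xi>. \<phi> \<xi> = p \<xi> w"
begin

sublocale p: bounded_bilinear p by (rule bilinear)

text \<open>The inner product with \<xi> - \<zeta> is itself represented by some w, and pairing the
  difference with this w gives its squared length.\<close>

lemma eqI: "(\<And>w. p \<xi> w = p \<zeta> w) \<Longrightarrow> \<xi> = \<zeta>"
proof -
  assume *: "\<And>w. p \<xi> w = p \<zeta> w"
  obtain w where w: "\<And>x. (\<xi> - \<zeta>) \<bullet> x = p x w" using represent(2)[OF bounded_linear.linear[OF bounded_linear_inner_right[of "\<xi> - \<zeta>"]]] by blast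
  have "(\<xi> - \<zeta>) \<bullet> (\<xi> - \<zeta>) = 0" unfolding w by (simp add: p.diff_left *)
  then show ?thesis by simp
qed

lemma ex1:
  assumes "linear \<phi>"
  shows "\<exists>!\<xi>. \<forall>w. p \<xi> w = \<phi> w"
proof -
  obtain \<xi> where "\<forall>w. \<phi> w = p \<xi> w" using represent(1)[OF assms] by blast
  then show ?thesis using eqI by (intro ex1I[of _ \<xi>]) auto
qed

lemma coordinates:
  obtains C :: "'v set" and w where "finite C" "\<And>\<xi>. (\<Sum>c\<in>C. p \<xi> (w c) *\<^sub>R c) = \<xi>"
proof -
  obtain C :: "'v set" where C: "finite C" "\<And>x. (\<Sum>b\<in>C. (x \<bullet> b) *\<^sub>R b) = x" using fin_dimE[OF fin_dim(1)] by metis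
  have "\<exists>w. \<forall>\<xi>. \<xi> \<bullet> c = p \<xi> w" for c :: 'v using represent(2)[OF bounded_linear.linear[OF bounded_linear_inner_left[of c]]] .
  then obtain w where "\<And>\<xi> c. \<xi> \<bullet> c = p \<xi> (w c)" by metis
  then show thesis using that[of C w] C by simp
qed

lemma continuous_onI:
  assumes "\<And>w. continuous_on S (\<lambda>x. p (f x) w)"
  shows "continuous_on S f"
proof -
  obtain C :: "'v set" and w where C: "finite C" "\<And>\<xi>. (\<Sum>c\<in>C. p \<xi> (w c) *\<^sub>R c) = \<xi>" by (rule coordinates) blast
  have "continuous_on S (\<lambda>x. \<Sum>c\<in>C. p (f x) (w c) *\<^sub>R c)" by (intro continuous_intros assms)
  then show ?thesis unfolding C(2) .
qed

lemma has_derivativeI: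
  assumes "\<And>w. ((\<lambda>x. p (f x) w) has_derivative (\<lambda>v. p (A v) w)) F"
  shows "(f has_derivative A) F"
proof -
  obtain C :: "'v set" and w where C: "finite C" "\<And>\<xi>. (\<Sum>c\<in>C. p \<xi> (w c) *\<^sub>R c) = \<xi>" by (rule coordinates) blast
  have "((\<lambda>x. \<Sum>c\<in>C. p (f x) (w c) *\<^sub>R c) has_derivative (\<lambda>v. \<Sum>c\<in>C. p (A v) (w c) *\<^sub>R c)) F"
    by (intro has_derivative_sum has_derivative_scaleR_left assms)
  then show ?thesis unfolding C(2) .
qed

end

lemma dual_pair_flip: "dual_pair p \<Longrightarrow> dual_pair (\<lambda>w \<xi>. p \<xi> w)"
  unfolding dual_pair_def by (auto intro: bounded_bilinear.flip)

lemma has_tmap_to_model_iff: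
  "has_tmap M model S f p A \<longleftrightarrow> ((\<lambda>z. f (chart_inv M p z)) has_derivative A) (at (chart_at M p p) within chart_at M p ` (S \<inter> dom_at M p))"
  unfolding has_tmap_def by auto

lemma (in dual_pair) has_tmapI:
  "(\<And>w. has_tmap M model S (\<lambda>x. p (f x) w) q (\<lambda>v. p (A v) w)) \<Longrightarrow> has_tmap M model S f q A"
  unfolding has_tmap_to_model_iff by (rule has_derivativeI)

text \<open>Product rule for a family of linear maps whose dependence on x is controlled vector by
  vector; expanding W x in an orthonormal set reduces it to multiples by scalar functions.\<close>

lemma has_tmap_apply:
  fixes L :: "'m \<Rightarrow> 'a::real_inner \<Rightarrow> 'b::real_normed_vector"
  assumes fd: "fin_dim TYPE('a)" and L: "\<And>x. linear (L x)" "\<And>v. linear (L' v)" "\<And>c. has_tmap M model S (\<lambda>x. L x c) q (\<lambda>v. L' v c)"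
    and W: "has_tmap M model S W q W'" and q: "chart_inv M q (chart_at M q q) = q"
  shows "has_tmap M model S (\<lambda>x. L x (W x)) q (\<lambda>v. L' v (W q) + L q (W' v))"
proof -
  obtain C :: "'a set" where C: "finite C" "\<And>x. (\<Sum>b\<in>C. (x \<bullet> b) *\<^sub>R b) = x" using fin_dimE[OF fd] by metis
  have e: "f x = (\<Sum>c\<in>C. (x \<bullet> c) *\<^sub>R f c)" if "linear f" for f :: "'a \<Rightarrow> 'b" and x
    by (subst C(2)[symmetric]) (simp add: linear_sum[OF that] linear_cmul[OF that])
  let ?i = "chart_inv M q" and ?F = "at (chart_at M q q) within chart_at M q ` (S \<inter> dom_at M q)"
  have D1: "((\<lambda>z. L (?i z) c) has_derivative (\<lambda>v. L' v c)) ?F" for c using L(3) unfolding has_tmap_to_model_iff .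
  have D2: "((\<lambda>z. W (?i z) \<bullet> c) has_derivative (\<lambda>v. W' v \<bullet> c)) ?F" for c
    by (rule has_derivative_inner_left) (use W in \<open>simp add: has_tmap_to_model_iff\<close>)
  have "((\<lambda>z. \<Sum>c\<in>C. (W (?i z) \<bullet> c) *\<^sub>R L (?i z) c) has_derivative
     (\<lambda>v. \<Sum>c\<in>C. (W (?i (chart_at M q q)) \<bullet> c) *\<^sub>R L' v c + (W' v \<bullet> c) *\<^sub>R L (?i (chart_at M q q)) c)) ?F"
    by (intro has_derivative_sum has_derivative_scaleR D1 D2)
  then show ?thesis unfolding has_tmap_to_model_iff q by (simp add: sum.distrib e[OF L(1)] e[OF L(2)] flip: e[OF L(1)] e[OF L(2)])
qed

lemma bilinear_bounded_fin_dim: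
  fixes f :: "'a::real_inner \<Rightarrow> 'b::real_inner \<Rightarrow> 'c::real_normed_vector"
  assumes "fin_dim TYPE('a)" "fin_dim TYPE('b)" "\<And>x. linear (f x)" "\<And>y. linear (\<lambda>x. f x y)"
  obtains K where "K \<ge> 0" "\<And>x y. norm (f x y) \<le> K * norm x * norm y"
proof -
  obtain C :: "'a set" where C: "finite C" "\<And>b. b \<in> C \<Longrightarrow> norm b = 1" "\<And>x. (\<Sum>b\<in>C. (x \<bullet> b) *\<^sub>R b) = x" using fin_dimE[OF assms(1)] by metis
  have bl: "bounded_linear (f c)" for c by (rule linear_bounded_fin_dim[OF assms(2,3)])
  let ?K = "\<Sum>c\<in>C. onorm (f c)"
  have "norm (f x y) \<le> ?K * norm x * norm y" for x y
  proof -
    have "f x y = (\<Sum>c\<in>C. (x \<bullet> c) *\<^sub>R f c y)"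
      by (subst C(3)[symmetric]) (simp add: linear_sum[OF assms(4)] linear_cmul[OF assms(4)])
    also have "norm \<dots> \<le> (\<Sum>c\<in>C. norm ((x \<bullet> c) *\<^sub>R f c y))" by (rule norm_sum)
    also have "\<dots> \<le> (\<Sum>c\<in>C. norm x * (onorm (f c) * norm y))"
    proof (rule sum_mono)
      fix c assume "c \<in> C"
      have "\<bar>x \<bullet> c\<bar> \<le> norm x" using Cauchy_Schwarz_ineq2[of x c] C(2)[OF \<open>c \<in> C\<close>] by simp
      then show "norm ((x \<bullet> c) *\<^sub>R f c y) \<le> norm x * (onorm (f c) * norm y)"
        using onorm[OF bl, of c y] by (simp add: mult_mono)
    qed
    also have "\<dots> = ?K * norm x * norm y" by (simp add: sum_distrib_left sum_distrib_right mult_ac)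
    finally show ?thesis .
  qed
  moreover have "?K \<ge> 0" by (intro sum_nonneg onorm_pos_le bl)
  ultimately show thesis using that by blast
qed

text \<open>The transpose of \<open>Ad B b\<close> under the pairing, without an inverse, hence an
  anti-homomorphism in b.\<close>

definition coad :: "('v::real_inner \<Rightarrow> 'w::real_inner \<Rightarrow> real) \<Rightarrow> ('b, 'w, 'z) lie_group_scheme \<Rightarrow> 'b \<Rightarrow> 'v \<Rightarrow>\<^sub>L 'v" where
  "coad p B b = Blinfun (\<lambda>\<xi>. THE \<zeta>. \<forall>w. p \<zeta> w = p \<xi> (Ad B b w))"

locale coadjoint = dual_pair p + lie_grp B
  for p :: "'v::real_inner \<Rightarrow> 'w::real_inner \<Rightarrow> real" and B :: "('b::topological_space, 'w, 'z) lie_group_scheme"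
begin

lemma coad_apply: "p (coad p B b \<xi>) w = p \<xi> (Ad B b w)"
proof -
  define f where "f = (\<lambda>\<xi>. THE \<zeta>. \<forall>w. p \<zeta> w = p \<xi> (Ad B b w))"
  have f: "p (f \<xi>) w = p \<xi> (Ad B b w)" for \<xi> w
  proof -
    have "bounded_linear (\<lambda>w. p \<xi> (Ad B b w))" by (rule bounded_linear_compose[OF p.bounded_linear_right Ad_linear])
    from theI'[OF ex1[OF bounded_linear.linear[OF this]]] show ?thesis unfolding f_def by blast
  qed
  have "linear f" by (rule linearI; rule eqI) (simp_all add: f p.add_left p.scaleR_left)
  then have "bounded_linear f" by (rule linear_bounded_fin_dim[OF fin_dim(1)])
  then show ?thesis unfolding coad_def f_def[symmetric] by (simp add: bounded_linear_Blinfun_apply f)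
qed

lemma coad_mult: "coad p B (gmult B a b) \<xi> = coad p B b (coad p B a \<xi>)"
  by (rule eqI) (simp add: coad_apply Ad_mult)

lemma coad_one [simp]: "coad p B (gone B) \<xi> = \<xi>"
  by (rule eqI) (simp add: coad_apply)

lemma coad_inv [simp]: "coad p B (ginv B b) (coad p B b \<xi>) = \<xi>" "coad p B b (coad p B (ginv B b) \<xi>) = \<xi>"
  by (rule eqI, simp add: coad_apply)+

lemma continuous_coad: "continuous_on UNIV (coad p B)"
proof (rule continuous_blinfunI[OF fin_dim(1)], rule continuous_onI)
  fix \<xi> w
  have "continuous_on UNIV (\<lambda>b. Ad B b w)"
    by (rule smooth_map_on_continuous_on[OF mf manifold_model[OF fin_dim(2)] smooth_Ad])
  then show "continuous_on UNIV (\<lambda>b. p (coad p B b \<xi>) w)"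
    unfolding coad_apply by (rule bounded_linear.continuous_on[OF p.bounded_linear_right])
qed

lemma lie_bracket_antisym: "lie_bracket B \<alpha> \<beta> = - lie_bracket B \<beta> \<alpha>"
  by (rule lie_bracket_mixed) simp

lemma lie_bracket_linear: "bounded_linear (\<lambda>\<alpha>. lie_bracket B \<alpha> \<beta>)" "bounded_linear (lie_bracket B \<alpha>)"
proof -
  show *: "bounded_linear (\<lambda>\<alpha>. lie_bracket B \<alpha> \<beta>)" for \<beta>
    using bounded_linear_minus[OF has_tmap_linear[OF has_tmap_Ad_one[of \<beta>]]] by simp
  show "bounded_linear (lie_bracket B \<alpha>)"
    using bounded_linear_minus[OF *[of \<alpha>]] lie_bracket_antisym[of \<alpha>] by presburger
qed

text \<open>The infinitesimal coadjoint operator, which is the derivative of \<open>coad\<close> at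
  the unit; its sign is that of \<open>has_tmap_Ad_one\<close>.\<close>

definition dcoad :: "'w \<Rightarrow> 'v \<Rightarrow> 'v" where
  "dcoad \<alpha> \<xi> = (THE \<zeta>. \<forall>w. p \<zeta> w = p \<xi> (- lie_bracket B \<alpha> w))"

lemma dcoad_apply: "p (dcoad \<alpha> \<xi>) w = - p \<xi> (lie_bracket B \<alpha> w)"
proof -
  have "bounded_linear (\<lambda>w. p \<xi> (- lie_bracket B \<alpha> w))"
    by (rule bounded_linear_compose[OF p.bounded_linear_right bounded_linear_minus[OF lie_bracket_linear(2)]])
  from theI'[OF ex1[OF bounded_linear.linear[OF this]]] show ?thesis unfolding dcoad_def by (simp add: p.minus_right)
qed

lemma has_tmap_coad_one: "has_tmap (atlas B) model UNIV (\<lambda>b. coad p B b \<xi>) (gone B) (\<lambda>\<alpha>. dcoad \<alpha> \<xi>)"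
proof (rule has_tmapI)
  fix w
  have "has_tmap (atlas B) model UNIV (\<lambda>b. p \<xi> (Ad B b w)) (gone B) (\<lambda>\<alpha>. p \<xi> (- lie_bracket B \<alpha> w))"
    using bounded_linear.has_derivative[OF p.bounded_linear_right] has_tmap_Ad_one[of w] unfolding has_tmap_to_model_iff by blast
  then show "has_tmap (atlas B) model UNIV (\<lambda>b. p (coad p B b \<xi>) w) (gone B) (\<lambda>\<alpha>. p (dcoad \<alpha> \<xi>) w)"
    by (simp add: coad_apply dcoad_apply p.minus_right)
qed

lemma dcoad_linear: "linear (dcoad \<alpha>)" "linear (\<lambda>\<alpha>. dcoad \<alpha> \<xi>)"
  by (rule linearI; rule eqI; simp add: dcoad_apply p.add_left p.scaleR_left)
    (rule linearI; rule eqI; simp add: dcoad_apply p.add_left p.scaleR_left p.add_right p.scaleR_right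
      linear_add[OF bounded_linear.linear[OF lie_bracket_linear(1)]] linear_cmul[OF bounded_linear.linear[OF lie_bracket_linear(1)]])

end

section \<open>Actions\<close>

locale lie_action = lie_grp G
  for G :: "('g::topological_space, 'v::real_inner, 'z) lie_group_scheme" +
  fixes P :: "('p::topological_space, 'u::real_inner) atlas" and act :: "'g \<Rightarrow> 'p \<Rightarrow> 'p"
  assumes mP: "manifold P" and action: "smooth_left_action G P act"
begin

abbreviation gen where "gen \<xi> p \<equiv> generator G P (\<lambda>g. act g p) \<xi>"

lemma smooth_act: "smooth_map (prod_atlas (atlas G) P) P (\<lambda>(g, p). act g p)"
  and act_one [simp]: "act \<e> p = p" and act_mult: "act (g \<star> h) p = act g (act h p)"
  using action unfolding smooth_left_action_def by blast+

lemma act_inv [simp]: "act (inv g) (act g p) = p" "act g (act (inv g) p) = p"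
  by (simp_all add: left_inverse right_inverse flip: act_mult)

lemma smooth_act1: "smooth_map (atlas G) P (\<lambda>g. act g p)" and smooth_act2: "smooth_map P P (act g)"
  using smooth_map_slices[OF mf mP mP smooth_act] by auto

lemma has_tmap_orbit_one: "has_tmap (atlas G) P UNIV (\<lambda>g. act g p) \<e> (\<lambda>\<xi>. gen \<xi> p)"
  unfolding generator_def by (rule smooth_map_has_tmap[OF mf smooth_act1])

lemma gen_linear: "bounded_linear (\<lambda>\<xi>. gen \<xi> p)"
  by (rule has_tmap_linear[OF has_tmap_orbit_one])

text \<open>Near g write k = (k g^-1) g: the orbit of p near g becomes the orbit of g p near the
  unit.\<close>

lemma orbit_derivative: "tmap (atlas G) P (\<lambda>g. act g p) g v = gen (dR G (inv g) g v) (act g p)"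
proof -
  have "has_tmap (atlas G) P UNIV (\<lambda>k. act (k \<star> inv g) (act g p)) g (\<lambda>v. gen (dR G (inv g) g v) (act g p))"
    by (rule has_tmap_chain[OF mf mf has_tmap_R]) (use has_tmap_orbit_one[of "act g p"] in \<open>auto simp: right_inverse\<close>)
  then have "has_tmap (atlas G) P UNIV (\<lambda>k. act k p) g (\<lambda>v. gen (dR G (inv g) g v) (act g p))"
    by (simp add: act_mult[symmetric])
  from has_tmap_unique[OF mf this] show ?thesis by simp
qed

lemma has_tmap_act:
  assumes L: "manifold L" and g: "has_tmap L (atlas G) S f x F" "has_tmap L P S c x C" "x \<in> S"
  shows "has_tmap L P S (\<lambda>x. act (f x) (c x)) x
     (\<lambda>v. gen (dR G (inv (f x)) (f x) (F v)) (act (f x) (c x)) + tmap P P (act (f x)) (c x) (C v))"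
  using has_tmap_compose2[OF L mf mP smooth_act g] unfolding orbit_derivative .

lemma tmap_act_inj: "tmap P P (act g) p v = 0 \<Longrightarrow> v = 0"
proof -
  assume *: "tmap P P (act g) p v = 0"
  have "has_tmap P P UNIV (\<lambda>x. act (inv g) (act g x)) p (\<lambda>v. tmap P P (act (inv g)) (act g p) (tmap P P (act g) p v))"
    by (rule has_tmap_chain[OF mP mP smooth_map_has_tmap[OF mP smooth_act2] smooth_map_has_tmap[OF mP smooth_act2]]) auto
  then have "has_tmap P P UNIV (\<lambda>x. x) p (\<lambda>v. tmap P P (act (inv g)) (act g p) (tmap P P (act g) p v))" by simp
  from fun_cong[OF has_tmap_uniq2[OF mP this has_tmap_ident[OF mP UNIV_I]], of v] show ?thesis using * by (simp add: blinfun.zero_right)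
qed

text \<open>D and f have the same right logarithmic derivative \<omega>, one in the group and one
  along the action, so acting with D^-1 freezes f. The differential of the inverse is never
  computed: differentiating f = D (D^-1 f) shows that the unknown differential Q is annihilated by
  an injective map.\<close>

lemma integrate:
  assumes L: "manifold L" and conn: "connected (UNIV :: 'l::topological_space set)"
    and D: "\<And>x. has_tmap L (atlas G) UNIV D x (\<lambda>v. dR G (D x) \<e> (\<omega> x v))"
    and f: "\<And>x. has_tmap L P UNIV f x (\<lambda>v. gen (\<omega> x v) (f x))"
  shows "act (inv (D x)) (f x) = act (inv (D (y::'l))) (f y)"
proof (rule tmap_zero_constant[OF L mP conn])
  fix x
  obtain I where I: "has_tmap (atlas G) (atlas G) UNIV (ginv G) (D x) I" using smooth_map_has_tmap[OF mf smooth_inv] by blast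
  have "has_tmap L (atlas G) UNIV (\<lambda>x. inv (D x)) x (\<lambda>v. I (dR G (D x) \<e> (\<omega> x v)))"
    by (rule has_tmap_chain[OF L mf D I]) auto
  from has_tmap_act[OF L this f UNIV_I]
  obtain Q where Q: "has_tmap L P UNIV (\<lambda>x. act (inv (D x)) (f x)) x Q" by blast
  have "has_tmap L P UNIV (\<lambda>x. act (D x) (act (inv (D x)) (f x))) x
     (\<lambda>v. gen (\<omega> x v) (f x) + tmap P P (act (D x)) (act (inv (D x)) (f x)) (Q v))"
    using has_tmap_act[OF L D Q UNIV_I] dR_inv[of "D x" \<e>] by simp
  then have "has_tmap L P UNIV f x (\<lambda>v. gen (\<omega> x v) (f x) + tmap P P (act (D x)) (act (inv (D x)) (f x)) (Q v))" by simp
  from fun_cong[OF has_tmap_uniq2[OF L this f]] have "tmap P P (act (D x)) (act (inv (D x)) (f x)) (Q v) = 0" for v by simp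
  then have "Q = (\<lambda>v. 0)" using tmap_act_inj by blast
  then show "has_tmap L P UNIV (\<lambda>x. act (inv (D x)) (f x)) x (\<lambda>v. 0)" using Q by simp
qed

end

section \<open>Dressing actions\<close>

text \<open>The differential of \<sigma> h at u, with left trivializations at u and at \<sigma> h
  u.\<close>

definition twist_tmap ::
  "('b, 'w::real_normed_vector, 'z) lie_group_scheme \<Rightarrow> ('a \<Rightarrow> 'b \<Rightarrow> 'b) \<Rightarrow> 'a \<Rightarrow> 'b \<Rightarrow> 'w \<Rightarrow>\<^sub>L 'w" where
  "twist_tmap B \<sigma> h u = tmap (atlas B) (atlas B) (\<lambda>y. gmult B (ginv B (\<sigma> h u)) (\<sigma> h (gmult B u y))) (gone B)"

text \<open>What the uniqueness argument needs about a dressing action. \<open>twist\<close>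
  expresses multiplicativity of the bivector of B on the generators; \<open>link\<close> says that
  the generators, linearized at the unit, give the bracket of A by duality.\<close>

locale dressing = A: lie_action A "atlas B" \<sigma> + coadjoint p B
  for A :: "('a::topological_space, 'v::real_inner, 'y) lie_group_scheme"
    and B :: "('b::topological_space, 'w::real_inner, 'z) lie_group_scheme"
    and \<sigma> :: "'a \<Rightarrow> 'b \<Rightarrow> 'b" and p :: "'v \<Rightarrow> 'w \<Rightarrow> real" +
  assumes connA: "connected (UNIV :: 'a set)"
    and twist: "generator A (atlas B) (\<lambda>g. \<sigma> g (gmult B a b)) \<xi> =
      dR B b a (generator A (atlas B) (\<lambda>g. \<sigma> g a) \<xi>) + dL B a b (generator A (atlas B) (\<lambda>g. \<sigma> g b) (coad p B a \<xi>))"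
    and link: "p \<xi>' (frechet_derivative (vf_loc (atlas B) (\<lambda>b. generator A (atlas B) (\<lambda>g. \<sigma> g b) \<xi>) (gone B))
        (at (chart_at (atlas B) (gone B) (gone B))) w) = p (lie_bracket A \<xi> \<xi>') w"
begin

abbreviation T where "T h u \<equiv> twist_tmap B \<sigma> h u"

lemma gen_one: "A.gen \<xi> (gone B) = 0"
  using twist[of "gone B" "gone B" \<xi>] by simp

text \<open>All generators vanish at the unit, so the constant map there has the logarithmic
  derivative of the orbit, and A is connected.\<close>

lemma fix_one: "\<sigma> h (gone B) = gone B"
proof -
  have 1: "has_tmap (atlas A) (atlas A) UNIV (\<lambda>x. x) x (\<lambda>v. dR A x (gone A) (dR A (ginv A x) x v))" for x
    using has_tmap_ident[OF A.mf UNIV_I, of x] by (simp add: A.dR_rlog)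
  have 2: "has_tmap (atlas A) (atlas B) UNIV (\<lambda>x. gone B) x (\<lambda>v. A.gen (dR A (ginv A x) x v) (gone B))" for x
    unfolding gen_one by (rule has_tmap_const[OF mf])
  have "\<sigma> (ginv A h) (gone B) = \<sigma> (ginv A (gone A)) (gone B)" by (rule A.integrate[OF A.mf connA 1 2])
  then have "\<sigma> h (\<sigma> (ginv A h) (gone B)) = \<sigma> h (gone B)" by simp
  then show ?thesis by simp
qed

lemma smooth_quotient:
  "smooth_map (prod_atlas (prod_atlas (atlas A) (atlas B)) (atlas B)) (atlas B)
     (\<lambda>(x, y). gmult B (ginv B (\<sigma> (fst x) (snd x))) (\<sigma> (fst x) (gmult B (snd x) y)))"
proof -
  note P = manifold_prod[OF A.mf mf] and P2 = manifold_prod[OF manifold_prod[OF A.mf mf] mf]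
  have s1: "smooth_map (prod_atlas (prod_atlas (atlas A) (atlas B)) (atlas B)) (atlas A) (\<lambda>z. fst (fst z))"
    by (rule smooth_map_on_compose[OF P2 P smooth_map_on_fst smooth_map_on_fst[where S = UNIV]]) auto
  have s2: "smooth_map (prod_atlas (prod_atlas (atlas A) (atlas B)) (atlas B)) (atlas B) (\<lambda>z. snd (fst z))"
    by (rule smooth_map_on_compose[OF P2 P smooth_map_on_fst smooth_map_on_snd[where S = UNIV]]) auto
  have "smooth_map (prod_atlas (prod_atlas (atlas A) (atlas B)) (atlas B)) (atlas B)
     (\<lambda>z. gmult B (ginv B (\<sigma> (fst (fst z)) (snd (fst z)))) (\<sigma> (fst (fst z)) (gmult B (snd (fst z)) (snd z))))"
    by (intro smooth_map_mult[OF P2] smooth_map_inv[OF P2] smooth_map_on_compose2[OF P2 A.mf mf A.smooth_act] s1 s2 smooth_map_on_snd)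
  then show ?thesis by (simp add: case_prod_unfold)
qed

lemma continuous_T: "continuous_on UNIV (\<lambda>(h, u). T h u)"
proof (rule continuous_blinfunI[OF manifold_fin_dim[OF mf]])
  fix v
  note P = manifold_prod[OF A.mf mf]
  have "smooth_map (prod_atlas (atlas A) (atlas B)) model
     (\<lambda>x. tmap (atlas B) (atlas B) (\<lambda>y. gmult B (ginv B (\<sigma> (fst x) (snd x))) (\<sigma> (fst x) (gmult B (snd x) y))) (gone B) v)"
    by (rule smooth_parameter_tmap[OF P mf mf smooth_quotient, of "gone B" "gone B"]) (simp add: left_inverse)
  from smooth_map_on_continuous_on[OF P manifold_model[OF manifold_fin_dim[OF mf]] this]
  show "continuous_on UNIV (\<lambda>x. (case x of (h, u) \<Rightarrow> T h u) v)" by (simp add: twist_tmap_def case_prod_unfold)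
qed

lemma smooth_quotient1: "smooth_map (prod_atlas (atlas A) (atlas B)) (atlas B) (\<lambda>(k, y). gmult B (ginv B (\<sigma> k a)) (\<sigma> k (gmult B a y)))"
proof -
  note P = manifold_prod[OF A.mf mf]
  have "smooth_map (prod_atlas (atlas A) (atlas B)) (atlas B) (\<lambda>z. gmult B (ginv B (\<sigma> (fst z) a)) (\<sigma> (fst z) (gmult B a (snd z))))"
    by (intro smooth_map_mult[OF P] smooth_map_inv[OF P] smooth_map_on_compose2[OF P A.mf mf A.smooth_act]
        smooth_map_on_fst smooth_map_on_snd smooth_map_on_const mf)
  then show ?thesis by (simp add: case_prod_unfold)
qed

lemma has_tmap_T: "has_tmap (atlas B) (atlas B) UNIV (\<lambda>y. gmult B (ginv B (\<sigma> h u)) (\<sigma> h (gmult B u y))) (gone B) (T h u)"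
  unfolding twist_tmap_def by (rule smooth_map_has_tmap[OF mf]) (use smooth_map_slices(2)[OF A.mf mf mf smooth_quotient1] in simp)

lemma T_one: "T (gone A) u v = v"
proof -
  have "has_tmap (atlas B) (atlas B) UNIV (\<lambda>y. y) (gone B) (T (gone A) u)" using has_tmap_T[of "gone A" u] by simp
  from has_tmap_uniq2[OF mf this has_tmap_ident[OF mf UNIV_I]] show ?thesis by (rule fun_cong)
qed

text \<open>Cocycle identity: the chain rule for \<sigma> k \<circ> \<sigma> h in left
  trivializations.\<close>

lemma T_mult: "T (gmult A k h) u v = T k (\<sigma> h u) (T h u v)"
proof -
  have T: "has_tmap (atlas B) (atlas B) UNIV (\<lambda>y. gmult B (ginv B (\<sigma> k (\<sigma> h u))) (\<sigma> k (gmult B (\<sigma> h u) y)))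
      (gmult B (ginv B (\<sigma> h u)) (\<sigma> h (gmult B u (gone B)))) (T k (\<sigma> h u))" using has_tmap_T by (simp add: left_inverse)
  have "has_tmap (atlas B) (atlas B) UNIV (\<lambda>y. gmult B (ginv B (\<sigma> k (\<sigma> h u))) (\<sigma> k (gmult B (\<sigma> h u) (gmult B (ginv B (\<sigma> h u)) (\<sigma> h (gmult B u y))))))
     (gone B) (\<lambda>v. T k (\<sigma> h u) (T h u v))"
    by (rule has_tmap_chain[OF mf mf has_tmap_T T]) auto
  then have "has_tmap (atlas B) (atlas B) UNIV (\<lambda>y. gmult B (ginv B (\<sigma> (gmult A k h) u)) (\<sigma> (gmult A k h) (gmult B u y)))
     (gone B) (\<lambda>v. T k (\<sigma> h u) (T h u v))" by (simp add: A.act_mult)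
  from has_tmap_uniq2[OF mf has_tmap_T this] show ?thesis by (rule fun_cong)
qed

text \<open>By \<open>twist\<close>, the infinitesimal field of the maps y \<mapsto> (\<sigma> k
  a)^-1 (\<sigma> k (a y)) at neutral k is the generator of the coadjoint transform of \<xi>. These
  maps fix the unit, so \<open>derivative_of_parameter_tmap\<close> applies.\<close>

lemma has_tmap_T_one:
  "has_tmap (atlas A) model UNIV (\<lambda>k. T k a v) (gone A)
     (\<lambda>\<xi>. frechet_derivative (vf_loc (atlas B) (A.gen (coad p B a \<xi>)) (gone B)) (at (chart_at (atlas B) (gone B) (gone B))) v)"
proof -
  let ?f = "\<lambda>k y. gmult B (ginv B (\<sigma> k a)) (\<sigma> k (gmult B a y))"
  have X: "tmap (atlas A) (atlas B) (\<lambda>k. ?f k y) (gone A) \<xi> = A.gen (coad p B a \<xi>) y" for y \<xi>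
  proof -
    obtain Q where Q: "has_tmap (atlas A) (atlas B) UNIV (\<lambda>k. ?f k y) (gone A) Q"
      using smooth_map_has_tmap[OF A.mf smooth_map_slices(1)[OF A.mf mf mf smooth_quotient1]] by blast
    have "has_tmap (atlas A) (atlas B) UNIV (\<lambda>k. gmult B (\<sigma> k a) (?f k y)) (gone A)
       (\<lambda>\<xi>. dR B (?f (gone A) y) (\<sigma> (gone A) a) (A.gen \<xi> a) + dL B (\<sigma> (gone A) a) (?f (gone A) y) (Q \<xi>))"
      by (rule has_tmap_mult[OF A.mf A.has_tmap_orbit_one Q UNIV_I])
    then have "has_tmap (atlas A) (atlas B) UNIV (\<lambda>k. \<sigma> k (gmult B a y)) (gone A) (\<lambda>\<xi>. dR B y a (A.gen \<xi> a) + dL B a y (Q \<xi>))"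
      by simp
    from fun_cong[OF has_tmap_uniq2[OF A.mf this A.has_tmap_orbit_one], of \<xi>]
    have "dL B a y (Q \<xi>) = dL B a y (A.gen (coad p B a \<xi>) y)" unfolding twist by simp
    then have "Q \<xi> = A.gen (coad p B a \<xi>) y" by (rule dL_eqD)
    then show ?thesis using has_tmap_unique[OF A.mf Q] by simp
  qed
  have "has_tmap (atlas A) model UNIV (\<lambda>k. tmap (atlas B) (atlas B) (?f k) (gone B) v) (gone A)
     (\<lambda>\<xi>. frechet_derivative (vf_loc (atlas B) (\<lambda>b. tmap (atlas A) (atlas B) (\<lambda>k. ?f k b) (gone A) \<xi>) (gone B)) (at (chart_at (atlas B) (gone B) (gone B))) v)"
    by (rule derivative_of_parameter_tmap[OF A.mf mf smooth_quotient1]) (simp_all add: left_inverse)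
  then show ?thesis unfolding X twist_tmap_def by simp
qed

end

text \<open>\<open>A\<close> acts on \<open>B\<close> from the left and \<open>B\<close> acts on \<open>A\<close> from the right.  Passing to opposite groups turns the latter into a left action and makes the situation symmetric.\<close>

locale matched = d1: dressing A B \<sigma> p + d2: dressing "op_group B" "op_group A" \<rho> "\<lambda>w \<xi>. p \<xi> w"
  for A :: "('a::topological_space, 'v::real_inner, 'y) lie_group_scheme"
    and B :: "('b::topological_space, 'w::real_inner, 'z) lie_group_scheme"
    and \<sigma> :: "'a \<Rightarrow> 'b \<Rightarrow> 'b" and \<rho> :: "'b \<Rightarrow> 'a \<Rightarrow> 'a" and p :: "'v \<Rightarrow> 'w \<Rightarrow> real"

lemma matched_swap: "matched A B \<sigma> \<rho> p \<Longrightarrow> matched (op_group B) (op_group A) \<rho> \<sigma> (\<lambda>w \<xi>. p \<xi> w)"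
  unfolding matched_def by simp

text \<open>Vanishes exactly when the left trivialized differential of \<sigma> h at u is the
  coadjoint operator of \<rho> u h. Composing with the inverse operator, instead of subtracting the
  operator, makes the derivative in h linear in the mirror defect alone.\<close>

definition defect where
  "defect p A B \<sigma> \<rho> h u = (coad (\<lambda>w \<xi>. p \<xi> w) (op_group A) (ginv A (\<rho> u h)) o\<^sub>L twist_tmap B \<sigma> h u) - id_blinfun"

context matched
begin

abbreviation "\<kappa>1 \<equiv> coad p B"
abbreviation "\<kappa>2 \<equiv> coad (\<lambda>w \<xi>. p \<xi> w) (op_group A)"

text \<open>\<open>link\<close> rewritten with the opposite group of A: the sign in
  \<open>dcoad\<close> cancels the sign of the opposite bracket.\<close>

lemma generator_derivative:
  "frechet_derivative (vf_loc (atlas B) (d1.A.gen \<zeta>) (gone B)) (at (chart_at (atlas B) (gone B) (gone B))) w = d2.dcoad \<zeta> w"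
proof (rule d2.eqI)
  fix \<xi>
  show "p \<xi> (frechet_derivative (vf_loc (atlas B) (d1.A.gen \<zeta>) (gone B)) (at (chart_at (atlas B) (gone B) (gone B))) w) = p \<xi> (d2.dcoad \<zeta> w)"
    unfolding d1.link d2.dcoad_apply by (simp add: d1.A.lie_bracket_op d1.p.minus_left)
qed

text \<open>Product rule for the operator of \<rho> and the differential of \<sigma>. The former
  contributes the mirror differential with a minus sign, the latter the coadjoint operator of
  \<sigma> h u; their difference is the mirror defect up to sign and an invertible factor.\<close>

lemma has_tmap_defect:
  "has_tmap (atlas A) model UNIV (\<lambda>k. defect p A B \<sigma> \<rho> (gmult A k h) u v) (gone A)
     (\<lambda>\<xi>. - \<kappa>2 (ginv A (\<rho> u h)) (d2.dcoad (\<kappa>1 (\<sigma> h u) (defect (\<lambda>w \<xi>. p \<xi> w) (op_group B) (op_group A) \<rho> \<sigma> u h \<xi>)) (twist_tmap B \<sigma> h u v)))"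
proof -
  let ?a = "\<sigma> h u" and ?b = "\<rho> u h"
  let ?T1 = "twist_tmap B \<sigma>" and ?T2 = "twist_tmap (op_group A) \<rho>"
  let ?v = "?T1 h u v"
  \<comment> \<open>The position of \<rho> u (k h) relative to \<rho> u h. Its differential at the
    unit is by definition the mirror of \<open>twist_tmap\<close>, and splitting it off leaves an
    outer operator that does not depend on k.\<close>
  define n where "n = (\<lambda>k. gmult A (\<rho> u (gmult A k h)) (ginv A ?b))"
  have n1: "n (gone A) = gone A" by (simp add: n_def d1.A.right_inverse)
  have n: "has_tmap (atlas A) (atlas A) UNIV n (gone A) (?T2 u h)"
    using d2.has_tmap_T[of u h] by (simp add: n_def)
  have inv_n: "has_tmap (atlas A) (atlas A) UNIV (\<lambda>k. ginv A (n k)) (gone A) (\<lambda>\<xi>. - ?T2 u h \<xi>)"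
    by (rule has_tmap_chain[OF d1.A.mf d1.A.mf n]) (use d1.A.has_tmap_inv_one n1 in auto)
  have c1: "has_tmap (atlas A) model UNIV (\<lambda>k. \<kappa>2 k c) (ginv A (n (gone A))) (\<lambda>\<xi>. d2.dcoad \<xi> c)" for c
    using d2.has_tmap_coad_one[of c] n1 by simp
  have K: "has_tmap (atlas A) model UNIV (\<lambda>k. \<kappa>2 (ginv A (n k)) c) (gone A) (\<lambda>\<xi>. d2.dcoad (- ?T2 u h \<xi>) c)" for c
    by (rule has_tmap_chain[OF d1.A.mf d1.A.mf inv_n c1]) auto
  have W: "has_tmap (atlas A) model UNIV (\<lambda>k. ?T1 k ?a ?v) (gone A) (\<lambda>\<xi>. d2.dcoad (\<kappa>1 ?a \<xi>) ?v)"
    using d1.has_tmap_T_one[of ?a ?v] unfolding generator_derivative .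
  have "has_tmap (atlas A) model UNIV (\<lambda>k. \<kappa>2 (ginv A (n k)) (?T1 k ?a ?v)) (gone A)
     (\<lambda>\<xi>. d2.dcoad (- ?T2 u h \<xi>) (?T1 (gone A) ?a ?v) + \<kappa>2 (ginv A (n (gone A))) (d2.dcoad (\<kappa>1 ?a \<xi>) ?v))"
    by (rule has_tmap_apply[OF d1.fin_dim(2) _ _ K W chart_inv_chart_self[OF d1.A.mf]])
       (rule bounded_linear.linear[OF blinfun.bounded_linear_right], rule d2.dcoad_linear(1))
  then have "has_tmap (atlas A) model UNIV (\<lambda>k. \<kappa>2 (ginv A (n k)) (?T1 k ?a ?v)) (gone A)
     (\<lambda>\<xi>. d2.dcoad (\<kappa>1 ?a \<xi> - ?T2 u h \<xi>) ?v)"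
    using d2.coad_one by (simp add: n1 d1.T_one linear_diff[OF d2.dcoad_linear(2)] linear_neg[OF d2.dcoad_linear(2)])
  then have "has_tmap (atlas A) model UNIV (\<lambda>k. \<kappa>2 (ginv A ?b) (\<kappa>2 (ginv A (n k)) (?T1 k ?a ?v)) - v) (gone A)
     (\<lambda>\<xi>. \<kappa>2 (ginv A ?b) (d2.dcoad (\<kappa>1 ?a \<xi> - ?T2 u h \<xi>) ?v))"
    unfolding has_tmap_to_model_iff
    by (drule_tac bounded_linear.has_derivative[OF blinfun.bounded_linear_right[of "\<kappa>2 (ginv A ?b)"]],
        drule_tac has_derivative_diff[OF _ has_derivative_const[of v]]) simp
  moreover have "\<kappa>2 (ginv A ?b) (\<kappa>2 (ginv A (n k)) (?T1 k ?a ?v)) - v = defect p A B \<sigma> \<rho> (gmult A k h) u v" for k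
    using d2.coad_mult[of "ginv A (n k)" "ginv A ?b" "?T1 k ?a ?v"]
    by (simp add: defect_def blinfun.diff_left d1.T_mult n_def)
  moreover have "\<kappa>2 (ginv A ?b) (d2.dcoad (\<kappa>1 ?a \<xi> - ?T2 u h \<xi>) ?v)
     = - \<kappa>2 (ginv A ?b) (d2.dcoad (\<kappa>1 ?a (defect (\<lambda>w \<xi>. p \<xi> w) (op_group B) (op_group A) \<rho> \<sigma> u h \<xi>)) ?v)" for \<xi>
  proof -
    have "\<kappa>1 ?a (defect (\<lambda>w \<xi>. p \<xi> w) (op_group B) (op_group A) \<rho> \<sigma> u h \<xi>) = - (\<kappa>1 ?a \<xi> - ?T2 u h \<xi>)"
      by (simp add: defect_def blinfun.diff_left blinfun.diff_right)
    then show ?thesis by (simp only: linear_neg[OF d2.dcoad_linear(2)] blinfun.minus_right minus_minus)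
  qed
  ultimately show ?thesis by simp
qed

lemma continuous_action: "continuous_on UNIV (\<lambda>(h, u). \<sigma> h u)"
  by (rule smooth_map_on_continuous_on[OF manifold_prod[OF d1.A.mf d1.mf] d1.mf d1.A.smooth_act])

lemma continuous_action2: "continuous_on UNIV (\<lambda>(h, u). \<rho> u h)"
proof -
  have "continuous_on UNIV (\<lambda>(u, h). \<rho> u h)"
    using smooth_map_on_continuous_on[OF manifold_prod[OF d2.A.mf d2.mf] d2.mf d2.A.smooth_act] .
  from continuous_on_compose2[OF this continuous_on_swap] show ?thesis by (simp add: case_prod_unfold prod.swap_def)
qed

lemma continuous_defect: "continuous_on UNIV (\<lambda>(h, u). defect p A B \<sigma> \<rho> h u)"
proof -
  have i: "continuous_on UNIV (ginv A)" by (rule smooth_map_on_continuous_on[OF d1.A.mf d1.A.mf d1.A.smooth_inv])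
  have "continuous_on UNIV (\<lambda>x. \<kappa>2 (ginv A (\<rho> (snd x) (fst x))))"
    by (rule continuous_on_compose2[OF d2.continuous_coad continuous_on_compose2[OF i]])
      (use continuous_action2 in \<open>auto simp: case_prod_unfold\<close>)
  moreover have "continuous_on UNIV (\<lambda>x. twist_tmap B \<sigma> (fst x) (snd x))" using d1.continuous_T by (simp add: case_prod_unfold)
  ultimately have "continuous_on UNIV (\<lambda>x. (\<kappa>2 (ginv A (\<rho> (snd x) (fst x))) o\<^sub>L twist_tmap B \<sigma> (fst x) (snd x)) - id_blinfun)"
    by (intro continuous_on_diff bounded_bilinear.continuous_on[OF bounded_bilinear_blinfun_compose] continuous_on_const)
  then show ?thesis by (simp add: defect_def case_prod_unfold)
qed

lemma defect_estimate:
  obtains k where "continuous_on UNIV (\<lambda>(h, u). k h u :: real)"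
    "\<And>h u \<eta>. \<exists>D. has_tmap (atlas A) model UNIV (\<lambda>k. defect p A B \<sigma> \<rho> (gmult A k h) u \<eta>) (gone A) D
      \<and> (\<forall>\<xi>. norm (D \<xi>) \<le> k h u * norm (defect (\<lambda>w \<xi>. p \<xi> w) (op_group B) (op_group A) \<rho> \<sigma> u h) * norm \<eta> * norm \<xi>)"
proof -
  obtain K where K: "K \<ge> 0" "\<And>\<xi> w. norm (d2.dcoad \<xi> w) \<le> K * norm \<xi> * norm w"
    by (rule bilinear_bounded_fin_dim[OF d1.fin_dim d2.dcoad_linear(1) d2.dcoad_linear(2)]) blast
  define k where "k = (\<lambda>h u. norm (\<kappa>2 (ginv A (\<rho> u h))) * (K * norm (\<kappa>1 (\<sigma> h u)) * norm (twist_tmap B \<sigma> h u)))"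
  have i: "continuous_on UNIV (ginv A)" by (rule smooth_map_on_continuous_on[OF d1.A.mf d1.A.mf d1.A.smooth_inv])
  have 1: "continuous_on UNIV (\<lambda>x. \<kappa>2 (ginv A (\<rho> (snd x) (fst x))))"
    by (rule continuous_on_compose2[OF d2.continuous_coad continuous_on_compose2[OF i]])
      (use continuous_action2 in \<open>auto simp: case_prod_unfold\<close>)
  have 2: "continuous_on UNIV (\<lambda>x. \<kappa>1 (\<sigma> (fst x) (snd x)))"
    by (rule continuous_on_compose2[OF d1.continuous_coad]) (use continuous_action in \<open>auto simp: case_prod_unfold\<close>)
  have 3: "continuous_on UNIV (\<lambda>x. twist_tmap B \<sigma> (fst x) (snd x))" using d1.continuous_T by (simp add: case_prod_unfold)
  have "continuous_on UNIV (\<lambda>(h, u). k h u)"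
    unfolding k_def case_prod_unfold by (intro continuous_on_mult continuous_on_norm continuous_on_const 1 2 3)
  moreover have "\<exists>D. has_tmap (atlas A) model UNIV (\<lambda>k. defect p A B \<sigma> \<rho> (gmult A k h) u \<eta>) (gone A) D
      \<and> (\<forall>\<xi>. norm (D \<xi>) \<le> k h u * norm (defect (\<lambda>w \<xi>. p \<xi> w) (op_group B) (op_group A) \<rho> \<sigma> u h) * norm \<eta> * norm \<xi>)" for h u \<eta>
  proof (intro exI conjI allI)
    show "has_tmap (atlas A) model UNIV (\<lambda>k. defect p A B \<sigma> \<rho> (gmult A k h) u \<eta>) (gone A)
     (\<lambda>\<xi>. - \<kappa>2 (ginv A (\<rho> u h)) (d2.dcoad (\<kappa>1 (\<sigma> h u) (defect (\<lambda>w \<xi>. p \<xi> w) (op_group B) (op_group A) \<rho> \<sigma> u h \<xi>)) (twist_tmap B \<sigma> h u \<eta>)))"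
      by (rule has_tmap_defect)
    fix \<xi>
    let ?D = "defect (\<lambda>w \<xi>. p \<xi> w) (op_group B) (op_group A) \<rho> \<sigma> u h" and ?T = "twist_tmap B \<sigma> h u"
    have "norm (\<kappa>1 (\<sigma> h u) (?D \<xi>)) \<le> norm (\<kappa>1 (\<sigma> h u)) * (norm ?D * norm \<xi>)"
      by (rule order_trans[OF norm_blinfun mult_left_mono[OF norm_blinfun]]) simp
    then have "K * norm (\<kappa>1 (\<sigma> h u) (?D \<xi>)) * norm (?T \<eta>) \<le> K * (norm (\<kappa>1 (\<sigma> h u)) * (norm ?D * norm \<xi>)) * (norm ?T * norm \<eta>)"
      using K(1) by (intro mult_mono norm_blinfun) auto
    then have "norm (d2.dcoad (\<kappa>1 (\<sigma> h u) (?D \<xi>)) (?T \<eta>)) \<le> K * (norm (\<kappa>1 (\<sigma> h u)) * (norm ?D * norm \<xi>)) * (norm ?T * norm \<eta>)"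
      using K(2) order_trans by blast
    then have "norm (\<kappa>2 (ginv A (\<rho> u h)) (d2.dcoad (\<kappa>1 (\<sigma> h u) (?D \<xi>)) (?T \<eta>)))
      \<le> norm (\<kappa>2 (ginv A (\<rho> u h))) * (K * (norm (\<kappa>1 (\<sigma> h u)) * (norm ?D * norm \<xi>)) * (norm ?T * norm \<eta>))"
      by (intro order_trans[OF norm_blinfun mult_left_mono]) auto
    then show "norm (- \<kappa>2 (ginv A (\<rho> u h)) (d2.dcoad (\<kappa>1 (\<sigma> h u) (?D \<xi>)) (?T \<eta>))) \<le> k h u * norm ?D * norm \<eta> * norm \<xi>"
      by (simp add: k_def mult_ac)
  qed
  ultimately show thesis using that by blast
qed

lemma defect_init: "defect p A B \<sigma> \<rho> (gone A) u = 0"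
proof (rule blinfun_eqI)
  fix v
  have "\<rho> u (gone A) = gone A" using d2.fix_one[of u] by simp
  then show "defect p A B \<sigma> \<rho> (gone A) u v = blinfun_apply 0 v"
    using d2.coad_one[of v] by (simp add: defect_def blinfun.diff_left d1.T_one)
qed

end

text \<open>The equation of the mirror defect is that of the defect in the swapped situation;
  swapping twice returns to the original, because \<open>op_group\<close> is an involution.\<close>

lemma (in matched) defects_vanish:
  "defect p A B \<sigma> \<rho> h u = 0" "defect (\<lambda>w \<xi>. p \<xi> w) (op_group B) (op_group A) \<rho> \<sigma> u h = 0"
proof -
  interpret s: matched "op_group B" "op_group A" \<rho> \<sigma> "\<lambda>w \<xi>. p \<xi> w" by (rule matched_swap[OF matched_axioms])
  let ?F1 = "defect p A B \<sigma> \<rho>" and ?F2 = "\<lambda>h u. defect (\<lambda>w \<xi>. p \<xi> w) (op_group B) (op_group A) \<rho> \<sigma> u h"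
  obtain k1 where k1: "continuous_on UNIV (\<lambda>(h, u). k1 h u :: real)"
    "\<And>h u \<eta>. \<exists>D. has_tmap (atlas A) model UNIV (\<lambda>k. ?F1 (gmult A k h) u \<eta>) (gone A) D
      \<and> (\<forall>\<xi>. norm (D \<xi>) \<le> k1 h u * norm (?F2 h u) * norm \<eta> * norm \<xi>)" by (rule defect_estimate) blast
  obtain k2 where k2: "continuous_on UNIV (\<lambda>(h, u). k2 h u :: real)"
    "\<And>h u \<eta>. \<exists>D. has_tmap (atlas (op_group B)) model UNIV (\<lambda>k. defect (\<lambda>w \<xi>. p \<xi> w) (op_group B) (op_group A) \<rho> \<sigma> (gmult (op_group B) k h) u \<eta>) (gone (op_group B)) D
      \<and> (\<forall>\<xi>. norm (D \<xi>) \<le> k2 h u * norm (defect (\<lambda>w \<xi>. p w \<xi>) (op_group (op_group A)) (op_group (op_group B)) \<sigma> \<rho> u h) * norm \<eta> * norm \<xi>)" by (rule s.defect_estimate) blast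
  have ck: "continuous_on UNIV (\<lambda>(h, u). k2 u h)"
    using continuous_on_compose2[OF k2(1) continuous_on_swap] by (simp add: case_prod_unfold prod.swap_def)
  have cF: "continuous_on UNIV (\<lambda>(h, u). ?F2 h u)"
    using continuous_on_compose2[OF s.continuous_defect continuous_on_swap] by (simp add: case_prod_unfold prod.swap_def)
  have k2': "\<exists>D. has_tmap (atlas (op_group B)) model UNIV (\<lambda>k. ?F2 h (gmult (op_group B) k u) \<eta>) (gone (op_group B)) D
      \<and> (\<forall>\<xi>. norm (D \<xi>) \<le> k2 u h * norm (?F1 h u) * norm \<eta> * norm \<xi>)" for h u \<eta>
    using k2(2)[of u h \<eta>] by simp
  have i2: "?F2 h (gone (op_group B)) = 0" for h using s.defect_init by simp
  note G = goursat_uniqueness[OF d1.A.lie_group d2.A.lie_group d1.connA d2.connA continuous_defect cF k1(1) ck k1(2) k2' defect_init i2]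
  show "?F1 h u = 0" "?F2 h u = 0" by (rule G)+
qed

text \<open>The infinitesimal form of \<open>\<rho>\<^sub>u(k h) = \<rho>\<^bsub>\<sigma>\<^sub>h(u)\<^esub>(k) \<rho>\<^sub>u(h)\<close>.\<close>

lemma (in matched) has_tmap_right_action:
  "has_tmap (atlas A) (atlas A) UNIV (\<rho> u) h (\<lambda>v. dR A (\<rho> u h) (gone A) (\<kappa>1 (\<sigma> h u) (dR A (ginv A h) h v)))"
proof -
  have T: "twist_tmap (op_group A) \<rho> u h \<xi> = \<kappa>1 (\<sigma> h u) \<xi>" for \<xi>
  proof -
    have "coad p B (ginv B (\<sigma> h u)) (twist_tmap (op_group A) \<rho> u h \<xi>) = \<xi>"
      using arg_cong[OF defects_vanish(2)[of u h], of "\<lambda>D. blinfun_apply D \<xi>"] by (simp add: defect_def blinfun.diff_left)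
    then have "\<kappa>1 (\<sigma> h u) (coad p B (ginv B (\<sigma> h u)) (twist_tmap (op_group A) \<rho> u h \<xi>)) = \<kappa>1 (\<sigma> h u) \<xi>" by simp
    then show ?thesis by simp
  qed
  have n: "has_tmap (atlas A) (atlas A) UNIV (\<lambda>k. gmult A (\<rho> u (gmult A k h)) (ginv A (\<rho> u h))) (gone A) (\<kappa>1 (\<sigma> h u))"
    using d2.has_tmap_T[of u h] T by (simp add: T[abs_def])
  have R: "has_tmap (atlas A) (atlas A) UNIV (\<lambda>k. gmult A k (ginv A h)) h (dR A (ginv A h) h)" by (rule d1.A.has_tmap_R)
  have 1: "has_tmap (atlas A) (atlas A) UNIV (\<lambda>k. gmult A (\<rho> u (gmult A (gmult A k (ginv A h)) h)) (ginv A (\<rho> u h))) h (\<lambda>v. \<kappa>1 (\<sigma> h u) (dR A (ginv A h) h v))"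
    by (rule has_tmap_chain[OF d1.A.mf d1.A.mf R]) (use n in \<open>auto simp: d1.A.right_inverse\<close>)
  have "has_tmap (atlas A) (atlas A) UNIV (\<lambda>k. gmult A (gmult A (\<rho> u (gmult A (gmult A k (ginv A h)) h)) (ginv A (\<rho> u h))) (\<rho> u h)) h
      (\<lambda>v. dR A (\<rho> u h) (gone A) (\<kappa>1 (\<sigma> h u) (dR A (ginv A h) h v)))"
    by (rule has_tmap_chain[OF d1.A.mf d1.A.mf 1]) (use d1.A.has_tmap_R[of "\<rho> u h" "gone A"] in \<open>auto simp: d1.A.right_inverse\<close>)
  then show ?thesis by simp
qed

section \<open>Multiplicative bivectors\<close>

lemma sharp_apply:
  assumes "fin_dim TYPE('v::real_inner)" "bounded_bilinear (\<pi> q :: ('v \<Rightarrow>\<^sub>L real) \<Rightarrow> ('v \<Rightarrow>\<^sub>L real) \<Rightarrow> real)"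
  shows "blinfun_apply \<beta> (sharp \<pi> q \<alpha>) = \<pi> q \<alpha> \<beta>"
proof -
  have "linear (\<pi> q \<alpha>)" by (rule bounded_linear.linear[OF bounded_bilinear.bounded_linear_right[OF assms(2)]])
  from theI'[OF linear_functional_eval[OF assms(1) this]] show ?thesis unfolding sharp_def by blast
qed

text \<open>At a zero of W the derivative of L drops out of the product rule. This serves to
  linearize fundamental fields at the unit.\<close>

lemma has_derivative_apply_zero:
  fixes L :: "'m::real_normed_vector \<Rightarrow> 'a::real_inner \<Rightarrow> 'b::real_normed_vector"
  assumes fd: "fin_dim TYPE('a)" and L: "\<And>x. x \<in> U \<Longrightarrow> linear (L x)" "\<And>c. (\<lambda>x. L x c) differentiable (at x0)" and U: "open U" "x0 \<in> U"
    and W: "(W has_derivative W') (at x0)" "W x0 = 0"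
  shows "((\<lambda>x. L x (W x)) has_derivative (\<lambda>v. L x0 (W' v))) (at x0)"
proof -
  obtain C :: "'a set" where C: "finite C" "\<And>x. (\<Sum>b\<in>C. (x \<bullet> b) *\<^sub>R b) = x" using fin_dimE[OF fd] by metis
  have e: "(\<Sum>c\<in>C. (x \<bullet> c) *\<^sub>R f c) = f x" if "linear f" for f :: "'a \<Rightarrow> 'b" and x
    by (subst (2) C(2)[symmetric]) (simp add: linear_sum[OF that] linear_cmul[OF that])
  have "((\<lambda>x. \<Sum>c\<in>C. (W x \<bullet> c) *\<^sub>R L x c) has_derivative
     (\<lambda>v. \<Sum>c\<in>C. (W x0 \<bullet> c) *\<^sub>R frechet_derivative (\<lambda>x. L x c) (at x0) v + (W' v \<bullet> c) *\<^sub>R L x0 c)) (at x0)"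
    by (intro has_derivative_sum has_derivative_scaleR has_derivative_inner_left W(1) L(2)[unfolded frechet_derivative_works])
  then have "((\<lambda>x. \<Sum>c\<in>C. (W x \<bullet> c) *\<^sub>R L x c) has_derivative (\<lambda>v. L x0 (W' v))) (at x0)"
    by (simp add: W(2) e[OF L(1)[OF U(2)]])
  then show ?thesis by (rule has_derivative_transform_within_open[OF _ U]) (simp add: e[OF L(1)])
qed

context lie_grp
begin

definition multiplicative :: "('g, 'v) bivector_field \<Rightarrow> bool" where
  "multiplicative \<pi> \<longleftrightarrow> (\<forall>q. bounded_bilinear (\<pi> q)) \<and> (\<forall>q \<alpha>. \<pi> q \<alpha> \<alpha> = 0) \<and>
     (\<forall>a b \<alpha> \<beta>. \<pi> (a \<star> b) \<alpha> \<beta> = \<pi> a (\<alpha> o\<^sub>L Blinfun (dR G b a)) (\<beta> o\<^sub>L Blinfun (dR G b a))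
       + \<pi> b (\<alpha> o\<^sub>L Blinfun (dL G a b)) (\<beta> o\<^sub>L Blinfun (dL G a b)))"

lemma Blinfun_dR: "blinfun_apply (Blinfun (dR G h g)) = dR G h g" and Blinfun_dL: "blinfun_apply (Blinfun (dL G h g)) = dL G h g"
  by (rule bounded_linear_Blinfun_apply, rule dR_linear, rule bounded_linear_Blinfun_apply, rule dL_linear)

lemma Blinfun_Ad: "blinfun_apply (Blinfun (Ad G g)) = Ad G g"
  by (rule bounded_linear_Blinfun_apply, rule Ad_linear)

lemma right_inv_form_apply: "right_inv_form G \<xi> q v = \<xi> (dR G (inv q) q v)"
  by (simp add: right_inv_form_def dR_def)

abbreviation fund where "fund \<pi> \<xi> q \<equiv> sharp \<pi> q (right_inv_form G \<xi> q)"

lemma multiplicativeD: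
  assumes "multiplicative \<pi>"
  shows "bounded_bilinear (\<pi> q)" "\<pi> q \<alpha> \<beta> = - \<pi> q \<beta> \<alpha>" "\<pi> \<e> \<alpha> \<beta> = 0"
proof -
  show bb: "bounded_bilinear (\<pi> q)" for q using assms unfolding multiplicative_def by blast
  interpret b: bounded_bilinear "\<pi> q" by (rule bb)
  have alt: "\<pi> q \<gamma> \<gamma> = 0" for \<gamma> using assms unfolding multiplicative_def by blast
  have "\<pi> q (\<alpha> + \<beta>) (\<alpha> + \<beta>) = \<pi> q \<alpha> \<alpha> + \<pi> q \<alpha> \<beta> + \<pi> q \<beta> \<alpha> + \<pi> q \<beta> \<beta>" by (simp add: b.add_left b.add_right)
  then show "\<pi> q \<alpha> \<beta> = - \<pi> q \<beta> \<alpha>" by (simp add: alt)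
  have "\<alpha> o\<^sub>L Blinfun (dR G \<e> \<e>) = \<alpha>" "\<alpha> o\<^sub>L Blinfun (dL G \<e> \<e>) = \<alpha>" for \<alpha> :: "'v \<Rightarrow>\<^sub>L real"
    by (rule blinfun_eqI, simp add: Blinfun_dR Blinfun_dL)+
  then have "\<pi> (\<e> \<star> \<e>) \<alpha> \<beta> = \<pi> \<e> \<alpha> \<beta> + \<pi> \<e> \<alpha> \<beta>" using assms unfolding multiplicative_def by metis
  then show "\<pi> \<e> \<alpha> \<beta> = 0" by simp
qed

lemma fund_apply: "multiplicative \<pi> \<Longrightarrow> blinfun_apply \<beta> (fund \<pi> \<xi> q) = \<pi> q (right_inv_form G \<xi> q) \<beta>"
  by (rule sharp_apply[OF manifold_fin_dim[OF mf] multiplicativeD(1)])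

lemma fund_one: "multiplicative \<pi> \<Longrightarrow> fund \<pi> \<xi> \<e> = 0"
  by (rule covector_eqD) (simp add: fund_apply multiplicativeD(3) blinfun.zero_right)

text \<open>A right invariant form is preserved by right translation with b, whereas left
  translation with a turns it into the right invariant form of the covector composed with
  \<open>Ad G a\<close>. This is the source of \<open>twist\<close>.\<close>

lemma fund_mult:
  assumes \<pi>: "multiplicative \<pi>"
  shows "fund \<pi> \<xi> (a \<star> b) = dR G b a (fund \<pi> \<xi> a) + dL G a b (fund \<pi> (\<xi> o\<^sub>L Blinfun (Ad G a)) b)"
proof (rule covector_eqD)
  fix \<beta>
  have 1: "right_inv_form G \<xi> (a \<star> b) o\<^sub>L Blinfun (dR G b a) = right_inv_form G \<xi> a"
    by (rule blinfun_eqI) (simp add: right_inv_form_apply Blinfun_dR dR_dR)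
  have 2: "right_inv_form G \<xi> (a \<star> b) o\<^sub>L Blinfun (dL G a b) = right_inv_form G (\<xi> o\<^sub>L Blinfun (Ad G a)) b"
  proof (rule blinfun_eqI)
    fix w
    have "Ad G a (dR G (inv b) b w) = dR G (inv b \<star> inv a) (a \<star> b) (dL G a b w)"
      using dL_dR[of a b "inv b" w] dR_dR[of "inv a" "a \<star> b" "inv b" "dL G a b w"] by (simp add: Ad_def right_inverse)
    then show "(right_inv_form G \<xi> (a \<star> b) o\<^sub>L Blinfun (dL G a b)) w = right_inv_form G (\<xi> o\<^sub>L Blinfun (Ad G a)) b w"
      by (simp add: right_inv_form_apply Blinfun_dL Blinfun_Ad)
  qed
  have "blinfun_apply \<beta> (fund \<pi> \<xi> (a \<star> b)) = \<pi> a (right_inv_form G \<xi> a) (\<beta> o\<^sub>L Blinfun (dR G b a))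
     + \<pi> b (right_inv_form G (\<xi> o\<^sub>L Blinfun (Ad G a)) b) (\<beta> o\<^sub>L Blinfun (dL G a b))"
    unfolding fund_apply[OF \<pi>] 1[symmetric] 2[symmetric] using \<pi> unfolding multiplicative_def by blast
  also have "\<dots> = blinfun_apply \<beta> (dR G b a (fund \<pi> \<xi> a) + dL G a b (fund \<pi> (\<xi> o\<^sub>L Blinfun (Ad G a)) b))"
    unfolding fund_apply[OF \<pi>, symmetric] by (simp add: Blinfun_dR Blinfun_dL blinfun.add_right)
  finally show "blinfun_apply \<beta> (fund \<pi> \<xi> (a \<star> b)) = blinfun_apply \<beta> (dR G b a (fund \<pi> \<xi> a) + dL G a b (fund \<pi> (\<xi> o\<^sub>L Blinfun (Ad G a)) b))" .
qed

text \<open>\<pi> vanishes at the unit, hence in each Lie derivative only the linearized field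
  survives. The second Lie derivative cancels against the differential of \<pi> evaluated on the two
  forms, which leaves the linearization of the bivector.\<close>

lemma form1_bracket_one:
  assumes \<pi>: "multiplicative \<pi>"
    and d: "vf_loc (atlas G) (fund \<pi> \<xi>) \<e> differentiable at (chart_at (atlas G) \<e> \<e>)"
      "vf_loc (atlas G) (fund \<pi> \<eta>) \<e> differentiable at (chart_at (atlas G) \<e> \<e>)"
  shows "form1_bracket (atlas G) \<pi> (right_inv_form G \<xi>) (right_inv_form G \<eta>) \<e> v
    = \<eta> (frechet_derivative (vf_loc (atlas G) (fund \<pi> \<xi>) \<e>) (at (chart_at (atlas G) \<e> \<e>)) v)"
proof -
  let ?A = "atlas G" and ?z = "chart_at (atlas G) \<e> \<e>" and ?\<phi> = "chart_inv (atlas G) \<e>"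
  let ?D = "\<lambda>\<xi>. frechet_derivative (vf_loc (atlas G) (fund \<pi> \<xi>) \<e>) (at (chart_at (atlas G) \<e> \<e>))"
  obtain W where W: "open W" "?z \<in> W" "W \<subseteq> chart_at ?A \<e> ` dom_at ?A \<e>" "\<And>\<xi>. smooth_on W (\<lambda>z. rlog G z \<xi>)"
    using rlog_smooth by metis
  have fl: "form1_loc ?A (right_inv_form G \<eta>) \<e> z v = \<eta> (rlog G z v)" for \<eta> z v
    by (simp add: form1_loc_def right_inv_form_apply rlog_def)
  have dfl: "(\<lambda>z. \<eta> (rlog G z v)) differentiable (at ?z)" for \<eta> :: "'v \<Rightarrow>\<^sub>L real" and v
    using bounded_linear.has_derivative[OF blinfun.bounded_linear_right smooth_on_has_derivative[OF W(4,2)]] unfolding differentiable_def by blast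
  have L: "lie_derivative ?A (fund \<pi> \<xi>) (right_inv_form G \<eta>) \<e> v = \<eta> (?D \<xi> v)"
    if d: "vf_loc (atlas G) (fund \<pi> \<xi>) \<e> differentiable at ?z" for \<xi> \<eta> v
  proof -
    have "frechet_derivative (\<lambda>z. \<eta> (rlog G z v)) (at ?z) 0 = 0" for v
      using linear_0[OF linear_frechet_derivative[OF dfl]] .
    then have "lie_derivative ?A (fund \<pi> \<xi>) (right_inv_form G \<eta>) \<e> = Blinfun (\<lambda>v. \<eta> (?D \<xi> v))"
      unfolding lie_derivative_def fl fund_one[OF \<pi>] by (simp add: right_inv_form_apply)
    moreover have "bounded_linear (?D \<xi>)" using d unfolding frechet_derivative_works by (rule has_derivative_bounded_linear)
    ultimately show ?thesis by (simp add: bounded_linear_Blinfun_apply bounded_linear_compose[OF blinfun.bounded_linear_right])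
  qed
  have dd: "has_tmap ?A model UNIV (\<lambda>q. \<pi> q (right_inv_form G \<xi> q) (right_inv_form G \<eta> q)) \<e> (\<lambda>v. \<eta> (?D \<xi> v))"
    if d: "vf_loc (atlas G) (fund \<pi> \<xi>) \<e> differentiable at ?z" for \<xi> \<eta>
  proof -
    have z0: "vf_loc ?A (fund \<pi> \<xi>) \<e> ?z = 0" by (simp add: vf_loc_def chart_inv_chart_self[OF mf] fund_one[OF \<pi>] blinfun.zero_right)
    have "((\<lambda>z. \<eta> (rlog G z (vf_loc ?A (fund \<pi> \<xi>) \<e> z))) has_derivative (\<lambda>v. \<eta> (rlog G ?z (?D \<xi> v)))) (at ?z)"
      by (rule has_derivative_apply_zero[where L = "\<lambda>z v. \<eta> (rlog G z v)" and W = "vf_loc ?A (fund \<pi> \<xi>) \<e>", OF manifold_fin_dim[OF mf] _ dfl open_UNIV UNIV_I _ z0])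
        (use d in \<open>simp_all add: frechet_derivative_works bounded_linear.linear[OF bounded_linear_compose[OF blinfun.bounded_linear_right rlog_linear]]\<close>)
    then have "((\<lambda>z. \<pi> (?\<phi> z) (right_inv_form G \<xi> (?\<phi> z)) (right_inv_form G \<eta> (?\<phi> z))) has_derivative (\<lambda>v. \<eta> (?D \<xi> v))) (at ?z)"
      unfolding rlog_one
    proof (rule has_derivative_transform_within_open[OF _ manifold_chartD(3)[OF mf] chart_in_image[OF mf]])
      fix z assume z: "z \<in> chart_at ?A \<e> ` dom_at ?A \<e>"
      have "rlog G z (vf_loc ?A (fund \<pi> \<xi>) \<e> z) = dR G (inv (?\<phi> z)) (?\<phi> z) (fund \<pi> \<xi> (?\<phi> z))"
        unfolding rlog_def vf_loc_def by (simp add: coframe_frame(2)[OF mf z])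
      then have "\<eta> (rlog G z (vf_loc ?A (fund \<pi> \<xi>) \<e> z)) = right_inv_form G \<eta> (?\<phi> z) (fund \<pi> \<xi> (?\<phi> z))" by (simp add: right_inv_form_apply)
      then show "\<eta> (rlog G z (vf_loc ?A (fund \<pi> \<xi>) \<e> z)) = \<pi> (?\<phi> z) (right_inv_form G \<xi> (?\<phi> z)) (right_inv_form G \<eta> (?\<phi> z))"
        by (simp add: fund_apply[OF \<pi>])
    qed
    from has_derivative_at_withinI[OF this] show ?thesis unfolding has_tmap_to_model_iff .
  qed
  \<comment> \<open>The last term of the bracket is computed twice, once with the roles of the two forms exchanged.\<close>
  have sw: "(\<lambda>q. \<pi> q (right_inv_form G \<xi> q) (right_inv_form G \<eta> q)) = (\<lambda>q. - \<pi> q (right_inv_form G \<eta> q) (right_inv_form G \<xi> q))"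
    by (rule ext) (rule multiplicativeD(2)[OF \<pi>])
  have "has_tmap ?A model UNIV (\<lambda>q. \<pi> q (right_inv_form G \<xi> q) (right_inv_form G \<eta> q)) \<e> (\<lambda>v. - \<xi> (?D \<eta> v))"
    unfolding sw has_tmap_to_model_iff by (rule has_derivative_minus[OF dd[OF d(2), of \<xi>, unfolded has_tmap_to_model_iff]])
  from has_tmap_unique[OF mf this] have "differential ?A (\<lambda>q. \<pi> q (right_inv_form G \<xi> q) (right_inv_form G \<eta> q)) \<e> v = - \<xi> (?D \<eta> v)" by simp
  then show ?thesis
    unfolding form1_bracket_def using L[OF d(1), of \<eta> v] L[OF d(2), of \<xi> v] has_tmap_unique[OF mf dd[OF d(1), of \<eta>]]
    by (simp add: blinfun.diff_left)
qed

end

text \<open>The differential of the multiplication splits into right and left translation, and a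
  product bivector has no cross terms.\<close>

lemma plg_multiplicative:
  assumes "is_poisson_lie_group K"
  shows "lie_grp.multiplicative K (bivector K)"
proof -
  have K: "is_lie_group K" and pb: "bivector_field (atlas K) (bivector K)"
    and pm: "poisson_map (prod_atlas (atlas K) (atlas K)) (prod_bivector (bivector K) (bivector K)) (atlas K) (bivector K) (\<lambda>(g, h). gmult K g h)"
    using assms unfolding is_poisson_lie_group_def poisson_bivector_def by blast+
  interpret lie_grp K by (rule lie_grp.intro[OF K])
  let ?m = "tmap (prod_atlas (atlas K) (atlas K)) (atlas K) (\<lambda>(g, h). gmult K g h)"
  have bl: "bounded_linear (\<lambda>v. (v, 0))" "bounded_linear (\<lambda>v. (0, v))"
    by (intro bounded_linear_Pair bounded_linear_ident bounded_linear_zero)+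
  have m: "has_tmap (prod_atlas (atlas K) (atlas K)) (atlas K) UNIV (\<lambda>(g, h). gmult K g h) (a, b) (?m (a, b))" for a b
    by (rule smooth_map_has_tmap[OF manifold_prod[OF mf mf] smooth_mult])
  have mR: "?m (a, b) (v, 0) = dR K b a v" and mL: "?m (a, b) (0, v) = dL K a b v" for a b v
    using fun_cong[OF has_tmap_uniq2[OF mf has_tmap_two(1)[OF mf mf m] has_tmap_R]]
      fun_cong[OF has_tmap_uniq2[OF mf has_tmap_two(2)[OF mf mf m] has_tmap_L]] by auto
  have "(\<alpha> o\<^sub>L ?m (a, b)) o\<^sub>L Blinfun (\<lambda>v. (v, 0)) = \<alpha> o\<^sub>L Blinfun (dR K b a)"
    "(\<alpha> o\<^sub>L ?m (a, b)) o\<^sub>L Blinfun (\<lambda>v. (0, v)) = \<alpha> o\<^sub>L Blinfun (dL K a b)" for \<alpha> a b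
    by (rule blinfun_eqI; simp add: bounded_linear_Blinfun_apply[OF bl(1)] bounded_linear_Blinfun_apply[OF bl(2)] mR mL Blinfun_dR Blinfun_dL)+
  moreover have "prod_bivector (bivector K) (bivector K) (a, b) (\<alpha> o\<^sub>L ?m (a, b)) (\<beta> o\<^sub>L ?m (a, b)) = bivector K (gmult K a b) \<alpha> \<beta>" for a b \<alpha> \<beta>
    using pm unfolding poisson_map_def by auto
  ultimately have "bivector K (gmult K a b) \<alpha> \<beta> = bivector K a (\<alpha> o\<^sub>L Blinfun (dR K b a)) (\<beta> o\<^sub>L Blinfun (dR K b a))
       + bivector K b (\<alpha> o\<^sub>L Blinfun (dL K a b)) (\<beta> o\<^sub>L Blinfun (dL K a b))" for a b \<alpha> \<beta>
    unfolding prod_bivector_def by (metis (no_types, lifting) case_prod_conv)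
  then show ?thesis using pb unfolding multiplicative_def bivector_field_def by blast
qed

lemma (in lie_grp) multiplicative_op:
  assumes "multiplicative \<pi>"
  shows "lie_grp.multiplicative (op_group G) \<pi>"
proof -
  interpret o: lie_grp "op_group G" by (rule lie_grp.intro[OF lie_op])
  show ?thesis using assms unfolding multiplicative_def o.multiplicative_def dR_op dL_op op_group_simps by (metis add.commute)
qed

lemma (in lie_grp) right_inv_form_op: "right_inv_form (op_group G) \<xi> q = left_inv_form G \<xi> q"
  by (simp add: right_inv_form_def left_inv_form_def)

section \<open>The dressing actions of a complete Poisson-Lie group\<close>

locale dual_plg =
  fixes G :: "('g::topological_space, 'v::real_inner) poisson_lie_group"
    and Gs :: "('h::topological_space, 'w::real_inner) poisson_lie_group"
    and \<iota> :: "'w \<Rightarrow>\<^sub>L 'v \<Rightarrow>\<^sub>L real" and \<sigma> :: "'g \<Rightarrow> 'h \<Rightarrow> 'h" and \<rho> :: "'g \<Rightarrow> 'h \<Rightarrow> 'g"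
  assumes plg: "is_poisson_lie_group G" and conn: "connected (UNIV :: 'g set)" and dual: "is_dual_group G Gs \<iota>"
    and left: "is_left_dressing_action G Gs \<iota> \<sigma>" and right: "is_right_dressing_action G Gs \<iota> \<rho>"
begin

lemma plgs: "is_poisson_lie_group Gs" and conns: "connected (UNIV :: 'h set)"
  and bij: "bij (blinfun_apply \<iota>)" and bracket: "\<iota> (lie_bracket Gs u v) = dual_bracket G (\<iota> u) (\<iota> v)"
  and bracket': "id_transpose \<iota> (lie_bracket G \<xi> \<eta>) = dual_bracket Gs (id_transpose \<iota> \<xi>) (id_transpose \<iota> \<eta>)"
  using dual unfolding is_dual_group_def by blast+

sublocale g: lie_grp G
  by (rule lie_grp.intro) (use plg in \<open>simp add: is_poisson_lie_group_def\<close>)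

sublocale s: lie_grp Gs
  by (rule lie_grp.intro) (use plgs in \<open>simp add: is_poisson_lie_group_def\<close>)

abbreviation pairing where "pairing \<equiv> \<lambda>\<xi> w. \<iota> w \<xi>"

lemma id_transpose_apply: "id_transpose \<iota> \<xi> w = \<iota> w \<xi>"
  unfolding id_transpose_def
  by (rule bounded_linear_Blinfun_apply[THEN fun_cong])
    (rule bounded_linear_compose[OF blinfun.bounded_linear_left blinfun.bounded_linear_right])

text \<open>Both representation properties come from bijectivity of \<iota>, combined with
  reflexivity for functionals on the domain of \<iota>.\<close>

lemma dual_pair: "dual_pair pairing"
  unfolding dual_pair_def
proof (intro conjI allI impI)
  show fd: "fin_dim TYPE('v)" "fin_dim TYPE('w)" by (rule manifold_fin_dim[OF g.mf], rule manifold_fin_dim[OF s.mf])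
  show "bounded_bilinear pairing"
    by (rule bounded_bilinear.flip[OF bounded_bilinear.comp1[OF bounded_bilinear_blinfun_apply blinfun.bounded_linear_right[of \<iota>]]])
  fix \<phi> :: "'v \<Rightarrow> real" assume "linear \<phi>"
  then have b: "bounded_linear \<phi>" by (rule linear_bounded_fin_dim[OF fd(1)])
  obtain w where "\<iota> w = Blinfun \<phi>" using bij unfolding bij_def surj_def by metis
  then show "\<exists>w. \<forall>\<xi>. \<phi> \<xi> = \<iota> w \<xi>" using bounded_linear_Blinfun_apply[OF b] by metis
next
  fix \<phi> :: "'w \<Rightarrow> real" assume l: "linear \<phi>"
  let ?j = "the_inv (blinfun_apply \<iota>)"
  have j: "?j (\<iota> w) = w" "\<iota> (?j \<beta>) = \<beta>" for w \<beta>
    using bij by (simp_all add: bij_is_inj the_inv_f_f bij_is_surj f_the_inv_into_f_bij_betw)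
  have "linear (\<lambda>\<beta>. \<phi> (?j \<beta>))"
  proof (rule linearI)
    fix a b :: "'v \<Rightarrow>\<^sub>L real" and r :: real
    have "?j (a + b) = ?j a + ?j b" using j(1)[of "?j a + ?j b"] by (simp add: blinfun.add_right j(2))
    then show "\<phi> (?j (a + b)) = \<phi> (?j a) + \<phi> (?j b)" by (simp add: linear_add[OF l])
    have "?j (r *\<^sub>R a) = r *\<^sub>R ?j a" using j(1)[of "r *\<^sub>R ?j a"] by (simp add: blinfun.scaleR_right j(2))
    then show "\<phi> (?j (r *\<^sub>R a)) = r *\<^sub>R \<phi> (?j a)" by (simp add: linear_cmul[OF l])
  qed
  from linear_functional_eval[OF manifold_fin_dim[OF g.mf] this] obtain \<xi> where "\<And>\<beta>. blinfun_apply \<beta> \<xi> = \<phi> (?j \<beta>)" by blast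
  then show "\<exists>\<xi>. \<forall>w. \<phi> w = \<iota> w \<xi>" using j(1) by metis
qed

sublocale c1: coadjoint pairing Gs
  by (intro coadjoint.intro dual_pair s.lie_grp_axioms)

sublocale c2: coadjoint "\<lambda>w \<xi>. pairing \<xi> w" "op_group G"
  by (intro coadjoint.intro dual_pair_flip[OF dual_pair] lie_grp.intro g.lie_op)

sublocale c3: coadjoint "\<lambda>w \<xi>. pairing \<xi> w" G
  by (intro coadjoint.intro dual_pair_flip[OF dual_pair] g.lie_grp_axioms)

abbreviation gens where "gens \<xi> a \<equiv> generator G (atlas Gs) (\<lambda>g. \<sigma> g a) \<xi>"
abbreviation genr where "genr u g \<equiv> generator Gs (atlas G) (\<lambda>a. \<rho> g a) u"

lemma gens_eq: "gens \<xi> a = s.fund (bivector Gs) (id_transpose \<iota> \<xi>) a"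
  using left unfolding is_left_dressing_action_def by blast

lemma genr_eq: "genr u g = - c2.fund (bivector G) (\<iota> u) g"
  using right unfolding is_right_dressing_action_def by (simp add: g.right_inv_form_op)

lemma twist_left: "gens \<xi> (gmult Gs a b) = dR Gs b a (gens \<xi> a) + dL Gs a b (gens (coad pairing Gs a \<xi>) b)"
proof -
  have "id_transpose \<iota> \<xi> o\<^sub>L Blinfun (Ad Gs a) = id_transpose \<iota> (coad pairing Gs a \<xi>)"
    by (rule blinfun_eqI) (simp add: id_transpose_apply s.Blinfun_Ad c1.coad_apply)
  then show ?thesis unfolding gens_eq using s.fund_mult[OF plg_multiplicative[OF plgs]] by simp
qed

lemma twist_right: "genr u (gmult (op_group G) a b) = dR (op_group G) b a (genr u a)
   + dL (op_group G) a b (genr (coad (\<lambda>w \<xi>. pairing \<xi> w) (op_group G) a u) b)"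
proof -
  have "\<iota> u o\<^sub>L Blinfun (Ad (op_group G) a) = \<iota> (coad (\<lambda>w \<xi>. pairing \<xi> w) (op_group G) a u)"
    by (rule blinfun_eqI) (simp add: c2.Blinfun_Ad c2.coad_apply)
  then show ?thesis unfolding genr_eq using c2.fund_mult[OF g.multiplicative_op[OF plg_multiplicative[OF plg]], where \<xi> = "\<iota> u" and a = a and b = b]
    by (simp add: c2.dR_uminus c2.dL_uminus)
qed

sublocale l: lie_action G "atlas Gs" \<sigma>
  using left by (intro lie_action.intro lie_action_axioms.intro g.lie_grp_axioms s.mf) (simp add: is_left_dressing_action_def)

lemma smooth_right: "smooth_map (prod_atlas (atlas G) (atlas Gs)) (atlas G) (\<lambda>(g, u). \<rho> g u)"
  and right_one: "\<rho> g (gone Gs) = g" and right_mult: "\<rho> g (gmult Gs u v) = \<rho> (\<rho> g u) v"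
  using right unfolding is_right_dressing_action_def smooth_right_action_def by blast+

sublocale r: lie_action "op_group Gs" "atlas G" "\<lambda>u g. \<rho> g u"
proof (intro lie_action.intro lie_action_axioms.intro lie_grp.intro s.lie_op g.mf)
  note P = manifold_prod[OF s.mf g.mf]
  have "smooth_map (prod_atlas (atlas Gs) (atlas G)) (atlas G) (\<lambda>x. \<rho> (snd x) (fst x))"
    by (rule smooth_map_on_compose2[OF P g.mf s.mf smooth_right smooth_map_on_snd smooth_map_on_fst])
  then show "smooth_left_action (op_group Gs) (atlas G) (\<lambda>u g. \<rho> g u)"
    unfolding smooth_left_action_def by (simp add: case_prod_unfold right_one right_mult)
qed

lemma generator_op: "generator (op_group K) P f \<xi> = generator K P f \<xi>"
  by (simp add: generator_def)

text \<open>The dual bracket of \<open>Gs\<close> is the linearization of its bivector by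
  \<open>form1_bracket_one\<close>, and duality of the Lie bialgebras identifies it with the bracket
  of G.\<close>

lemma link_left:
  "pairing \<xi>' (frechet_derivative (vf_loc (atlas Gs) (gens \<xi>) (gone Gs)) (at (chart_at (atlas Gs) (gone Gs) (gone Gs))) w)
     = pairing (lie_bracket G \<xi> \<xi>') w"
proof -
  have d: "vf_loc (atlas Gs) (s.fund (bivector Gs) (id_transpose \<iota> \<xi>)) (gone Gs) differentiable at (chart_at (atlas Gs) (gone Gs) (gone Gs))" for \<xi>
    unfolding gens_eq[symmetric] generator_def by (rule vf_loc_differentiable[OF g.mf s.mf l.smooth_act]) simp
  have "id_transpose \<iota> (lie_bracket G \<xi> \<xi>') w = id_transpose \<iota> \<xi>' (frechet_derivative (vf_loc (atlas Gs) (gens \<xi>) (gone Gs)) (at (chart_at (atlas Gs) (gone Gs) (gone Gs))) w)"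
    unfolding bracket' dual_bracket_def gens_eq by (rule s.form1_bracket_one[OF plg_multiplicative[OF plgs] d d])
  then show ?thesis by (simp add: id_transpose_apply)
qed

lemma genr_linear: "bounded_linear (\<lambda>u. genr u g)"
  using r.gen_linear[of g] unfolding generator_op .

lemma genr_one: "genr u (gone G) = 0"
  unfolding genr_eq using c2.fund_one[OF g.multiplicative_op[OF plg_multiplicative[OF plg]]] by simp

text \<open>The dual bracket uses right invariant forms, the right dressing action left invariant
  ones. At q they differ by the coadjoint operator of q, and since the generators vanish at the unit
  this factor does not affect the linearization; only the sign of the action remains.\<close>

lemma fund_right_linearized:
  "(vf_loc (atlas G) (g.fund (bivector G) (\<iota> u)) (gone G) has_derivative
     (\<lambda>\<xi>. - frechet_derivative (vf_loc (atlas G) (genr u) (gone G)) (at (chart_at (atlas G) (gone G) (gone G))) \<xi>))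
     (at (chart_at (atlas G) (gone G) (gone G)))"
proof -
  let ?A = "atlas G" and ?z = "chart_at (atlas G) (gone G) (gone G)" and ?\<phi> = "chart_inv (atlas G) (gone G)"
  let ?K = "\<lambda>g. coad (\<lambda>w \<xi>. pairing \<xi> w) G g u"
  have m: "lie_grp.multiplicative (op_group G) (bivector G)" by (rule g.multiplicative_op[OF plg_multiplicative[OF plg]])
  have X: "g.fund (bivector G) (\<iota> u) q = - genr (?K q) q" for q
  proof -
    have "right_inv_form G (\<iota> u) q = left_inv_form G (\<iota> (?K q)) q"
    proof (rule blinfun_eqI)
      fix v
      have "left_inv_form G (\<iota> (?K q)) q v = \<iota> u (Ad G q (dL G (ginv G q) q v))"
        by (simp add: left_inv_form_def dL_def c3.coad_apply)
      also have "Ad G q (dL G (ginv G q) q v) = dR G (ginv G q) q v"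
        using g.dL_dL[of q "ginv G q" q v] by (simp add: Ad_def g.left_inverse g.right_inverse)
      finally show "right_inv_form G (\<iota> u) q v = left_inv_form G (\<iota> (?K q)) q v" by (simp add: g.right_inv_form_apply)
    qed
    then show ?thesis unfolding genr_eq by (simp add: g.right_inv_form_op)
  qed
  have lin: "linear (\<lambda>w. vf_loc ?A (genr w) (gone G) z)" for z
    unfolding vf_loc_def by (rule bounded_linear.linear[OF bounded_linear_compose[OF blinfun.bounded_linear_right genr_linear]])
  have dif: "vf_loc ?A (genr w) (gone G) differentiable at ?z" for w
    unfolding generator_def using vf_loc_differentiable[OF s.mf g.mf, of "\<lambda>u g. \<rho> g u" "gone Gs"] r.smooth_act right_one by simp
  let ?L' = "\<lambda>v w. frechet_derivative (vf_loc ?A (genr w) (gone G)) (at ?z) v"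
  have L: "has_tmap (model :: ('v, 'v) atlas) model UNIV (\<lambda>z. vf_loc ?A (genr w) (gone G) z) ?z (\<lambda>v. ?L' v w)" for w
    using dif unfolding has_tmap_model_iff frechet_derivative_works .
  have L'lin: "linear (?L' v)" for v
  proof (rule linearI)
    fix a b and r :: real
    have "(vf_loc ?A (genr (a + b)) (gone G) has_derivative (\<lambda>v. ?L' v a + ?L' v b)) (at ?z)"
      using has_derivative_add[OF L[of a, unfolded has_tmap_model_iff] L[of b, unfolded has_tmap_model_iff]] unfolding linear_add[OF lin, symmetric] .
    then show "?L' v (a + b) = ?L' v a + ?L' v b" by (rule fun_cong[OF frechet_derivative_at[symmetric]])
    have "(vf_loc ?A (genr (r *\<^sub>R a)) (gone G) has_derivative (\<lambda>v. r *\<^sub>R ?L' v a)) (at ?z)"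
      using has_derivative_scaleR_right[OF L[of a, unfolded has_tmap_model_iff], of r] unfolding linear_cmul[OF lin, symmetric] .
    then show "?L' v (r *\<^sub>R a) = r *\<^sub>R ?L' v a" by (rule fun_cong[OF frechet_derivative_at[symmetric]])
  qed
  have W: "has_tmap (model :: ('v, 'v) atlas) model UNIV (\<lambda>z. ?K (?\<phi> z)) ?z (\<lambda>v. c3.dcoad v u)"
    using has_derivative_subset[OF c3.has_tmap_coad_one[of u, unfolded has_tmap_to_model_iff]] at_within_open[OF chart_in_image[OF g.mf] manifold_chartD(3)[OF g.mf]]
      c3.has_tmap_coad_one[of u, unfolded has_tmap_to_model_iff] unfolding has_tmap_model_iff by simp
  have "has_tmap (model :: ('v, 'v) atlas) model UNIV (\<lambda>z. vf_loc ?A (genr (?K (?\<phi> z))) (gone G) z) ?z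
    (\<lambda>v. ?L' v (?K (?\<phi> ?z)) + vf_loc ?A (genr (c3.dcoad v u)) (gone G) ?z)"
    by (rule has_tmap_apply[OF manifold_fin_dim[OF s.mf] lin L'lin L W]) simp
  then have "((\<lambda>z. vf_loc ?A (genr (?K (?\<phi> z))) (gone G) z) has_derivative (\<lambda>v. ?L' v u)) (at ?z)"
    unfolding has_tmap_model_iff by (simp add: chart_inv_chart_self[OF g.mf] vf_loc_def genr_one blinfun.zero_right)
  from has_derivative_minus[OF this]
  have "((\<lambda>z. - vf_loc ?A (genr (?K (?\<phi> z))) (gone G) z) has_derivative (\<lambda>v. - ?L' v u)) (at ?z)" .
  moreover have "vf_loc ?A (g.fund (bivector G) (\<iota> u)) (gone G) = (\<lambda>z. - vf_loc ?A (genr (?K (?\<phi> z))) (gone G) z)"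
    unfolding vf_loc_def X by (simp add: blinfun.minus_right)
  ultimately show ?thesis by simp
qed

text \<open>Two signs cancel: the one in the definition of the right dressing action and the one of
  the opposite bracket.\<close>

lemma link_right:
  "pairing (frechet_derivative (vf_loc (atlas G) (genr u) (gone G)) (at (chart_at (atlas G) (gone G) (gone G))) \<xi>) w
     = pairing \<xi> (lie_bracket (op_group Gs) u w)"
proof -
  have d: "vf_loc (atlas G) (g.fund (bivector G) (\<iota> u)) (gone G) differentiable at (chart_at (atlas G) (gone G) (gone G))" for u
    using fund_right_linearized unfolding differentiable_def by blast
  have "\<iota> (lie_bracket Gs u w) \<xi> = \<iota> w (frechet_derivative (vf_loc (atlas G) (g.fund (bivector G) (\<iota> u)) (gone G)) (at (chart_at (atlas G) (gone G) (gone G))) \<xi>)"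
    unfolding bracket dual_bracket_def by (rule g.form1_bracket_one[OF plg_multiplicative[OF plg] d d])
  also have "frechet_derivative (vf_loc (atlas G) (g.fund (bivector G) (\<iota> u)) (gone G)) (at (chart_at (atlas G) (gone G) (gone G))) \<xi>
     = - frechet_derivative (vf_loc (atlas G) (genr u) (gone G)) (at (chart_at (atlas G) (gone G) (gone G))) \<xi>"
    using fun_cong[OF frechet_derivative_at[OF fund_right_linearized[of u]], of \<xi>] by simp
  finally show ?thesis by (simp add: s.lie_bracket_op blinfun.minus_right blinfun.minus_left)
qed

sublocale m: matched G Gs \<sigma> "\<lambda>u g. \<rho> g u" pairing
proof (intro matched.intro dressing.intro dressing_axioms.intro)
  show "lie_action G (atlas Gs) \<sigma>" by (rule l.lie_action_axioms)
  show "coadjoint pairing Gs" by (rule c1.coadjoint_axioms)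
  show "connected (UNIV :: 'g set)" by (rule conn)
  show "lie_action (op_group Gs) (atlas (op_group G)) (\<lambda>u g. \<rho> g u)" using r.lie_action_axioms by simp
  show "coadjoint (\<lambda>w \<xi>. pairing \<xi> w) (op_group G)" by (rule c2.coadjoint_axioms)
  show "connected (UNIV :: 'h set)" by (rule conns)
qed (use twist_left link_left twist_right link_right in \<open>simp_all add: generator_op\<close>)

end

section \<open>Submersions of manifolds\<close>

lemma has_tmap_uniq_open:
  assumes "manifold M" "open S" "p \<in> S" "has_tmap M N S f p A" "has_tmap M N S f p B"
  shows "A = B"
proof -
  have "has_tmap M N UNIV f p A" by (rule has_tmap_cong_open[OF assms(1,4,2,3)]) auto
  moreover have "has_tmap M N UNIV f p B" by (rule has_tmap_cong_open[OF assms(1,5,2,3)]) auto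
  ultimately show ?thesis by (rule has_tmap_uniq2[OF assms(1)])
qed

lemma manifold_real: "manifold (model :: (real, real) atlas)"
  by (rule manifold_model[OF fin_dim_real])

abbreviation Ivl :: "real \<Rightarrow> real set" where "Ivl \<delta> \<equiv> {-\<delta><..<\<delta>}"

text \<open>Tangent vectors as velocities of curves that are differentiable at 0, perhaps nowhere
  else. Within an open interval the derivative is unique, so a velocity computed in two ways gives
  an equation even where differentials along subsets are not determined.\<close>

abbreviation has_velocity :: "('a, 'v::real_normed_vector) atlas \<Rightarrow> real \<Rightarrow> (real \<Rightarrow> 'a) \<Rightarrow> 'v \<Rightarrow> bool" where
  "has_velocity M \<delta> c v \<equiv> has_tmap model M (Ivl \<delta>) c 0 (\<lambda>t. t *\<^sub>R v)"

lemma has_velocity_shrink: "has_velocity M \<delta> c v \<Longrightarrow> \<delta>' \<le> \<delta> \<Longrightarrow> has_velocity M \<delta>' c v"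
  by (rule has_tmap_subset) auto

lemma has_velocity_unique:
  assumes "\<delta> > 0" "has_velocity M \<delta> c v" "has_tmap model M (Ivl \<delta>) c 0 F"
  shows "F 1 = v"
proof -
  have "F = (\<lambda>t. t *\<^sub>R v)" by (rule has_tmap_uniq_open[OF manifold_real _ _ assms(3,2)]) (use assms(1) in auto)
  then show ?thesis by simp
qed

lemma has_velocityI:
  assumes "has_tmap model M (Ivl \<delta>) c 0 F"
  shows "has_velocity M \<delta> c (F 1)"
proof -
  interpret F: bounded_linear F by (rule has_tmap_linear[OF assms])
  have "F = (\<lambda>t. t *\<^sub>R F 1)"
  proof
    fix t show "F t = t *\<^sub>R F 1" using F.scaleR[of t 1] by simp
  qed
  then show ?thesis using assms by metis
qed

lemma has_velocity_compose:
  assumes "manifold M" "has_velocity M \<delta> c v" "has_tmap M N UNIV f (c 0) A" "\<delta> > 0"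
  shows "has_velocity N \<delta> (\<lambda>t. f (c t)) (A v)"
proof -
  have "has_tmap model N (Ivl \<delta>) (\<lambda>t. f (c t)) 0 (\<lambda>t. A (t *\<^sub>R v))"
    by (rule has_tmap_chain[OF manifold_real assms(1,2,3)]) (use assms(4) in auto)
  from has_velocityI[OF this] show ?thesis by simp
qed

lemma has_velocity_const: "manifold M \<Longrightarrow> has_velocity M \<delta> (\<lambda>t. x) 0"
  using has_tmap_const[of M model "Ivl \<delta>" x 0] by simp

lemma curve_with_velocity:
  assumes "manifold M"
  obtains c where "c 0 = p" "has_velocity M 1 c v"
proof -
  let ?c = "\<lambda>t. chart_inv M p (chart_at M p p + t *\<^sub>R v)"
  note m = manifold_model[OF manifold_fin_dim[OF assms]]
  have 1: "has_tmap model model (Ivl 1) (\<lambda>t. chart_at M p p + t *\<^sub>R v) 0 (\<lambda>t. t *\<^sub>R v)"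
    unfolding has_tmap_model_iff by (auto intro!: derivative_eq_intros)
  have 2: "has_tmap model M UNIV (chart_inv M p) (chart_at M p p + 0 *\<^sub>R v) (frame M p (chart_at M p p))"
    using frame_has_tmap[OF assms chart_in_image[OF assms]] by simp
  have "has_tmap model M (Ivl 1) ?c 0 (\<lambda>t. frame M p (chart_at M p p) (t *\<^sub>R v))"
    by (rule has_tmap_chain[OF manifold_real m 1 2]) auto
  then show thesis using that[of ?c] by (simp add: frame_self[OF assms] chart_inv_chart_self[OF assms])
qed

text \<open>\<open>curve_lift\<close> in the charts at p and f p. The interval shrinks so that both
  curves remain in the chart domain at f p, where equality of coordinates implies equality of
  points.\<close>

lemma submersion_lift:
  assumes M: "manifold P" "manifold M" and f: "smooth_map P M f" and sur: "surj (blinfun_apply (tmap P M f p))"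
    and c: "has_velocity M \<delta> c (tmap P M f p v)" "c 0 = f p" "\<delta> > 0"
  obtains \<gamma> \<delta>' where "0 < \<delta>'" "\<delta>' \<le> \<delta>" "\<gamma> 0 = p" "has_velocity P \<delta>' \<gamma> v" "\<And>t. t \<in> Ivl \<delta>' \<Longrightarrow> f (\<gamma> t) = c t"
proof -
  let ?z = "chart_at P p p" and ?f = "\<lambda>z. chart_at M (f p) (f (chart_inv P p z))" and ?c = "\<lambda>t. chart_at M (f p) (c t)"
  obtain V where V: "open V" "?z \<in> V" "V \<subseteq> chart_at P p ` dom_at P p" "smooth_on V ?f" "\<And>z. z \<in> V \<Longrightarrow> f (chart_inv P p z) \<in> dom_at M (f p)"
    by (rule smooth_map_local_rep[OF M f, of p]) blast
  note m = manifold_model[OF manifold_fin_dim[OF M(1)]]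
  have fz: "?f ?z = chart_at M (f p) (f p)" by (simp add: chart_inv_chart_self[OF M(1)])
  have pd: "f (chart_inv P p ?z) \<in> dom_at M (f p)" using manifold_chartD(1)[OF M(2)] by (simp add: chart_inv_chart_self[OF M(1)])
  have "(?f has_derivative (\<lambda>v. tmap P M f p v)) (at ?z)"
    using local_rep_has_derivative[OF M chart_in_image[OF M(1)] smooth_map_has_tmap[OF M(1) f] pd]
    by (simp add: chart_inv_chart_self[OF M(1)] frame_self[OF M(1)] coframe_self[OF M(2)])
  from frechet_derivative_at[OF this] have D: "frechet_derivative ?f (at ?z) = tmap P M f p" by simp
  have o: "at (0::real) within Ivl \<delta> = at 0" by (rule at_within_open) (use c(3) in auto)
  obtain X where X: "open X" "0 \<in> X" "\<And>t. t \<in> Ivl \<delta> \<Longrightarrow> t \<in> X \<Longrightarrow> c t \<in> dom_at M (c 0)"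
    and cD: "(?c has_derivative (\<lambda>t. t *\<^sub>R tmap P M f p v)) (at 0)"
    using c(1) unfolding has_tmap_def by (auto simp: o c(2))
  obtain \<gamma> \<delta>1 where g: "\<delta>1 > 0" "\<gamma> 0 = ?z" "(\<gamma> has_derivative (\<lambda>t. t *\<^sub>R v)) (at 0)" "\<And>t. \<bar>t\<bar> < \<delta>1 \<Longrightarrow> \<gamma> t \<in> V \<and> ?f (\<gamma> t) = ?c t"
    by (rule curve_lift[OF manifold_fin_dim[OF M(1)] manifold_fin_dim[OF M(2)] V(1,4,2), of ?c v])
      (use D sur cD c(2) fz in auto)
  obtain r where r: "r > 0" "ball 0 r \<subseteq> X" using X(1,2) open_contains_ball by blast
  define \<delta>' where "\<delta>' = min \<delta> (min \<delta>1 r)"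
  have \<delta>': "\<delta>' > 0" using c(3) g(1) r(1) by (simp add: \<delta>'_def)
  have "has_tmap model model (Ivl \<delta>') \<gamma> 0 (\<lambda>t. t *\<^sub>R v)" unfolding has_tmap_model_iff by (rule has_derivative_at_withinI[OF g(3)])
  then have "has_tmap model P (Ivl \<delta>') (\<lambda>t. chart_inv P p (\<gamma> t)) 0 (\<lambda>t. frame P p ?z (t *\<^sub>R v))"
    by (rule has_tmap_chain[OF manifold_real m]) (use frame_has_tmap[OF M(1) chart_in_image[OF M(1)]] \<delta>' g(2) in auto)
  then have vel: "has_velocity P \<delta>' (\<lambda>t. chart_inv P p (\<gamma> t)) v" by (simp add: frame_self[OF M(1)])
  have "f (chart_inv P p (\<gamma> t)) = c t" if t: "t \<in> Ivl \<delta>'" for t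
  proof (rule chart_inj[OF M(2)])
    have a: "\<bar>t\<bar> < \<delta>1" "t \<in> Ivl \<delta>" "t \<in> X" using t r(2) by (auto simp: \<delta>'_def subset_eq dist_real_def)
    show "f (chart_inv P p (\<gamma> t)) \<in> dom_at M (f p)" using V(5) g(4)[OF a(1)] by blast
    show "c t \<in> dom_at M (f p)" using X(3)[OF a(2,3)] c(2) by simp
    show "chart_at M (f p) (f (chart_inv P p (\<gamma> t))) = chart_at M (f p) (c t)" using g(4)[OF a(1)] by simp
  qed
  then show thesis using that[of \<delta>' "\<lambda>t. chart_inv P p (\<gamma> t)"] \<delta>' vel g(2) by (simp add: \<delta>'_def chart_inv_chart_self[OF M(1)])
qed

lemma locally_constant_connected:
  assumes "connected S" "\<And>x. x \<in> S \<Longrightarrow> \<exists>U. open U \<and> x \<in> U \<and> (\<forall>y\<in>U \<inter> S. q y = q x)" "a \<in> S" "b \<in> S"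
  shows "q a = q b"
proof (rule ccontr)
  assume ne: "q a \<noteq> q b"
  obtain U where U: "\<And>x. x \<in> S \<Longrightarrow> open (U x) \<and> x \<in> U x \<and> (\<forall>y\<in>U x \<inter> S. q y = q x)" using assms(2) by metis
  let ?A = "\<Union>x\<in>{x\<in>S. q x = q a}. U x" and ?B = "\<Union>x\<in>{x\<in>S. q x \<noteq> q a}. U x"
  have o: "open ?A" "open ?B" using U by auto
  have d: "?A \<inter> ?B \<inter> S = {}"
  proof (rule ccontr)
    assume "?A \<inter> ?B \<inter> S \<noteq> {}"
    then obtain y x x' where "y \<in> S" "x \<in> S" "q x = q a" "y \<in> U x" "x' \<in> S" "q x' \<noteq> q a" "y \<in> U x'" by blast
    then show False using U by (metis IntI)
  qed
  have c: "S \<subseteq> ?A \<union> ?B" using U by blast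
  have A: "a \<in> ?A \<inter> S" using U[OF assms(3)] assms(3) by blast
  have B: "b \<in> ?B \<inter> S"
  proof -
    have "b \<in> {x\<in>S. q x \<noteq> q a}" using assms(4) not_sym[OF ne] by blast
    then have "b \<in> ?B" by (rule UN_I) (use U[OF assms(4)] in blast)
    then show ?thesis using assms(4) by blast
  qed
  from connectedD[OF assms(1) o d c] show False
  proof
    assume "?A \<inter> S = {}" then show False using A by (simp only: empty_iff)
  next
    assume "?B \<inter> S = {}" then show False using B by (simp only: empty_iff)
  qed
qed

text \<open>Locally q is the restriction of a smooth F on an open set, and
  \<open>submersion_fibre_constant\<close> asks for the derivative of F on vertical vectors. F is
  linked to q on the fibre only, so a vertical vector is realized as the velocity of a curve inside
  the fibre, along which F and q agree.\<close>

lemma submersion_fibre_connected: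
  assumes M: "manifold P" "manifold M" "manifold N" and f: "submersion P M f"
    and S: "S = {x. f x = m}" "connected S" and q: "smooth_map_on P N S q"
    and ker: "\<And>x v. x \<in> S \<Longrightarrow> tmap P M f x v = 0 \<Longrightarrow> tmap_on P N S q x v = 0"
    and ab: "a \<in> S" "b \<in> S"
  shows "q a = q b"
proof (rule locally_constant_connected[OF S(2) _ ab])
  fix x0 assume x0: "x0 \<in> S"
  have fs: "smooth_map P M f" and sur: "surj (blinfun_apply (tmap P M f x))" for x using f unfolding submersion_def by auto
  let ?z = "chart_at P x0 x0" and ?f = "\<lambda>z. chart_at M (f x0) (f (chart_inv P x0 z))"
  obtain V where V: "open V" "?z \<in> V" "V \<subseteq> chart_at P x0 ` dom_at P x0" "smooth_on V ?f" "\<And>z. z \<in> V \<Longrightarrow> f (chart_inv P x0 z) \<in> dom_at M (f x0)"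
    by (rule smooth_map_local_rep[OF M(1,2) fs, of x0]) blast
  obtain W F where F: "open W" "?z \<in> W" "smooth_on W F"
    "\<And>x. x \<in> S \<Longrightarrow> x \<in> dom_at P x0 \<Longrightarrow> chart_at P x0 x \<in> W \<Longrightarrow> q x \<in> dom_at N (q x0)"
    "\<And>x. x \<in> S \<Longrightarrow> x \<in> dom_at P x0 \<Longrightarrow> chart_at P x0 x \<in> W \<Longrightarrow> chart_at N (q x0) (q x) = F (chart_at P x0 x)"
    by (rule smooth_map_onE[OF q x0]) blast
  let ?U = "V \<inter> W"
  have U: "open ?U" "?z \<in> ?U" "smooth_on ?U ?f" "smooth_on ?U F" using V(1,2) F(1,2) smooth_on_subset[OF V(4)] smooth_on_subset[OF F(3)] by auto
  have Df: "frechet_derivative ?f (at z) v = coframe M (f x0) (?f z) (tmap P M f (chart_inv P x0 z) (frame P x0 z v))" if "z \<in> ?U" for z v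
  proof -
    have "z \<in> chart_at P x0 ` dom_at P x0" "f (chart_inv P x0 z) \<in> dom_at M (f x0)" using that V(3,5) by auto
    from fun_cong[OF frechet_derivative_at[OF local_rep_has_derivative[OF M(1,2) this(1) smooth_map_has_tmap[OF M(1) fs] this(2)]], of v]
    show ?thesis by (rule sym)
  qed
  have fim: "?f z \<in> chart_at M (f x0) ` dom_at M (f x0)" if "z \<in> ?U" for z using V(5) that by blast
  have s: "surj (frechet_derivative ?f (at z))" if z: "z \<in> ?U" for z
  proof (rule surjI)
    fix y
    let ?w = "SOME w. tmap P M f (chart_inv P x0 z) w = frame M (f x0) (?f z) y"
    have "\<exists>w. tmap P M f (chart_inv P x0 z) w = frame M (f x0) (?f z) y" using sur unfolding surj_def by metis
    then have w: "tmap P M f (chart_inv P x0 z) ?w = frame M (f x0) (?f z) y" by (rule someI_ex)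
    have zi: "z \<in> chart_at P x0 ` dom_at P x0" using z V(3) by blast
    show "frechet_derivative ?f (at z) (coframe P x0 z ?w) = y"
      unfolding Df[OF z] coframe_frame(2)[OF M(1) zi] w by (rule coframe_frame(1)[OF M(2) fim[OF z]])
  qed
  have k: "frechet_derivative F (at z) v = 0" if z: "z \<in> ?U" and fz: "?f z = ?f ?z" and v: "frechet_derivative ?f (at z) v = 0" for z v
  proof -
    let ?x = "chart_inv P x0 z" and ?v = "frame P x0 z v"
    have zi: "z \<in> chart_at P x0 ` dom_at P x0" using z V(3) by blast
    have xd: "?x \<in> dom_at P x0" "chart_at P x0 ?x = z" using chart_inv_in[OF M(1) zi] chart_chart_inv[OF M(1) zi] by auto
    have "f ?x = f x0"
      using chart_inj[OF M(2) V(5) manifold_chartD(1)[OF M(2)]] fz z by (simp add: chart_inv_chart_self[OF M(1)])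
    then have xS: "?x \<in> S" using x0 S(1) by simp
    have "frame M (f x0) (?f z) (coframe M (f x0) (?f z) (tmap P M f ?x ?v)) = frame M (f x0) (?f z) 0" using v unfolding Df[OF z] by simp
    then have tv: "tmap P M f ?x ?v = 0" unfolding coframe_frame(2)[OF M(2) fim[OF z]] by (simp add: blinfun.zero_right)
    \<comment> \<open>A vertical vector lies over velocity zero, so the constant base curve has a
      lift with this velocity, and the lift stays in the fibre.\<close>
    have "has_velocity M 1 (\<lambda>t. f ?x) (tmap P M f ?x ?v)" unfolding tv by (rule has_velocity_const[OF M(2)])
    from submersion_lift[OF M(1,2) fs sur this refl zero_less_one]
    obtain \<gamma> \<delta> where g: "0 < \<delta>" "\<gamma> 0 = ?x" "has_velocity P \<delta> \<gamma> ?v" "\<And>t. t \<in> Ivl \<delta> \<Longrightarrow> f (\<gamma> t) = f ?x"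
      by blast
    have gS: "\<gamma> t \<in> S" if "t \<in> Ivl \<delta>" for t using g(4)[OF that] xS S(1) by simp
    have xW: "q ?x \<in> dom_at N (q x0)" using F(4)[OF xS xd(1)] xd(2) z by simp
    have "has_tmap model N (Ivl \<delta>) (\<lambda>t. q (\<gamma> t)) 0 (\<lambda>t. tmap_on P N S q ?x (t *\<^sub>R ?v))"
      by (rule has_tmap_chain[OF manifold_real M(1) g(3)]) (use smooth_map_on_has_tmap[OF M(1) q xS] g(1,2) gS in auto)
    then have 1: "has_tmap model N (Ivl \<delta>) (\<lambda>t. q (\<gamma> t)) 0 (\<lambda>t. 0)"
      using ker[OF xS tv] by (simp add: blinfun.scaleR_right)
    have "has_tmap model model (Ivl \<delta>) (\<lambda>t. chart_at N (q x0) (q (\<gamma> t))) 0 (\<lambda>t. coframe N (q x0) (chart_at N (q x0) (q ?x)) 0)"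
      by (rule has_tmap_chain[OF manifold_real M(3) 1]) (use coframe_has_tmap[OF M(3) xW] g(1,2) in auto)
    then have 1: "has_tmap model model (Ivl \<delta>) (\<lambda>t. chart_at N (q x0) (q (\<gamma> t))) 0 (\<lambda>t. 0)" by (simp add: blinfun.zero_right)
    have "has_velocity model \<delta> (\<lambda>t. chart_at P x0 (\<gamma> t)) (coframe P x0 (chart_at P x0 ?x) ?v)"
      by (rule has_velocity_compose[OF M(1) g(3)]) (use coframe_has_tmap[OF M(1) xd(1)] g(1,2) in auto)
    then have cv: "has_velocity model \<delta> (\<lambda>t. chart_at P x0 (\<gamma> t)) v" by (simp add: xd(2) coframe_frame(1)[OF M(1) zi])
    have Fz: "has_tmap model model UNIV F (chart_at P x0 (\<gamma> 0)) (frechet_derivative F (at z))"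
      unfolding has_tmap_model_iff g(2) xd(2) by (rule smooth_on_has_derivative[OF F(3)]) (use z in auto)
    have 2: "has_velocity model \<delta> (\<lambda>t. F (chart_at P x0 (\<gamma> t))) (frechet_derivative F (at z) v)"
      by (rule has_velocity_compose[OF manifold_model[OF manifold_fin_dim[OF M(1)]] cv Fz g(1)])
    have "open (W \<inter> chart_at P x0 ` dom_at P x0)" using F(1) manifold_chartD(3)[OF M(1)] by (rule open_Int)
    have "\<exists>\<epsilon>>0. \<forall>t\<in>Ivl \<epsilon>. t \<in> Ivl \<delta> \<and> \<gamma> t \<in> dom_at P x0 \<and> chart_at P x0 (\<gamma> t) \<in> W"
    proof -
      let ?O = "{x \<in> dom_at P x0. chart_at P x0 x \<in> W}"
      have O: "open ?O" "\<gamma> 0 \<in> ?O" using chart_open_vimage[OF M(1) F(1)] xd z g(2) by auto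
      have "has_tmap model P UNIV \<gamma> 0 (\<lambda>t. t *\<^sub>R ?v)"
        by (rule has_tmap_cong_open[OF manifold_real g(3), of "Ivl \<delta>"]) (use g(1) in auto)
      from has_tmap_nhd[OF manifold_real M(1) this O] obtain Y where Y: "open Y" "0 \<in> Y" "\<And>t. t \<in> Y \<Longrightarrow> \<gamma> t \<in> ?O" by metis
      obtain e where "e > 0" "ball 0 e \<subseteq> Y" using Y(1,2) open_contains_ball by blast
      then show ?thesis using Y(3) g(1) by (intro exI[of _ "min e \<delta>"]) (auto simp: subset_eq dist_real_def)
    qed
    then obtain \<epsilon> where \<epsilon>: "\<epsilon> > 0" "\<And>t. t \<in> Ivl \<epsilon> \<Longrightarrow> t \<in> Ivl \<delta> \<and> \<gamma> t \<in> dom_at P x0 \<and> chart_at P x0 (\<gamma> t) \<in> W" by blast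
    have "has_tmap model model (Ivl \<epsilon>) (\<lambda>t. F (chart_at P x0 (\<gamma> t))) 0 (\<lambda>t. 0)"
      by (rule has_tmap_cong_open[OF manifold_real 1, of "Ivl \<epsilon>"]) (use \<epsilon> F(5) gS in auto)
    moreover have "has_velocity model \<epsilon> (\<lambda>t. F (chart_at P x0 (\<gamma> t))) (frechet_derivative F (at z) v)"
      by (rule has_tmap_subset[OF 2]) (use \<epsilon>(2) in blast)
    ultimately show ?thesis using has_velocity_unique[OF \<epsilon>(1)] by metis
  qed
  obtain r where r: "r > 0" "\<And>z. z \<in> ball ?z r \<Longrightarrow> z \<in> ?U \<Longrightarrow> ?f z = ?f ?z \<Longrightarrow> F z = F ?z"
    by (rule submersion_fibre_constant[OF manifold_fin_dim[OF M(1)] manifold_fin_dim[OF M(2)] U(1,3,4,2) s k]) blast+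
  let ?X = "{x \<in> dom_at P x0. chart_at P x0 x \<in> ?U \<inter> ball ?z r}"
  have "open ?X" by (rule chart_open_vimage[OF M(1)]) (use U(1) in auto)
  moreover have "x0 \<in> ?X" using manifold_chartD(1)[OF M(1)] U(2) r(1) by simp
  moreover have "q x = q x0" if x: "x \<in> ?X \<inter> S" for x
  proof (rule chart_inj[OF M(3)])
    have xx: "x \<in> S" "x \<in> dom_at P x0" "chart_at P x0 x \<in> W" "chart_at P x0 x \<in> ?U" "chart_at P x0 x \<in> ball ?z r" using x by auto
    show "q x \<in> dom_at N (q x0)" by (rule F(4)[OF xx(1-3)])
    show "q x0 \<in> dom_at N (q x0)" by (rule manifold_chartD(1)[OF M(3)])
    have "?f (chart_at P x0 x) = ?f ?z" using xx(1) x0 S(1) by (simp add: chart_inv_chart[OF M(1) xx(2)] chart_inv_chart_self[OF M(1)])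
    then have "F (chart_at P x0 x) = F ?z" using r(2)[OF xx(5,4)] by blast
    then show "chart_at N (q x0) (q x) = chart_at N (q x0) (q x0)"
      using F(5)[OF xx(1-3)] F(5)[OF x0 manifold_chartD(1)[OF M(1)] F(2)] by simp
  qed
  ultimately show "\<exists>U. open U \<and> x0 \<in> U \<and> (\<forall>y\<in>U \<inter> S. q y = q x0)" by blast
qed

section \<open>Symplectic groupoids\<close>

lemma has_velocity_within_compose:
  assumes "manifold M" "has_velocity M \<delta> c v" "has_tmap M N S f (c 0) A" "\<delta> > 0" "\<And>t. t \<in> Ivl \<delta> \<Longrightarrow> c t \<in> S"
  shows "has_velocity N \<delta> (\<lambda>t. f (c t)) (A v)"
proof -
  have "has_tmap model N (Ivl \<delta>) (\<lambda>t. f (c t)) 0 (\<lambda>t. A (t *\<^sub>R v))"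
    by (rule has_tmap_chain[OF manifold_real assms(1,2,3)]) (use assms(4,5) in auto)
  from has_velocityI[OF this] show ?thesis by simp
qed

lemma has_velocity_cong:
  assumes "has_velocity M \<delta> c v" "\<delta> > 0" "\<And>t. t \<in> Ivl \<delta> \<Longrightarrow> c t = d t"
  shows "has_velocity M \<delta> d v"
  by (rule has_tmap_cong_open[OF manifold_real assms(1), of "Ivl \<delta>"]) (use assms(2,3) in auto)

lemma has_velocity_unique2: "\<delta> > 0 \<Longrightarrow> has_velocity M \<delta> c v \<Longrightarrow> has_velocity M \<delta> c w \<Longrightarrow> v = w"
  using has_velocity_unique[of \<delta> M c v "\<lambda>t. t *\<^sub>R w"] by simp

locale symp_groupoid =
  fixes \<G> :: "('p::topological_space, 'u::real_inner, 'm::topological_space, 'x::real_inner) groupoid"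
    and \<Omega> :: "'p \<Rightarrow> 'u \<Rightarrow> 'u \<Rightarrow> real"
  assumes sg: "symplectic_groupoid \<G> \<Omega>"
begin

abbreviation src' ("\<s>") where "\<s> \<equiv> src \<G>"
abbreviation tgt' ("\<t>") where "\<t> \<equiv> tgt \<G>"
abbreviation ident' ("\<epsilon>") where "\<epsilon> \<equiv> ident \<G>"
abbreviation mul (infixl "\<odot>" 70) where "x \<odot> y \<equiv> arr_mult \<G> x y"
abbreviation Arr where "Arr \<equiv> arrows \<G>"
abbreviation Obj where "Obj \<equiv> objects \<G>"
abbreviation "ds x \<equiv> blinfun_apply (tmap Arr Obj \<s> x)"
abbreviation "dt x \<equiv> blinfun_apply (tmap Arr Obj \<t> x)"
abbreviation "de m \<equiv> blinfun_apply (tmap Obj Arr \<epsilon> m)"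
abbreviation "dm x y \<equiv> blinfun_apply (tmap_on (prod_atlas Arr Arr) Arr (composable \<G>) (\<lambda>(x, y). x \<odot> y) (x, y))"
abbreviation "CT x y \<equiv> composable_tangent \<G> (x, y)"

lemma lg: "lie_groupoid \<G>" and symp: "symplectic_form Arr \<Omega>" and mult_form: "multiplicative_form \<G> \<Omega>"
  using sg unfolding symplectic_groupoid_def by blast+

lemma gr: "is_groupoid \<G>" and mA: "manifold Arr" and mO: "manifold Obj"
  and sub_s: "submersion Arr Obj \<s>" and sub_t: "submersion Arr Obj \<t>"
  and smooth_e: "smooth_map Obj Arr \<epsilon>" and smooth_i: "smooth_map Arr Arr (invs \<G>)"
  and smooth_m: "smooth_map_on (prod_atlas Arr Arr) Arr (composable \<G>) (\<lambda>(x, y). x \<odot> y)"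
  using lg unfolding lie_groupoid_def by blast+

lemma smooth_s: "smooth_map Arr Obj \<s>" and smooth_t: "smooth_map Arr Obj \<t>"
  and surj_s: "surj (ds x)" and surj_t: "surj (dt x)"
  using sub_s sub_t unfolding submersion_def by blast+

lemma composable_iff: "(x, y) \<in> composable \<G> \<longleftrightarrow> \<s> x = \<t> y"
  by (simp add: composable_def)

lemma st_mult: "\<s> x = \<t> y \<Longrightarrow> \<s> (x \<odot> y) = \<s> y" "\<s> x = \<t> y \<Longrightarrow> \<t> (x \<odot> y) = \<t> x"
  and assoc: "\<s> x = \<t> y \<Longrightarrow> \<s> y = \<t> z \<Longrightarrow> x \<odot> y \<odot> z = x \<odot> (y \<odot> z)"
  and st_e [simp]: "\<s> (\<epsilon> m) = m" "\<t> (\<epsilon> m) = m"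
  and mult_e [simp]: "x \<odot> \<epsilon> (\<s> x) = x" "\<epsilon> (\<t> x) \<odot> x = x"
  and st_i [simp]: "\<s> (invs \<G> x) = \<t> x" "\<t> (invs \<G> x) = \<s> x"
  and mult_i: "x \<odot> invs \<G> x = \<epsilon> (\<t> x)" "invs \<G> x \<odot> x = \<epsilon> (\<s> x)"
  using gr unfolding is_groupoid_def composable_def by auto

lemma CT_iff: "(v, w) \<in> CT x y \<longleftrightarrow> ds x v = dt y w"
  by (simp add: composable_tangent_def)

lemma has_tmap_s: "has_tmap Arr Obj UNIV \<s> x (ds x)" and has_tmap_t: "has_tmap Arr Obj UNIV \<t> x (dt x)"
  and has_tmap_e: "has_tmap Obj Arr UNIV \<epsilon> m (de m)"
  by (rule smooth_map_has_tmap[OF mA smooth_s] smooth_map_has_tmap[OF mA smooth_t] smooth_map_has_tmap[OF mO smooth_e])+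

lemma ds_de [simp]: "ds (\<epsilon> m) (de m a) = a" and dt_de [simp]: "dt (\<epsilon> m) (de m a) = a"
proof -
  have "has_tmap Obj Obj UNIV (\<lambda>m. \<s> (\<epsilon> m)) m (\<lambda>a. ds (\<epsilon> m) (de m a))" "has_tmap Obj Obj UNIV (\<lambda>m. \<t> (\<epsilon> m)) m (\<lambda>a. dt (\<epsilon> m) (de m a))"
    by (rule has_tmap_chain[OF mO mA has_tmap_e has_tmap_s UNIV_I UNIV_I] has_tmap_chain[OF mO mA has_tmap_e has_tmap_t UNIV_I UNIV_I])+
  then have "has_tmap Obj Obj UNIV (\<lambda>m. m) m (\<lambda>a. ds (\<epsilon> m) (de m a))" "has_tmap Obj Obj UNIV (\<lambda>m. m) m (\<lambda>a. dt (\<epsilon> m) (de m a))" by simp_all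
  from fun_cong[OF has_tmap_uniq2[OF mO this(1) has_tmap_ident[OF mO UNIV_I]], of a] fun_cong[OF has_tmap_uniq2[OF mO this(2) has_tmap_ident[OF mO UNIV_I]], of a]
  show "ds (\<epsilon> m) (de m a) = a" "dt (\<epsilon> m) (de m a) = a" by auto
qed

lemma has_tmap_m:
  assumes "manifold L" "has_tmap L Arr S f q F" "has_tmap L Arr S g q H" "q \<in> S" "\<And>q. q \<in> S \<Longrightarrow> \<s> (f q) = \<t> (g q)"
  shows "has_tmap L Arr S (\<lambda>q. f q \<odot> g q) q (\<lambda>v. dm (f q) (g q) (F v, H v))"
proof -
  have P: "manifold (prod_atlas Arr Arr)" by (rule manifold_prod[OF mA mA])
  have "has_tmap (prod_atlas Arr Arr) Arr (composable \<G>) (\<lambda>(x, y). x \<odot> y) (f q, g q) (dm (f q) (g q))"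
    by (rule smooth_map_on_has_tmap[OF P smooth_m]) (use assms(4,5) composable_iff in auto)
  from has_tmap_chain[OF assms(1) P has_tmap_Pair[OF assms(2,3)] this assms(4)] assms(5)
  show ?thesis by (simp add: composable_iff)
qed

lemma velocity_m:
  assumes "\<delta> > 0" "has_velocity Arr \<delta> c v" "has_velocity Arr \<delta> d w" "\<And>t. t \<in> Ivl \<delta> \<Longrightarrow> \<s> (c t) = \<t> (d t)"
  shows "has_velocity Arr \<delta> (\<lambda>t. c t \<odot> d t) (dm (c 0) (d 0) (v, w))" "(v, w) \<in> CT (c 0) (d 0)"
proof -
  have "has_tmap model Arr (Ivl \<delta>) (\<lambda>q. c q \<odot> d q) 0 (\<lambda>t. dm (c 0) (d 0) (t *\<^sub>R v, t *\<^sub>R w))"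
    by (rule has_tmap_m[OF manifold_real assms(2,3) _ assms(4)]) (use assms(1) in auto)
  from has_velocityI[OF this] show "has_velocity Arr \<delta> (\<lambda>t. c t \<odot> d t) (dm (c 0) (d 0) (v, w))" by simp
  have 1: "has_velocity Obj \<delta> (\<lambda>t. \<s> (c t)) (ds (c 0) v)" by (rule has_velocity_compose[OF mA assms(2) has_tmap_s assms(1)])
  have "has_velocity Obj \<delta> (\<lambda>t. \<t> (d t)) (dt (d 0) w)" by (rule has_velocity_compose[OF mA assms(3) has_tmap_t assms(1)])
  then have "has_velocity Obj \<delta> (\<lambda>t. \<s> (c t)) (dt (d 0) w)" by (rule has_velocity_cong[OF _ assms(1)]) (use assms(4) in auto)
  then show "(v, w) \<in> CT (c 0) (d 0)" unfolding CT_iff using has_velocity_unique2[OF assms(1) 1] by blast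
qed

text \<open>The curve of the second factor is free; the first factor lifts the target of that curve
  through the source submersion.\<close>

lemma composable_curves:
  assumes "\<s> x = \<t> y" "(v, w) \<in> CT x y"
  obtains c d \<delta> where "\<delta> > 0" "has_velocity Arr \<delta> c v" "has_velocity Arr \<delta> d w" "c 0 = x" "d 0 = y" "\<And>t. t \<in> Ivl \<delta> \<Longrightarrow> \<s> (c t) = \<t> (d t)"
proof -
  obtain d where d: "d 0 = y" "has_velocity Arr 1 d w" by (rule curve_with_velocity[OF mA])
  have "has_velocity Obj 1 (\<lambda>t. \<t> (d t)) (dt (d 0) w)" by (rule has_velocity_compose[OF mA d(2) has_tmap_t]) simp
  then have 1: "has_velocity Obj 1 (\<lambda>t. \<t> (d t)) (ds x v)" using assms(2) d(1) unfolding CT_iff by simp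
  obtain c \<delta> where c: "0 < \<delta>" "\<delta> \<le> 1" "c 0 = x" "has_velocity Arr \<delta> c v" "\<And>t. t \<in> Ivl \<delta> \<Longrightarrow> \<s> (c t) = \<t> (d t)"
    by (rule submersion_lift[OF mA mO smooth_s surj_s 1]) (use assms(1) d(1) in auto)
  show thesis by (rule that[OF c(1,4) has_velocity_shrink[OF d(2) c(2)] c(3) d(1) c(5)])
qed

lemma dm_unit_right: "dm x (\<epsilon> (\<s> x)) (v, de (\<s> x) (ds x v)) = v" and dm_unit_left: "dm (\<epsilon> (\<t> y)) y (de (\<t> y) (dt y w), w) = w"
proof -
  have s: "has_tmap Arr Arr UNIV (\<lambda>x. \<epsilon> (\<s> x)) x (\<lambda>v. de (\<s> x) (ds x v))"
    by (rule has_tmap_chain[OF mA mO has_tmap_s has_tmap_e]) auto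
  have t: "has_tmap Arr Arr UNIV (\<lambda>x. \<epsilon> (\<t> x)) y (\<lambda>v. de (\<t> y) (dt y v))"
    by (rule has_tmap_chain[OF mA mO has_tmap_t has_tmap_e]) auto
  have "has_tmap Arr Arr UNIV (\<lambda>x. x \<odot> \<epsilon> (\<s> x)) x (\<lambda>v. dm x (\<epsilon> (\<s> x)) (v, de (\<s> x) (ds x v)))"
    by (rule has_tmap_m[OF mA has_tmap_ident[OF mA UNIV_I] s]) auto
  then have "has_tmap Arr Arr UNIV (\<lambda>x. x) x (\<lambda>v. dm x (\<epsilon> (\<s> x)) (v, de (\<s> x) (ds x v)))" by simp
  from fun_cong[OF has_tmap_uniq2[OF mA this has_tmap_ident[OF mA UNIV_I]], of v] show "dm x (\<epsilon> (\<s> x)) (v, de (\<s> x) (ds x v)) = v" .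
  have "has_tmap Arr Arr UNIV (\<lambda>x. \<epsilon> (\<t> x) \<odot> x) y (\<lambda>v. dm (\<epsilon> (\<t> y)) y (de (\<t> y) (dt y v), v))"
    by (rule has_tmap_m[OF mA t has_tmap_ident[OF mA UNIV_I]]) auto
  then have "has_tmap Arr Arr UNIV (\<lambda>x. x) y (\<lambda>v. dm (\<epsilon> (\<t> y)) y (de (\<t> y) (dt y v), v))" by simp
  from fun_cong[OF has_tmap_uniq2[OF mA this has_tmap_ident[OF mA UNIV_I]], of w] show "dm (\<epsilon> (\<t> y)) y (de (\<t> y) (dt y w), w) = w" .
qed

text \<open>A curve z through x y factors as (z r^-1) r for any curve r through y with the same
  sources as z, and such r exists because the source map is a submersion.\<close>

lemma dm_surj:
  assumes xy: "\<s> x = \<t> y"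
  obtains v w where "(v, w) \<in> CT x y" "dm x y (v, w) = V"
proof -
  obtain z where z: "z 0 = x \<odot> y" "has_velocity Arr 1 z V" by (rule curve_with_velocity[OF mA])
  obtain w where w: "ds y w = ds (x \<odot> y) V" using surj_s unfolding surj_def by metis
  have "has_velocity Obj 1 (\<lambda>t. \<s> (z t)) (ds (z 0) V)" by (rule has_velocity_compose[OF mA z(2) has_tmap_s]) simp
  then have 1: "has_velocity Obj 1 (\<lambda>t. \<s> (z t)) (ds y w)" using w z(1) by simp
  obtain r \<delta> where r: "0 < \<delta>" "\<delta> \<le> 1" "r 0 = y" "has_velocity Arr \<delta> r w" "\<And>t. t \<in> Ivl \<delta> \<Longrightarrow> \<s> (r t) = \<s> (z t)"
    by (rule submersion_lift[OF mA mO smooth_s surj_s 1]) (use st_mult[OF xy] z(1) in auto)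
  have i: "has_velocity Arr \<delta> (\<lambda>t. invs \<G> (r t)) (tmap Arr Arr (invs \<G>) (r 0) w)"
    by (rule has_velocity_compose[OF mA r(4) smooth_map_has_tmap[OF mA smooth_i] r(1)])
  let ?c = "\<lambda>t. z t \<odot> invs \<G> (r t)"
  obtain v where v: "has_velocity Arr \<delta> ?c v"
    using velocity_m(1)[OF r(1) has_velocity_shrink[OF z(2) r(2)] i] r(5) by auto
  have sc: "\<s> (?c t) = \<t> (r t)" if "t \<in> Ivl \<delta>" for t using r(5)[OF that] st_mult(1)[of "z t" "invs \<G> (r t)"] by simp
  have c0: "?c 0 = x" using assoc[OF xy, of "invs \<G> y"] z(1) r(3) mult_i(1)[of y] mult_e(1)[of x] by (simp add: xy[symmetric])
  note vm = velocity_m[OF r(1) v r(4) sc]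
  have eq: "?c t \<odot> r t = z t" if "t \<in> Ivl \<delta>" for t
    using assoc[of "z t" "invs \<G> (r t)" "r t"] r(5)[OF that] mult_i(2)[of "r t"] mult_e(1)[of "z t"] by simp
  have "has_velocity Arr \<delta> z (dm (?c 0) (r 0) (v, w))"
    by (rule has_velocity_cong[OF vm(1) r(1) eq])
  then have "dm x y (v, w) = V" using has_velocity_unique2[OF r(1) _ has_velocity_shrink[OF z(2) r(2)]] c0 r(3) by metis
  then show thesis using that vm(2) c0 r(3) by simp
qed

section \<open>Consequences of multiplicativity of the symplectic form\<close>

lemma Omega_bilinear: "bounded_bilinear (\<Omega> x)"
  and Omega_alt: "\<Omega> x v v = 0" and Omega_nondeg: "v \<noteq> 0 \<Longrightarrow> \<exists>w. \<Omega> x v w \<noteq> 0"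
  using symp unfolding symplectic_form_def by blast+

lemma Omega_mult:
  assumes "\<s> x = \<t> y" "(v, w) \<in> CT x y" "(v', w') \<in> CT x y"
  shows "\<Omega> (x \<odot> y) (dm x y (v, w)) (dm x y (v', w')) = \<Omega> x v v' + \<Omega> y w w'"
  using mult_form assms unfolding multiplicative_form_def Let_def composable_iff[symmetric] by fast

lemma Omega_zero [simp]: "\<Omega> x v 0 = 0" "\<Omega> x 0 v = 0"
  using bounded_bilinear.zero_right[OF Omega_bilinear] bounded_bilinear.zero_left[OF Omega_bilinear] by auto

lemma dm_one_units: "dm (\<epsilon> m) (\<epsilon> m) (de m a, de m a) = de m a"
  using dm_unit_right[of "\<epsilon> m" "de m a"] by simp

lemma unit_mult: "\<epsilon> m \<odot> \<epsilon> m = \<epsilon> m"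
  using mult_e(1)[of "\<epsilon> m"] by simp

text \<open>Multiplying a tangent vector of the unit section by itself returns it, so
  multiplicativity equates \<Omega> on such vectors with its double.\<close>

lemma units_isotropic: "\<Omega> (\<epsilon> m) (de m a) (de m b) = 0"
proof -
  have "\<Omega> (\<epsilon> m \<odot> \<epsilon> m) (dm (\<epsilon> m) (\<epsilon> m) (de m a, de m a)) (dm (\<epsilon> m) (\<epsilon> m) (de m b, de m b)) = \<Omega> (\<epsilon> m) (de m a) (de m b) + \<Omega> (\<epsilon> m) (de m a) (de m b)"
    by (rule Omega_mult) (simp_all add: CT_iff)
  then show ?thesis by (simp add: dm_one_units unit_mult)
qed

text \<open>The composability of \<open>X\<close> and \<open>Y\<close> is detected by pairing with the tangent vector of a curve
  \<open>(x \<gamma>, \<gamma>\<^sup>-\<^sup>1 y)\<close>, where \<open>\<gamma>\<close> runs in a target fibre: its product is constant.\<close>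

lemma composable_tangent_criterion:
  assumes xy: "\<s> x = \<t> y" and Z: "\<And>v w. (v, w) \<in> CT x y \<Longrightarrow> \<Omega> (x \<odot> y) Z (dm x y (v, w)) = \<Omega> x X v + \<Omega> y Y w"
  shows "(X, Y) \<in> CT x y" "Z = dm x y (X, Y)"
proof -
  define m where "m = \<s> x"
  have m: "\<s> x = m" "\<t> y = m" using xy by (auto simp: m_def)
  interpret O: bounded_bilinear "\<Omega> z" for z by (rule Omega_bilinear)
  let ?a = "ds x X - dt y Y"
  \<comment> \<open>u is tangent to the target fibre at the unit over m. The pair (v, w) built from
    it multiplies to zero, so the hypothesis compares only the contributions of X and Y.\<close>
  have 1: "\<Omega> (\<epsilon> m) (de m ?a) u = 0" if u: "dt (\<epsilon> m) u = 0" for u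
  proof -
    have "has_velocity Obj 1 (\<lambda>t. m) (dt (\<epsilon> m) u)" unfolding u by (rule has_velocity_const[OF mO])
    then obtain \<gamma> \<delta> where g: "0 < \<delta>" "\<gamma> 0 = \<epsilon> m" "has_velocity Arr \<delta> \<gamma> u" "\<And>t. t \<in> Ivl \<delta> \<Longrightarrow> \<t> (\<gamma> t) = m"
      by (rule submersion_lift[OF mA mO smooth_t surj_t]) auto
    let ?u = "tmap Arr Arr (invs \<G>) (\<epsilon> m) u"
    have gi: "has_velocity Arr \<delta> (\<lambda>t. invs \<G> (\<gamma> t)) ?u"
      using has_velocity_compose[OF mA g(3) smooth_map_has_tmap[OF mA smooth_i] g(1)] g(2) by simp
    have i0: "invs \<G> (\<epsilon> m) = \<epsilon> m" using mult_i(1)[of "\<epsilon> m"] mult_e(2)[of "invs \<G> (\<epsilon> m)"] by simp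
    have c: "has_velocity Arr \<delta> (\<lambda>t. q) 0" for q by (rule has_velocity_const[OF mA])
    have X: "has_velocity Arr \<delta> (\<lambda>t. x \<odot> \<gamma> t) (dm x (\<epsilon> m) (0, u))" "(0, u) \<in> CT x (\<epsilon> m)"
      using velocity_m[OF g(1) c[of x] g(3)] g(2,4) m by auto
    have Y: "has_velocity Arr \<delta> (\<lambda>t. invs \<G> (\<gamma> t) \<odot> y) (dm (\<epsilon> m) y (?u, 0))" "(?u, 0) \<in> CT (\<epsilon> m) y"
      using velocity_m[OF g(1) gi c[of y]] g(2,4) m i0 by auto
    have U: "has_velocity Arr \<delta> (\<lambda>t. \<gamma> t \<odot> invs \<G> (\<gamma> t)) (dm (\<epsilon> m) (\<epsilon> m) (u, ?u))" "(u, ?u) \<in> CT (\<epsilon> m) (\<epsilon> m)"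
      using velocity_m[OF g(1,3) gi] g(2) i0 by auto
    have "has_velocity Arr \<delta> (\<lambda>t. \<epsilon> m) (dm (\<epsilon> m) (\<epsilon> m) (u, ?u))"
      by (rule has_velocity_cong[OF U(1) g(1)]) (use mult_i(1) g(4) in auto)
    then have uu: "dm (\<epsilon> m) (\<epsilon> m) (u, ?u) = 0" using has_velocity_unique2[OF g(1) _ c] by blast
    \<comment> \<open>The product of \<gamma> and its inverse is constant; hence inversion reverses
      the sign of the pairing with tangent vectors of the unit section.\<close>
    have "\<Omega> (\<epsilon> m \<odot> \<epsilon> m) (dm (\<epsilon> m) (\<epsilon> m) (de m a, de m a)) (dm (\<epsilon> m) (\<epsilon> m) (u, ?u)) = \<Omega> (\<epsilon> m) (de m a) u + \<Omega> (\<epsilon> m) (de m a) ?u" for a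
      by (rule Omega_mult) (use U(2) in \<open>simp_all add: CT_iff\<close>)
    then have neg: "\<Omega> (\<epsilon> m) (de m a) ?u = - \<Omega> (\<epsilon> m) (de m a) u" for a by (simp add: uu) (metis add.commute neg_eq_iff_add_eq_0)
    let ?v = "dm x (\<epsilon> m) (0, u)" and ?w = "dm (\<epsilon> m) y (?u, 0)"
    have sx: "\<s> (x \<odot> \<gamma> t) = \<t> (invs \<G> (\<gamma> t) \<odot> y)" if "t \<in> Ivl \<delta>" for t
      using st_mult[of x "\<gamma> t"] st_mult[of "invs \<G> (\<gamma> t)" y] g(4)[OF that] m by simp
    have x1: "x \<odot> \<epsilon> m = x" "\<epsilon> m \<odot> y = y" using mult_e(1)[of x] mult_e(2)[of y] m by auto
    have V: "has_velocity Arr \<delta> (\<lambda>t. x \<odot> \<gamma> t \<odot> (invs \<G> (\<gamma> t) \<odot> y)) (dm x y (?v, ?w))" "(?v, ?w) \<in> CT x y"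
      using velocity_m[OF g(1) X(1) Y(1) sx] g(2) i0 x1 by auto
    have "x \<odot> \<gamma> t \<odot> (invs \<G> (\<gamma> t) \<odot> y) = x \<odot> y" if "t \<in> Ivl \<delta>" for t
    proof -
      have tg: "\<t> (\<gamma> t) = m" by (rule g(4)[OF that])
      have "x \<odot> \<gamma> t \<odot> (invs \<G> (\<gamma> t) \<odot> y) = x \<odot> (\<gamma> t \<odot> (invs \<G> (\<gamma> t) \<odot> y))"
        by (rule assoc) (use tg m st_mult(2)[of "invs \<G> (\<gamma> t)" y] in auto)
      also have "\<gamma> t \<odot> (invs \<G> (\<gamma> t) \<odot> y) = \<gamma> t \<odot> invs \<G> (\<gamma> t) \<odot> y" by (rule assoc[symmetric]) (use tg m in auto)
      also have "\<dots> = y" using mult_i(1)[of "\<gamma> t"] tg x1 by simp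
      finally show ?thesis .
    qed
    then have "has_velocity Arr \<delta> (\<lambda>t. x \<odot> y) (dm x y (?v, ?w))" by (rule has_velocity_cong[OF V(1) g(1)])
    then have vw: "dm x y (?v, ?w) = 0" using has_velocity_unique2[OF g(1) _ c] by blast
    \<comment> \<open>Writing X as its product with the unit vector over its source direction turns
      the pairing with the velocity of x \<gamma> into a pairing at the unit.\<close>
    have "\<Omega> (x \<odot> \<epsilon> m) (dm x (\<epsilon> m) (X, de m (ds x X))) ?v = \<Omega> x X 0 + \<Omega> (\<epsilon> m) (de m (ds x X)) u"
      by (rule Omega_mult) (use X(2) m in \<open>simp_all add: CT_iff\<close>)
    then have a: "\<Omega> x X ?v = \<Omega> (\<epsilon> m) (de m (ds x X)) u" using dm_unit_right[of x X] m x1 by simp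
    have "\<Omega> (\<epsilon> m \<odot> y) (dm (\<epsilon> m) y (de m (dt y Y), Y)) ?w = \<Omega> (\<epsilon> m) (de m (dt y Y)) ?u + \<Omega> y Y 0"
      by (rule Omega_mult) (use Y(2) m in \<open>simp_all add: CT_iff\<close>)
    then have b: "\<Omega> y Y ?w = - \<Omega> (\<epsilon> m) (de m (dt y Y)) u" using dm_unit_left[of y Y] m x1 neg by simp
    show ?thesis using Z[OF V(2)] a b vw by (simp add: blinfun.diff_right O.diff_left)
  qed
  \<comment> \<open>A tangent vector at a unit splits into one along the target fibre and one along
    the unit section; the latter contributes nothing by isotropy.\<close>
  have "\<Omega> (\<epsilon> m) (de m ?a) w = 0" for w
  proof -
    have "dt (\<epsilon> m) (w - de m (dt (\<epsilon> m) w)) = 0" by (simp add: blinfun.diff_right)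
    from 1[OF this] show ?thesis by (simp add: O.diff_right units_isotropic)
  qed
  then have "de m ?a = 0" using Omega_nondeg by blast
  then have "?a = 0" using ds_de[of m ?a] by (metis blinfun.zero_right)
  then show ct: "(X, Y) \<in> CT x y" by (simp add: CT_iff)
  \<comment> \<open>Products of composable vectors fill the tangent space at x y, so nondegeneracy
    identifies Z.\<close>
  have "\<Omega> (x \<odot> y) (Z - dm x y (X, Y)) V = 0" for V
  proof -
    obtain v w where vw: "(v, w) \<in> CT x y" "dm x y (v, w) = V" by (rule dm_surj[OF xy])
    show ?thesis using Z[OF vw(1)] Omega_mult[OF xy ct vw(1)] vw(2) by (simp add: O.diff_left)
  qed
  then have "Z - dm x y (X, Y) = 0" using Omega_nondeg by blast
  then show "Z = dm x y (X, Y)" by simp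
qed

text \<open>Nondegeneracy makes v \<mapsto> \<Omega> x v injective, hence bijective onto the
  covectors by dimension, so the descriptions in \<open>inverse_bivector\<close> and in
  \<open>sharp\<close> each single out one vector.\<close>

lemma sharp_inverse: "\<Omega> x (sharp (inverse_bivector \<Omega>) x \<alpha>) w = blinfun_apply \<alpha> w"
proof -
  interpret O: bounded_bilinear "\<Omega> x" by (rule Omega_bilinear)
  have fd: "fin_dim TYPE('u)" by (rule manifold_fin_dim[OF mA])
  obtain B :: "'u set" where B: "finite B" "\<And>b. b \<in> B \<Longrightarrow> norm b = 1" "\<And>x. (\<Sum>b\<in>B. (x \<bullet> b) *\<^sub>R b) = x" using fin_dimE[OF fd] by metis
  let ?f = "\<lambda>v. \<Sum>b\<in>B. \<Omega> x v b *\<^sub>R b"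
  have l: "linear ?f"
    by (rule linearI) (simp_all add: O.add_left O.scaleR_left scaleR_left.add sum.distrib scaleR_right.sum)
  have exp: "\<Omega> x v w = ?f v \<bullet> w" for v w
  proof -
    have "\<Omega> x v w = \<Omega> x v (\<Sum>b\<in>B. (w \<bullet> b) *\<^sub>R b)" by (simp add: B(3))
    also have "\<dots> = ?f v \<bullet> w" unfolding O.sum_right O.scaleR_right inner_sum_left inner_scaleR_left
      by (intro sum.cong refl) (simp add: inner_commute[of w])
    finally show ?thesis .
  qed
  have "inj ?f"
  proof (rule injI)
    fix v w assume eq: "?f v = ?f w"
    have "\<Omega> x (v - w) z = 0" for z unfolding O.diff_left exp[of v z] exp[of w z] eq by simp
    then show "v = w" using Omega_nondeg[of "v - w" x] by auto
  qed
  then have s: "surj ?f" by (rule linear_inj_imp_surj_fin_dim[OF fd l])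
  define a where "a = (\<Sum>b\<in>B. \<alpha> b *\<^sub>R b)"
  have a: "blinfun_apply \<alpha> w = a \<bullet> w" for w
  proof -
    have "blinfun_apply \<alpha> w = \<alpha> (\<Sum>b\<in>B. (w \<bullet> b) *\<^sub>R b)" by (simp add: B(3))
    then show ?thesis unfolding a_def blinfun.sum_right blinfun.scaleR_right inner_sum_left inner_scaleR_left
      by (simp add: inner_commute[of w] mult.commute)
  qed
  obtain v where fv: "?f v = a" by (rule surjE[OF s, of a]) simp
  have "\<Omega> x v w = \<alpha> w" for w unfolding exp[of v w] fv a ..
  then have v: "\<forall>w. \<Omega> x v w = \<alpha> w" by blast
  have uniq: "v' = v" if "\<forall>w. \<Omega> x v' w = \<alpha> w" for v'
  proof (rule ccontr)
    assume "v' \<noteq> v"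
    then obtain w where "\<Omega> x (v' - v) w \<noteq> 0" using Omega_nondeg[of "v' - v" x] by auto
    then show False using that v by (simp add: O.diff_left)
  qed
  have the: "(THE v. \<forall>w. \<Omega> x v w = \<alpha> w) = v"
  proof (rule the_equality)
    show "\<forall>w. \<Omega> x v w = \<alpha> w" by (rule v)
  qed (rule uniq)
  have "sharp (inverse_bivector \<Omega>) x \<alpha> = (THE v'. \<forall>\<beta>::'u \<Rightarrow>\<^sub>L real. blinfun_apply \<beta> v' = \<beta> v)"
    unfolding sharp_def inverse_bivector_def the by (rule refl)
  also have "(THE v'. \<forall>\<beta>::'u \<Rightarrow>\<^sub>L real. blinfun_apply \<beta> v' = \<beta> v) = v"
  proof (rule the_equality)
    show "\<forall>\<beta>::'u \<Rightarrow>\<^sub>L real. blinfun_apply \<beta> v = \<beta> v" by blast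
    fix v' assume "\<forall>\<beta>::'u \<Rightarrow>\<^sub>L real. blinfun_apply \<beta> v' = \<beta> v"
    then show "v' = v" by - (rule covector_eqD, blast)
  qed
  finally show ?thesis using v by simp
qed

end

section \<open>Hamiltonian actions on symplectic groupoids\<close>

locale hamiltonian_groupoid = symp_groupoid \<G> \<Omega> + dual_plg G Gs \<iota> \<sigma> \<rho>
  for \<G> :: "('p::topological_space, 'u::real_inner, 'm::topological_space, 'x::real_inner) groupoid"
    and \<Omega> :: "'p \<Rightarrow> 'u \<Rightarrow> 'u \<Rightarrow> real"
    and G :: "('g::topological_space, 'v::real_inner) poisson_lie_group"
    and Gs :: "('h::topological_space, 'w::real_inner) poisson_lie_group"
    and \<iota> :: "'w \<Rightarrow>\<^sub>L 'v \<Rightarrow>\<^sub>L real" and \<sigma> :: "'g \<Rightarrow> 'h \<Rightarrow> 'h" and \<rho> :: "'g \<Rightarrow> 'h \<Rightarrow> 'g" +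
  fixes act :: "'g \<Rightarrow> 'p \<Rightarrow> 'p" and J :: "'p \<Rightarrow> 'h"
  assumes action: "smooth_left_action G (arrows \<G>) act"
    and momentum: "momentum_map G Gs \<iota> (arrows \<G>) (inverse_bivector \<Omega>) act J"
    and equivariant: "J (act g x) = \<sigma> g (J x)"
    and J_unit [simp]: "J (ident \<G> m) = gone Gs"
begin

sublocale a: lie_action G "arrows \<G>" act
  by (intro lie_action.intro lie_action_axioms.intro g.lie_grp_axioms mA action)

abbreviation "dJ x \<equiv> blinfun_apply (tmap (arrows \<G>) (atlas Gs) J x)"
abbreviation "\<kappa> u \<equiv> blinfun_apply (coad pairing Gs u)"
abbreviation "\<xi>R \<xi> u v \<equiv> blinfun_apply (right_inv_form Gs (id_transpose \<iota> \<xi>) u) v"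

lemma smooth_J: "smooth_map Arr (atlas Gs) J"
  using momentum unfolding momentum_map_def by blast

lemma has_tmap_J: "has_tmap Arr (atlas Gs) UNIV J x (dJ x)"
  by (rule smooth_map_has_tmap[OF mA smooth_J])

lemma Omega_gen: "\<Omega> x (a.gen \<xi> x) v = \<xi>R \<xi> (J x) (dJ x v)"
proof -
  have "a.gen \<xi> x = sharp (inverse_bivector \<Omega>) x (right_inv_form Gs (id_transpose \<iota> \<xi>) (J x) o\<^sub>L tmap Arr (atlas Gs) J x)"
    using momentum unfolding momentum_map_def by blast
  then show ?thesis by (simp add: sharp_inverse)
qed

text \<open>In the right trivialization of a product the second factor is moved past a by
  \<open>Ad Gs a\<close>, whose transpose is \<kappa> a.\<close>

lemma right_form_mult:
  "\<xi>R \<xi> (gmult Gs a b) (dR Gs b a v + dL Gs a b w) = \<xi>R \<xi> a v + \<xi>R (\<kappa> a \<xi>) b w"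
proof -
  have "dR Gs (ginv Gs (gmult Gs a b)) (gmult Gs a b) (dL Gs a b w) = Ad Gs a (dR Gs (ginv Gs b) b w)"
    using s.dL_dR[of a b "ginv Gs b" w] s.dR_dR[of "ginv Gs a" "gmult Gs a b" "ginv Gs b" "dL Gs a b w"]
    by (simp add: Ad_def s.right_inverse)
  then show ?thesis
    by (simp add: s.right_inv_form_apply blinfun.add_right s.dR_dR id_transpose_apply c1.coad_apply)
qed

definition infinitesimal where
  "infinitesimal x y \<longleftrightarrow> (\<forall>\<xi>. (a.gen \<xi> x, a.gen (\<kappa> (J x) \<xi>) y) \<in> CT x y \<and>
     a.gen \<xi> (x \<odot> y) = dm x y (a.gen \<xi> x, a.gen (\<kappa> (J x) \<xi>) y))"

text \<open>By the momentum map condition the hypothesis of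
  \<open>composable_tangent_criterion\<close> concerns the differential of J on a product vector. It
  is obtained by differentiating the morphism property along composable curves.\<close>

lemma morphism_imp_infinitesimal:
  assumes J: "\<And>x y. \<s> x = \<t> y \<Longrightarrow> J (x \<odot> y) = gmult Gs (J x) (J y)" and xy: "\<s> x = \<t> y"
  shows "infinitesimal x y"
  unfolding infinitesimal_def
proof (intro allI)
  fix \<xi>
  have "\<Omega> (x \<odot> y) (a.gen \<xi> (x \<odot> y)) (dm x y (v, w)) = \<Omega> x (a.gen \<xi> x) v + \<Omega> y (a.gen (\<kappa> (J x) \<xi>) y) w"
    if vw: "(v, w) \<in> CT x y" for v w
  proof -
    obtain c d \<delta> where c: "\<delta> > 0" "has_velocity Arr \<delta> c v" "has_velocity Arr \<delta> d w" "c 0 = x" "d 0 = y" "\<And>t. t \<in> Ivl \<delta> \<Longrightarrow> \<s> (c t) = \<t> (d t)"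
      by (rule composable_curves[OF xy vw]) blast
    have 1: "has_velocity Arr \<delta> (\<lambda>t. c t \<odot> d t) (dm x y (v, w))" using velocity_m(1)[OF c(1,2,3,6)] c(4,5) by simp
    have 2: "has_velocity (atlas Gs) \<delta> (\<lambda>t. J (c t \<odot> d t)) (dJ (x \<odot> y) (dm x y (v, w)))"
      by (rule has_velocity_compose[OF mA 1 _ c(1)]) (use has_tmap_J c(4,5) in simp)
    have "has_velocity (atlas Gs) \<delta> (\<lambda>t. J (c t)) (dJ x v)" "has_velocity (atlas Gs) \<delta> (\<lambda>t. J (d t)) (dJ y w)"
      by (rule has_velocity_compose[OF mA c(2) _ c(1)], use has_tmap_J c(4) in simp)
        (rule has_velocity_compose[OF mA c(3) _ c(1)], use has_tmap_J c(5) in simp)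
    from has_velocityI[OF s.has_tmap_mult[OF manifold_real this]] c(1,4,5)
    have 3: "has_velocity (atlas Gs) \<delta> (\<lambda>t. gmult Gs (J (c t)) (J (d t))) (dR Gs (J y) (J x) (dJ x v) + dL Gs (J x) (J y) (dJ y w))"
      by simp
    have "has_velocity (atlas Gs) \<delta> (\<lambda>t. J (c t \<odot> d t)) (dR Gs (J y) (J x) (dJ x v) + dL Gs (J x) (J y) (dJ y w))"
      by (rule has_velocity_cong[OF 3 c(1)]) (use J c(6) in auto)
    from has_velocity_unique2[OF c(1) 2 this] show ?thesis
      unfolding Omega_gen J[OF xy] by (simp add: right_form_mult)
  qed
  from composable_tangent_criterion[OF xy this]
  show "(a.gen \<xi> x, a.gen (\<kappa> (J x) \<xi>) y) \<in> CT x y \<and> a.gen \<xi> (x \<odot> y) = dm x y (a.gen \<xi> x, a.gen (\<kappa> (J x) \<xi>) y)" by blast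
qed

lemma infinitesimal_pairing:
  assumes xy: "\<s> x = \<t> y" and i: "infinitesimal x y" and vw: "(v, w) \<in> CT x y"
  shows "\<xi>R \<xi> (J (x \<odot> y)) (dJ (x \<odot> y) (dm x y (v, w))) = \<xi>R \<xi> (J x) (dJ x v) + \<xi>R (\<kappa> (J x) \<xi>) (J y) (dJ y w)"
  using Omega_mult[OF xy _ vw, of "a.gen \<xi> x" "a.gen (\<kappa> (J x) \<xi>) y"] i unfolding infinitesimal_def by (metis Omega_gen)

section \<open>Integration along the group and along source fibres\<close>

lemma right_dress_one: "\<rho> (gone G) u = gone G"
  using m.d2.fix_one by simp

lemma has_tmap_dress: "has_tmap (atlas G) (atlas G) UNIV (\<lambda>h. \<rho> h u) h (\<lambda>v. dR G (\<rho> h u) (gone G) (\<kappa> (\<sigma> h u) (dR G (ginv G h) h v)))"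
  by (rule m.has_tmap_right_action)

lemma has_tmap_orbit: "has_tmap (atlas G) Arr UNIV (\<lambda>h. act h x) h (\<lambda>v. a.gen (dR G (ginv G h) h v) (act h x))"
  using smooth_map_has_tmap[OF g.mf a.smooth_act1[of x], of h] unfolding a.orbit_derivative[abs_def] .

lemma has_tmap_dress_orbit:
  "has_tmap (atlas G) Arr UNIV (\<lambda>h. act (\<rho> h u) y) h (\<lambda>v. a.gen (\<kappa> (\<sigma> h u) (dR G (ginv G h) h v)) (act (\<rho> h u) y))"
proof -
  have "has_tmap (atlas G) Arr UNIV (\<lambda>h. act (\<rho> h u) y) h (\<lambda>v. a.gen (dR G (ginv G (\<rho> h u)) (\<rho> h u)
      (dR G (\<rho> h u) (gone G) (\<kappa> (\<sigma> h u) (dR G (ginv G h) h v)))) (act (\<rho> h u) y))"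
    by (rule has_tmap_chain[OF g.mf g.mf has_tmap_dress has_tmap_orbit]) auto
  then show ?thesis using g.dR_inv[of "\<rho> h u" "gone G"] by simp
qed

lemma integrate_orbit:
  assumes "\<And>h. has_tmap (atlas G) Arr UNIV f h (\<lambda>v. a.gen (dR G (ginv G h) h v) (f h))"
  shows "f h = act h (f (gone G))"
proof -
  have 1: "has_tmap (atlas G) (atlas G) UNIV (\<lambda>x. x) x (\<lambda>v. dR G x (gone G) (dR G (ginv G x) x v))" for x
    using has_tmap_ident[OF g.mf UNIV_I, of x] by (simp add: g.dR_rlog)
  have "act (ginv G h) (f h) = act (ginv G (gone G)) (f (gone G))" by (rule a.integrate[OF g.mf conn 1 assms])
  then have "act h (act (ginv G h) (f h)) = act h (f (gone G))" by simp
  then show ?thesis by simp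
qed

text \<open>By the compatibility of the dressing actions, the map h \<mapsto> \<rho> h u has
  logarithmic derivative \<kappa> (\<sigma> h u) applied to that of h. A map with the same
  logarithmic derivative along the action is moved by \<rho> h u.\<close>

lemma integrate_dress:
  assumes "\<And>h. has_tmap (atlas G) Arr UNIV f h (\<lambda>v. a.gen (\<kappa> (\<sigma> h u) (dR G (ginv G h) h v)) (f h))"
  shows "f h = act (\<rho> h u) (f (gone G))"
proof -
  have "act (ginv G (\<rho> h u)) (f h) = act (ginv G (\<rho> (gone G) u)) (f (gone G))"
    by (rule a.integrate[OF g.mf conn has_tmap_dress assms])
  then have "act (\<rho> h u) (act (ginv G (\<rho> h u)) (f h)) = act (\<rho> h u) (f (gone G))" by (simp add: right_dress_one)
  then show ?thesis by simp
qed

text \<open>The product on the right makes sense only after composability is known for all h. This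
  is settled on units: the identity at pairs containing a unit shows how generators project under
  source and target, and integration gives the motion of the units at the ends of x and y.\<close>

lemma twisted_multiplicativity:
  assumes inf: "\<And>x y. \<s> x = \<t> y \<Longrightarrow> infinitesimal x y" and xy: "\<s> x = \<t> y"
  shows "\<s> (act h x) = \<t> (act (\<rho> h (J x)) y)" "act h (x \<odot> y) = act h x \<odot> act (\<rho> h (J x)) y"
proof -
  \<comment> \<open>Generators at units are tangent to the unit section: with c the unit vector over
    the source direction of X, linearity and the unit laws turn X = dm (X, X) into X = X + X -
    c.\<close>
  have unit: "de m (ds (\<epsilon> m) (a.gen \<xi> (\<epsilon> m))) = a.gen \<xi> (\<epsilon> m)" for m \<xi>
  proof -
    let ?X = "a.gen \<xi> (\<epsilon> m)"
    have i: "(?X, ?X) \<in> CT (\<epsilon> m) (\<epsilon> m)" "?X = dm (\<epsilon> m) (\<epsilon> m) (?X, ?X)"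
      using inf[of "\<epsilon> m" "\<epsilon> m"] unfolding infinitesimal_def by (simp_all add: unit_mult)
    let ?c = "de m (ds (\<epsilon> m) ?X)"
    have "(?X, ?X) = (?X, ?c) + (?c, ?X) - (?c, ?c)" by simp
    then have "dm (\<epsilon> m) (\<epsilon> m) (?X, ?X) = dm (\<epsilon> m) (\<epsilon> m) (?X, ?c) + dm (\<epsilon> m) (\<epsilon> m) (?c, ?X) - dm (\<epsilon> m) (\<epsilon> m) (?c, ?c)"
      by (simp only: blinfun.add_right blinfun.diff_right)
    moreover have "dm (\<epsilon> m) (\<epsilon> m) (?X, ?c) = ?X" using dm_unit_right[of "\<epsilon> m" ?X] by simp
    moreover have "dm (\<epsilon> m) (\<epsilon> m) (?c, ?X) = ?X" using dm_unit_left[of "\<epsilon> m" ?X] i(1) by (simp add: CT_iff)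
    ultimately have "?X = ?X + ?X - ?c" using i(2) dm_one_units[of m] by simp
    from arg_cong[OF this, of "\<lambda>z. z + ?c"] show ?thesis by simp
  qed
  \<comment> \<open>J is neutral on units, so for a pair of a unit and y both generators belong to
    the same \<xi>.\<close>
  have t: "de (\<t> y) (dt y (a.gen \<xi> y)) = a.gen \<xi> (\<epsilon> (\<t> y))" for y \<xi>
    using inf[of "\<epsilon> (\<t> y)" y] unit[of "\<t> y" \<xi>] unfolding infinitesimal_def CT_iff by simp
  \<comment> \<open>For a pair of x and a unit the second generator carries \<kappa> (J x); this is
    why the source of x moves by the dressed element.\<close>
  have s: "de (\<s> x) (ds x (a.gen \<xi> x)) = a.gen (\<kappa> (J x) \<xi>) (\<epsilon> (\<s> x))" for x \<xi>
    using inf[of x "\<epsilon> (\<s> x)"] t[of "\<epsilon> (\<s> x)" "\<kappa> (J x) \<xi>"] unfolding infinitesimal_def CT_iff by simp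
  have et: "\<epsilon> (\<t> (act h y)) = act h (\<epsilon> (\<t> y))" for h y
  proof -
    have "has_tmap (atlas G) Obj UNIV (\<lambda>h. \<t> (act h y)) h (\<lambda>v. dt (act h y) (a.gen (dR G (ginv G h) h v) (act h y)))" for h
      by (rule has_tmap_chain[OF g.mf mA has_tmap_orbit has_tmap_t]) auto
    then have "has_tmap (atlas G) Arr UNIV (\<lambda>h. \<epsilon> (\<t> (act h y))) h (\<lambda>v. de (\<t> (act h y)) (dt (act h y) (a.gen (dR G (ginv G h) h v) (act h y))))" for h
      by (rule has_tmap_chain[OF g.mf mO _ has_tmap_e]) auto
    then show ?thesis using integrate_orbit[of "\<lambda>h. \<epsilon> (\<t> (act h y))" h] unfolding t by simp
  qed
  have es: "\<epsilon> (\<s> (act h x)) = act (\<rho> h (J x)) (\<epsilon> (\<s> x))" for h x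
  proof -
    have "has_tmap (atlas G) Obj UNIV (\<lambda>h. \<s> (act h x)) h (\<lambda>v. ds (act h x) (a.gen (dR G (ginv G h) h v) (act h x)))" for h
      by (rule has_tmap_chain[OF g.mf mA has_tmap_orbit has_tmap_s]) auto
    then have "has_tmap (atlas G) Arr UNIV (\<lambda>h. \<epsilon> (\<s> (act h x))) h (\<lambda>v. de (\<s> (act h x)) (ds (act h x) (a.gen (dR G (ginv G h) h v) (act h x))))" for h
      by (rule has_tmap_chain[OF g.mf mO _ has_tmap_e]) auto
    then show ?thesis using integrate_dress[of "\<lambda>h. \<epsilon> (\<s> (act h x))" "J x" h] unfolding s equivariant by simp
  qed
  \<comment> \<open>The units at both ends are images of the common unit over \<s> x = \<t> y under
    the same group element.\<close>
  have comp: "\<s> (act h x) = \<t> (act (\<rho> h (J x)) y)" for h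
  proof -
    have "\<epsilon> (\<s> (act h x)) = \<epsilon> (\<t> (act (\<rho> h (J x)) y))" unfolding es et xy ..
    then show ?thesis by (metis st_e(1))
  qed
  show "\<s> (act h x) = \<t> (act (\<rho> h (J x)) y)" by (rule comp)
  have "has_tmap (atlas G) Arr UNIV (\<lambda>h. act h x \<odot> act (\<rho> h (J x)) y) h
     (\<lambda>v. a.gen (dR G (ginv G h) h v) (act h x \<odot> act (\<rho> h (J x)) y))" for h
  proof -
    have "has_tmap (atlas G) Arr UNIV (\<lambda>h. act h x \<odot> act (\<rho> h (J x)) y) h
       (\<lambda>v. dm (act h x) (act (\<rho> h (J x)) y) (a.gen (dR G (ginv G h) h v) (act h x), a.gen (\<kappa> (\<sigma> h (J x)) (dR G (ginv G h) h v)) (act (\<rho> h (J x)) y)))"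
      by (rule has_tmap_m[OF g.mf has_tmap_orbit has_tmap_dress_orbit UNIV_I comp])
    \<comment> \<open>The identity is applied at the moved pair, where equivariance turns \<sigma> h
      (J x) into the value of J there.\<close>
    then show ?thesis using inf[OF comp[of h]] unfolding infinitesimal_def equivariant by simp
  qed
  from integrate_orbit[of "\<lambda>h. act h x \<odot> act (\<rho> h (J x)) y", OF this, of h]
  show "act h (x \<odot> y) = act h x \<odot> act (\<rho> h (J x)) y" by (simp add: right_dress_one)
qed

text \<open>Composability and the product formula are both differentiated at the unit of the group,
  where h \<mapsto> \<rho> h (J x) has differential \<kappa> (J x).\<close>

lemma twisted_imp_infinitesimal:
  assumes tw: "\<And>h. \<s> (act h x) = \<t> (act (\<rho> h (J x)) y)" "\<And>h. act h (x \<odot> y) = act h x \<odot> act (\<rho> h (J x)) y"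
  shows "infinitesimal x y"
  unfolding infinitesimal_def
proof (intro allI)
  fix \<xi>
  let ?X = "a.gen \<xi> x" and ?Y = "a.gen (\<kappa> (J x) \<xi>) y"
  let ?e = "gone G"
  have D: "has_tmap (atlas G) Arr UNIV (\<lambda>h. act (\<rho> h (J x)) y) ?e (\<lambda>\<xi>. a.gen (\<kappa> (J x) \<xi>) y)"
    using has_tmap_dress_orbit[of "J x" y ?e] by (simp add: right_dress_one)
  have "has_tmap (atlas G) Arr UNIV (\<lambda>h. act h x \<odot> act (\<rho> h (J x)) y) ?e (\<lambda>\<xi>. dm x y (a.gen \<xi> x, a.gen (\<kappa> (J x) \<xi>) y))"
    using has_tmap_m[OF g.mf a.has_tmap_orbit_one D UNIV_I tw(1)] by (simp add: right_dress_one)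
  then have "has_tmap (atlas G) Arr UNIV (\<lambda>h. act h (x \<odot> y)) ?e (\<lambda>\<xi>. dm x y (a.gen \<xi> x, a.gen (\<kappa> (J x) \<xi>) y))"
    unfolding tw(2) .
  from fun_cong[OF has_tmap_uniq2[OF g.mf a.has_tmap_orbit_one this], of \<xi>]
  have 1: "a.gen \<xi> (x \<odot> y) = dm x y (?X, ?Y)" .
  have s: "has_tmap (atlas G) Obj UNIV (\<lambda>h. \<s> (act h x)) ?e (\<lambda>\<xi>. ds x (a.gen \<xi> x))"
    by (rule has_tmap_chain[OF g.mf mA a.has_tmap_orbit_one]) (use has_tmap_s in auto)
  have "has_tmap (atlas G) Obj UNIV (\<lambda>h. \<t> (act (\<rho> h (J x)) y)) ?e (\<lambda>\<xi>. dt y (a.gen (\<kappa> (J x) \<xi>) y))"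
    by (rule has_tmap_chain[OF g.mf mA D]) (use has_tmap_t in \<open>auto simp: right_dress_one\<close>)
  then have "has_tmap (atlas G) Obj UNIV (\<lambda>h. \<s> (act h x)) ?e (\<lambda>\<xi>. dt y (a.gen (\<kappa> (J x) \<xi>) y))" unfolding tw(1) .
  from fun_cong[OF has_tmap_uniq2[OF g.mf s this], of \<xi>] have "(?X, ?Y) \<in> CT x y" by (simp add: CT_iff)
  with 1 show "(?X, ?Y) \<in> CT x y \<and> a.gen \<xi> (x \<odot> y) = dm x y (?X, ?Y)" by blast
qed

lemma covector_separation: "(\<And>\<xi>. \<iota> u \<xi> = \<iota> v \<xi>) \<Longrightarrow> u = v"
  using bij by (metis bij_is_inj blinfun_eqI inj_eq)

text \<open>For fixed y, the quotient of J x J y by J (x y) is a function of x on the source fibre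
  over the target of y, and it is neutral at the unit in that fibre. The infinitesimal identity,
  paired with vectors (v, 0), makes its differential vanish.\<close>

lemma infinitesimal_imp_morphism:
  assumes sc: "source_connected \<G>" and inf: "\<And>x y. \<s> x = \<t> y \<Longrightarrow> infinitesimal x y" and xy: "\<s> x = \<t> y"
  shows "J (x \<odot> y) = gmult Gs (J x) (J y)"
proof -
  let ?S = "{x. \<s> x = \<t> y}" and ?q = "\<lambda>x. gmult Gs (ginv Gs (J (x \<odot> y))) (gmult Gs (J x) (J y))"
  have P: "manifold (prod_atlas Arr Arr)" by (rule manifold_prod[OF mA mA])
  have "smooth_map_on Arr (prod_atlas Arr Arr) ?S (\<lambda>x. (x, y))"
    by (intro smooth_map_on_Pair smooth_map_on_ident smooth_map_on_const mA)
  from smooth_map_on_compose[OF mA P this smooth_m]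
  have "smooth_map_on Arr Arr ?S (\<lambda>x. x \<odot> y)" by (simp add: composable_iff)
  then have "smooth_map_on Arr (atlas Gs) ?S (\<lambda>x. J (x \<odot> y))"
    by (rule smooth_map_on_compose[OF mA mA _ smooth_J]) auto
  then have q: "smooth_map_on Arr (atlas Gs) ?S ?q"
    by (intro s.smooth_map_mult[OF mA] s.smooth_map_inv[OF mA] smooth_map_on_const s.mf smooth_map_on_subset[OF smooth_J]) auto
  have ker: "tmap_on Arr (atlas Gs) ?S ?q z v = 0" if z: "z \<in> ?S" and v: "ds z v = 0" for z v
  proof -
    have zy: "\<s> z = \<t> y" using z by simp
    let ?Q = "tmap_on Arr (atlas Gs) ?S ?q z v"
    have "has_velocity Obj 1 (\<lambda>t. \<s> z) (ds z v)" unfolding v by (rule has_velocity_const[OF mO])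
    from submersion_lift[OF mA mO smooth_s surj_s this refl zero_less_one]
    obtain \<gamma> \<delta> where g: "0 < \<delta>" "\<gamma> 0 = z" "has_velocity Arr \<delta> \<gamma> v" "\<And>t. t \<in> Ivl \<delta> \<Longrightarrow> \<s> (\<gamma> t) = \<s> z" by blast
    have gy: "\<s> (\<gamma> t) = \<t> y" if "t \<in> Ivl \<delta>" for t using g(4)[OF that] zy by simp
    let ?V = "dm z y (v, 0)"
    have m: "has_velocity Arr \<delta> (\<lambda>t. \<gamma> t \<odot> y) ?V" "(v, 0) \<in> CT z y"
      using velocity_m[OF g(1,3) has_velocity_const[OF mA, of \<delta> y] gy] g(2) by auto
    have VJ: "has_velocity (atlas Gs) \<delta> (\<lambda>t. J (\<gamma> t \<odot> y)) (dJ (z \<odot> y) ?V)"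
      by (rule has_velocity_compose[OF mA m(1) _ g(1)]) (unfold g(2), rule has_tmap_J)
    have vJ: "has_velocity (atlas Gs) \<delta> (\<lambda>t. J (\<gamma> t)) (dJ z v)"
      by (rule has_velocity_compose[OF mA g(3) _ g(1)]) (unfold g(2), rule has_tmap_J)
    have vq: "has_velocity (atlas Gs) \<delta> (\<lambda>t. ?q (\<gamma> t)) ?Q"
      by (rule has_velocity_within_compose[OF mA g(3) _ g(1)]) (use smooth_map_on_has_tmap[OF mA q z] g(2) gy in auto)
    \<comment> \<open>The differential of the quotient is found by differentiating its product with
      J (x y), which avoids differentiating the inverse.\<close>
    have 1: "has_velocity (atlas Gs) \<delta> (\<lambda>t. gmult Gs (J (\<gamma> t \<odot> y)) (?q (\<gamma> t))) (dR Gs (?q z) (J (z \<odot> y)) (dJ (z \<odot> y) ?V) + dL Gs (J (z \<odot> y)) (?q z) ?Q)"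
      using has_velocityI[OF s.has_tmap_mult[OF manifold_real VJ vq]] g(1,2) by simp
    have 2: "has_velocity (atlas Gs) \<delta> (\<lambda>t. gmult Gs (J (\<gamma> t)) (J y)) (dR Gs (J y) (J z) (dJ z v))"
      using has_velocityI[OF s.has_tmap_mult[OF manifold_real vJ has_velocity_const[OF s.mf]]] g(1,2) by simp
    have "has_velocity (atlas Gs) \<delta> (\<lambda>t. gmult Gs (J (\<gamma> t)) (J y)) (dR Gs (?q z) (J (z \<odot> y)) (dJ (z \<odot> y) ?V) + dL Gs (J (z \<odot> y)) (?q z) ?Q)"
      by (rule has_velocity_cong[OF 1 g(1)]) simp
    from has_velocity_unique2[OF g(1) 2 this]
    have eq: "dR Gs (J y) (J z) (dJ z v) = dR Gs (?q z) (J (z \<odot> y)) (dJ (z \<odot> y) ?V) + dL Gs (J (z \<odot> y)) (?q z) ?Q" .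
    let ?\<omega> = "dR Gs (ginv Gs (J z)) (J z) (dJ z v)"
    \<comment> \<open>As the second vector is 0, the pairing identity equates the right logarithmic
      derivatives of J (\<gamma> y) and J \<gamma> against every \<xi>.\<close>
    have "dR Gs (ginv Gs (J (z \<odot> y))) (J (z \<odot> y)) (dJ (z \<odot> y) ?V) = ?\<omega>"
    proof (rule covector_separation)
      fix \<xi>
      show "\<iota> (dR Gs (ginv Gs (J (z \<odot> y))) (J (z \<odot> y)) (dJ (z \<odot> y) ?V)) \<xi> = \<iota> ?\<omega> \<xi>"
        using infinitesimal_pairing[OF zy inf[OF zy] m(2), of \<xi>]
        by (simp add: blinfun.zero_right s.right_inv_form_apply id_transpose_apply)
    qed
    then have V: "dJ (z \<odot> y) ?V = dR Gs (J (z \<odot> y)) (gone Gs) ?\<omega>" using s.dR_rlog[of "J (z \<odot> y)" "dJ (z \<odot> y) ?V"] by simp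
    have v': "dJ z v = dR Gs (J z) (gone Gs) ?\<omega>" by (simp add: s.dR_rlog)
    have "dR Gs (?q z) (J (z \<odot> y)) (dJ (z \<odot> y) ?V) = dR Gs (gmult Gs (J z) (J y)) (gone Gs) ?\<omega>"
      unfolding V using s.dR_dR[of "?q z" "gone Gs" "J (z \<odot> y)" ?\<omega>] by simp
    moreover have "dR Gs (J y) (J z) (dJ z v) = dR Gs (gmult Gs (J z) (J y)) (gone Gs) ?\<omega>"
      using s.dR_dR[of "J y" "gone Gs" "J z" ?\<omega>] by (simp add: s.dR_rlog)
    ultimately have "dL Gs (J (z \<odot> y)) (?q z) ?Q = dL Gs (J (z \<odot> y)) (?q z) 0" using eq by simp
    then show ?thesis by (rule s.dL_eqD)
  qed
  have "connected ?S" using sc unfolding source_connected_def by blast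
  from submersion_fibre_connected[OF mA mO s.mf sub_s refl this q ker, of x "\<epsilon> (\<t> y)"]
  have "?q x = ?q (\<epsilon> (\<t> y))" using xy by simp
  then have "?q x = gone Gs" by (simp add: s.left_inverse)
  then have "gmult Gs (J (x \<odot> y)) (?q x) = J (x \<odot> y)" by simp
  then show ?thesis by simp
qed

end

theorem proposition1:
  fixes G :: "('g::{t2_space,second_countable_topology}, 'v::real_inner) poisson_lie_group"
    and Gs :: "('h::{t2_space,second_countable_topology}, 'w::real_inner) poisson_lie_group"
    and \<iota> :: "'w \<Rightarrow>\<^sub>L 'v \<Rightarrow>\<^sub>L real"
    and \<G> :: "('p::second_countable_topology, 'u::real_inner,
               'm::{t2_space,second_countable_topology}, 'x::real_inner) groupoid"
    and \<Omega> :: "'p \<Rightarrow> 'u \<Rightarrow> 'u \<Rightarrow> real"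
    and act :: "'g \<Rightarrow> 'p \<Rightarrow> 'p"
    and J :: "'p \<Rightarrow> 'h"
  assumes "is_poisson_lie_group G" and "connected (UNIV :: 'g set)"
    and "is_dual_group G Gs \<iota>"
    and "complete_poisson_lie_group G Gs \<iota>"
    and "symplectic_groupoid \<G> \<Omega>" and "source_connected \<G>"
    and "hamiltonian_action G Gs \<iota> (arrows \<G>) (inverse_bivector \<Omega>) act J"
    and "J ` range (ident \<G>) = {gone Gs}"
  shows "(\<forall>(x, y) \<in> composable \<G>. J (arr_mult \<G> x y) = gmult Gs (J x) (J y)) \<longleftrightarrow>
         (\<forall>(x, y) \<in> composable \<G>. \<forall>g.
            (act g x, act (dress G Gs \<iota> g (J x)) y) \<in> composable \<G> \<and>
            act g (arr_mult \<G> x y) = arr_mult \<G> (act g x) (act (dress G Gs \<iota> g (J x)) y))"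
proof -
  obtain \<sigma> where \<sigma>: "is_left_dressing_action G Gs \<iota> \<sigma>" "\<And>g p. J (act g p) = \<sigma> g (J p)"
    using assms(7) unfolding hamiltonian_action_def by blast
  \<comment> \<open>\<open>dress\<close> is a choice among right dressing actions; completeness
    provides one, so the choice has the defining property.\<close>
  have \<rho>: "is_right_dressing_action G Gs \<iota> (dress G Gs \<iota>)"
    using assms(4) unfolding complete_poisson_lie_group_def dress_def by (rule someI_ex)
  interpret hamiltonian_groupoid \<G> \<Omega> G Gs \<iota> \<sigma> "dress G Gs \<iota>" act J
  proof (intro hamiltonian_groupoid.intro symp_groupoid.intro dual_plg.intro hamiltonian_groupoid_axioms.intro assms(1,2,3,5) \<sigma> \<rho>)
    show "smooth_left_action G (arrows \<G>) act" "momentum_map G Gs \<iota> (arrows \<G>) (inverse_bivector \<Omega>) act J"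
      using assms(7) unfolding hamiltonian_action_def poisson_action_def by blast+
    show "J (ident \<G> m) = gone Gs" for m using assms(8) by blast
  qed
  show ?thesis
  proof
    assume "\<forall>(x, y) \<in> composable \<G>. J (arr_mult \<G> x y) = gmult Gs (J x) (J y)"
    then have "\<And>x y. \<s> x = \<t> y \<Longrightarrow> infinitesimal x y" by (intro morphism_imp_infinitesimal) (auto simp: composable_def)
    from twisted_multiplicativity[OF this]
    show "\<forall>(x, y) \<in> composable \<G>. \<forall>g. (act g x, act (dress G Gs \<iota> g (J x)) y) \<in> composable \<G> \<and>
            act g (arr_mult \<G> x y) = arr_mult \<G> (act g x) (act (dress G Gs \<iota> g (J x)) y)"
      by (auto simp: composable_def)
  next
    assume tw: "\<forall>(x, y) \<in> composable \<G>. \<forall>g. (act g x, act (dress G Gs \<iota> g (J x)) y) \<in> composable \<G> \<and>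
            act g (arr_mult \<G> x y) = arr_mult \<G> (act g x) (act (dress G Gs \<iota> g (J x)) y)"
    have "infinitesimal x y" if "\<s> x = \<t> y" for x y
      by (rule twisted_imp_infinitesimal) (use tw that in \<open>auto simp: composable_def\<close>)
    from infinitesimal_imp_morphism[OF assms(6) this]
    show "\<forall>(x, y) \<in> composable \<G>. J (arr_mult \<G> x y) = gmult Gs (J x) (J y)" by (auto simp: composable_def)
  qed
qed
end
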